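(* Let $(N^n,g)$ be a closed Riemannian manifold and $k\in\mathbb R$. Suppose $r>0$ is smaller than the injectivity radius of $N$, with $r<\frac{\pi}{\sqrt k}$ if $k>0$. Then $$\frac{d}{dr}\left(\frac{1}{\mu_{SN}(SN)}\int_{SN}\log\left(\frac{F(p,r,\theta)}{F_k(r)}\right)d\mu_{SN}(p,\theta)\right)\le-\frac{\overline{R_k}}{n}\,\phi_k(r),$$ where $\phi_k$ is the non-negative function given by $$\phi_k(r)=\begin{cases}\frac12\left(r\csc^2(\sqrt k\,r)-\frac{\cot(\sqrt k\,r)}{\sqrt k}\right)&\text{if }k>0,\\ \frac r3&\text{if }k=0,\\ \frac12\left(\frac{\coth(\sqrt{-k}\,r)}{\sqrt{-k}}-r\,\mathrm{csch}^2(\sqrt{-k}\,r)\right)&\text{if }k<0.\end{cases}$$ In particular, if $\overline{R_k}\ge0$, then the quantity $\frac{1}{\mu_{SN}(SN)}\int_{SN}\log\left(\frac{F(p,r,\theta)}{F_k(r)}\right)d\mu_{SN}(p,\theta)$ is monotone decreasing in $r$. The equality holds in the displayed inequality for some $r>0$ if and only if $(N,g)$ has constant sectional curvature $k$.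
   Context: All Riemannian manifolds are complete, smooth and oriented, with smooth metric. $SN$ is the unit sphere bundle of $N$ with canonical measure $d\mu_{SN}=d\theta\,d\mu_N$, where $d\theta$ is the standard measure on $S_pN\cong\mathbb S^{n-1}$. Let $s_k(t)=\frac{1}{\sqrt k}\sin(\sqrt k\,t)$ if $k>0$, $s_0(t)=t$, and $s_k(t)=\frac{1}{\sqrt{-k}}\sinh(\sqrt{-k}\,t)$ if $k<0$; let $F_k(r)=s_k(r)^{n-1}$. $F(p,r,\theta)$ is the Jacobian in geodesic polar coordinates centered at $p$: within the cut locus of $p$, the volume element is $d\mu_N=F(p,r,\theta)\,dr\,d\theta$ at the point $\exp_p(r\theta)$, $\theta\in S_pN$. $R$ is the scalar curvature, $R_k=R-n(n-1)k$, and $\overline{R_k}=\frac1{|N|}\int_N R_k\,d\mu_N$, where $|N|$ is the volume of $N$. *)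

theory Defs
  imports "HOL-Analysis.Analysis"
begin

section \<open>Smooth maps between open subsets of normed spaces\<close>

fun Ck_on ::
  "nat \<Rightarrow> 'a::real_normed_vector set \<Rightarrow> ('a \<Rightarrow> 'b::real_normed_vector) \<Rightarrow> bool" where
  "Ck_on 0 S f \<longleftrightarrow> continuous_on S f"
| "Ck_on (Suc m) S f \<longleftrightarrow>
     (\<forall>x\<in>S. f differentiable (at x)) \<and>
     (\<forall>v. Ck_on m S (\<lambda>x. frechet_derivative f (at x) v))"

definition smooth_on ::
  "'a::real_normed_vector set \<Rightarrow> ('a \<Rightarrow> 'b::real_normed_vector) \<Rightarrow> bool" where
  "smooth_on S f \<longleftrightarrow> (\<forall>m. Ck_on m S f)"

definition jacobian_matrix ::
  "(real^'n::finite \<Rightarrow> real^'n) \<Rightarrow> real^'n \<Rightarrow> real^'n^'n" where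
  "jacobian_matrix f x = matrix (frechet_derivative f (at x))"

definition pd :: "'n::finite \<Rightarrow> (real^'n \<Rightarrow> real) \<Rightarrow> real^'n \<Rightarrow> real" where
  "pd i f x = frechet_derivative f (at x) (axis i 1)"


section \<open>Oriented Riemannian manifolds\<close>

text \<open>
  The underlying space of the manifold is a whole type. A chart is a pair of its domain and
  its coordinate map; the values of the coordinate map outside the domain are irrelevant.
\<close>

type_synonym ('a, 'n) chart = "'a set \<times> ('a \<Rightarrow> real^'n)"

abbreviation dom_ch :: "('a, 'n::finite) chart \<Rightarrow> 'a set" where
  "dom_ch c \<equiv> fst c"

abbreviation map_ch :: "('a, 'n::finite) chart \<Rightarrow> 'a \<Rightarrow> real^'n" where
  "map_ch c \<equiv> snd c"

definition inv_ch :: "('a, 'n::finite) chart \<Rightarrow> real^'n \<Rightarrow> 'a" where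
  "inv_ch c = inv_into (dom_ch c) (map_ch c)"

definition transition ::
  "('a, 'n::finite) chart \<Rightarrow> ('a, 'n) chart \<Rightarrow> real^'n \<Rightarrow> real^'n" where
  "transition c d = map_ch d \<circ> inv_ch c"

definition oriented_smooth_atlas :: "('a::topological_space, 'n::finite) chart set \<Rightarrow> bool" where
  "oriented_smooth_atlas A \<longleftrightarrow>
     (\<Union>c\<in>A. dom_ch c) = UNIV \<and>
     (\<forall>c\<in>A. open (dom_ch c) \<and> open (map_ch c ` dom_ch c) \<and>
        homeomorphism (dom_ch c) (map_ch c ` dom_ch c) (map_ch c) (inv_ch c)) \<and>
     (\<forall>c\<in>A. \<forall>d\<in>A. smooth_on (map_ch c ` (dom_ch c \<inter> dom_ch d)) (transition c d) \<and>
        (\<forall>x \<in> map_ch c ` (dom_ch c \<inter> dom_ch d). det (jacobian_matrix (transition c d) x) > 0))"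

text \<open>
  A Riemannian metric is given by its component matrices: \<open>g c x\<close> is the Gram matrix of the
  coordinate frame of the chart \<open>c\<close> at the point with coordinates \<open>x\<close>. The last clause is the
  transformation law of a symmetric covariant 2-tensor.
\<close>

type_synonym ('a, 'n) metric = "('a, 'n) chart \<Rightarrow> real^'n \<Rightarrow> real^'n^'n"

definition riemannian_metric ::
  "('a::topological_space, 'n::finite) chart set \<Rightarrow> ('a, 'n) metric \<Rightarrow> bool" where
  "riemannian_metric A g \<longleftrightarrow>
     (\<forall>c\<in>A. smooth_on (map_ch c ` dom_ch c) (g c) \<and>
        (\<forall>x \<in> map_ch c ` dom_ch c.
           transpose (g c x) = g c x \<and> (\<forall>v. v \<noteq> 0 \<longrightarrow> v \<bullet> (g c x *v v) > 0))) \<and>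
     (\<forall>c\<in>A. \<forall>d\<in>A. \<forall>x \<in> map_ch c ` (dom_ch c \<inter> dom_ch d).
        g c x = transpose (jacobian_matrix (transition c d) x) **
                  g d (transition c d x) ** jacobian_matrix (transition c d) x)"

text \<open>
  Every point \<open>p\<close> gets a preferred chart, and a tangent vector at \<open>p\<close> is represented by its
  component vector in that chart, so that the tangent space at \<open>p\<close> is \<open>real^'n\<close> with the
  inner product \<open>inner_at A g p\<close>. The preferred chart need not depend on \<open>p\<close> in any regular
  way; no regularity in \<open>p\<close> is ever expressed through it.
\<close>

definition chart_at :: "('a, 'n::finite) chart set \<Rightarrow> 'a \<Rightarrow> ('a, 'n) chart" where
  "chart_at A p = (SOME c. c \<in> A \<and> p \<in> dom_ch c)"

definition coord :: "('a, 'n::finite) chart set \<Rightarrow> 'a \<Rightarrow> real^'n" where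
  "coord A p = map_ch (chart_at A p) p"

definition gram_at ::
  "('a, 'n::finite) chart set \<Rightarrow> ('a, 'n) metric \<Rightarrow> 'a \<Rightarrow> real^'n^'n" where
  "gram_at A g p = g (chart_at A p) (coord A p)"

definition inner_at ::
  "('a, 'n::finite) chart set \<Rightarrow> ('a, 'n) metric \<Rightarrow> 'a \<Rightarrow> real^'n \<Rightarrow> real^'n \<Rightarrow> real" where
  "inner_at A g p u v = u \<bullet> (gram_at A g p *v v)"

definition norm_at ::
  "('a, 'n::finite) chart set \<Rightarrow> ('a, 'n) metric \<Rightarrow> 'a \<Rightarrow> real^'n \<Rightarrow> real" where
  "norm_at A g p v = sqrt (inner_at A g p v v)"


section \<open>Levi-Civita connection and curvature\<close>

text \<open>
  \<open>christoffel g c l i j\<close> is \<open>\<Gamma>\<close> with upper index \<open>l\<close> and lower indices \<open>i\<close>, \<open>j\<close>.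
  \<open>curv g c l k i j\<close> is the \<open>l\<close>-th component of \<open>R(\<partial>\<^sub>i, \<partial>\<^sub>j) \<partial>\<^sub>k\<close>, where
  \<open>R(X, Y) Z = \<nabla>\<^sub>X \<nabla>\<^sub>Y Z - \<nabla>\<^sub>Y \<nabla>\<^sub>X Z - \<nabla>\<^bsub>[X, Y]\<^esub> Z\<close>; with this sign the unit sphere has positive curvature.
\<close>

definition christoffel ::
  "('a, 'n::finite) metric \<Rightarrow> ('a, 'n) chart \<Rightarrow> 'n \<Rightarrow> 'n \<Rightarrow> 'n \<Rightarrow> real^'n \<Rightarrow> real" where
  "christoffel g c l i j x =
     (\<Sum>m\<in>UNIV. matrix_inv (g c x) $ l $ m *
        (pd i (\<lambda>y. g c y $ j $ m) x + pd j (\<lambda>y. g c y $ i $ m) x - pd m (\<lambda>y. g c y $ i $ j) x)) / 2"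

definition curv ::
  "('a, 'n::finite) metric \<Rightarrow> ('a, 'n) chart \<Rightarrow> 'n \<Rightarrow> 'n \<Rightarrow> 'n \<Rightarrow> 'n \<Rightarrow> real^'n \<Rightarrow> real" where
  "curv g c l k i j x =
     pd i (christoffel g c l j k) x - pd j (christoffel g c l i k) x +
     (\<Sum>m\<in>UNIV. christoffel g c l i m x * christoffel g c m j k x
               - christoffel g c l j m x * christoffel g c m i k x)"

definition curvature_op ::
  "('a, 'n::finite) chart set \<Rightarrow> ('a, 'n) metric \<Rightarrow> 'a \<Rightarrow> real^'n \<Rightarrow> real^'n \<Rightarrow> real^'n \<Rightarrow> real^'n" where
  "curvature_op A g p u v w =
     (\<chi> l. \<Sum>k\<in>UNIV. \<Sum>i\<in>UNIV. \<Sum>j\<in>UNIV.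
        curv g (chart_at A p) l k i j (coord A p) * u $ i * v $ j * w $ k)"

definition sectional_curvature ::
  "('a, 'n::finite) chart set \<Rightarrow> ('a, 'n) metric \<Rightarrow> 'a \<Rightarrow> real^'n \<Rightarrow> real^'n \<Rightarrow> real" where
  "sectional_curvature A g p u v =
     inner_at A g p (curvature_op A g p u v v) u /
     (inner_at A g p u u * inner_at A g p v v - (inner_at A g p u v)\<^sup>2)"

definition constant_sectional_curvature ::
  "('a, 'n::finite) chart set \<Rightarrow> ('a, 'n) metric \<Rightarrow> real \<Rightarrow> bool" where
  "constant_sectional_curvature A g k \<longleftrightarrow>
     (\<forall>p u v. u \<noteq> v \<and> independent {u, v} \<longrightarrow> sectional_curvature A g p u v = k)"

definition ricci ::
  "('a, 'n::finite) metric \<Rightarrow> ('a, 'n) chart \<Rightarrow> 'n \<Rightarrow> 'n \<Rightarrow> real^'n \<Rightarrow> real" where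
  "ricci g c j k x = (\<Sum>i\<in>UNIV. curv g c i k i j x)"

definition scalar_curvature ::
  "('a, 'n::finite) chart set \<Rightarrow> ('a, 'n) metric \<Rightarrow> 'a \<Rightarrow> real" where
  "scalar_curvature A g p =
     (\<Sum>j\<in>UNIV. \<Sum>k\<in>UNIV. matrix_inv (gram_at A g p) $ j $ k * ricci g (chart_at A p) j k (coord A p))"


section \<open>Geodesics, exponential map, injectivity radius\<close>

definition geodesic ::
  "('a::topological_space, 'n::finite) chart set \<Rightarrow> ('a, 'n) metric \<Rightarrow> (real \<Rightarrow> 'a) \<Rightarrow> bool" where
  "geodesic A g \<gamma> \<longleftrightarrow>
     continuous_on UNIV \<gamma> \<and>
     (\<forall>c\<in>A. \<exists>v :: real \<Rightarrow> real^'n. \<forall>t. \<gamma> t \<in> dom_ch c \<longrightarrow>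
        ((map_ch c \<circ> \<gamma>) has_vector_derivative v t) (at t) \<and>
        (v has_vector_derivative
           (\<chi> l. - (\<Sum>i\<in>UNIV. \<Sum>j\<in>UNIV.
                christoffel g c l i j (map_ch c (\<gamma> t)) * v t $ i * v t $ j))) (at t))"

definition geodesic_from ::
  "('a::topological_space, 'n::finite) chart set \<Rightarrow> ('a, 'n) metric \<Rightarrow>
     'a \<Rightarrow> real^'n \<Rightarrow> (real \<Rightarrow> 'a) \<Rightarrow> bool" where
  "geodesic_from A g p v \<gamma> \<longleftrightarrow>
     geodesic A g \<gamma> \<and> \<gamma> 0 = p \<and>
     ((map_ch (chart_at A p) \<circ> \<gamma>) has_vector_derivative v) (at 0)"

definition geodesically_complete ::
  "('a::topological_space, 'n::finite) chart set \<Rightarrow> ('a, 'n) metric \<Rightarrow> bool" where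
  "geodesically_complete A g \<longleftrightarrow> (\<forall>p v. \<exists>\<gamma>. geodesic_from A g p v \<gamma>)"

definition exp_map ::
  "('a::topological_space, 'n::finite) chart set \<Rightarrow> ('a, 'n) metric \<Rightarrow> 'a \<Rightarrow> real^'n \<Rightarrow> 'a" where
  "exp_map A g p v = (THE q. \<exists>\<gamma>. geodesic_from A g p v \<gamma> \<and> \<gamma> 1 = q)"

definition tangent_ball ::
  "('a, 'n::finite) chart set \<Rightarrow> ('a, 'n) metric \<Rightarrow> 'a \<Rightarrow> real \<Rightarrow> (real^'n) set" where
  "tangent_ball A g p r = {v. norm_at A g p v < r}"

definition exp_diffeo_on ::
  "('a::topological_space, 'n::finite) chart set \<Rightarrow> ('a, 'n) metric \<Rightarrow> 'a \<Rightarrow> (real^'n) set \<Rightarrow> bool" where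
  "exp_diffeo_on A g p B \<longleftrightarrow>
     inj_on (exp_map A g p) B \<and> open (exp_map A g p ` B) \<and>
     (\<forall>c\<in>A. smooth_on {v \<in> B. exp_map A g p v \<in> dom_ch c} (map_ch c \<circ> exp_map A g p) \<and>
        smooth_on (map_ch c ` (dom_ch c \<inter> exp_map A g p ` B))
          (inv_into B (exp_map A g p) \<circ> inv_ch c))"

definition injectivity_radius_at ::
  "('a::topological_space, 'n::finite) chart set \<Rightarrow> ('a, 'n) metric \<Rightarrow> 'a \<Rightarrow> ereal" where
  "injectivity_radius_at A g p =
     Sup {ereal r | r. 0 < r \<and> exp_diffeo_on A g p (tangent_ball A g p r)}"

definition injectivity_radius ::
  "('a::topological_space, 'n::finite) chart set \<Rightarrow> ('a, 'n) metric \<Rightarrow> ereal" where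
  "injectivity_radius A g = (INF p. injectivity_radius_at A g p)"


section \<open>Volume, unit sphere bundle, polar Jacobian\<close>

definition volume_measure ::
  "('a::topological_space, 'n::finite) chart set \<Rightarrow> ('a, 'n) metric \<Rightarrow> 'a measure" where
  "volume_measure A g = (THE M. sets M = sets borel \<and>
     (\<forall>c\<in>A. \<forall>B\<in>sets borel. B \<subseteq> dom_ch c \<longrightarrow>
        emeasure M B =
          (\<integral>\<^sup>+ x. ennreal (sqrt (det (g c x))) * indicator (map_ch c ` B) x \<partial>lborel)))"

text \<open>
  The standard measure on the unit sphere of the Euclidean space \<open>(real^'n, inner_at A g p)\<close>:
  the measure of a set of directions is \<open>n\<close> times the volume (with respect to the inner product)
  of the part of the unit ball lying over it. In dimension 1 it is the counting measure on the
  two unit vectors.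
\<close>

definition sphere_measure ::
  "('a, 'n::finite) chart set \<Rightarrow> ('a, 'n) metric \<Rightarrow> 'a \<Rightarrow> (real^'n) measure" where
  "sphere_measure A g p =
     distr
       (scale_measure (ennreal (real CARD('n) * sqrt (det (gram_at A g p))))
          (restrict_space lborel {v. 0 < norm_at A g p v \<and> norm_at A g p v < 1}))
       borel (\<lambda>v. v /\<^sub>R norm_at A g p v)"

definition unit_sphere_bundle ::
  "('a, 'n::finite) chart set \<Rightarrow> ('a, 'n) metric \<Rightarrow> ('a \<times> (real^'n)) set" where
  "unit_sphere_bundle A g = {(p, \<theta>). norm_at A g p \<theta> = 1}"

text \<open>
  \<open>bundle_chart A c\<close> is the chart of the tangent bundle induced by \<open>c\<close>; it turns components in
  the preferred chart into components in \<open>c\<close>. A subset of the sphere bundle is Borel iff it is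
  Borel in all induced charts, which is independent of the choice of preferred charts.
\<close>

definition bundle_chart ::
  "('a, 'n::finite) chart set \<Rightarrow> ('a, 'n) chart \<Rightarrow> 'a \<times> (real^'n) \<Rightarrow> (real^'n) \<times> (real^'n)" where
  "bundle_chart A c = (\<lambda>(p, v).
     (map_ch c p, jacobian_matrix (transition (chart_at A p) c) (coord A p) *v v))"

definition sphere_bundle_measure ::
  "('a::topological_space, 'n::finite) chart set \<Rightarrow> ('a, 'n) metric \<Rightarrow> ('a \<times> (real^'n)) measure" where
  "sphere_bundle_measure A g =
     measure_of (unit_sphere_bundle A g)
       {B. B \<subseteq> unit_sphere_bundle A g \<and>
           (\<forall>c\<in>A. bundle_chart A c ` {(p, \<theta>) \<in> B. p \<in> dom_ch c} \<in> sets borel)}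
       (\<lambda>B. \<integral>\<^sup>+ p. emeasure (sphere_measure A g p) {\<theta>. (p, \<theta>) \<in> B} \<partial>volume_measure A g)"

text \<open>
  \<open>exp_jacobian A g p v\<close> is the Jacobian of the exponential map at \<open>v\<close>, taken with respect to
  the inner products at \<open>p\<close> and at the image point. Since the Euclidean volume element of the
  tangent space at \<open>p\<close> is \<open>r^(n-1) dr d\<theta>\<close>, the volume element of the manifold at the image of
  \<open>r \<theta>\<close> is \<open>polar_jacobian A g p r \<theta> dr d\<theta>\<close>.
\<close>

definition exp_jacobian ::
  "('a::topological_space, 'n::finite) chart set \<Rightarrow> ('a, 'n) metric \<Rightarrow> 'a \<Rightarrow> real^'n \<Rightarrow> real" where
  "exp_jacobian A g p v =
     (let q = exp_map A g p v in
      \<bar>det (jacobian_matrix (map_ch (chart_at A q) \<circ> exp_map A g p) v)\<bar> *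
      sqrt (det (gram_at A g q)) / sqrt (det (gram_at A g p)))"

definition polar_jacobian ::
  "('a::topological_space, 'n::finite) chart set \<Rightarrow> ('a, 'n) metric \<Rightarrow>
     'a \<Rightarrow> real \<Rightarrow> real^'n \<Rightarrow> real" where
  "polar_jacobian A g p r \<theta> = r ^ (CARD('n) - 1) * exp_jacobian A g p (r *\<^sub>R \<theta>)"


section \<open>Model functions and averages\<close>

definition s_fun :: "real \<Rightarrow> real \<Rightarrow> real" where
  "s_fun k t =
     (if k > 0 then sin (sqrt k * t) / sqrt k
      else if k = 0 then t
      else sinh (sqrt (- k) * t) / sqrt (- k))"

definition model_jacobian :: "'n::finite itself \<Rightarrow> real \<Rightarrow> real \<Rightarrow> real" where
  "model_jacobian _ k r = s_fun k r ^ (CARD('n) - 1)"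

definition phi :: "real \<Rightarrow> real \<Rightarrow> real" where
  "phi k r =
     (if k > 0 then (r / (sin (sqrt k * r))\<^sup>2 - cot (sqrt k * r) / sqrt k) / 2
      else if k = 0 then r / 3
      else (cosh (sqrt (- k) * r) / sinh (sqrt (- k) * r) / sqrt (- k)
              - r / (sinh (sqrt (- k) * r))\<^sup>2) / 2)"

definition mean_reduced_scalar ::
  "('a::topological_space, 'n::finite) chart set \<Rightarrow> ('a, 'n) metric \<Rightarrow> real \<Rightarrow> real" where
  "mean_reduced_scalar A g k =
     (\<integral>p. scalar_curvature A g p - real CARD('n) * (real CARD('n) - 1) * k \<partial>volume_measure A g)
       / measure (volume_measure A g) UNIV"

definition mean_log_jacobian ::
  "('a::topological_space, 'n::finite) chart set \<Rightarrow> ('a, 'n) metric \<Rightarrow> real \<Rightarrow> real \<Rightarrow> real" where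
  "mean_log_jacobian A g k r =
     (\<integral>x. ln (polar_jacobian A g (fst x) r (snd x) / model_jacobian TYPE('n) k r)
        \<partial>sphere_bundle_measure A g)
       / measure (sphere_bundle_measure A g) (unit_sphere_bundle A g)"

definition admissible_radii ::
  "('a::topological_space, 'n::finite) chart set \<Rightarrow> ('a, 'n) metric \<Rightarrow> real \<Rightarrow> real set" where
  "admissible_radii A g k =
     {r. 0 < r \<and> ereal r < injectivity_radius A g \<and> (k > 0 \<longrightarrow> r < pi / sqrt k)}"

end

theory Submission
 imports Defs
begin

text \<open>
Along a unit speed geodesic let \<open>H\<close> be the mean curvature of the distance spheres about its starting point.
The traced Riccati equation and the Cauchy-Schwarz inequality for the shape operator bound the derivative of
\<open>s\<^sub>k\<^sup>2 (H - (n-1) s\<^sub>k'/s\<^sub>k)\<close> by \<open>- s\<^sub>k\<^sup>2 (Ric - (n-1) k)\<close>, and \<open>H\<close> is the radial derivative of \<open>log F\<close>.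
Integrating along the geodesic and averaging over the unit sphere bundle, the mean of \<open>Ric\<close> at time \<open>t\<close>
does not depend on \<open>t\<close> by Liouville's theorem and equals the mean of the scalar curvature divided by \<open>n\<close>; the
remaining integral of \<open>s\<^sub>k\<^sup>2\<close> over \<open>s\<^sub>k(r)\<^sup>2\<close> is \<open>phi k r\<close>. Equality forces all shape operators to be those
of the model, so the curvature operator along every geodesic is that of the model.
\<close>

text \<open>All local computations concern one object, the metric \<open>hN p\<close> that the
  exponential map at \<open>p\<close> pulls back to the tangent space. There rays are geodesics, the
  shape operators of the spheres about \<open>p\<close> sit inside the covariant derivative
  \<open>Sm\<close> of the position field, and \<open>F\<close> is a power of the radius times the
  root of a determinant. Cauchy-Schwarz takes the form \<open>trace (Mm ** Mm) >= 0\<close> for the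
  self-adjoint deviation \<open>Mm\<close> from the model, so that equality can be read off as
  \<open>Mm = 0\<close>. The exponential map must be smooth in base point and vector jointly. Smooth
  dependence of solutions on initial values is derived from Gronwall's inequality, and the flow is
  composed of short pieces, each inside one chart. Integrals over unit spheres become Lebesgue
  integrals over punctured unit balls by radial projection. Liouville's theorem then says that
  \<open>det g\<close> times the spray has no divergence in a chart; cutoffs in the length cost
  nothing, since the flow preserves it. The factor 1/n is the spherical mean of a quadratic form.
  The equality clause asks for some radius, hence the injectivity radius has to be shown
  positive.\<close>

notation scaleR (infixr "*R" 75) and inner (infix "<.>" 70)
abbreviation times_set (infixr "><" 80) where "A >< B == Sigma A (%_. B)"
notation has_derivative (infix "hasD" 50) and has_vector_derivative (infix "hasVD" 50)
notation has_real_derivative (infix "hasRD" 50)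
abbreviation "NN == nn_integral"
abbreviation "BM == borel_measurable borel"
abbreviation "ind == indicator"
abbreviation "em == emeasure"
abbreviation "minv == matrix_inv"
abbreviation "cont_on == continuous_on"
notation iff (infixr "<->" 25) and tendsto (infixr "--->" 55) and LIMSEQ ("((_)/ ----> (_))" [60, 60] 60)

lemmas alg = algebra_simps
 and deriv_intros = derivative_eq_intros and hasVD_def = has_vector_derivative_def
 and hasD_ident = has_derivative_ident
 and hasRD_def = has_field_derivative_def
 and hasD_open = has_derivative_transform_within_open
 and hasD_linear = has_derivative_linear
 and sq_eq = power2_eq_square and mv_scaleR = matrix_vector_mult_scaleR
 and hasD_compose = has_derivative_compose
 and cont_onI = continuous_at_imp_continuous_on and cont_BM = borel_measurable_continuous_onI
 and cont_subset = continuous_on_subset and hasRD_open = has_field_derivative_transform_within_open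
 and hasRD_iff = has_real_derivative_iff_has_vector_derivative
 and mv_assoc = matrix_vector_mul_assoc and compact_image = compact_continuous_image
 and cont_compose = continuous_on_compose2 and hasVD_cont = has_vector_derivative_continuous
 and hasVD_open = has_vector_derivative_transform_within_open
 and scaleR_mv = scaleR_matrix_vector_assoc and hasVD_diff = has_vector_derivative_diff
 and open_preimage = continuous_open_preimage and cont_if_BM = borel_measurable_continuous_on_if
 and mv_basis = matrix_vector_mult_basis and mv_add_r = matrix_vector_mult_add_rdistrib
 and mv_diff_r = matrix_vector_mult_diff_rdistrib and mv_add = matrix_vector_right_distrib
 and eucl_rep = euclidean_representation and hasD_within = has_derivative_at_withinI
 and hasD_unique = has_derivative_unique

section \<open>Calculus of $C^k$ maps\<close>

abbreviation Df :: "('a::real_normed_vector => 'b::real_normed_vector) => 'a => 'a => 'b"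
 where "Df f x == frechet_derivative f (at x)"

lemma Df_eq: "(f hasD f') (at x) ==> Df f x = f'" using frechet_derivative_at by metis

lemma Df_cong:
 assumes "open S" "x : S" "!!y. y : S ==> f y = g y"
 shows "Df f x = Df g x" proof -
 have "(f hasD f') (at x) <-> (g hasD f') (at x)" for f' using assms hasD_open[of f f' x UNIV S g]
   hasD_open[of g f' x UNIV S f] by metis
 thus ?thesis unfolding frechet_derivative_def by simp
qed

lemma Ck_hasD: "Ck_on (Suc m) S f ==> x : S ==> (f hasD Df f x) (at x)"
 using frechet_derivative_works by (metis Ck_on.simps(2))

lemma Ck_D: "Ck_on (Suc m) S f ==> Ck_on m S (%x. Df f x v)" by simp

lemma Ck_cont: "Ck_on m S f ==> cont_on S f" by (cases m) (auto simp:continuous_on_eq_continuous_within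
   intro:continuous_at_imp_continuous_at_within differentiable_imp_continuous_within)

lemma Ck_Suc: "Ck_on (Suc m) S f ==> Ck_on m S f" proof (induction m arbitrary:f)
 case 0
 thus ?case using Ck_cont[of 1] by auto
next
 case (Suc m)
 thus ?case by (metis Ck_on.simps(2))
qed

lemma Ck_le: "Ck_on m S f ==> k <= m ==> Ck_on k S f"
 by (induction m) (auto simp del:Ck_on.simps simp:le_Suc_eq intro:Ck_Suc)

lemma Ck_subset: "Ck_on m S f ==> T <= S ==> Ck_on m T f" by (induction m arbitrary:f) (auto intro:cont_subset)

lemma Ck_cong:
 "open S ==> (!!x. x : S ==> f x = g x) ==> Ck_on m S f ==> Ck_on m S g" proof (induction m arbitrary:f g)
 case 0
 thus ?case by (simp cong:continuous_on_cong)
next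
 case (Suc m)
 have "g differentiable (at x)" if "x : S" for x proof -
  have "(f hasD Df f x) (at x)" using Ck_hasD Suc.prems(3) that by blast
  hence "(g hasD Df f x) (at x)" using hasD_open Suc.prems(1,2) that by blast
  thus ?thesis by (rule differentiableI)
 qed
 moreover have "Ck_on m S (%x. Df g x v)" for v proof (rule Suc.IH[OF Suc.prems(1)])
  show "Ck_on m S (%x. Df f x v)" using Suc.prems(3) by simp
  show "Df f x v = Df g x v" if "x : S" for x using Df_cong[OF Suc.prems(1) that, of f g] Suc.prems(2) by metis
 qed
 ultimately show ?case by simp
qed

lemma Ck_local:
 "(!!x. x : S ==> EX T. open T & x : T & Ck_on m T f) ==> Ck_on m S f" proof (induction m arbitrary:f)
 case 0
 thus ?case by (simp, intro cont_onI) (metis continuous_on_eq_continuous_at)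
next
 case (Suc m)
 have "f differentiable (at x)" if "x : S" for x using Suc.prems[OF that] by auto
 moreover have "Ck_on m S (%x. Df f x v)" for v proof (rule Suc.IH)
  fix x assume "x : S"
  then obtain T where "open T" "x : T" "Ck_on (Suc m) T f" using Suc.prems[of x] by blast
  thus "EX T. open T & x : T & Ck_on m T (%x. Df f x v)" using Ck_D by blast
 qed
 ultimately show ?case by simp
qed

lemma Ck_SucI:
 assumes "open S" "!!x. x : S ==> (f hasD f' x) (at x)" and "!!v. Ck_on m S (%x. f' x v)"
 shows "Ck_on (Suc m) S f" proof -
 have "Ck_on m S (%x. Df f x v)" for v by (rule Ck_cong[OF assms(1) _ assms(3)]) (simp add:Df_eq[OF assms(2)])
 moreover have "f differentiable (at x)" if "x : S" for x using differentiableI[OF assms(2)[OF that]] .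
 ultimately show ?thesis by simp
qed

lemma Ck_const [simp]: "Ck_on m S (%x. c)" by (induction m arbitrary:c) auto

lemma Ck_bounded_linear:
 assumes "bounded_linear l" "open S"
 shows "Ck_on m S l" proof (cases m)
 case 0
 thus ?thesis using assms(1) by (simp add:linear_continuous_on)
next
 case (Suc k)
 thus ?thesis unfolding Suc using bounded_linear_imp_has_derivative[OF assms(1)]
  by (intro Ck_SucI[OF assms(2), where f'="%_. l"] Ck_const) blast
qed

lemma Ck_linear_comp:
 assumes "bounded_linear l" "open S" "Ck_on m S f"
 shows "Ck_on m S (%x. l (f x))" using assms(3) proof (induction m arbitrary:f)
 case 0
 thus ?case using assms(1) by (simp add:bounded_linear.continuous_on)
next
 case (Suc m)
 show ?case proof (rule Ck_SucI[OF assms(2)])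
  fix x assume "x : S"
  thus "((%x. l (f x)) hasD (%v. l (Df f x v))) (at x)"
   using bounded_linear.has_derivative[OF assms(1)] Ck_hasD[OF Suc.prems] by blast
 qed (use Suc in auto)
qed

lemma Ck_add:
 assumes "open S" shows "Ck_on m S f ==> Ck_on m S g ==> Ck_on m S (%x. f x + g x)" proof (induction m arbitrary:f g)
 case 0
 thus ?case by (simp add:continuous_on_add)
next
 case (Suc m)
 show ?case proof (rule Ck_SucI[OF assms(1)])
  fix x assume "x : S"
  thus "((%x. f x + g x) hasD (%v. Df f x v + Df g x v)) (at x)"
   using Ck_hasD[OF Suc.prems(1)] Ck_hasD[OF Suc.prems(2)] by (intro has_derivative_add) auto
 qed (use Suc in auto)
qed

lemma Ck_bilinear:
 assumes "bounded_bilinear b" "open S"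
 shows "Ck_on m S f ==> Ck_on m S g ==> Ck_on m S (%x. b (f x) (g x))" proof (induction m arbitrary:f g)
 case 0
 thus ?case using bounded_bilinear.continuous_on[OF assms(1)] by simp
next
 case (Suc m)
 note c = Ck_Suc[OF Suc.prems(1)] Ck_Suc[OF Suc.prems(2)]
 show ?case proof (rule Ck_SucI[OF assms(2)])
  fix x assume "x : S"
  thus "((%x. b (f x) (g x)) hasD (%v. b (f x) (Df g x v) + b (Df f x v) (g x))) (at x)"
   using Ck_hasD[OF Suc.prems(1)] Ck_hasD[OF Suc.prems(2)]
    bounded_bilinear.FDERIV[OF assms(1)] by blast
 next
  show "Ck_on m S (%x. b (f x) (Df g x v) + b (Df f x v) (g x))" for v using Suc c by (intro Ck_add assms Suc.IH) auto
 qed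
qed

lemmas Ck_mult = Ck_bilinear[OF bounded_bilinear_mult]
lemmas Ck_scaleR = Ck_bilinear[OF bounded_bilinear_scaleR]
lemmas Ck_inner = Ck_bilinear[OF bounded_bilinear_inner]

lemma Ck_minus: "open S ==> Ck_on m S f ==> Ck_on m S (%x. - f x)"
 by (rule Ck_linear_comp[OF bounded_linear_minus[OF bounded_linear_ident]])

lemma Ck_diff: "open S ==> Ck_on m S f ==> Ck_on m S g ==> Ck_on m S (%x. f x - g x)"
 unfolding diff_conv_add_uminus by (intro Ck_add Ck_minus)

lemma Ck_sum:
 "open S ==> (!!i. i : I ==> Ck_on m S (f i)) ==> Ck_on m S (%x. SUM i:I. f i x)"
 by (induction I rule:infinite_finite_induct) (simp_all del:Ck_on.simps add:Ck_add)

lemma Ck_prod: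
 fixes f :: "'i => 'a::real_normed_vector => real"
 shows "open S ==> (!!i. i : I ==> Ck_on m S (f i)) ==> Ck_on m S (%x. PROD i:I. f i x)"
 by (induction I rule:infinite_finite_induct) (simp_all del:Ck_on.simps add:Ck_mult)

lemma Ck_ident: "open S ==> Ck_on m S (%x. x)" by (rule Ck_bounded_linear[OF bounded_linear_ident])

lemma Ck_components:
 fixes f :: "'a::real_normed_vector => 'b::euclidean_space"
 assumes "open S" "!!b. b : Basis ==> Ck_on m S (%x. f x <.> b)"
 shows "Ck_on m S f" proof -
 have "Ck_on m S (%x. SUM b:Basis. (f x <.> b) *R b)" using assms by (intro Ck_sum Ck_scaleR) auto
 thus ?thesis by (simp add:eucl_rep)
qed

text \<open>\<open>Ck_on\<close> differentiates along fixed vectors, whereas the chain rule inserts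
  the moving vector \<open>Df f x v\<close> into \<open>Df g (f x)\<close>. Expanding that vector in
  the basis leaves sums of products of functions to which the induction hypothesis applies.\<close>

lemma Ck_compose:
 fixes f :: "'a::real_normed_vector => 'b::euclidean_space"
 assumes "open S" "open T"
 shows "Ck_on m S f ==> f ` S <= T ==> Ck_on m T g ==> Ck_on m S (%x. g (f x))" proof (induction m arbitrary:g)
 case 0
 thus ?case by (auto intro:cont_compose)
next
 case (Suc m)
 note cf = Ck_Suc[OF Suc.prems(1)]
 show ?case proof (rule Ck_SucI[OF assms(1)])
  fix x assume x: "x : S"
  hence fx: "f x : T" using Suc.prems(2) by auto
  have lin: "linear (Df g (f x))" using Ck_hasD[OF Suc.prems(3) fx] hasD_linear by blast
  have e: "Df g (f x) (Df f x v) = (SUM b:Basis. (Df f x v <.> b) *R Df g (f x) b)" for v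
   by (subst eucl_rep[of "Df f x v", symmetric])
    (simp add:linear_sum[OF lin] linear_scale[OF lin])
  show "((%x. g (f x)) hasD (%v. SUM b:Basis. (Df f x v <.> b) *R Df g (f x) b)) (at x)"
   using hasD_compose[OF Ck_hasD[OF Suc.prems(1) x] Ck_hasD[OF Suc.prems(3) fx]] by (simp add:e)
 next
  show "Ck_on m S (%x. SUM b:Basis. (Df f x v <.> b) *R Df g (f x) b)" for v
   using Suc by (intro Ck_sum assms Ck_scaleR Ck_inner Suc.IH cf) auto
 qed
qed

lemma Ck_real_inverse: "Ck_on m (- {0}) (inverse :: real => real)" proof (induction m)
 case 0
 thus ?case by (auto intro:continuous_on_inverse)
next
 case (Suc m)
 have o: "open (- {0::real})" by auto
 show ?case proof (rule Ck_SucI[OF o])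
  show "(inverse hasD (%v. - (inverse x * v * inverse x))) (at x)" if "x : - {0}" for x :: real
   using that by (auto intro!:deriv_intros)
  show "Ck_on m (- {0}) (%x::real. - (inverse x * v * inverse x))" for v using Suc by (intro Ck_minus Ck_mult o) auto
 qed
qed

lemma Ck_divide:
 fixes f g :: "'a::real_normed_vector => real"
 assumes "open S" "Ck_on m S f" "Ck_on m S g" "!!x. x : S ==> g x ~= 0"
 shows "Ck_on m S (%x. f x / g x)" unfolding divide_inverse
 by (intro Ck_mult assms Ck_compose[OF _ _ assms(3) _ Ck_real_inverse]) (use assms in auto)

lemma Ck_real_sqrt: "Ck_on m {0<..} sqrt" proof (induction m)
 case 0
 thus ?case by (auto intro:continuous_on_real_sqrt)
next
 case (Suc m)
 have o: "open {0::real<..}" by auto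
 show ?case proof (rule Ck_SucI[OF o])
  show "(sqrt hasD (%v. v / (2 * sqrt x))) (at x)" if "x : {0<..}" for x :: real
   using that by (auto intro!:deriv_intros simp:field_simps)
  show "Ck_on m {0<..} (%x. v / (2 * sqrt x))" for v using Suc by (intro Ck_divide Ck_mult o) auto
 qed
qed

lemma Ck_sqrt:
 fixes f :: "'a::real_normed_vector => real"
 assumes "open S" "Ck_on m S f" "!!x. x : S ==> f x > 0"
 shows "Ck_on m S (%x. sqrt (f x))" by (rule Ck_compose[OF _ _ assms(2) _ Ck_real_sqrt]) (use assms in auto)

lemma Ck_vec_lambda:
 fixes f :: "'a::real_normed_vector => 'n::finite => 'b::euclidean_space"
 assumes "open S" "!!i. Ck_on m S (%x. f x i)"
 shows "Ck_on m S (%x. \<chi> i. f x i)" proof (rule Ck_components[OF assms(1)])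
 fix b :: "'b^'n" assume "b : Basis"
 then obtain i u where b: "b = axis i u" by (auto simp:Basis_vec_def)
 show "Ck_on m S (%x. (\<chi> i. f x i) <.> b)" unfolding b inner_axis using assms by (auto intro!:Ck_inner)
qed

lemma Ck_vec_nth:
 fixes f :: "'a::real_normed_vector => 'b::euclidean_space^'n::finite"
 shows "open S ==> Ck_on m S f ==> Ck_on m S (%x. f x $ i)" by (rule Ck_linear_comp[OF bounded_linear_vec_nth])

lemma Ck_Pair:
 fixes f :: "'a::real_normed_vector => 'b::real_normed_vector" and g :: "'a => 'c::real_normed_vector"
 assumes "open S" "Ck_on m S f" "Ck_on m S g"
 shows "Ck_on m S (%x. (f x, g x))" proof -
 have "bounded_linear (%x. (x, 0)::'b * 'c)" "bounded_linear (%x. (0, x)::'b * 'c)"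
  by (intro bounded_linear_Pair bounded_linear_ident bounded_linear_zero)+
 from Ck_add[OF assms(1) Ck_linear_comp[OF this(1) assms(1,2)] Ck_linear_comp[OF this(2) assms(1,3)]]
 show ?thesis by simp
qed

lemma Ck_fst: "open S ==> Ck_on m S f ==> Ck_on m S (%x. fst (f x))" by (rule Ck_linear_comp[OF bounded_linear_fst])

lemma Ck_snd: "open S ==> Ck_on m S f ==> Ck_on m S (%x. snd (f x))" by (rule Ck_linear_comp[OF bounded_linear_snd])

lemma Ck_det:
 fixes M :: "'a::real_normed_vector => real^'n^'n::finite"
 assumes "open S" "!!i j. Ck_on m S (%x. M x $ i $ j)"
 shows "Ck_on m S (%x. det (M x))" unfolding det_def by (intro Ck_sum Ck_mult Ck_prod assms Ck_const)

section \<open>Matrix inverses, symmetry of second derivatives, inverse functions\<close>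

lemma minv_mult:
 fixes M :: "real^'n^'n::finite"
 assumes "det M ~= 0"
 shows "M ** minv M = mat 1" "minv M ** M = mat 1" proof -
 have "EX N. M ** N = mat 1 & N ** M = mat 1" using assms invertible_det_nz invertible_def by blast
 from someI_ex[OF this] show "M ** minv M = mat 1" "minv M ** M = mat 1" unfolding matrix_inv_def by auto
qed

text \<open>Cramer's rule turns an entry of the inverse into a quotient of polynomials in the
  entries, so smoothness of inversion reduces to \<open>Ck_det\<close> and
  \<open>Ck_divide\<close>.\<close>

lemma minv_entry_cramer:
 fixes M :: "real^'n^'n::finite"
 assumes "det M ~= 0"
 shows "minv M $ k $ l = det (\<chi> i j. if j = k then axis l 1 $ i else M $ i $ j) / det M" proof -
 have "M *v (minv M *v axis l 1) = axis l 1" using assms by (simp add:mv_assoc minv_mult)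
 hence "minv M *v axis l 1 = (\<chi> k. det (\<chi> i j. if j = k then axis l 1 $ i else M $ i $ j) / det M)"
  using cramer[OF assms] by blast
 moreover have "(minv M *v axis l 1) $ k = minv M $ k $ l" by (simp add:mv_basis column_def)
 ultimately show ?thesis by simp
qed

lemma Ck_matrix_inv:
 fixes M :: "'a::real_normed_vector => real^'n^'n::finite"
 assumes "open S" "!!i j. Ck_on m S (%x. M x $ i $ j)" "!!x. x : S ==> det (M x) ~= 0"
 shows "Ck_on m S (%x. minv (M x) $ k $ l)" proof -
 have "Ck_on m S (%x. det (\<chi> i j. if j = k then axis l 1 $ i else M x $ i $ j) / det (M x))"
 proof (intro Ck_divide Ck_det assms)
  show "Ck_on m S (%x. (\<chi> i j. if j = k then axis l 1 $ i else M x $ i $ j) $ i $ j)" for i j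
   by (cases "j = k") (simp_all add:assms)
 qed
 thus ?thesis by (rule Ck_cong[OF assms(1), rotated]) (simp add:minv_entry_cramer assms)
qed

text \<open>The increment of \<open>f\<close> in direction \<open>u\<close> is an integral of
  \<open>P\<close> (fact \<open>I\<close>). Differentiating it in direction \<open>v\<close> under
  the integral sign gives \<open>J\<close>, an integral formula for the increment of
  \<open>Q\<close>; its derivative at the lower end is the claim.\<close>

lemma Df_symmetric:
 fixes f :: "'a::real_normed_vector => 'b::banach"
 assumes S: "open S" "Ck_on (Suc (Suc 0)) S f" "x : S"
 shows "Df (%y. Df f y u) x v = Df (%y. Df f y v) x u" proof -
 define P where "P = (%y. Df f y u)"
 define Q where "Q = (%y. Df f y v)"
 define c where "c s t = x + s *R u + t *R v" for s t :: real
 have "open ((%q. c (fst q) (snd q)) -` S)" unfolding c_def by (intro open_vimage S(1) continuous_intros)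
 moreover have "(0, 0) : (%q. c (fst q) (snd q)) -` S" using S(3) by (simp add:c_def)
 ultimately obtain e where e: "e > 0" "cball (0, 0) e <= (%q. c (fst q) (snd q)) -` S"
  using open_contains_cball by blast
 \<comment> \<open>Half of \<open>e\<close> suffices because the norm of \<open>(s, t)\<close> is at
   most \<open>abs s + abs t\<close>.\<close>
 define a where "a = e / 2"
 have cS: "c s t : S" if "abs s <= a" "abs t <= a" for s t proof -
  have "(s, t) : cball (0, 0) e" using norm_Pair_le[of "- s" "- t"] that by (simp add:a_def dist_norm)
  thus ?thesis using e(2) by auto
 qed
 have a: "0 < a" using e by (simp add:a_def)
 have f: "(f hasD Df f y) (at y)" and h: "(P hasD Df P y) (at y)" "(Q hasD Df Q y) (at y)" if "y : S" for y
  using Ck_hasD[OF S(2) that] Ck_hasD[OF Ck_D[OF S(2)] that] unfolding P_def Q_def by auto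
 have d: "((%s. h (c s t)) hasVD Df h (c s t) u) (at s within T)" "((%t. h (c s t)) hasVD Df h (c s t) v) (at t within T)"
  if "(h hasD Df h (c s t)) (at (c s t))" for h :: "'a => 'b" and s t T proof -
  have "((%s. c s t) hasD (%r. r *R u)) (at s within T)" "((%t. c s t) hasD (%r. r *R v)) (at t within T)"
   unfolding c_def by (auto intro!:deriv_intros)
  from this[THEN hasD_compose, OF that]
  show "((%s. h (c s t)) hasVD Df h (c s t) u) (at s within T)" "((%t. h (c s t)) hasVD Df h (c s t) v) (at t within T)"
   by (simp_all add:hasVD_def linear_scale[OF hasD_linear[OF that]])
 qed
 have I: "((%r. P (c r t)) has_integral f (c s t) - f (c 0 t)) {0..s}" if "0 <= s" "s <= a" "abs t <= a" for s t
  using that cS d(1)[OF f] unfolding P_def by (intro fundamental_theorem_of_calculus) auto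
 have D: "cont_on S (%y. Df P y v)" unfolding P_def using S(2) Ck_D Ck_cont by blast
 have cont: "cont_on T (%r. c r t)" for T t unfolding c_def by (intro continuous_intros)
 have J: "Q (c s 0) - Q (c 0 0) = integral {0..s} (%r. Df P (c r 0) v)" if s: "0 <= s" "s <= a" for s proof -
  have "((%t. integral (cbox 0 s) (%r. P (c r t))) hasVD integral (cbox 0 s) (%r. Df P (c r 0) v)) (at 0 within {-a..a})"
  proof (rule leibniz_rule_vector_derivative)
   show "cont_on ({-a..a} \<times> cbox 0 s) (%(t, r). Df P (c r t) v)" unfolding split_beta
    by (rule cont_compose[OF D]) (use cS s in \<open>auto simp:c_def intro!:continuous_intros\<close>)
  qed (use a s cS I[OF s, THEN has_integral_integrable] in \<open>auto intro!:d h\<close>)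
  hence "((%t. f (c s t) - f (c 0 t)) hasVD integral {0..s} (%r. Df P (c r 0) v)) (at 0 within {-a..a})"
   unfolding cbox_interval by (rule has_vector_derivative_transform[rotated 2]) (use a integral_unique[OF I[OF s]] in \<open>simp_all add:abs_le_iff\<close>)
  moreover have "((%t. f (c s t) - f (c 0 t)) hasVD Q (c s 0) - Q (c 0 0)) (at 0 within {-a..a})"
   unfolding Q_def using a s cS by (intro hasVD_diff d f) auto
  ultimately show ?thesis using a vector_derivative_unique_within_closed_interval[of "-a" a 0] by auto
 qed
 have "((%s. integral {0..s} (%r. Df P (c r 0) v)) hasVD Df P (c 0 0) v) (at 0 within {0..a})"
  by (intro integral_has_vector_derivative cont_compose[OF D cont]) (use a cS in auto)
 moreover have "((%s. Q (c s 0) - Q (c 0 0)) hasVD Df Q (c 0 0) u - 0) (at 0 within {0..a})"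
  using a cS by (intro hasVD_diff d h has_vector_derivative_const) auto
 hence "((%s. integral {0..s} (%r. Df P (c r 0) v)) hasVD Df Q (c 0 0) u) (at 0 within {0..a})"
  unfolding diff_zero by (rule has_vector_derivative_transform[rotated 2]) (use a J in auto)
 ultimately have "Df P (c 0 0) v = Df Q (c 0 0) u"
  using a by (intro vector_derivative_unique_within_closed_interval[of 0 a 0]) auto
 thus ?thesis by (simp add:P_def Q_def c_def)
qed

text \<open>Bootstrapping: the derivative of \<open>g\<close> is the inverse Jacobian of
  \<open>f\<close> evaluated at \<open>g\<close>, so each order of smoothness of \<open>g\<close>
  makes its derivative equally smooth and gains one order. Continuity of \<open>g\<close> starts the
  induction.\<close>

lemma Ck_inverse_function:
 fixes f :: "real^'n => real^'n::finite"
 assumes "open S" "open T" "Ck_on (Suc m) S f" "!!x. x : S ==> det (matrix (Df f x)) ~= 0"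
  and "cont_on T g" "g ` T <= S" "!!y. y : T ==> f (g y) = y"
 shows "Ck_on (Suc m) T g" proof -
 define B where "B x = minv (matrix (Df f x))" for x
 have der: "(g hasD (%v. B (g y) *v v)) (at y)" if y: "y : T" for y proof -
  have gy: "g y : S" using assms(6) y by auto
  have f: "(f hasD Df f (g y)) (at (g y))" using Ck_hasD[OF assms(3) gy] .
  show ?thesis proof (rule has_derivative_inverse_basic[where f=f and f'="Df f (g y)" and T=T])
   show "(f hasD Df f (g y)) (at (g y))" "open T" "y : T" using f assms(2) y by auto
  next
   show "bounded_linear ((*v) (B (g y)))" by (rule matrix_vector_mul_bounded_linear)
   show "(*v) (B (g y)) o Df f (g y) = id" proof
    fix v
    have "Df f (g y) v = matrix (Df f (g y)) *v v" using f hasD_linear matrix_vector_mul(2) by metis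
    thus "((*v) (B (g y)) o Df f (g y)) v = id v" by (simp add:B_def mv_assoc minv_mult assms(4) gy)
   qed
   show "continuous (at y) g" using assms(2,5) y continuous_on_eq_continuous_at by blast
   show "f (g z) = z" if "z : T" for z using assms(7) that .
  qed
 qed
 have B: "Ck_on m S (%x. B x $ i $ j)" for i j unfolding B_def by (rule Ck_matrix_inv[OF assms(1) _ assms(4)])
   (auto simp:matrix_def intro!:Ck_vec_nth assms Ck_D[OF assms(3)])
 have "Ck_on k T g" if "k <= Suc m" for k using that proof (induction k)
  case 0
  thus ?case using assms(5) by simp
 next
  case (Suc k)
  hence gk: "Ck_on k T g" and k: "k <= m" by auto
  show ?case proof (rule Ck_SucI[OF assms(2) der])
   fix v
   have "Ck_on k T (%y. B (g y) $ i $ j)" for i j by (rule Ck_compose[OF assms(2,1) gk assms(6)]) (rule Ck_le[OF B k])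
   thus "Ck_on k T (%y. B (g y) *v v)" unfolding matrix_vector_mult_def
    by (intro Ck_vec_lambda Ck_sum Ck_mult assms Ck_const)
  qed
 qed
 thus ?thesis by blast
qed

section \<open>Smooth dependence of solutions of differential equations\<close>

text \<open>The squared norm is differentiable also where \<open>y\<close> vanishes. Its growth rate
  is \<open>2 * K\<close> plus 1, where the 1 pays for estimating the mixed term
  \<open>2 * norm (y s) * e\<close> by a sum of squares.\<close>

lemma gronwall_forward:
 fixes y :: "real => 'a::real_inner"
 assumes "0 <= t" "K >= 0" and der: "!!s. 0 <= s ==> s <= t ==> (y hasVD y' s) (at s)"
  and bd: "!!s. 0 <= s ==> s <= t ==> norm (y' s) <= K * norm (y s) + e"
 shows "(norm (y t))^2 + e^2 <= ((norm (y 0))^2 + e^2) * exp ((2 * K + 1) * t)" proof -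
 define N where "N s = (y s <.> y s + e^2) * exp (- (2 * K + 1) * s)" for s
 have dN: "(N hasRD (2 * (y s <.> y' s) - (2 * K + 1) * (y s <.> y s + e^2)) * exp (- (2 * K + 1) * s)) (at s)"
  if s: "0 <= s" "s <= t" for s proof -
  have "((%s. y s <.> y s) hasRD (2 * (y s <.> y' s))) (at s)" using der[OF s] unfolding hasVD_def hasRD_def
   by (auto intro!:deriv_intros simp:inner_commute)
  thus ?thesis unfolding N_def by (auto intro!:deriv_intros simp:alg)
 qed
 have neg: "2 * (y s <.> y' s) - (2 * K + 1) * (y s <.> y s + e^2) <= 0" if s: "0 <= s" "s <= t" for s proof -
  have "y s <.> y' s <= norm (y s) * norm (y' s)" by (rule norm_cauchy_schwarz)
  also have "... <= norm (y s) * (K * norm (y s) + e)" using bd[OF s] by (simp add:mult_left_mono)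
  finally have 1: "2 * (y s <.> y' s) <= 2 * K * (norm (y s))^2 + 2 * norm (y s) * e" by (simp add:sq_eq alg)
  have "2 * norm (y s) * e <= (norm (y s))^2 + e^2" by (rule sum_squares_bound)
  hence "2 * (y s <.> y' s) <= (2 * K + 1) * (norm (y s))^2 + e^2" using 1 by (simp add:alg)
  moreover have "(2 * K + 1) * (y s <.> y s + e^2) = (2 * K + 1) * (norm (y s))^2 + e^2 + 2 * K * e^2"
   by (simp add:power2_norm_eq_inner alg)
  moreover have "2 * K * e^2 >= 0" using assms(2) by simp
  ultimately show ?thesis by linarith
 qed
 have "N t <= N 0" proof (rule DERIV_nonpos_imp_decreasing_open[OF assms(1)])
  fix s assume s: "0 < s" "s < t"
  have "(2 * (y s <.> y' s) - (2 * K + 1) * (y s <.> y s + e^2)) * exp (- (2 * K + 1) * s) <= 0"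
   using neg[of s] s by (intro mult_nonpos_nonneg) auto
  thus "EX d. (N hasRD d) (at s) & d <= 0" using dN[of s] s by auto
 next
  show "cont_on {0..t} N" proof (intro cont_onI ballI)
   fix s assume "s : {0..t}"
   thus "isCont N s" using DERIV_isCont[OF dN] by auto
  qed
 qed
 hence "N t * exp ((2 * K + 1) * t) <= N 0 * exp ((2 * K + 1) * t)" by (rule mult_right_mono) simp
 moreover have "N t * exp ((2 * K + 1) * t) = y t <.> y t + e^2"
  unfolding N_def mult.assoc exp_add[symmetric] by (simp add:alg)
 moreover have "N 0 = (norm (y 0))^2 + e^2" "y t <.> y t = (norm (y t))^2"
  by (simp_all add:N_def power2_norm_eq_inner)
 ultimately show ?thesis by metis
qed

text \<open>Negative times follow by reversing time. The exponential factor is at least 1, so it may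
  be replaced by its square; the right-hand side then becomes a perfect square and the root can be
  taken.\<close>

lemma gronwall:
 fixes y :: "real => 'a::real_inner"
 assumes "abs t <= ta" "K >= 0" "e >= 0" and der: "!!s. abs s <= ta ==> (y hasVD y' s) (at s)"
  and bd: "!!s. abs s <= ta ==> norm (y' s) <= K * norm (y s) + e"
 shows "norm (y t) <= (norm (y 0) + e) * exp ((2 * K + 1) * ta)" proof -
 define E where "E = exp ((2 * K + 1) * ta)"
 have E1: "E >= 1" unfolding E_def using assms(1,2) by (simp add:mult_nonneg_nonneg)
 have "(norm (y t))^2 + e^2 <= ((norm (y 0))^2 + e^2) * exp ((2 * K + 1) * abs t)" proof (cases "t >= 0")
  case True
  have "(norm (y t))^2 + e^2 <= ((norm (y 0))^2 + e^2) * exp ((2 * K + 1) * t)"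
   by (rule gronwall_forward[where y'=y', OF True assms(2)]) (use der bd assms(1) in auto)
  thus ?thesis using True by simp
 next
  case False
  have "(norm (y (- (- t))))^2 + e^2 <= ((norm (y (- 0)))^2 + e^2) * exp ((2 * K + 1) * (- t))"
  proof (rule gronwall_forward[where y="%s. y (- s)" and y'="%s. - y' (- s)", OF _ assms(2)])
   fix s assume s: "0 <= s" "s <= - t"
   have "(uminus hasVD (-1)) (at s)" by (auto intro!:deriv_intros)
   from vector_diff_chain_at[OF this der[of "- s"]] s assms(1)
   show "((%s. y (- s)) hasVD - y' (- s)) (at s)" by (simp add:o_def)
   show "norm (- y' (- s)) <= K * norm (y (- s)) + e" using bd[of "- s"] s assms(1) by simp
  qed (use False in simp)
  thus ?thesis using False by simp
 qed
 also have "... <= ((norm (y 0))^2 + e^2) * E"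
  unfolding E_def using assms(1,2) by (intro mult_left_mono) (auto simp:mult_left_mono)
 also have "... <= (norm (y 0) + e)^2 * E^2" proof (rule mult_mono)
  show "(norm (y 0))^2 + e^2 <= (norm (y 0) + e)^2" using assms(3) by (simp add:power2_sum)
  show "E <= E^2" using E1 by (simp add:sq_eq)
 qed (use E1 in auto)
 finally have "(norm (y t))^2 <= ((norm (y 0) + e) * E)^2" by (simp add:power_mult_distrib add_increasing2 le_diff_eq)
   (smt (verit) zero_le_power2)
 hence "norm (y t) <= (norm (y 0) + e) * E" by (rule power2_le_imp_le) (use assms(3) E1 in auto)
 thus ?thesis by (simp add:E_def)
qed

text \<open>\<open>Ck_on\<close> only provides continuity of \<open>Df X y b\<close> for each fixed
  \<open>b\<close>. The bound on the operator norm is therefore assembled from the finitely many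
  basis vectors.\<close>

lemma C1_derivative_bound:
 fixes X :: "'a::euclidean_space => 'b::euclidean_space"
 assumes "Ck_on (Suc 0) U X" "compact C" "C <= U"
 obtains K where "K >= 0" "!!y v. y : C ==> norm (Df X y v) <= K * norm v" proof -
 have "EX B. ALL y:C. norm (Df X y b) <= B" for b proof -
  have "cont_on C (%y. Df X y b)" using assms(1,3) by (auto intro:cont_subset)
  hence "bounded ((%y. Df X y b) ` C)" using assms(2) compact_image compact_imp_bounded by blast
  thus ?thesis by (auto simp:bounded_iff)
 qed
 then obtain B where B: "!!b y. y : C ==> norm (Df X y b) <= B b" by metis
 define K where "K = (SUM b:Basis. abs (B b))"
 have "norm (Df X y v) <= K * norm v" if y: "y : C" for y v proof -
  have lin: "linear (Df X y)" using Ck_hasD[OF assms(1)] y assms(3) hasD_linear by blast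
  have "Df X y v = (SUM b:Basis. (v <.> b) *R Df X y b)"
   by (subst eucl_rep[of v, symmetric]) (simp add:linear_sum[OF lin] linear_scale[OF lin])
  hence "norm (Df X y v) <= (SUM b:Basis. abs (v <.> b) * norm (Df X y b))"
   by (metis (no_types, lifting) norm_scaleR norm_sum sum.cong)
  also have "... <= (SUM b:Basis. norm v * abs (B b))"
   using B[OF y] by (intro sum_mono mult_mono) (auto simp:Basis_le_norm intro:order_trans[OF _ abs_ge_self])
  finally show ?thesis by (simp add:K_def sum_distrib_left mult.commute)
 qed
 moreover have "K >= 0" by (simp add:K_def sum_nonneg)
 ultimately show ?thesis using that by blast
qed

text \<open>Mean value inequality on segments that start in \<open>C\<close>, with the derivative
  uniformly continuous on a compact neighbourhood of \<open>C\<close>.\<close>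

lemma C1_uniformly_diff:
 fixes X :: "'a::euclidean_space => 'b::euclidean_space"
 assumes "open U" "Ck_on (Suc 0) U X" "compact C" "C <= U" "e > 0"
 obtains dta where "dta > 0" "!!y d. y : C ==> norm d < dta ==> y + d : U"
  "!!y d. y : C ==> norm d < dta ==> norm (X (y + d) - X y - Df X y d) <= e * norm d" proof -
 obtain dta0 where d0: "dta0 > 0" "(UN x:C. cball x dta0) <= U"
  using compact_subset_open_imp_cball_epsilon_subset[OF assms(3,1,4)] by blast
 \<comment> \<open>A compact thickening of \<open>C\<close> inside \<open>U\<close> that contains
   all the segments in question.\<close>
 define C' where "C' = (UN x:C. UN y:cball 0 dta0. {x + y})"
 have cC': "compact C'" unfolding C'_def by (rule compact_sums'[OF assms(3) compact_cball])
 have C'mem: "y + d : C'" if "y : C" "norm d <= dta0" for y d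
  using that unfolding C'_def by (intro UN_I[of y] UN_I[of d]) auto
 have C'U: "C' <= U" proof -
  have "x + d : cball x dta0" if "d : cball 0 dta0" for x d :: 'a using that by (simp add:dist_norm)
  thus ?thesis using d0(2) unfolding C'_def by blast
 qed
 \<comment> \<open>The operator norm is estimated by a sum over the basis, so each basis vector may
   contribute \<open>e / DIM('a)\<close>.\<close>
 define e' where "e' = e / real DIM('a)"
 have e': "e' > 0" using assms(5) by (simp add:e'_def)
 have "EX d>0. ALL x:C'. ALL x':C'. dist x' x < d --> dist (Df X x' b) (Df X x b) < e'" for b proof -
  have "cont_on C' (%y. Df X y b)" using assms(2) C'U by (auto intro:cont_subset)
  hence "uniformly_continuous_on C' (%y. Df X y b)" using cC' compact_uniformly_continuous by blast
  thus ?thesis using e' unfolding uniformly_continuous_on_def by blast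
 qed
 then obtain D where D: "!!b. D b > 0"
  "!!b x x'. x : C' ==> x' : C' ==> dist x' x < D b ==> dist (Df X x' b) (Df X x b) < e'" by metis
 define dta where "dta = min dta0 (Min (D ` Basis))"
 have d: "dta > 0" "dta <= dta0" "!!b. b : Basis ==> dta <= D b" using d0 D(1) by (auto simp:dta_def min.coboundedI2)
 show ?thesis proof (rule that[OF d(1)])
  fix y d :: 'a assume y: "y : C" and nd: "norm d < dta"
  have yd: "y + t *R d : C'" if "t : {0..1}" for t proof -
   have "norm (t *R d) <= norm d" using that by (auto simp:mult_left_le_one_le)
   thus ?thesis using C'mem[OF y, of "t *R d"] nd d(2) by linarith
  qed
  show "y + d : U" using yd[of 1] C'U by auto
  define S where "S = (%t. y + t *R d) ` {0..1}"
  have SU: "S <= U" using yd C'U by (auto simp:S_def)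
  have lin: "linear (Df X x)" if "x : U" for x using Ck_hasD[OF assms(2) that] hasD_linear by blast
  have yS: "y : S" unfolding S_def by (rule image_eqI[of _ _ 0]) auto
  have "norm (X (y + d) - X y - Df X y (y + d - y)) <= norm (y + d - y) * e"
  proof (rule differentiable_bound_linearization[where S=S])
   show "y + t *R (y + d - y) : S" if "t : {0..1}" for t using that by (auto simp:S_def)
   show "(X hasD Df X x) (at x within S)" if "x : S" for x
    using that SU Ck_hasD[OF assms(2)] hasD_within by blast
   show "y : S" by (rule yS)
   show "onorm (Df X x - Df X y) <= e" if x: "x : S" for x proof (rule onorm_le)
    fix v
    obtain t where t: "x = y + t *R d" "t : {0..1}" using x unfolding S_def by blast
    have xC: "x : C'" "y : C'" using yd[OF t(2)] yd[of 0] t by auto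
    have "norm (t *R d) <= norm d" using t by (auto simp:mult_left_le_one_le)
    hence dx: "dist x y < dta" using nd t by (simp add:dist_norm)
    have lD: "linear (%v. Df X x v - Df X y v)" using lin xC C'U by (auto intro:linear_compose_sub)
    have "Df X x v - Df X y v = (SUM b:Basis. (v <.> b) *R (Df X x b - Df X y b))" proof -
     have "Df X x v - Df X y v = (%v. Df X x v - Df X y v) (SUM b:Basis. (v <.> b) *R b)" by (simp add:eucl_rep)
     thus ?thesis unfolding linear_sum[OF lD] linear_scale[OF lD] .
    qed
    hence "norm (Df X x v - Df X y v) <= (SUM b:Basis. norm ((v <.> b) *R (Df X x b - Df X y b)))"
     by (simp only: norm_sum)
    also have "... <= (SUM b:(Basis::'a set). norm v * e')" proof (rule sum_mono)
     fix b :: 'a assume b: "b : Basis"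
     have "norm (Df X x b - Df X y b) <= e'" using D(2)[OF xC(2,1), of b] dx d(3)[OF b] by (simp add:dist_norm)
     thus "norm ((v <.> b) *R (Df X x b - Df X y b)) <= norm v * e'"
      using Basis_le_norm[OF b, of v] by (auto intro:mult_mono)
    qed
    also have "... = e * norm v" by (simp add:e'_def)
    finally show "norm ((Df X x - Df X y) v) <= e * norm v" by simp
   qed
  qed
  thus "norm (X (y + d) - X y - Df X y d) <= e * norm d" by (simp add:mult.commute)
 qed
qed

lemma continuous_uniformly_close:
 fixes ph :: "real * 'p::euclidean_space => 'e::metric_space"
 assumes "cont_on ({-T<..<T} >< P) ph" "open P" "x0 : P" "0 <= ta" "ta < T" "dta > 0"
 obtains et where "et > 0" "!!x t. norm (x - x0) < et ==> abs t <= ta ==> x : P & dist (ph (t, x)) (ph (t, x0)) < dta"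
proof -
 obtain r where r: "r > 0" "cball x0 r <= P" using assms(2,3) open_contains_cball by blast
 have "compact ({-ta..ta} >< cball x0 r)" by (intro compact_Times) auto
 moreover have "cont_on ({-ta..ta} >< cball x0 r) ph"
  by (rule cont_subset[OF assms(1)]) (use r assms(5) in auto)
 ultimately have "uniformly_continuous_on ({-ta..ta} >< cball x0 r) ph" using compact_uniformly_continuous by blast
 then obtain d where d: "d > 0" "!!p q. p : {-ta..ta} >< cball x0 r ==> q : {-ta..ta} >< cball x0 r ==>
   dist q p < d ==> dist (ph q) (ph p) < dta" using assms(6) unfolding uniformly_continuous_on_def by metis
 show ?thesis proof (rule that[of "min d r"])
  fix x t assume x: "norm (x - x0) < min d r" and t: "abs t <= ta"
  have xr: "x : cball x0 r" using x by (simp add:dist_norm norm_minus_commute)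
  have "dist (t, x) (t, x0) < d" using x by (simp add:dist_Pair_Pair dist_norm)
  thus "x : P & dist (ph (t, x)) (ph (t, x0)) < dta"
   using d(2)[of "(t, x0)" "(t, x)"] xr r t by (auto simp:abs_le_iff)
 qed (use d r in auto)
qed

text \<open>A continuous family of solutions is given, not constructed. The affine initial condition
  covers the two uses: the geodesic flow in a chart, where the parameter is the initial value
  itself, and the system of \<open>Ck_linear_ode\<close>, which carries the parameter as an extra
  component.\<close>

locale ode_family =
 fixes U :: "'e::euclidean_space set" and X :: "'e => 'e" and T :: real
  and P :: "'p::euclidean_space set" and ph :: "real * 'p => 'e" and a :: 'e and io :: "'p => 'e"
 assumes openU: "open U" and X_C1: "Ck_on (Suc 0) U X" and openP: "open P"
  and ph_cont: "cont_on ({-T<..<T} >< P) ph" and ph_U: "abs t < T ==> x : P ==> ph (t, x) : U"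
  and ph_ode: "abs t < T ==> x : P ==> ((%t. ph (t, x)) hasVD X (ph (t, x))) (at t)"
  and ph_init: "x : P ==> ph (0, x) = a + io x" and io_linear: "linear io"
begin

lemma DX_linear: "y : U ==> linear (Df X y)" using Ck_hasD[OF X_C1] hasD_linear by blast

definition "dev x0 u t = ph (t, x0 + u) - ph (t, x0)"

text \<open>The Taylor remainder of \<open>X\<close> along the unperturbed orbit; it measures how
  far the deviation is from solving the linearised equation.\<close>

definition "dev_err x0 u t = X (ph (t, x0 + u)) - X (ph (t, x0)) - Df X (ph (t, x0)) (dev x0 u t)"

lemma dev_deriv:
 assumes "x0 : P" "x0 + u : P" "abs t < T"
 shows "(dev x0 u hasVD (Df X (ph (t, x0)) (dev x0 u t) + dev_err x0 u t)) (at t)" unfolding dev_def dev_err_def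
 using hasVD_diff[OF ph_ode[OF assms(3,2)] ph_ode[OF assms(3,1)]] by simp

lemma orbit_bound:
 assumes "x0 : P" "ta < T"
 obtains K where "K >= 0" "!!t v. abs t <= ta ==> norm (Df X (ph (t, x0)) v) <= K * norm v" proof -
 have c: "compact (ph ` ({-ta..ta} >< {x0}))"
  by (intro compact_image cont_subset[OF ph_cont] compact_Times) (use assms in auto)
 have "ph ` ({-ta..ta} >< {x0}) <= U" using assms ph_U by auto
 from C1_derivative_bound[OF X_C1 c this] obtain K where "K >= 0"
  "!!y v. y : ph ` ({-ta..ta} >< {x0}) ==> norm (Df X y v) <= K * norm v" by blast
 thus ?thesis using that by (auto simp:abs_le_iff)
qed

lemma dev_err_small:
 assumes "x0 : P" "0 <= ta" "ta < T" "e > 0"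
 obtains et where "et > 0" "!!u. norm u < et ==> x0 + u : P"
  "!!u t. norm u < et ==> abs t <= ta ==> norm (dev_err x0 u t) <= e * norm (dev x0 u t)" proof -
 have c: "compact (ph ` ({-ta..ta} >< {x0}))"
  by (intro compact_image cont_subset[OF ph_cont] compact_Times) (use assms in auto)
 have CU: "ph ` ({-ta..ta} >< {x0}) <= U" using assms ph_U by auto
 obtain dta where d: "dta > 0" "!!y d. y : ph ` ({-ta..ta} >< {x0}) ==> norm d < dta ==>
   norm (X (y + d) - X y - Df X y d) <= e * norm d"
  using C1_uniformly_diff[OF openU X_C1 c CU assms(4)] by metis
 obtain et where h: "et > 0" "!!x t. norm (x - x0) < et ==> abs t <= ta ==> x : P & dist (ph (t, x)) (ph (t, x0)) < dta"
  using continuous_uniformly_close[OF ph_cont openP assms(1,2,3) d(1)] by metis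
 show ?thesis proof (rule that[OF h(1)])
  fix u :: 'p assume u: "norm u < et"
  show "x0 + u : P" using h(2)[of "x0 + u" 0] u assms(2) by simp
  fix t assume t: "abs t <= ta"
  have "norm (dev x0 u t) < dta" using h(2)[of "x0 + u" t] u t by (simp add:dev_def dist_norm)
  from d(2)[OF _ this, of "ph (t, x0)"] t
  show "norm (dev_err x0 u t) <= e * norm (dev x0 u t)" by (simp add:dev_err_def) (simp add:dev_def abs_le_iff)
 qed
qed

lemma dev_init: "x0 : P ==> x0 + u : P ==> dev x0 u 0 = io u"
 using io_linear by (simp add:dev_def ph_init linear_add)

lemma io_bound: obtains L where "L >= 0" "!!u. norm (io u) <= L * norm u"
 using linear_bounded[OF io_linear] onorm_pos_le
 by (metis abs_ge_self abs_ge_zero mult_right_mono norm_ge_zero order_trans)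

text \<open>\<open>dev_err_small\<close> bounds the error relative to the deviation at the same
  time. Gronwall's inequality bounds that deviation linearly in the perturbation \<open>u\<close> of
  the parameter.\<close>

lemma dev_err_small':
 assumes "x0 : P" "0 <= ta" "ta < T" "e > 0"
 obtains et where "et > 0" "!!u. norm u < et ==> x0 + u : P"
  "!!u t. norm u < et ==> abs t <= ta ==> norm (dev_err x0 u t) <= e * norm u" proof -
 obtain K where K: "K >= 0" "!!t v. abs t <= ta ==> norm (Df X (ph (t, x0)) v) <= K * norm v"
  using orbit_bound[OF assms(1,3)] by metis
 obtain L where L: "L >= 0" "!!u. norm (io u) <= L * norm u" using io_bound by metis
 define E where "E = exp ((2 * (K + 1) + 1) * ta)"
 \<comment> \<open>The minimum with 1 keeps the Gronwall rate at \<open>K + 1\<close> whatever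
   \<open>e\<close> is; the second entry absorbs the factor \<open>L * E\<close> by which deviations
   can grow.\<close>
 define e' where "e' = min 1 (e / (L * E + 1))"
 have LE: "L * E >= 0" using L by (simp add:E_def)
 hence e': "e' > 0" "e' <= 1" "e' * (L * E) <= e" proof -
  show "e' > 0" "e' <= 1" using assms(4) LE by (simp_all add:e'_def)
  have "e' * (L * E) <= e / (L * E + 1) * (L * E)" using LE by (intro mult_right_mono) (auto simp:e'_def)
  also have "... <= e" using LE assms(4) by (simp add:field_simps)
  finally show "e' * (L * E) <= e" .
 qed
 obtain et where h: "et > 0" "!!u. norm u < et ==> x0 + u : P"
  "!!u t. norm u < et ==> abs t <= ta ==> norm (dev_err x0 u t) <= e' * norm (dev x0 u t)"
  using dev_err_small[OF assms(1,2,3) e'(1)] by metis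
 show ?thesis proof (rule that[OF h(1,2)])
  fix u :: 'p and t assume u: "norm u < et" and t: "abs t <= ta"
  have "norm (dev x0 u t) <= (norm (dev x0 u 0) + 0) * exp ((2 * (K + 1) + 1) * ta)" proof (rule gronwall[OF t])
   fix s assume s: "abs s <= ta"
   show "(dev x0 u hasVD (Df X (ph (s, x0)) (dev x0 u s) + dev_err x0 u s)) (at s)"
    using dev_deriv[OF assms(1) h(2)[OF u]] s assms(3) by auto
   have "norm (Df X (ph (s, x0)) (dev x0 u s) + dev_err x0 u s) <= K * norm (dev x0 u s) + e' * norm (dev x0 u s)"
    using K(2)[OF s] h(3)[OF u s] norm_triangle_mono by blast
   also have "... <= (K + 1) * norm (dev x0 u s) + 0"
    using e'(2) mult_right_mono[of e' 1 "norm (dev x0 u s)"] by (simp add:distrib_right)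
   finally show "norm (Df X (ph (s, x0)) (dev x0 u s) + dev_err x0 u s) <= (K + 1) * norm (dev x0 u s) + 0" .
  qed (use K(1) in auto)
  also have "... <= L * norm u * E"
   using dev_init[OF assms(1) h(2)[OF u]] L(2)[of u] by (simp add:E_def mult_right_mono)
  finally have "e' * norm (dev x0 u t) <= e' * (L * E) * norm u"
   using mult_left_mono[of "norm (dev x0 u t)" "L * norm u * E" e'] e'(1) by (simp add:alg)
  also have "... <= e * norm u" using e'(3) by (intro mult_right_mono) auto
  finally show "norm (dev_err x0 u t) <= e * norm u" using h(3)[OF u t] by linarith
 qed
qed

text \<open>The difference quotients almost solve the linearised equation, so by Gronwall's inequality they
 converge; this yields the solution of the linearised equation without an existence theorem.\<close>

lemma variation_exists:
 assumes x0: "x0 : P" and T: "T > 0"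
 obtains z where "z 0 = io u" "!!t. abs t < T ==> (z hasVD Df X (ph (t, x0)) (z t)) (at t)" proof -
 define q where "q n t = real (Suc n) *R dev x0 (u /\<^sub>R real (Suc n)) t" for n t
 define r where "r n t = real (Suc n) *R dev_err x0 (u /\<^sub>R real (Suc n)) t" for n t
 have *: "EX N. ALL n>=N. x0 + u /\<^sub>R real (Suc n) : P & (ALL t. abs t <= ta --> norm (r n t) <= e)"
  if t: "0 <= ta" "ta < T" and e: "e > 0" for ta e proof -
  define e' where "e' = e / (norm u + 1)"
  have nu: "norm u + 1 > 0" by (smt (verit) norm_ge_zero)
  hence e': "e' > 0" using e by (simp add:e'_def)
  obtain et where h: "et > 0" "!!u. norm u < et ==> x0 + u : P"
   "!!u t. norm u < et ==> abs t <= ta ==> norm (dev_err x0 u t) <= e' * norm u"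
   using dev_err_small'[OF x0 t e'] by metis
  obtain N :: nat where N: "norm u / et < real N" using reals_Archimedean2 by blast
  have "x0 + u /\<^sub>R real (Suc n) : P & (ALL t. abs t <= ta --> norm (r n t) <= e)" if n: "n >= N" for n proof -
   have "norm u / et < real (Suc n)" using N n by linarith
   hence small: "norm (u /\<^sub>R real (Suc n)) < et" using h(1) by (simp add:field_simps)
   have "norm (r n t) <= e" if "abs t <= ta" for t proof -
    have "norm (r n t) = real (Suc n) * norm (dev_err x0 (u /\<^sub>R real (Suc n)) t)"
     unfolding r_def by (simp del:of_nat_Suc)
    also have "... <= real (Suc n) * (e' * norm (u /\<^sub>R real (Suc n)))"
     using h(3)[OF small that] by (intro mult_left_mono) auto
    also have "... = e' * norm u" by (simp del:of_nat_Suc)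
    also have "... <= e" using e nu by (simp add:e'_def field_simps)
    finally show ?thesis .
   qed
   thus ?thesis using h(2)[OF small] by blast
  qed
  thus ?thesis by blast
 qed
 have dq: "(q n hasVD (Df X (ph (t, x0)) (q n t) + r n t)) (at t)"
  if "x0 + u /\<^sub>R real (Suc n) : P" "abs t < T" for n t proof -
  have "linear (Df X (ph (t, x0)))" using DX_linear ph_U x0 that by blast
  thus ?thesis
   using bounded_linear.has_vector_derivative[OF bounded_linear_scaleR_right dev_deriv[OF x0 that], of "real (Suc n)"]
   unfolding q_def r_def by (simp add:linear_scale scaleR_add_right del:of_nat_Suc)
 qed
 have q0: "q n 0 = io u" if "x0 + u /\<^sub>R real (Suc n) : P" for n
  using dev_init[OF x0 that] io_linear by (simp add:q_def linear_scale del:of_nat_Suc)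
 have cauchy: "EX N. ALL n>=N. ALL m>=N. ALL t. abs t <= ta --> norm (q n t - q m t) <= e"
  if t: "0 <= ta" "ta < T" and e: "e > 0" for ta e proof -
  obtain K where K: "K >= 0" "!!t v. abs t <= ta ==> norm (Df X (ph (t, x0)) v) <= K * norm v"
   using orbit_bound[OF x0 t(2)] by metis
  define E where "E = exp ((2 * K + 1) * ta)"
  have E: "E > 0" by (simp add:E_def)
  define e' where "e' = e / (2 * E)"
  have e': "e' > 0" "2 * e' * E = e" using e E by (simp_all add:e'_def)
  from *[OF t e'(1)] obtain N where N: "!!n. n >= N ==> x0 + u /\<^sub>R real (Suc n) : P"
   "!!n t. n >= N ==> abs t <= ta ==> norm (r n t) <= e'" by blast
  have "norm (q n t - q m t) <= e" if nm: "n >= N" "m >= N" and t': "abs t <= ta" for n m t proof -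
   have "norm (q n t - q m t) <= (norm (q n 0 - q m 0) + 2 * e') * exp ((2 * K + 1) * ta)"
   proof (rule gronwall[OF t' K(1)])
    fix s assume s: "abs s <= ta"
    have lin: "linear (Df X (ph (s, x0)))" using DX_linear ph_U x0 s t by auto
    show "((%s. q n s - q m s) hasVD (Df X (ph (s, x0)) (q n s - q m s) + (r n s - r m s))) (at s)"
     using hasVD_diff[OF dq[OF N(1)[OF nm(1)]] dq[OF N(1)[OF nm(2)]], of s] s t
     by (simp add:linear_diff[OF lin] alg)
    show "norm (Df X (ph (s, x0)) (q n s - q m s) + (r n s - r m s)) <= K * norm (q n s - q m s) + 2 * e'"
     using norm_triangle_ineq[of "Df X (ph (s, x0)) (q n s - q m s)" "r n s - r m s"]
      norm_triangle_ineq4[of "r n s" "r m s"] K(2)[OF s, of "q n s - q m s"] N(2)[OF nm(1) s] N(2)[OF nm(2) s]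
     by linarith
   qed (use e'(1) in simp)
   thus ?thesis using q0[OF N(1)] nm e'(2) by (simp add:E_def)
  qed
  thus ?thesis by blast
 qed
 define z where "z t = lim (%n. q n t)" for t
 have lim: "(%n. q n t) ----> z t" if "abs t < T" for t proof -
  have "Cauchy (%n. q n t)" proof (rule CauchyI)
   fix e :: real assume "e > 0"
   then obtain N where "ALL n>=N. ALL m>=N. ALL s. abs s <= abs t --> norm (q n s - q m s) <= e / 2"
    using cauchy[OF abs_ge_zero `\<bar>t\<bar> < T` half_gt_zero[OF `e > 0`]] by blast
   thus "EX M. ALL m>=M. ALL n>=M. norm (q m t - q n t) < e" using `e > 0` by (smt (verit) field_sum_of_halves)
  qed
  thus ?thesis unfolding z_def using Cauchy_convergent convergent_LIMSEQ_iff by blast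
 qed
 have uni: "EX N. ALL n>=N. ALL t. abs t <= ta --> norm (q n t - z t) <= e"
  if t: "0 <= ta" "ta < T" and e: "e > 0" for ta e proof -
  obtain N where N: "!!n m t. n >= N ==> m >= N ==> abs t <= ta ==> norm (q n t - q m t) <= e"
   using cauchy[OF t e] by blast
  have "norm (q n t - z t) <= e" if n: "n >= N" and t': "abs t <= ta" for n t proof (rule LIMSEQ_le_const2)
   show "(%m. norm (q n t - q m t)) ----> norm (q n t - z t)"
    using lim t t' by (intro tendsto_norm tendsto_diff) auto
   show "EX M. ALL m>=M. norm (q n t - q m t) <= e" using N n t' by blast
  qed
  thus ?thesis by blast
 qed
 have dz: "(z hasVD Df X (ph (t, x0)) (z t)) (at t)" if t: "abs t < T" for t proof -
  obtain ta where tau: "abs t < ta" "ta < T" using t dense by blast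
  obtain K where K: "K >= 0" "!!t v. abs t <= ta ==> norm (Df X (ph (t, x0)) v) <= K * norm v"
   using orbit_bound[OF x0 tau(2)] by metis
  have tau0: "0 <= ta" using tau by linarith
  obtain N0 where N0: "!!n. n >= N0 ==> x0 + u /\<^sub>R real (Suc n) : P" using *[OF tau0 tau(2), of 1] by auto
  \<comment> \<open>The derivatives of the quotients converge uniformly by \<open>uni\<close> and
    \<open>*\<close>, so the limit is differentiable. The shift by \<open>N0\<close> discards the
    quotients whose perturbed parameter may lie outside \<open>P\<close>.\<close>
  have "EX g. ALL s:{-ta<..<ta}. (%n. q (n + N0) s) ----> g s &
    (g hasD (%h. h *R Df X (ph (s, x0)) (z s))) (at s within {-ta<..<ta})"
  proof (rule has_derivative_sequence[where ?x0.0=0 and l="z 0" and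
     f'="%n s h. h *R (Df X (ph (s, x0)) (q (n + N0) s) + r (n + N0) s)"])
   show "(q (n + N0) hasD (%h. h *R (Df X (ph (s, x0)) (q (n + N0) s) + r (n + N0) s))) (at s within {-ta<..<ta})"
    if "s : {-ta<..<ta}" for n s using dq[OF N0, of "n + N0" s] that tau hasD_within
    unfolding hasVD_def by fastforce
   show "(%n. q (n + N0) 0) ----> z 0" by (rule LIMSEQ_ignore_initial_segment[OF lim]) (use T in auto)
   fix e :: real assume e: "e > 0"
   define e' where "e' = e / (K + 1)"
   have e': "e' > 0" "(K + 1) * e' = e" using e K by (simp_all add:e'_def)
   obtain N1 where N1: "!!n t. n >= N1 ==> abs t <= ta ==> norm (q n t - z t) <= e'"
    using uni[OF tau0 tau(2) e'(1)] by blast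
   obtain N2 where N2: "!!n t. n >= N2 ==> abs t <= ta ==> norm (r n t) <= e'" using *[OF tau0 tau(2) e'(1)] by blast
   have "norm (h *R (Df X (ph (s, x0)) (q (n + N0) s) + r (n + N0) s) - h *R Df X (ph (s, x0)) (z s)) <= e * norm h"
    if n: "n >= max N1 N2" and s: "s : {-ta<..<ta}" for n s h proof -
    have sT: "abs s <= ta" using s by auto
    have lin: "linear (Df X (ph (s, x0)))" using DX_linear ph_U x0 s tau by auto
    have "norm (Df X (ph (s, x0)) (q (n + N0) s - z s) + r (n + N0) s) <= K * e' + e'"
     using norm_triangle_ineq[of "Df X (ph (s, x0)) (q (n + N0) s - z s)" "r (n + N0) s"]
      K(2)[OF sT, of "q (n + N0) s - z s"] N1[of "n + N0" s] N2[of "n + N0" s] n sT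
      mult_left_mono[of "norm (q (n + N0) s - z s)" e' K] K(1) by fastforce
    hence "abs h * norm (Df X (ph (s, x0)) (q (n + N0) s - z s) + r (n + N0) s) <= abs h * e"
     using e' by (intro mult_left_mono) (auto simp:alg)
    moreover have "h *R (Df X (ph (s, x0)) (q (n + N0) s) + r (n + N0) s) - h *R Df X (ph (s, x0)) (z s)
      = h *R (Df X (ph (s, x0)) (q (n + N0) s - z s) + r (n + N0) s)" by (simp add:linear_diff[OF lin] alg)
    ultimately show ?thesis by (simp add:mult.commute)
   qed
   thus "\<forall>\<^sub>F n in sequentially. ALL s:{-ta<..<ta}. ALL h. norm (h *R (Df X (ph (s, x0)) (q (n + N0) s) + r (n + N0) s)
     - h *R Df X (ph (s, x0)) (z s)) <= e * norm h" unfolding eventually_sequentially by blast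
  qed (use tau in auto)
  then obtain g where g: "!!s. s : {-ta<..<ta} ==> (%n. q (n + N0) s) ----> g s"
   "!!s. s : {-ta<..<ta} ==> (g hasD (%h. h *R Df X (ph (s, x0)) (z s))) (at s within {-ta<..<ta})" by blast
  have gz: "g s = z s" if s: "s : {-ta<..<ta}" for s proof -
   have "(%n. q (n + N0) s) ----> z s" by (rule LIMSEQ_ignore_initial_segment[OF lim]) (use s tau in auto)
   thus ?thesis using g(1)[OF s] LIMSEQ_unique by blast
  qed
  have tin: "t : {-ta<..<ta}" using tau by auto
  hence "(g hasVD Df X (ph (t, x0)) (z t)) (at t)"
   using g(2)[OF tin] at_within_open[OF tin] by (simp add:hasVD_def)
  thus ?thesis by (rule hasVD_open[OF _ _ tin gz]) auto
 qed
 have "z 0 = io u" proof (rule LIMSEQ_unique[OF lim])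
  obtain N where "!!n. n >= N ==> x0 + u /\<^sub>R real (Suc n) : P" using *[of 0 1] T by auto
  thus "(%n. q n 0) ----> io u" using q0 by (intro tendsto_eventually) (auto simp:eventually_sequentially)
 qed (use T in auto)
 thus ?thesis using that dz by blast
qed

lemma variation_unique:
 assumes x0: "x0 : P" and t: "abs t < T"
  and z: "!!s. abs s < T ==> (z hasVD Df X (ph (s, x0)) (z s)) (at s)" and z0: "z 0 = 0"
 shows "z t = 0" proof -
 obtain K where K: "K >= 0" "!!s v. abs s <= abs t ==> norm (Df X (ph (s, x0)) v) <= K * norm v"
  using orbit_bound[OF x0 t] by metis
 have "norm (z t) <= (norm (z 0) + 0) * exp ((2 * K + 1) * abs t)"
  by (rule gronwall[OF order_refl K(1) _ z]) (use K t in auto)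
 thus ?thesis using z0 by simp
qed

text \<open>Uniqueness makes the solutions \<open>z\<close> of the linearised equation linear in
  \<open>u\<close>. The remainder of \<open>ph\<close> splits into three parts: the deviation minus
  \<open>z\<close>, controlled by Gronwall's inequality; the change of \<open>z\<close> in time,
  controlled on a basis; and the remainder of the orbit itself in time.\<close>

lemma ph_diff:
 assumes T: "T > 0"
 obtains z where "!!u x. x : P ==> z u x 0 = io u"
  "!!u x t. x : P ==> abs t < T ==> (z u x hasVD Df X (ph (t, x)) (z u x t)) (at t)"
  "!!x t. x : P ==> abs t < T ==> (ph hasD (%(s, u). s *R X (ph (t, x)) + z u x t)) (at (t, x))" proof -
 have "EX z. ALL x u. x : P --> z u x 0 = io u &
   (ALL t. abs t < T --> (z u x hasVD Df X (ph (t, x)) (z u x t)) (at t))" proof -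
  have "ALL u x. EX z. x : P --> z 0 = io u &
   (ALL t. abs t < T --> (z hasVD Df X (ph (t, x)) (z t)) (at t))" using variation_exists[OF _ T] by metis
  thus ?thesis by metis
 qed
 then obtain z where z0: "!!x u. x : P ==> z u x 0 = io u"
  and z: "!!x u t. x : P ==> abs t < T ==> (z u x hasVD Df X (ph (t, x)) (z u x t)) (at t)" by metis
 have zlin: "linear (%u. z u x t)" if x: "x : P" and t: "abs t < T" for x t proof (rule linearI)
  fix u v
  have "(%t. z (u + v) x t - z u x t - z v x t) t = 0" proof (rule variation_unique[OF x t])
   fix s assume s: "abs s < T"
   have "linear (Df X (ph (s, x)))" using DX_linear ph_U x s by blast
   thus "((%t. z (u + v) x t - z u x t - z v x t) hasVD
     Df X (ph (s, x)) (z (u + v) x s - z u x s - z v x s)) (at s)"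
    using hasVD_diff[OF hasVD_diff[OF z[OF x s] z[OF x s]] z[OF x s], of "u + v" u v] by (simp add:linear_diff)
  qed (use io_linear in "simp add:z0 x linear_add")
  thus "z (u + v) x t = z u x t + z v x t" by (simp add:alg)
 next
  fix c u
  have "(%t. z (c *R u) x t - c *R z u x t) t = 0" proof (rule variation_unique[OF x t])
   fix s assume s: "abs s < T"
   have "linear (Df X (ph (s, x)))" using DX_linear ph_U x s by blast
   thus "((%t. z (c *R u) x t - c *R z u x t) hasVD
     Df X (ph (s, x)) (z (c *R u) x s - c *R z u x s)) (at s)"
    using hasVD_diff[OF z[OF x s] bounded_linear.has_vector_derivative[OF bounded_linear_scaleR_right z[OF x s]], of "c *R u" c u]
    by (simp add:linear_diff linear_scale)
  qed (use io_linear in "simp add:z0 x linear_scale")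
  thus "z (c *R u) x t = c *R z u x t" by simp
 qed
 have "(ph hasD (%(s, u). s *R X (ph (t, x)) + z u x t)) (at (t, x))" if x: "x : P" and t: "abs t < T" for x t proof -
  obtain ta where tau: "abs t < ta" "ta < T" using t dense by blast
  have tau0: "0 <= ta" using tau by linarith
  obtain K where K: "K >= 0" "!!t v. abs t <= ta ==> norm (Df X (ph (t, x)) v) <= K * norm v"
   using orbit_bound[OF x tau(2)] by metis
  define E where "E = exp ((2 * K + 1) * ta)"
  have E: "E > 0" by (simp add:E_def)
  let ?D = "%(s, u). s *R X (ph (t, x)) + z u x t"
  have bl: "bounded_linear ?D" proof (rule linear_conv_bounded_linear[THEN iffD1], rule linearI)
   fix p q :: "real * 'p" and c :: real
   show "?D (p + q) = ?D p + ?D q" by (cases p, cases q) (simp add:linear_add[OF zlin[OF x t]] alg)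
   show "?D (c *R p) = c *R ?D p" by (cases p) (simp add:linear_scale[OF zlin[OF x t]] alg)
  qed
  have main: "EX d>0. ALL y. norm (y - (t, x)) < d --> norm (ph y - ph (t, x) - ?D (y - (t, x))) <= e * norm (y - (t, x))"
   if e: "e > 0" for e proof -
   define e1 where "e1 = e / (3 * E)"
   have e1: "e1 > 0" "e1 * E = e / 3" using e E by (simp_all add:e1_def)
   obtain et where h: "et > 0" "!!u. norm u < et ==> x + u : P"
    "!!u t. norm u < et ==> abs t <= ta ==> norm (dev_err x u t) <= e1 * norm u"
    using dev_err_small'[OF x tau0 tau(2) e1(1)] by metis
   have r: "norm (dev x u s - z u x s) <= e / 3 * norm u" if u: "norm u < et" and s: "abs s <= ta" for u s proof -
    have "norm (dev x u s - z u x s) <= (norm (dev x u 0 - z u x 0) + e1 * norm u) * exp ((2 * K + 1) * ta)"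
    proof (rule gronwall[OF s K(1)])
     fix s assume s: "abs s <= ta"
     hence sT: "abs s < T" using tau by linarith
     have lin: "linear (Df X (ph (s, x)))" using DX_linear ph_U x sT by blast
     show "((%s. dev x u s - z u x s) hasVD
       (Df X (ph (s, x)) (dev x u s - z u x s) + dev_err x u s)) (at s)"
      using hasVD_diff[OF dev_deriv[OF x h(2)[OF u] sT] z[OF x sT, of u]] by (simp add:linear_diff[OF lin] alg)
     show "norm (Df X (ph (s, x)) (dev x u s - z u x s) + dev_err x u s)
       <= K * norm (dev x u s - z u x s) + e1 * norm u" using K(2)[OF s] h(3)[OF u s] norm_triangle_mono by blast
    qed (use e1 in simp)
    also have "... = e1 * E * norm u" using dev_init[OF x h(2)[OF u]] z0[OF x] by (simp add:E_def)
    finally show ?thesis using e1(2) by simp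
   qed
   define e2 where "e2 = e / (3 * real DIM('p))"
   have e2: "e2 > 0" "real DIM('p) * e2 = e / 3" using e by (simp_all add:e2_def)
   have "EX d>0. ALL s. abs (s - t) < d --> norm (z b x s - z b x t) < e2" for b
    using hasVD_cont[OF z[OF x t, of b]] e2(1) unfolding continuous_at_eps_delta dist_norm by auto
   then obtain D where D: "!!b. D b > 0" "!!b s. abs (s - t) < D b ==> norm (z b x s - z b x t) < e2" by metis
   define d2 where "d2 = Min (D ` (Basis :: 'p set))"
   have d2: "d2 > 0" "!!b. b : (Basis :: 'p set) ==> d2 <= D b" using D(1) by (auto simp:d2_def)
   have zc: "norm (z u x s - z u x t) <= e / 3 * norm u" if s: "abs (s - t) < d2" "abs s < T" for u s proof -
    have lz: "linear (%u. z u x s - z u x t)" by (intro linear_compose_sub zlin x t s)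
    have "z u x s - z u x t = (%u. z u x s - z u x t) (SUM b:Basis. (u <.> b) *R b)" by (simp add:eucl_rep)
    hence "z u x s - z u x t = (SUM b:Basis. (u <.> b) *R (z b x s - z b x t))"
     unfolding linear_sum[OF lz] linear_scale[OF lz] .
    hence "norm (z u x s - z u x t) <= (SUM b:Basis. norm ((u <.> b) *R (z b x s - z b x t)))"
     by (simp only: norm_sum)
    also have "... <= (SUM b:(Basis::'p set). norm u * e2)" proof (rule sum_mono)
     fix b :: 'p assume b: "b : Basis"
     have "norm (z b x s - z b x t) <= e2" using D(2)[of s b] s(1) d2(2)[OF b] by linarith
     thus "norm ((u <.> b) *R (z b x s - z b x t)) <= norm u * e2"
      using Basis_le_norm[OF b, of u] by (auto intro:mult_mono)
    qed
    also have "... = (real DIM('p) * e2) * norm u" by simp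
    finally show ?thesis using e2(2) by simp
   qed
   obtain d3 where d3: "d3 > 0" "!!s. norm (s - t) < d3 ==>
     norm (ph (s, x) - ph (t, x) - (s - t) *R X (ph (t, x))) <= e / 3 * norm (s - t)"
    using ph_ode[OF t x] e unfolding hasVD_def has_derivative_at_alt
    by (metis zero_less_divide_iff zero_less_numeral)
   define d where "d = Min {et, d2, d3, ta - abs t}"
   have d: "d > 0" "d <= et" "d <= d2" "d <= d3" "d <= ta - abs t" using h(1) d2(1) d3(1) tau by (auto simp:d_def)
   have "norm (ph y - ph (t, x) - ?D (y - (t, x))) <= e * norm (y - (t, x))" if y: "norm (y - (t, x)) < d" for y
   proof -
    obtain s x' where y': "y = (s, x')" by (cases y)
    define u where "u = x' - x"
    have nu: "norm u <= norm (y - (t, x))" "abs (s - t) <= norm (y - (t, x))"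
     using norm_snd_le[of u "s - t"] norm_fst_le[of "s - t" u] by (auto simp:y' u_def)
    have s: "abs s <= ta" "abs s < T" "norm u < et" "abs (s - t) < d2" "norm (s - t) < d3" using nu y d tau by auto
    have "ph y - ph (t, x) - ?D (y - (t, x)) = (dev x u s - z u x s) + (z u x s - z u x t)
      + (ph (s, x) - ph (t, x) - (s - t) *R X (ph (t, x)))" by (simp add:y' u_def dev_def)
    hence "norm (ph y - ph (t, x) - ?D (y - (t, x))) <= e / 3 * norm u + e / 3 * norm u + e / 3 * norm (s - t)"
     using r[OF s(3,1)] zc[OF s(4,2), of u] d3(2)[OF s(5)] by (metis norm_triangle_mono)
    also have "... <= e / 3 * norm (y - (t, x)) + e / 3 * norm (y - (t, x)) + e / 3 * norm (y - (t, x))"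
     using nu e by (intro add_mono mult_left_mono) auto
    finally show ?thesis by simp
   qed
   thus ?thesis using d(1) by blast
  qed
  show ?thesis unfolding has_derivative_at_alt using bl main by blast
 qed
 from that[OF z0 z this] show ?thesis .
qed

end

lemma hasVD_zero_const:
 fixes f :: "real => 'a::real_normed_vector"
 assumes "!!t. abs t < T ==> (f hasVD 0) (at t)" "abs t < T"
 shows "f t = f 0" proof (rule has_derivative_zero_unique[where s="{-T<..<T}"])
 show "(f hasD (%h. 0)) (at x within {-T<..<T})" if "x : {-T<..<T}" for x
  using assms(1)[of x] that hasD_within unfolding hasVD_def by fastforce
qed (use assms(2) in auto)

text \<open>The solution of a linear equation is as smooth as its coefficients: its derivative in the
 parameter solves a linear equation with the same homogeneous part.\<close>

lemma linear_ode_cont: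
 fixes w :: "real * 'p::euclidean_space => 'f::euclidean_space"
 assumes "open P"
  and a: "!!b. b : Basis ==> cont_on ({-T<..<T} >< P) (a b)" and be: "cont_on ({-T<..<T} >< P) be"
  and init: "!!x. x : P ==> w (0, x) = w0" and ode: "!!t x. abs t < T ==> x : P ==>
   ((%t. w (t, x)) hasVD (SUM b:Basis. (w (t, x) <.> b) *R a b (t, x)) + be (t, x)) (at t)"
 shows "cont_on ({-T<..<T} >< P) w" proof (intro cont_onI ballI)
 fix p assume "p : {-T<..<T} >< P"
 then obtain t0 x0 where p: "p = (t0, x0)" "abs t0 < T" "x0 : P" by (cases p) auto
 obtain ta where tau: "abs t0 < ta" "ta < T" using p dense by blast
 have tau0: "0 <= ta" using tau by linarith
 have "bounded ((%t. w (t, x0)) ` {-ta..ta})" proof (intro compact_imp_bounded compact_image cont_onI ballI)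
  fix t assume "t : {-ta..ta}"
  thus "isCont (%t. w (t, x0)) t" using hasVD_cont[OF ode] p tau by auto
 qed simp
 then obtain M where M: "M >= 0" "!!t. abs t <= ta ==> norm (w (t, x0)) <= M"
  unfolding bounded_iff by (metis abs_le_iff atLeastAtMost_iff imageI minus_le_iff norm_ge_zero order_trans tau0 abs_zero)
 obtain ro where rho: "ro > 0" "cball x0 ro <= P" using assms(1) p(3) open_contains_cball by blast
 have "EX B. ALL q : {-ta..ta} >< cball x0 ro. norm (a b q) <= B" if "b : Basis" for b proof -
  have "compact (a b ` ({-ta..ta} >< cball x0 ro))"
   by (intro compact_image cont_subset[OF a[OF that]] compact_Times) (use rho tau in auto)
  from compact_imp_bounded[OF this] show ?thesis by (auto simp:bounded_iff)
 qed
 then obtain B where B: "!!b q. b : Basis ==> q : {-ta..ta} >< cball x0 ro ==> norm (a b q) <= B b" by metis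
 define K where "K = (SUM b:(Basis::'f set). abs (B b))"
 have K0: "K >= 0" by (simp add:K_def sum_nonneg)
 define E where "E = exp ((2 * K + 1) * ta)"
 have E: "E > 0" by (simp add:E_def)
 \<comment> \<open>With coefficients off by at most \<open>e'\<close>, each basis vector contributes
   at most \<open>M * e'\<close> and \<open>be\<close> at most \<open>e'\<close>; \<open>E\<close>
   is the Gronwall factor.\<close>
 define C where "C = (real DIM('f) * M + 1) * E"
 have C: "C > 0" using M E by (simp add:C_def add_nonneg_pos)
 have close: "EX et>0. ALL x t. norm (x - x0) < et --> abs t <= ta --> x : P & norm (w (t, x) - w (t, x0)) <= e" if e: "e > 0" for e
 proof -
  define e' where "e' = e / C"
  have e': "e' > 0" "e' * C = e" using e C by (simp_all add:e'_def)
  have "EX et>0. ALL x t. norm (x - x0) < et --> abs t <= ta --> dist (a b (t, x)) (a b (t, x0)) < e'" if "b : Basis" for b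
   using continuous_uniformly_close[OF a[OF that] assms(1) p(3) tau0 tau(2) e'(1)] by metis
  then obtain D where D: "!!b. b : Basis ==> D b > 0"
   "!!b x t. b : Basis ==> norm (x - x0) < D b ==> abs t <= ta ==> dist (a b (t, x)) (a b (t, x0)) < e'" by metis
  obtain D' where D': "D' > 0" "!!x t. norm (x - x0) < D' ==> abs t <= ta ==> dist (be (t, x)) (be (t, x0)) < e'"
   using continuous_uniformly_close[OF be assms(1) p(3) tau0 tau(2) e'(1)] by metis
  define et where "et = Min (insert ro (insert D' (D ` Basis)))"
  have h: "et <= ro" "et <= D'" "!!b. b : Basis ==> et <= D b" unfolding et_def by (rule Min_le; simp)+
  have h0: "et > 0" unfolding et_def using D(1) D'(1) rho(1) by (subst Min_gr_iff) auto
  have "x : P & norm (w (t, x) - w (t, x0)) <= e" if x: "norm (x - x0) < et" and t: "abs t <= ta" for x t proof -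
   have xc: "x : cball x0 ro" using x h(1) by (simp add:dist_norm norm_minus_commute)
   hence xP: "x : P" using rho by blast
   have "norm (w (t, x) - w (t, x0)) <= (norm (w (0, x) - w (0, x0)) + (real DIM('f) * M + 1) * e') * exp ((2 * K + 1) * ta)"
   proof (rule gronwall[OF t K0])
    show "0 <= (real DIM('f) * M + 1) * e'" using M e' by simp
    fix s assume s: "abs s <= ta"
    hence sT: "abs s < T" using tau by linarith
    let ?d = "(SUM b:Basis. ((w (s, x) - w (s, x0)) <.> b) *R a b (s, x))
      + ((SUM b:Basis. (w (s, x0) <.> b) *R (a b (s, x) - a b (s, x0))) + (be (s, x) - be (s, x0)))"
    show "((%t. w (t, x) - w (t, x0)) has_vector_derivative ?d) (at s)"
     using hasVD_diff[OF ode[OF sT xP] ode[OF sT p(3)]]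
     by (rule has_vector_derivative_eq_rhs) (simp add:inner_diff_left alg sum.distrib sum_subtractf)
    have 1: "norm (SUM b:Basis. ((w (s, x) - w (s, x0)) <.> b) *R a b (s, x)) <= K * norm (w (s, x) - w (s, x0))"
    proof -
     have "norm (SUM b:Basis. ((w (s, x) - w (s, x0)) <.> b) *R a b (s, x)) <= (SUM b:Basis. abs (B b) * norm (w (s, x) - w (s, x0)))"
     proof (rule sum_norm_le)
      fix b :: 'f assume b: "b : Basis"
      have "norm (a b (s, x)) <= abs (B b)" using B[OF b, of "(s, x)"] s xc by (auto simp:abs_le_iff intro:order_trans)
      thus "norm (((w (s, x) - w (s, x0)) <.> b) *R a b (s, x)) <= abs (B b) * norm (w (s, x) - w (s, x0))"
       using Basis_le_norm[OF b, of "w (s, x) - w (s, x0)"] by (subst mult.commute) (auto intro:mult_mono)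
     qed
     thus ?thesis by (simp add:K_def sum_distrib_right)
    qed
    have 2: "norm (SUM b:Basis. (w (s, x0) <.> b) *R (a b (s, x) - a b (s, x0))) <= real DIM('f) * (M * e')" proof -
     have "norm (SUM b:Basis. (w (s, x0) <.> b) *R (a b (s, x) - a b (s, x0))) <= (SUM b:(Basis::'f set). M * e')"
     proof (rule sum_norm_le)
      fix b :: 'f assume b: "b : Basis"
      have "norm (a b (s, x) - a b (s, x0)) <= e'" using D(2)[OF b _ s, of x] x h(3)[OF b] by (simp add:dist_norm)
      moreover have "abs (w (s, x0) <.> b) <= M" using Basis_le_norm[OF b, of "w (s, x0)"] M(2)[OF s] by linarith
      ultimately show "norm ((w (s, x0) <.> b) *R (a b (s, x) - a b (s, x0))) <= M * e'"
       using M(1) by (auto intro:mult_mono)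
     qed
     thus ?thesis by simp
    qed
    have 3: "norm (be (s, x) - be (s, x0)) <= e'" using D'(2)[OF _ s, of x] x h(2) by (simp add:dist_norm)
    have "norm ?d <= K * norm (w (s, x) - w (s, x0)) + (real DIM('f) * (M * e') + e')"
     by (intro norm_triangle_mono 1 2 3)
    thus "norm ?d <= K * norm (w (s, x) - w (s, x0)) + (real DIM('f) * M + 1) * e'" by (simp add:alg)
   qed
   hence "norm (w (t, x) - w (t, x0)) <= e' * C" using init[OF xP] init[OF p(3)] by (simp add:C_def E_def alg)
   thus ?thesis using xP e' by simp
  qed
  thus ?thesis using h0 by blast
 qed
 show "isCont w p" unfolding continuous_at_eps_delta proof (intro allI impI)
  fix e :: real assume "e > 0"
  then obtain et where h: "et > 0" "!!x t. norm (x - x0) < et ==> abs t <= ta ==> norm (w (t, x) - w (t, x0)) <= e / 2"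
   using close[of "e / 2"] by auto
  obtain d where d: "d > 0" "!!t. dist t t0 < d ==> dist (w (t, x0)) (w (t0, x0)) < e / 2"
   using hasVD_cont[OF ode[OF p(2,3)]] `e > 0` unfolding continuous_at_eps_delta by (metis half_gt_zero)
  define d' where "d' = Min {et, d, ta - abs t0}"
  have d': "d' > 0" "d' <= et" "d' <= d" "d' <= ta - abs t0" using h d tau by (auto simp:d'_def)
  have "dist (w q) (w p) < e" if q: "dist q p < d'" for q proof -
   obtain t x where q': "q = (t, x)" by (cases q)
   have tx: "norm (x - x0) < d'" "abs (t - t0) < d'"
    using q dist_fst_le[of q p] dist_snd_le[of q p] by (auto simp:q' p dist_norm)
   have "norm (w (t, x) - w (t, x0)) <= e / 2" using h(2) tx d' by auto
   moreover have "norm (w (t, x0) - w (t0, x0)) < e / 2" using d(2)[of t] tx d' by (auto simp:dist_norm)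
   ultimately have "norm ((w (t, x) - w (t, x0)) + (w (t, x0) - w (t0, x0))) < e"
    using norm_triangle_ineq[of "w (t, x) - w (t, x0)" "w (t, x0) - w (t0, x0)"] by linarith
   thus ?thesis by (simp add:q' p dist_norm)
  qed
  thus "EX d>0. ALL x'. dist x' p < d --> dist (w x') (w p) < e" using d' by blast
 qed
qed

text \<open>Time and parameter are adjoined to the state, which makes the equation autonomous and
  lets \<open>ode_family\<close> supply the derivative of \<open>w\<close>. Its parameter part
  \<open>y\<close> starts at 0 and has inhomogeneity \<open>ga\<close>, so the induction has to run
  over all \<open>w\<close>, \<open>be\<close> and \<open>w0\<close>.\<close>

lemma Ck_linear_ode:
 fixes w :: "real * 'p::euclidean_space => 'f::euclidean_space"
 assumes "open P" "T > 0"
 shows "(!!b. b : Basis ==> Ck_on k ({-T<..<T} >< P) (a b)) ==> Ck_on k ({-T<..<T} >< P) be ==>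
  (!!x. x : P ==> w (0, x) = w0) ==>
  (!!t x. abs t < T ==> x : P ==>
   ((%t. w (t, x)) hasVD (SUM b:Basis. (w (t, x) <.> b) *R a b (t, x)) + be (t, x)) (at t)) ==>
  Ck_on k ({-T<..<T} >< P) w" proof (induction k arbitrary:w be w0)
 case 0
 show ?case unfolding Ck_on.simps by (rule linear_ode_cont[OF assms(1) _ _ 0(3) 0(4)]) (use 0(1,2) in auto)
next
 case (Suc k)
 let ?I = "{-T<..<T}"
 have oIP: "open (?I >< P)" using assms(1) by (intro open_Times) auto
 have wk: "Ck_on k (?I >< P) w"
  using Suc.prems(1,2) by (intro Suc.IH[OF _ _ Suc.prems(3,4)]) (auto intro:Ck_Suc simp del:Ck_on.simps)
 define U where "U = {p::real * 'p * 'f. fst p : ?I & fst (snd p) : P}"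
 have oU: "open U" proof -
  have "U = ?I >< P >< UNIV" by (auto simp:U_def)
  thus ?thesis using assms(1) by (simp add:open_Times)
 qed
 define A where "A p = (SUM b:Basis. (snd (snd p) <.> b) *R a b (fst p, fst (snd p))) + be (fst p, fst (snd p))" for p :: "real * 'p * 'f"
 define X where "X p = (1::real, 0::'p, A p)" for p :: "real * 'p * 'f"
 define ph where "ph q = (fst q, snd q, w q)" for q :: "real * 'p"
 define io where "io x = (0::real, x, 0::'f)" for x :: 'p
 have base: "Ck_on m U (%p. (fst p, fst (snd p)))" for m by (intro Ck_Pair Ck_fst Ck_snd Ck_ident oU)
 have cmp: "Ck_on m U (%p. f (fst p, fst (snd p)))" if "Ck_on m (?I >< P) f" for m and f :: "real * 'p => 'f"
  by (rule Ck_compose[OF oU oIP base _ that]) (auto simp:U_def)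
 have AC: "Ck_on (Suc k) U A" unfolding A_def using Suc.prems(1,2)
  by (intro Ck_add Ck_sum Ck_scaleR Ck_inner Ck_snd Ck_ident oU cmp Ck_const) auto
 have XC: "Ck_on (Suc k) U X" unfolding X_def by (intro Ck_Pair oU AC Ck_const)
 interpret ode_family U X T P ph "(0, 0, w0)" io proof (rule ode_family.intro)
  show "open U" by (rule oU)
  show "Ck_on (Suc 0) U X" by (rule Ck_le[OF XC]) simp
  show "open P" by (rule assms(1))
  show "cont_on (?I >< P) ph" unfolding ph_def by (intro continuous_intros Ck_cont[OF wk])
  show "ph (t, x) : U" if "abs t < T" "x : P" for t x using that by (auto simp:ph_def U_def)
  show "((%t. ph (t, x)) hasVD X (ph (t, x))) (at t)" if "abs t < T" "x : P" for t x unfolding ph_def X_def A_def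
   by (auto intro!:has_vector_derivative_Pair Suc.prems(4) that has_vector_derivative_const has_vector_derivative_id)
  show "ph (0, x) = (0, 0, w0) + io x" if "x : P" for x using Suc.prems(3)[OF that] by (simp add:ph_def io_def)
  show "linear io" unfolding io_def by (rule linearI) auto
 qed
 obtain z where z: "!!u x. x : P ==> z u x 0 = io u"
  "!!u x t. x : P ==> abs t < T ==> (z u x hasVD Df X (ph (t, x)) (z u x t)) (at t)"
  "!!x t. x : P ==> abs t < T ==> (ph hasD (%(s, u). s *R X (ph (t, x)) + z u x t)) (at (t, x))"
  by (rule ph_diff[OF assms(2)], rule that)
 define y where "y u q = snd (snd (z u (snd q) (fst q)))" for u q
 have DX: "Df X (t, x, v) (s, u, v') = (0, 0, (SUM b:Basis. (v' <.> b) *R a b (t, x))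
   + ((SUM b:Basis. (v <.> b) *R Df (a b) (t, x) (s, u)) + Df be (t, x) (s, u)))"
  if "abs t < T" "x : P" for t x v s u v' proof -
  have tx: "(t, x) : ?I >< P" using that by auto
  have da: "((%p::real * 'p * 'f. f (fst p, fst (snd p))) hasD (%p. Df f (t, x) (fst p, fst (snd p)))) (at (t, x, v))"
   if "Ck_on (Suc k) (?I >< P) f" for f :: "real * 'p => 'f" proof -
   have "((%p::real * 'p * 'f. (fst p, fst (snd p))) hasD (%p. (fst p, fst (snd p)))) (at (t, x, v))"
    by (auto intro!:deriv_intros)
   from hasD_compose[OF this, of f "Df f (t, x)"] Ck_hasD[OF that tx]
   show ?thesis by simp
  qed
  have dterm: "((%p::real * 'p * 'f. (snd (snd p) <.> b) *R a b (fst p, fst (snd p))) hasD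
    (%p. (v <.> b) *R Df (a b) (t, x) (fst p, fst (snd p)) + (snd (snd p) <.> b) *R a b (t, x))) (at (t, x, v))"
   if "b : Basis" for b proof -
   have "((%p::real * 'p * 'f. snd (snd p) <.> b) hasD (%p. snd (snd p) <.> b)) (at (t, x, v))"
    by (auto intro!:deriv_intros)
   from has_derivative_scaleR[OF this da[OF Suc.prems(1)[OF that]]] show ?thesis by simp
  qed
  have "(A hasD (%p. (SUM b:Basis. (v <.> b) *R Df (a b) (t, x) (fst p, fst (snd p)) + (snd (snd p) <.> b) *R a b (t, x))
    + Df be (t, x) (fst p, fst (snd p)))) (at (t, x, v))"
   unfolding A_def by (intro has_derivative_add has_derivative_sum dterm da Suc.prems(2))
  hence "(X hasD (%p. (0, 0, (SUM b:Basis. (v <.> b) *R Df (a b) (t, x) (fst p, fst (snd p)) + (snd (snd p) <.> b) *R a b (t, x))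
    + Df be (t, x) (fst p, fst (snd p))))) (at (t, x, v))"
   unfolding X_def by (intro has_derivative_Pair has_derivative_const)
  thus ?thesis by (simp add:Df_eq sum.distrib alg)
 qed
 have zder: "((%t. f (z u x t)) hasVD f (Df X (ph (t, x)) (z u x t))) (at t)"
  if "bounded_linear f" "abs t < T" "x : P" for t x u and f :: "real * 'p * 'f => 'g::real_normed_vector"
  by (rule bounded_linear.has_vector_derivative[OF that(1) z(2)[OF that(3,2)]])
 have bl: "bounded_linear (%p::real * 'p * 'f. fst p)" "bounded_linear (%p::real * 'p * 'f. fst (snd p))"
  "bounded_linear (%p::real * 'p * 'f. snd (snd p))"
  by (intro bounded_linear_fst bounded_linear_compose[OF bounded_linear_fst bounded_linear_snd]
    bounded_linear_compose[OF bounded_linear_snd bounded_linear_snd])+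
 have DX0: "fst (Df X (ph (t, x)) p) = 0" "fst (snd (Df X (ph (t, x)) p)) = 0" if "abs t < T" "x : P" for t x p
  using DX[OF that] by (cases p, simp add:ph_def)+
 have zz: "z u x t = (0, u, y u (t, x))" if "abs t < T" "x : P" for t x u proof -
  have "fst (z u x t) = fst (z u x 0)"
   by (rule hasVD_zero_const[OF _ that(1)]) (use zder[OF bl(1) _ that(2)] DX0[OF _ that(2)] in fastforce)
  moreover have "fst (snd (z u x t)) = fst (snd (z u x 0))"
   by (rule hasVD_zero_const[where f="%t. fst (snd (z u x t))", OF _ that(1)])
    (use zder[OF bl(2) _ that(2)] DX0[OF _ that(2)] in fastforce)
  ultimately show ?thesis using z(1)[OF that(2)] by (simp add:io_def y_def prod_eq_iff)
 qed
 define ga where "ga u q = (SUM b:Basis. (w q <.> b) *R Df (a b) q (0, u)) + Df be q (0, u)" for u q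
 have yC: "Ck_on k (?I >< P) (y u)" for u proof (rule Suc.IH[where be="ga u" and ?w0.0=0])
  show "Ck_on k (?I >< P) (a b)" if "b : Basis" for b using Ck_Suc[OF Suc.prems(1)[OF that]] .
  show "Ck_on k (?I >< P) (ga u)" unfolding ga_def using Suc.prems(1,2)
   by (intro Ck_add Ck_sum Ck_scaleR Ck_inner oIP wk Ck_D Ck_const)
  show "y u (0, x) = 0" if "x : P" for x using z(1)[OF that] by (simp add:y_def io_def)
  show "((%t. y u (t, x)) hasVD (SUM b:Basis. (y u (t, x) <.> b) *R a b (t, x)) + ga u (t, x)) (at t)"
   if "abs t < T" "x : P" for t x proof -
   have "snd (snd (Df X (ph (t, x)) (z u x t))) = (SUM b:Basis. (y u (t, x) <.> b) *R a b (t, x)) + ga u (t, x)"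
    unfolding zz[OF that] using DX[OF that] by (simp add:ph_def ga_def)
   thus ?thesis using zder[OF bl(3) that, of u] by (simp add:y_def)
  qed
 qed
 show ?case proof (rule Ck_SucI[OF oIP])
  fix q assume "q : ?I >< P"
  then obtain t x where q: "q = (t, x)" "abs t < T" "x : P" by (cases q) auto
  have "((%q. snd (snd (ph q))) hasD (%p. snd (snd (case p of (s, u) => s *R X (ph (t, x)) + z u x t)))) (at (t, x))"
   by (intro has_derivative_snd z(3) q)
  moreover have "(%p. snd (snd (case p of (s, u) => s *R X (ph (t, x)) + z u x t))) = (%p. fst p *R A (ph q) + y (snd p) q)"
   by (auto simp:X_def q zz)
  ultimately show "(w hasD (%p. fst p *R A (ph q) + y (snd p) q)) (at q)" by (simp add:ph_def q)
 next
  fix p :: "real * 'p"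
  have "Ck_on k (?I >< P) (%q. A (ph q))" proof (rule Ck_compose[OF oIP oU])
   show "Ck_on k (?I >< P) ph" unfolding ph_def by (intro Ck_Pair Ck_fst Ck_snd Ck_ident oIP wk)
   show "ph ` (?I >< P) <= U" by (auto simp:ph_def U_def)
   show "Ck_on k U A" using Ck_Suc[OF AC] .
  qed
  thus "Ck_on k (?I >< P) (%q. fst p *R A (ph q) + y (snd p) q)" by (intro Ck_add Ck_scaleR oIP yC Ck_const)
 qed
qed

text \<open>If \<open>ph\<close> is of class k, so are the coefficients of the linearised equation
  along it. By \<open>Ck_linear_ode\<close> the derivatives of \<open>ph\<close> are then of class k
  as well, which is one order more for \<open>ph\<close>.\<close>

theorem (in ode_family) Ck_flow:
 assumes "T > 0" "smooth_on U X"
 shows "Ck_on k ({-T<..<T} >< P) ph" proof (induction k)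
 case 0
 thus ?case using ph_cont by simp
next
 case (Suc k)
 let ?I = "{-T<..<T}"
 have oIP: "open (?I >< P)" using openP by (intro open_Times) auto
 have im: "ph ` (?I >< P) <= U" using ph_U by auto
 obtain z where z: "!!u x. x : P ==> z u x 0 = io u"
  "!!u x t. x : P ==> abs t < T ==> (z u x hasVD Df X (ph (t, x)) (z u x t)) (at t)"
  "!!x t. x : P ==> abs t < T ==> (ph hasD (%(s, u). s *R X (ph (t, x)) + z u x t)) (at (t, x))"
  by (rule ph_diff[OF assms(1)], rule that)
 define y where "y u q = z u (snd q) (fst q)" for u q
 have "Ck_on k (?I >< P) (y u)" for u
 proof (rule Ck_linear_ode[OF openP assms(1), where a="%b q. Df X (ph q) b" and be="%_. 0"])
  show "Ck_on k (?I >< P) (%q. Df X (ph q) b)" for b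
   using assms(2) by (intro Ck_compose[OF oIP openU Suc.IH im, where g="%y. Df X y b"] Ck_D) (simp add:smooth_on_def)
  show "y u (0, x) = io u" if "x : P" for x using z(1)[OF that] by (simp add:y_def)
  show "((%t. y u (t, x)) hasVD (SUM b:Basis. (y u (t, x) <.> b) *R Df X (ph (t, x)) b) + 0) (at t)"
   if "abs t < T" "x : P" for t x proof -
   have lin: "linear (Df X (ph (t, x)))" using DX_linear ph_U that by blast
   have "Df X (ph (t, x)) (z u x t) = Df X (ph (t, x)) (SUM b:Basis. (z u x t <.> b) *R b)"
    by (simp add:eucl_rep)
   thus ?thesis using z(2)[OF that(2,1), of u] by (simp add:y_def linear_sum[OF lin] linear_scale[OF lin])
  qed
 qed simp
 hence yC: "Ck_on k (?I >< P) (%q. y u q)" for u .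
 show ?case proof (rule Ck_SucI[OF oIP])
  fix q assume "q : ?I >< P"
  thus "(ph hasD (%p. fst p *R X (ph q) + y (snd p) q)) (at q)"
   using z(3)[of "snd q" "fst q"] by (auto simp:y_def case_prod_beta')
 next
  fix p :: "real * 'p"
  have "Ck_on k (?I >< P) (%q. X (ph q))"
   using assms(2) by (intro Ck_compose[OF oIP openU Suc.IH im]) (simp add:smooth_on_def)
  thus "Ck_on k (?I >< P) (%q. fst p *R X (ph q) + y (snd p) q)" by (intro Ck_add Ck_scaleR oIP yC Ck_const)
 qed
qed

section \<open>Christoffel symbols and curvature without coordinates\<close>

text \<open>The Christoffel symbols as a vector-valued bilinear map. \<open>christoffel\<close> sees
  its chart only through the component matrix \<open>g c\<close>, so a dummy chart over
  \<open>unit\<close> lets the same formula serve any matrix field \<open>h\<close>.\<close>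

definition Gam :: "(real^'n::finite => real^'n^'n) => real^'n => real^'n => real^'n => real^'n" where
 "Gam h x u v = (\<chi> l. SUM i:UNIV. SUM j:UNIV.
   christoffel (%_::(unit, 'n) chart. h) undefined l i j x * u $ i * v $ j)"

abbreviation "DG h u v x == Df (%y. Gam h y u v) x"

definition Rm :: "(real^'n::finite => real^'n^'n) => real^'n => real^'n => real^'n => real^'n => real^'n" where
 "Rm h x u v w = (\<chi> l. SUM k:UNIV. SUM i:UNIV. SUM j:UNIV.
   curv (%_::(unit, 'n) chart. h) undefined l k i j x * u $ i * v $ j * w $ k)"

lemma christoffel_cong_metric: "g c = g' c' ==> christoffel g c = christoffel g' c'"
 by (auto simp:christoffel_def fun_eq_iff)

lemma curv_cong_metric: "g c = g' c' ==> curv g c = curv g' c'" proof -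
 assume "g c = g' c'"
 hence e: "christoffel g c = christoffel g' c'" by (rule christoffel_cong_metric)
 show ?thesis by (intro ext) (simp only: curv_def e)
qed

lemma linear_axis_expand:
 fixes L :: "real^'n::finite => 'b::real_vector"
 assumes "linear L"
 shows "L u = (SUM i:UNIV. u $ i *R L (axis i 1))" proof -
 have "u = (SUM i:UNIV. u $ i *R axis i 1)" using basis_expansion[of u] by (simp add:scalar_mult_eq_scaleR)
 hence "L u = L (SUM i:UNIV. u $ i *R axis i 1)" by simp
 thus ?thesis by (simp add:linear_sum[OF assms] linear_scale[OF assms])
qed

lemma bilinear_eq_axis:
 fixes B :: "real^'n::finite => real^'n => 'b::real_vector"
 assumes "!!v. linear (%u. B u v)" "!!u. linear (B u)" "!!v. linear (%u. B' u v)" "!!u. linear (B' u)"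
  and "!!i j. B (axis i 1) (axis j 1) = B' (axis i 1) (axis j 1)"
 shows "B u v = B' u v" proof -
 have ex: "C u v = (SUM i:UNIV. u $ i *R (SUM j:UNIV. v $ j *R C (axis i 1) (axis j 1)))"
  if "!!v. linear (%u. C u v)" "!!u. linear (C u)" for C :: "real^'n => real^'n => 'b"
  by (subst linear_axis_expand[OF that(1)], subst linear_axis_expand[OF that(2)]) simp
 show ?thesis unfolding ex[of B, OF assms(1,2)] ex[of B', OF assms(3,4)] assms(5) ..
qed

lemma trilinear_eq_axis:
 fixes B :: "real^'n::finite => real^'n => real^'n => 'b::real_vector"
 assumes "!!v w. linear (%u. B u v w)" "!!u w. linear (%v. B u v w)" "!!u v. linear (B u v)"
  "!!v w. linear (%u. B' u v w)" "!!u w. linear (%v. B' u v w)" "!!u v. linear (B' u v)"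
  and "!!i j k. B (axis i 1) (axis j 1) (axis k 1) = B' (axis i 1) (axis j 1) (axis k 1)"
 shows "B u v w = B' u v w" proof -
 have "B (axis i 1) v w = B' (axis i 1) v w" for i
  by (rule bilinear_eq_axis[where B="B (axis i 1)" and B'="B' (axis i 1)"]) (use assms in auto)
 thus ?thesis by (subst linear_axis_expand[OF assms(1)], subst linear_axis_expand[OF assms(4)]) simp
qed

lemma Gam_linear: "linear (%u. Gam h x u v)" "linear (Gam h x u)" unfolding Gam_def
 by (auto intro!:linearI simp:vec_eq_iff sum.distrib[symmetric] sum_distrib_left alg)

lemma Rm_linear: "linear (%u. Rm h x u v w)" "linear (%v. Rm h x u v w)" "linear (Rm h x u v)" unfolding Rm_def
 by (auto intro!:linearI simp:vec_eq_iff sum.distrib[symmetric] sum_distrib_left alg)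

lemma sum_axis:
 fixes f :: "'n::finite => real"
 shows "(SUM j:UNIV. f j * axis i 1 $ j) = f i" "(SUM j:UNIV. f j * axis i 1 $ j * y) = f i * y" proof -
 have "f j * axis i 1 $ j = (if j = i then f j else 0)" for j by (simp add:axis_def)
 thus "(SUM j:UNIV. f j * axis i 1 $ j) = f i" by simp
 thus "(SUM j:UNIV. f j * axis i 1 $ j * y) = f i * y" by (simp add:sum_distrib_right[symmetric])
qed

lemma Gam_axis: "Gam h x (axis i 1) (axis j 1) $ l = christoffel (%_::(unit, 'n) chart. h) undefined l i j (x::real^'n::finite)"
 by (simp add:Gam_def sum_axis)

lemma Rm_axis: "Rm h x (axis i 1) (axis j 1) (axis k 1) $ l = curv (%_::(unit, 'n) chart. h) undefined l k i j (x::real^'n::finite)"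
 by (simp add:Rm_def sum_axis)

lemma matrix_field_deriv:
 fixes h :: "'a::real_normed_vector => real^'n^'m::finite"
 assumes "(h hasD h') (at x)"
 shows "((%y. u <.> (h y *v w)) hasD (%z. u <.> (h' z *v w))) (at x)" proof -
 have "bounded_linear (%A::real^'n^'m. u <.> (A *v w))" by (intro linear_conv_bounded_linear[THEN iffD1] linearI)
   (simp_all add:mv_add_r inner_add_right scaleR_mv[symmetric])
 from bounded_linear.has_derivative[OF this assms] show ?thesis .
qed

locale metric_field =
 fixes U :: "(real^'n::finite) set" and h :: "real^'n => real^'n^'n"
 assumes openU: "open U" and smooth: "smooth_on U h" and sym: "x : U ==> transpose (h x) = h x"
  and pos: "x : U ==> v ~= 0 ==> v <.> (h x *v v) > 0"
begin

lemma h_Ck: "Ck_on m U h" using smooth by (simp add:smooth_on_def)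

lemma h_deriv: "x : U ==> (h hasD Df h x) (at x)" by (rule Ck_hasD[OF h_Ck[of "Suc 0"]])

lemma h_commute: "x : U ==> u <.> (h x *v v) = v <.> (h x *v u)"
 by (metis sym dot_lmul_matrix inner_commute vector_transpose_matrix)

lemma h_commute': "x : U ==> u <.> (h x *v v) = (h x *v u) <.> v" using h_commute by (simp add:inner_commute)

lemma h_det: "x : U ==> det (h x) ~= 0" proof
 assume x: "x : U" and "det (h x) = 0"
 hence "~ invertible (h x)" by (simp add:invertible_det_nz)
 then obtain v where "v ~= 0" "h x *v v = 0" using matrix_left_invertible_ker invertible_left_inverse by blast
 thus False using pos[OF x, of v] by simp
qed

lemma h_nondegenerate: "x : U ==> (!!w. u <.> (h x *v w) = v <.> (h x *v w)) ==> u = v"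
 using pos[of x "u - v"] by (metis eq_iff_diff_eq_0 inner_diff_left less_irrefl)

lemma entry_Ck: "Ck_on m U (%x. h x $ i $ j)" by (intro Ck_vec_nth openU h_Ck)

lemma pd_entry: "x : U ==> pd i (%y. h y $ j $ m) x = Df h x (axis i 1) $ j $ m" proof -
 assume "x : U"
 have "((%y. h y $ j $ m) hasD (%z. Df h x z $ j $ m)) (at x)"
  by (intro bounded_linear.has_derivative[OF bounded_linear_vec_nth] h_deriv `x : U`)
 thus ?thesis by (simp add:pd_def Df_eq)
qed

lemma christoffel_Ck: "Ck_on m U (christoffel (%_::(unit, 'n) chart. h) undefined l i j)" proof -
 have "Ck_on m U (%x. pd i (%y. h y $ j $ k) x)" for i j k unfolding pd_def by (rule Ck_D[OF entry_Ck])
 moreover have "Ck_on m U (%x. minv (h x) $ l $ k)" for l k by (rule Ck_matrix_inv[OF openU entry_Ck h_det])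
 ultimately show ?thesis unfolding christoffel_def[abs_def]
  by (intro Ck_divide Ck_sum Ck_mult Ck_add Ck_diff openU Ck_const) auto
qed

lemma Gam_Ck:
 assumes "open S" "Ck_on m S f" "f ` S <= U" "Ck_on m S a" "Ck_on m S b"
 shows "Ck_on m S (%x. Gam h (f x) (a x) (b x))" unfolding Gam_def
 by (intro Ck_vec_lambda Ck_sum Ck_mult Ck_vec_nth assms
   Ck_compose[OF assms(1) openU assms(2,3) christoffel_Ck])

text \<open>Both sides are trilinear, so basis vectors suffice. There the claim is the defining
  formula of \<open>christoffel\<close> with the inverse matrix cancelled against
  \<open>h x\<close>.\<close>

lemma koszul:
 assumes "x : U"
 shows "2 * (Gam h x u v <.> (h x *v w)) = v <.> (Df h x u *v w) + u <.> (Df h x v *v w) - u <.> (Df h x w *v v)"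
proof -
 have lin: "linear (Df h x)" using h_deriv[OF assms] hasD_linear by blast
 have l1: "linear (%u. a <.> (Df h x u *v w))" for a w
  by (rule linearI) (simp_all add:linear_add[OF lin] linear_scale[OF lin] mv_add_r
    inner_add_right scaleR_mv[symmetric])
 have l2: "linear (%u. u <.> (A *v w))" "linear (%w. u <.> (A *v w))" for A :: "real^'n^'n" and u w
  by (auto intro!:linearI simp:inner_add_left inner_add_right mv_add mv_scaleR)
 have l3: "linear (%u. Gam h x u v <.> (A *v w))" "linear (%v. Gam h x u v <.> (A *v w))" for A :: "real^'n^'n" and u v w
  by (rule linear_compose[OF Gam_linear(1) l2(1), unfolded o_def])
   (rule linear_compose[OF Gam_linear(2) l2(1), unfolded o_def])
 define B where "B u v w = 2 * (Gam h x u v <.> (h x *v w))" for u v w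
 define B' where "B' u v w = v <.> (Df h x u *v w) + u <.> (Df h x v *v w) - u <.> (Df h x w *v v)" for u v w
 have "B u v w = B' u v w" proof (rule trilinear_eq_axis)
  show "linear (%u. B u v w)" "linear (%v. B u v w)" "linear (B u v)" for u v w proof -
   have L: "linear (%x. 2 * f x)" if "linear f" for f :: "real^'n => real"
    by (rule linearI) (simp_all add:linear_add[OF that] linear_scale[OF that] alg)
   show "linear (%u. B u v w)" "linear (%v. B u v w)" "linear (B u v)" unfolding B_def[abs_def] by (intro L l3 l2)+
  qed
  show "linear (%u. B' u v w)" "linear (%v. B' u v w)" "linear (B' u v)" for u v w
   unfolding B'_def[abs_def] by (intro linear_compose_sub linear_compose_add l1 l2)+
  fix i j k :: 'n
  have ax: "axis a 1 <.> (M *v axis b 1) = M $ a $ b" for M :: "real^'n^'n" and a b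
   by (simp add:mv_basis inner_axis' column_def)
  define K where "K m = Df h x (axis i 1) $ j $ m + Df h x (axis j 1) $ i $ m - Df h x (axis m 1) $ i $ j" for m
  have G: "Gam h x (axis i 1) (axis j 1) = minv (h x) *v (\<chi> m. K m / 2)"
   by (simp add:vec_eq_iff Gam_axis christoffel_def pd_entry[OF assms] matrix_vector_mult_def K_def sum_divide_distrib)
  have "Gam h x (axis i 1) (axis j 1) <.> (h x *v axis k 1) = (h x *v Gam h x (axis i 1) (axis j 1)) <.> axis k 1"
   using h_commute'[OF assms] by blast
  also have "... = (\<chi> m. K m / 2) <.> axis k 1" unfolding G by (simp add:mv_assoc minv_mult h_det assms)
  also have "... = K k / 2" by (simp add:inner_axis)
  finally show "B (axis i 1) (axis j 1) (axis k 1) = B' (axis i 1) (axis j 1) (axis k 1)"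
   by (simp add:B_def B'_def ax K_def)
 qed
 thus ?thesis by (simp add:B_def B'_def)
qed

lemma Dh_sym: "x : U ==> u <.> (Df h x w *v v) = v <.> (Df h x w *v u)" proof -
 assume x: "x : U"
 have "Df (%y. u <.> (h y *v v)) x = Df (%y. v <.> (h y *v u)) x" by (rule Df_cong[OF openU x h_commute])
 thus ?thesis using Df_eq[OF matrix_field_deriv[OF h_deriv[OF x], of u v]]
   Df_eq[OF matrix_field_deriv[OF h_deriv[OF x], of v u]] by metis
qed

lemma Gam_sym: "x : U ==> Gam h x u v = Gam h x v u" proof (rule h_nondegenerate)
 fix w assume x: "x : U"
 show "Gam h x u v <.> (h x *v w) = Gam h x v u <.> (h x *v w)"
  using koszul[OF x, of u v w] koszul[OF x, of v u w] Dh_sym[OF x, of u w v] by simp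
qed

text \<open>Sum of two Koszul identities, in which the terms antisymmetric in \<open>u\<close> and
  \<open>w\<close> cancel.\<close>

lemma metric_compatible:
 "x : U ==> u <.> (Df h x z *v w) = Gam h x z u <.> (h x *v w) + Gam h x z w <.> (h x *v u)"
 using koszul[of x z u w] koszul[of x z w u] Dh_sym[of x u z w] Dh_sym[of x z u w] Dh_sym[of x z w u] by simp

lemma Gam_hasD: "x : U ==> ((%y. Gam h y v w) hasD DG h v w x) (at x)"
 by (rule Ck_hasD[of 0 U]) (intro Gam_Ck Ck_ident openU Ck_const, auto)

lemma DGam_axis:
 assumes "x : U"
 shows "DG h (axis j 1) (axis k 1) x (axis i 1) $ l
  = pd i (christoffel (%_::(unit, 'n) chart. h) undefined l j k) x" proof -
 have "((%y. Gam h y (axis j 1) (axis k 1) $ l) hasD (%z. DG h (axis j 1) (axis k 1) x z $ l)) (at x)"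
  by (intro bounded_linear.has_derivative[OF bounded_linear_vec_nth] Gam_hasD assms)
 thus ?thesis by (simp add:pd_def Df_eq[symmetric] Gam_axis Df_eq)
qed

lemma DGam_linear:
 assumes "x : U"
 shows "linear (DG h v w x)" "linear (%v. DG h v w x u)" "linear (%w. DG h v w x u)"
proof -
 show "linear (DG h v w x)" using Gam_hasD[OF assms] hasD_linear by blast
 note d = Gam_hasD[OF assms]
 show "linear (%v. DG h v w x u)" proof (rule linearI)
  fix a b c
  have "DG h (a + b) w x = (%z. DG h a w x z + DG h b w x z)"
   using has_derivative_add[OF d[of a w] d[of b w]] by (intro Df_eq) (simp add:linear_add[OF Gam_linear(1)])
  thus "DG h (a + b) w x u = DG h a w x u + DG h b w x u" by simp
  have "DG h (c *R b) w x = (%z. c *R DG h b w x z)"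
   using has_derivative_scaleR_right[OF d[of b w], of c] by (intro Df_eq) (simp add:linear_scale[OF Gam_linear(1)])
  thus "DG h (c *R b) w x u = c *R DG h b w x u" by simp
 qed
 show "linear (%w. DG h v w x u)" proof (rule linearI)
  fix a b c
  have "DG h v (a + b) x = (%z. DG h v a x z + DG h v b x z)"
   using has_derivative_add[OF d[of v a] d[of v b]] by (intro Df_eq) (simp add:linear_add[OF Gam_linear(2)])
  thus "DG h v (a + b) x u = DG h v a x u + DG h v b x u" by simp
  have "DG h v (c *R b) x = (%z. c *R DG h v b x z)"
   using has_derivative_scaleR_right[OF d[of v b], of c] by (intro Df_eq) (simp add:linear_scale[OF Gam_linear(2)])
  thus "DG h v (c *R b) x u = c *R DG h v b x u" by simp
 qed
qed

lemma Rm_eq: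
 assumes x: "x : U"
 shows "Rm h x u v w = DG h v w x u - DG h u w x v + Gam h x u (Gam h x v w) - Gam h x v (Gam h x u w)"
proof (rule trilinear_eq_axis[where B'="%u v w. DG h v w x u - DG h u w x v
  + Gam h x u (Gam h x v w) - Gam h x v (Gam h x u w)"])
 have c1: "linear (%v. Gam h x u (Gam h x v w))" "linear (%w. Gam h x u (Gam h x v w))" for u v w
  using linear_compose[OF Gam_linear(1)[of h x w] Gam_linear(2)[of h x u]]
   linear_compose[OF Gam_linear(2)[of h x v] Gam_linear(2)[of h x u]] by (simp_all add:o_def)
 show "linear (%u. DG h v w x u - DG h u w x v + Gam h x u (Gam h x v w) - Gam h x v (Gam h x u w))"
  "linear (%v. DG h v w x u - DG h u w x v + Gam h x u (Gam h x v w) - Gam h x v (Gam h x u w))"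
  "linear (%w. DG h v w x u - DG h u w x v + Gam h x u (Gam h x v w) - Gam h x v (Gam h x u w))" for u v w
  by (intro linear_compose_sub linear_compose_add DGam_linear[OF x] Gam_linear c1)+
next
 fix i j k
 let ?G = "christoffel (%_::(unit, 'n) chart. h) undefined"
 have "Gam h x (axis a 1) b $ l = (SUM m:UNIV. ?G l a m x * b $ m)" for a b l proof -
  have "(SUM m:UNIV. ?G l i m x * axis a 1 $ i * b $ m) = (SUM m:UNIV. ?G l i m x * b $ m) * axis a 1 $ i" for i
   by (simp add:sum_distrib_left mult_ac)
  thus ?thesis by (simp add:Gam_def sum_axis)
 qed
 thus "Rm h x (axis i 1) (axis j 1) (axis k 1) =
   DG h (axis j 1) (axis k 1) x (axis i 1) - DG h (axis i 1) (axis k 1) x (axis j 1)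
   + Gam h x (axis i 1) (Gam h x (axis j 1) (axis k 1)) - Gam h x (axis j 1) (Gam h x (axis i 1) (axis k 1))"
  by (simp add:vec_eq_iff Rm_axis DGam_axis[OF x] curv_def Gam_axis sum_subtractf)
qed (rule Rm_linear)+

end

text \<open>A product rule for evaluating a variable linear map at a variable vector.
  Differentiability of \<open>L\<close> is available only on fixed vectors, hence the expansion of
  \<open>a y\<close> in the basis.\<close>

lemma apply_hasD:
 fixes L :: "'a::real_normed_vector => 'c::euclidean_space => 'b::real_normed_vector"
 assumes "open S" "x : S" and lin: "!!y. y : S ==> linear (L y)"
  and d: "!!c. (%y. L y c) differentiable (at x)" and a: "(a hasD a') (at x)"
 shows "((%y. L y (a y)) hasD (%z. Df (%y. L y (a x)) x z + L x (a' z))) (at x)" proof -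
 have dd: "((%y. L y c) hasD Df (%y. L y c) x) (at x)" for c using d frechet_derivative_works by blast
 have ex: "L y c = (SUM b:Basis. (c <.> b) *R L y b)" if "y : S" for y c proof -
  have "L y c = L y (SUM b:Basis. (c <.> b) *R b)" by (simp add:eucl_rep)
  thus ?thesis by (simp only: linear_sum[OF lin[OF that]] linear_scale[OF lin[OF that]])
 qed
 have i: "((%y. a y <.> b) hasD (%z. a' z <.> b)) (at x)" for b by (intro has_derivative_inner_left a)
 have "((%y. SUM b:Basis. (a y <.> b) *R L y b) hasD
   (%z. SUM b:Basis. (a x <.> b) *R Df (%y. L y b) x z + (a' z <.> b) *R L x b)) (at x)"
  by (intro has_derivative_sum has_derivative_scaleR i dd)
 hence 1: "((%y. L y (a y)) hasD
   (%z. SUM b:Basis. (a x <.> b) *R Df (%y. L y b) x z + (a' z <.> b) *R L x b)) (at x)"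
  by (rule hasD_open[OF _ assms(1,2)]) (simp add:ex[symmetric])
 have "((%y. SUM b:Basis. (a x <.> b) *R L y b) hasD
   (%z. SUM b:Basis. (a x <.> b) *R Df (%y. L y b) x z)) (at x)"
  by (intro has_derivative_sum has_derivative_scaleR_right dd)
 hence "((%y. L y (a x)) hasD
   (%z. SUM b:Basis. (a x <.> b) *R Df (%y. L y b) x z)) (at x)"
  by (rule hasD_open[OF _ assms(1,2)]) (simp add:ex[symmetric])
 hence 2: "Df (%y. L y (a x)) x = (%z. SUM b:Basis. (a x <.> b) *R Df (%y. L y b) x z)" by (rule Df_eq)
 show ?thesis using 1 by (simp add:2 sum.distrib ex[OF assms(2), symmetric])
qed

text \<open>A local isometry written in coordinates. Both coordinate changes and the exponential map
  seen in a chart are instances, so each tensor law is proved once.\<close>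

locale pullback = src: metric_field W h + tgt: metric_field U g for W h U and g :: "real^'n::finite => real^'n^'n" +
 fixes E :: "real^'n => real^'n"
 assumes E_smooth: "smooth_on W E" and E_U: "x : W ==> E x : U"
  and pull: "x : W ==> u <.> (h x *v v) = Df E x u <.> (g (E x) *v Df E x v)"
begin

abbreviation "D2 x u v == Df (%y. Df E y v) x u"

lemma E_Ck: "Ck_on m W E" using E_smooth by (simp add:smooth_on_def)

lemma DE_Ck: "Ck_on m W (%y. Df E y v)" by (rule Ck_D[OF E_Ck])

lemma D2_Ck: "Ck_on m W (%y. D2 y u v)" by (rule Ck_D[OF DE_Ck])

lemma E_deriv: "x : W ==> (E hasD Df E x) (at x)" by (rule Ck_hasD[OF E_Ck[of "Suc 0"]])

lemma DE_deriv: "x : W ==> ((%y. Df E y v) hasD (%u. D2 x u v)) (at x)" by (rule Ck_hasD[OF DE_Ck[of "Suc 0"]])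

lemma D2_sym: "x : W ==> D2 x u v = D2 x v u" by (rule Df_symmetric[OF src.openU E_Ck])

lemma DE_linear: "x : W ==> linear (Df E x)" using E_deriv hasD_linear by blast

lemma DE_inj: "x : W ==> inj (Df E x)" proof -
 assume x: "x : W"
 have "u = 0" if "Df E x u = 0" for u
  using src.pos[OF x, of u] pull[OF x, of u u] that by (metis inner_zero_left less_irrefl)
 thus ?thesis using linear_injective_0[OF DE_linear[OF x]] by blast
qed

lemma DE_surj: "x : W ==> surj (Df E x)" by (rule linear_injective_imp_surjective[OF DE_linear DE_inj]) auto

lemma pullback_deriv:
 assumes x: "x : W"
 shows "v <.> (Df h x u *v w) = D2 x u v <.> (g (E x) *v Df E x w) + D2 x u w <.> (g (E x) *v Df E x v)
  + Df E x v <.> (Df g (E x) (Df E x u) *v Df E x w)" proof -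
 have ge: "((%y. g (E y)) hasD (%u. Df g (E x) (Df E x u))) (at x)"
  using hasD_compose[OF E_deriv[OF x] tgt.h_deriv[OF E_U[OF x]]] .
 have bb: "bounded_bilinear (%(A::real^'n^'n) v. A *v v)" by (rule bilinear_conv_bounded_bilinear[THEN iffD1])
   (auto simp:bilinear_def intro!:linearI simp:mv_add mv_add_r
    mv_scaleR scaleR_mv[symmetric])
 have "((%y. Df E y v <.> (g (E y) *v Df E y w)) hasD
   (%u. Df E x v <.> (g (E x) *v D2 x u w + Df g (E x) (Df E x u) *v Df E x w) + D2 x u v <.> (g (E x) *v Df E x w))) (at x)"
  by (intro has_derivative_inner bounded_bilinear.FDERIV[OF bb] ge DE_deriv x)
 hence "((%y. v <.> (h y *v w)) hasD
   (%u. Df E x v <.> (g (E x) *v D2 x u w + Df g (E x) (Df E x u) *v Df E x w) + D2 x u v <.> (g (E x) *v Df E x w))) (at x)"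
  by (rule hasD_open[OF _ src.openU x]) (simp add:pull)
 from Df_eq[OF this] Df_eq[OF matrix_field_deriv[OF src.h_deriv[OF x], of v w]]
 have "v <.> (Df h x u *v w) = Df E x v <.> (g (E x) *v D2 x u w + Df g (E x) (Df E x u) *v Df E x w) + D2 x u v <.> (g (E x) *v Df E x w)"
  by metis
 thus ?thesis using tgt.h_commute[OF E_U[OF x], of "Df E x v" "D2 x u w"] by (simp add:inner_add_right)
qed

text \<open>In the Koszul combination of \<open>pullback_deriv\<close> the symmetry of second
  derivatives cancels every second-order term except twice \<open>D2 x u v\<close>.\<close>

lemma Gam_pullback:
 assumes x: "x : W"
 shows "Df E x (Gam h x u v) = D2 x u v + Gam g (E x) (Df E x u) (Df E x v)"
proof (rule tgt.h_nondegenerate[OF E_U[OF x]])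
 fix w'
 obtain w where w: "w' = Df E x w" using DE_surj[OF x] by (metis surjD)
 have "2 * (Df E x (Gam h x u v) <.> (g (E x) *v w')) = 2 * (Gam h x u v <.> (h x *v w))" by (simp add:w pull[OF x])
 also have "... = 2 * (D2 x u v <.> (g (E x) *v w')) + (Df E x v <.> (Df g (E x) (Df E x u) *v Df E x w)
   + Df E x u <.> (Df g (E x) (Df E x v) *v Df E x w) - Df E x u <.> (Df g (E x) (Df E x w) *v Df E x v))"
  unfolding src.koszul[OF x] pullback_deriv[OF x]
  using D2_sym[OF x, of u v] D2_sym[OF x, of w u] D2_sym[OF x, of w v] by (simp add:w)
 also have "... = 2 * ((D2 x u v + Gam g (E x) (Df E x u) (Df E x v)) <.> (g (E x) *v w'))"
  using tgt.koszul[OF E_U[OF x], of "Df E x u" "Df E x v" w'] by (simp add:w inner_add_left)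
 finally show "Df E x (Gam h x u v) <.> (g (E x) *v w')
   = (D2 x u v + Gam g (E x) (Df E x u) (Df E x v)) <.> (g (E x) *v w')" by simp
qed

lemma DGam_pullback:
 assumes x: "x : W"
 shows "D2 x z (Gam h x u v) + Df E x (DG h u v x z)
  = Df (%y. D2 y u v) x z + Df (%p. Gam g p (Df E x u) (Df E x v)) (E x) (Df E x z)
   + Gam g (E x) (D2 x z u) (Df E x v) + Gam g (E x) (Df E x u) (D2 x z v)" proof -
 note Ex = E_U[OF x]
 have l: "((%y. Df E y (Gam h y u v)) hasD
   (%z. D2 x z (Gam h x u v) + Df E x (DG h u v x z))) (at x)" by (rule apply_hasD[OF src.openU x DE_linear])
   (use DE_deriv[OF x] src.Gam_hasD[OF x] in "auto simp:differentiable_def")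
 have g0: "((%y. Gam g (E y) c d) hasD (%z. Df (%p. Gam g p c d) (E x) (Df E x z))) (at x)" for c d
  using hasD_compose[OF E_deriv[OF x] tgt.Gam_hasD[OF Ex, of c d]] .
 have g1: "((%y. Gam g (E y) c (Df E y v)) hasD
   (%z. Df (%p. Gam g p c (Df E x v)) (E x) (Df E x z) + Gam g (E x) c (D2 x z v))) (at x)" for c
  using apply_hasD[OF src.openU x, of "%y. Gam g (E y) c", OF Gam_linear(2) _ DE_deriv[OF x], of v]
   g0 by (simp add:Df_eq[OF g0] differentiableI[OF g0])
 have g2: "((%y. Gam g (E y) (Df E y u) (Df E y v)) hasD
   (%z. Df (%p. Gam g p (Df E x u) (Df E x v)) (E x) (Df E x z) + Gam g (E x) (Df E x u) (D2 x z v)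
    + Gam g (E x) (D2 x z u) (Df E x v))) (at x)"
  using apply_hasD[OF src.openU x, of "%y c. Gam g (E y) c (Df E y v)", OF Gam_linear(1) _ DE_deriv[OF x], of u]
  by (simp add:Df_eq[OF g1] differentiableI[OF g1])
 have d2: "((%y. D2 y u v) hasD Df (%y. D2 y u v) x) (at x)" by (rule Ck_hasD[OF D2_Ck[of "Suc 0"] x])
 have "((%y. Df E y (Gam h y u v)) hasD
   (%z. Df (%y. D2 y u v) x z + (Df (%p. Gam g p (Df E x u) (Df E x v)) (E x) (Df E x z) + Gam g (E x) (Df E x u) (D2 x z v)
    + Gam g (E x) (D2 x z u) (Df E x v)))) (at x)" using has_derivative_add[OF d2 g2]
  by (rule hasD_open[OF _ src.openU x]) (simp add:Gam_pullback)
 from fun_cong[OF hasD_unique[OF l this], of z] show ?thesis by simp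
qed

text \<open>Differentiating \<open>Gam_pullback\<close> brings in third derivatives of
  \<open>E\<close>, which are symmetric in \<open>u\<close> and \<open>v\<close>. The terms with
  \<open>D2\<close> cancel against those that \<open>Gam_pullback\<close> produces in the quadratic
  part.\<close>

theorem Rm_pullback:
 assumes x: "x : W"
 shows "Df E x (Rm h x u v w) = Rm g (E x) (Df E x u) (Df E x v) (Df E x w)" proof -
 note Ex = E_U[OF x]
 note lin = linear_add[OF DE_linear[OF x]] linear_diff[OF DE_linear[OF x]]
  linear_add[OF Gam_linear(1)] linear_add[OF Gam_linear(2)]
 have D: "Df E x (DG h v w x u) = Df (%y. D2 y v w) x u
   + Df (%p. Gam g p (Df E x v) (Df E x w)) (E x) (Df E x u)
   + Gam g (E x) (D2 x u v) (Df E x w) + Gam g (E x) (Df E x v) (D2 x u w) - D2 x u (Gam h x v w)" for u v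
  using DGam_pullback[OF x, where z=u and u=v and v=w] by (simp add:alg)
 have GG: "Df E x (Gam h x u (Gam h x v w)) = D2 x u (Gam h x v w) + Gam g (E x) (Df E x u) (D2 x v w)
   + Gam g (E x) (Df E x u) (Gam g (E x) (Df E x v) (Df E x w))" for u v by (simp add:Gam_pullback[OF x] lin)
 have s3: "Df (%y. D2 y v w) x u = Df (%y. D2 y u w) x v" by (rule Df_symmetric[OF src.openU DE_Ck x])
 show ?thesis unfolding src.Rm_eq[OF x] tgt.Rm_eq[OF Ex] lin GG D using s3 D2_sym[OF x, of u v] by simp
qed

end

definition Ric :: "(real^'n::finite => real^'n^'n) => real^'n => real^'n => real" where
 "Ric h x v = trace (matrix (%u. Rm h x u v v))"

text \<open>The operators \<open>u\<close> to R(u, v) v at \<open>x\<close> and at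
  \<open>E x\<close> are conjugate by \<open>Df E x\<close>, and conjugation preserves the
  trace.\<close>

lemma (in pullback) Ric_pullback:
 assumes x: "x : W"
 shows "Ric h x v = Ric g (E x) (Df E x v)" proof -
 define A where "A = matrix (Df E x)"
 define M where "M = matrix (%u. Rm h x u v v)"
 define N where "N = matrix (%u. Rm g (E x) u (Df E x v) (Df E x v))"
 have A: "A *v u = Df E x u" for u by (simp add:A_def matrix_works DE_linear[OF x])
 have M: "M *v u = Rm h x u v v" for u by (simp add:M_def matrix_works Rm_linear)
 have N: "N *v u = Rm g (E x) u (Df E x v) (Df E x v)" for u by (simp add:N_def matrix_works Rm_linear)
 have "(A ** M) *v u = (N ** A) *v u" for u by (simp add:mv_assoc[symmetric] A M N Rm_pullback[OF x])
 hence e: "A ** M = N ** A" by (simp add:matrix_eq)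
 have "det A ~= 0" unfolding A_def using det_nz_iff_inj[OF DE_linear[OF x]] DE_inj[OF x] by simp
 note inv = minv_mult[OF this]
 have "M = minv A ** (A ** M)" by (simp add:matrix_mul_assoc inv)
 hence "trace M = trace (minv A ** (N ** A))" by (simp add:e)
 also have "... = trace ((N ** A) ** minv A)" by (rule trace_mul_sym)
 also have "... = trace N" by (simp add:matrix_mul_assoc[symmetric] inv)
 finally show ?thesis by (simp add:Ric_def M_def N_def)
qed

section \<open>Determinants and traces\<close>

text \<open>A permutation other than the identity moves at least two indices. After one factor of
  its product is differentiated, an off-diagonal zero of the unit matrix remains.\<close>

lemma det_has_derivative_mat_1:
 fixes M :: "'a::real_normed_vector => real^'n^'n::finite"
 assumes "(M hasD M') (at x)" "M x = mat 1"
 shows "((%y. det (M y)) hasD (%z. trace (M' z))) (at x)" proof -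
 let ?P = "{p. p permutes (UNIV :: 'n set)}"
 have e: "((%y. M y $ i $ j) hasD (%z. M' z $ i $ j)) (at x)" for i j
  by (intro bounded_linear.has_derivative[OF bounded_linear_vec_nth] assms)
 have p: "((%y. PROD i:UNIV. M y $ i $ p i) hasD
   (%z. SUM i:UNIV. M' z $ i $ p i * (PROD j:UNIV - {i}. M x $ j $ p j))) (at x)" for p
  by (rule has_derivative_prod) (rule e)
 have "((%y. det (M y)) hasD (%z. SUM p:?P. of_int (sign p) *
   (SUM i:UNIV. M' z $ i $ p i * (PROD j:UNIV - {i}. M x $ j $ p j)))) (at x)"
  unfolding det_def by (intro has_derivative_sum has_derivative_mult_right p)
 moreover have "(SUM p:?P. of_int (sign p) * (SUM i:UNIV. M' z $ i $ p i * (PROD j:UNIV - {i}. M x $ j $ p j)))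
   = trace (M' z)" for z proof -
  have z: "of_int (sign p) * (SUM i:UNIV. M' z $ i $ p i * (PROD j:UNIV - {i}. M x $ j $ p j)) = 0"
   if p: "p permutes UNIV" "p ~= id" for p proof -
   obtain a where a: "p a ~= a" using p(2) by (auto simp:fun_eq_iff)
   hence "p (p a) ~= p a" using p(1) by (metis permutes_univ)
   have "(PROD j:UNIV - {i}. M x $ j $ p j) = 0" for i proof (cases "i = a")
    case True
    thus ?thesis using a `p (p a) ~= p a` by (intro prod_zero) (auto intro!:bexI[of _ "p a"] simp:assms(2) mat_def)
   next
    case False
    thus ?thesis using a by (intro prod_zero) (auto intro!:bexI[of _ a] simp:assms(2) mat_def)
   qed
   thus ?thesis by (simp del:prod_zero_iff)
  qed
  have "(SUM p:?P. of_int (sign p) * (SUM i:UNIV. M' z $ i $ p i * (PROD j:UNIV - {i}. M x $ j $ p j)))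
    = (SUM p:{id}. of_int (sign p) * (SUM i:UNIV. M' z $ i $ p i * (PROD j:UNIV - {i}. M x $ j $ p j)))"
   by (rule sum.mono_neutral_right) (use z permutes_id in auto)
  also have "... = trace (M' z)" by (simp add:assms(2) mat_def trace_def)
  finally show ?thesis .
 qed
 ultimately show ?thesis by simp
qed

lemma matrix_mult_scaleR:
 fixes A :: "real^'m::finite^'n::finite" and B :: "real^'p::finite^'m"
 shows "A ** (c *R B) = c *R (A ** B)" "(c *R A) ** B = c *R (A ** B)"
 by (simp_all add:matrix_matrix_mult_def vec_eq_iff sum_distrib_left mult_ac)

text \<open>Jacobi's formula. Multiplying by the constant inverse of \<open>M x\<close> moves the
  base point to the unit matrix.\<close>

lemma det_has_deriv:
 fixes M :: "'a::real_normed_vector => real^'n^'n::finite"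
 assumes "(M hasD M') (at x)" "det (M x) ~= 0"
 shows "((%y. det (M y)) hasD (%z. det (M x) * trace (minv (M x) ** M' z))) (at x)" proof -
 have bl: "bounded_linear (%A::real^'n^'n. minv (M x) ** A)"
  by (intro linear_conv_bounded_linear[THEN iffD1] linearI) (simp_all add:matrix_add_ldistrib matrix_mult_scaleR)
 have "((%y. det (minv (M x) ** M y)) hasD (%z. trace (minv (M x) ** M' z))) (at x)"
  by (rule det_has_derivative_mat_1[OF bounded_linear.has_derivative[OF bl assms(1)]])
   (simp add:minv_mult assms)
 hence "((%y. det (M x) * det (minv (M x) ** M y)) hasD
   (%z. det (M x) * trace (minv (M x) ** M' z))) (at x)" by (rule has_derivative_mult_right)
 moreover have "det (M x) * det (minv (M x) ** M y) = det (M y)" for y proof -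
  have "det (M x) * det (minv (M x)) = det (M x ** minv (M x))" by (simp add:det_mul)
  thus ?thesis by (simp add:minv_mult assms(2) det_mul)
 qed
 ultimately show ?thesis by simp
qed

lemma inner_transpose:
 fixes A :: "real^'m::finite^'n::finite"
 shows "u <.> (transpose A *v w) = (A *v u) <.> w" "u <.> (w v* A) = (A *v u) <.> w" proof -
 show "u <.> (w v* A) = (A *v u) <.> w" by (metis dot_lmul_matrix inner_commute)
 thus "u <.> (transpose A *v w) = (A *v u) <.> w" by simp
qed

text \<open>Gram-Schmidt for the inner product \<open>H\<close>, run over the index set. For
  dimensional reasons there is always a vector outside the span reached so far.\<close>

lemma pos_def_orthonormalize:
 fixes H :: "real^'n^'n::finite"
 assumes sym: "transpose H = H" and pos: "!!v. v ~= 0 ==> v <.> (H *v v) > 0"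
 obtains Q :: "real^'n^'n" where "transpose Q ** H ** Q = mat 1" proof -
 have cm: "u <.> (H *v v) = v <.> (H *v u)" for u v
  by (metis sym dot_lmul_matrix inner_commute vector_transpose_matrix)
 have "EX q::'n => real^'n. ALL i:F. ALL j:F. q i <.> (H *v q j) = (if i = j then 1 else 0)" for F
 proof (induction F rule:finite_induct[OF finite])
  case 1
  thus ?case by simp
 next
  case (2 a F)
  then obtain q where q: "!!i j. i : F ==> j : F ==> q i <.> (H *v q j) = (if i = j then 1 else 0)" by blast
  have "dim (q ` F) <= card (q ` F)" by (rule dim_le_card') simp
  also have "... <= card F" by (rule card_image_le) simp
  also have "... < CARD('n)" using 2(2) by (intro psubset_card_mono) auto
  finally have "dim (q ` F) < DIM(real^'n)" by simp
  hence "span (q ` F) ~= UNIV" by (metis dim_UNIV dim_span less_irrefl)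
  then obtain x where x: "x ~: span (q ` F)" by blast
  define y where "y = x - (SUM j:F. (q j <.> (H *v x)) *R q j)"
  have y0: "y ~= 0" proof
   assume "y = 0"
   hence "x = (SUM j:F. (q j <.> (H *v x)) *R q j)" by (simp add:y_def)
   moreover have "(SUM j:F. (q j <.> (H *v x)) *R q j) : span (q ` F)" by (intro span_sum span_scale span_base) auto
   ultimately show False using x by simp
  qed
  have orth: "q i <.> (H *v y) = 0" if i: "i : F" for i proof -
   have "q i <.> (H *v y) = q i <.> (H *v x) - (SUM j:F. (q j <.> (H *v x)) * (q i <.> (H *v q j)))"
    by (simp add:y_def matrix_vector_mult_diff_distrib inner_diff_right linear_sum[OF matrix_vector_mul_linear]
      inner_sum_right mv_scaleR)
   also have "(SUM j:F. (q j <.> (H *v x)) * (q i <.> (H *v q j))) = (SUM j:F. if j = i then q j <.> (H *v x) else 0)"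
    by (rule sum.cong) (auto simp:q i)
   finally show ?thesis using i by simp
  qed
  have orth': "y <.> (H *v q i) = 0" if "i : F" for i using orth[OF that] cm[of y "q i"] by simp
  define c where "c = 1 / sqrt (y <.> (H *v y))"
  have c: "c * c * (y <.> (H *v y)) = 1" using pos[OF y0] by (simp add:c_def)
  let ?q = "q(a := c *R y)"
  have "?q i <.> (H *v ?q j) = (if i = j then 1 else 0)" if "i : insert a F" "j : insert a F" for i j
   using that 2(2) c by (auto simp:mv_scaleR mult.assoc q orth orth')
  thus ?case by blast
 qed
 then obtain q :: "'n => real^'n" where q: "!!i j. q i <.> (H *v q j) = (if i = j then 1 else 0)" by (metis UNIV_I)
 define Q :: "real^'n^'n" where "Q = (\<chi> i j. q j $ i)"
 have Qax: "Q *v axis j 1 = q j" for j by (simp add:mv_basis column_def Q_def)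
 have "(transpose Q ** H ** Q) $ i $ j = mat 1 $ i $ j" for i j proof -
  have "(transpose Q ** H ** Q) $ i $ j = axis i 1 <.> ((transpose Q ** H ** Q) *v axis j 1)"
   by (simp add:mv_basis inner_axis' column_def)
  also have "... = (Q *v axis i 1) <.> (H *v (Q *v axis j 1))" by (simp add:mv_assoc[symmetric] inner_transpose)
  finally show ?thesis by (simp add:Qax q mat_def)
 qed
 hence "transpose Q ** H ** Q = mat 1" unfolding vec_eq_iff by blast
 thus ?thesis by (rule that)
qed

text \<open>In an \<open>H\<close>-orthonormal frame the operator becomes a symmetric matrix, and
  the trace of its square is the sum of the squared entries. This carries the Cauchy-Schwarz step
  and its equality case.\<close>

lemma trace_square_self_adjoint:
 fixes H T :: "real^'n^'n::finite"
 assumes sym: "transpose H = H" and pos: "!!v. v ~= 0 ==> v <.> (H *v v) > 0"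
  and sa: "!!u w. (T *v u) <.> (H *v w) = u <.> (H *v (T *v w))"
 shows "trace (T ** T) >= 0" "trace (T ** T) = 0 ==> T = 0" proof -
 obtain Q :: "real^'n^'n" where Q: "transpose Q ** H ** Q = mat 1" using pos_def_orthonormalize[OF sym pos] by blast
 define R where "R = transpose Q ** H"
 have RQ: "R ** Q = mat 1" using Q by (simp add:R_def)
 hence QR: "Q ** R = mat 1" using matrix_left_right_inverse by blast
 define X where "X = R ** T ** Q"
 have "transpose T ** H = H ** T" proof -
  have "u <.> ((transpose T ** H) *v w) = u <.> ((H ** T) *v w)" for u w
   using sa[of u w] by (simp add:mv_assoc[symmetric] inner_transpose)
  hence "(transpose T ** H) *v w = (H ** T) *v w" for w using vector_eq_ldot by blast
  thus ?thesis by (simp add:matrix_eq)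
 qed
 hence Xs: "transpose X = X" by (simp add:X_def R_def matrix_transpose_mul sym matrix_mul_assoc)
 have XX: "X ** X = R ** (T ** T) ** Q" proof -
  have "X ** X = R ** T ** (Q ** R) ** T ** Q" by (simp add:X_def matrix_mul_assoc)
  thus ?thesis by (simp add:QR matrix_mul_assoc)
 qed
 have "trace (X ** X) = trace (Q ** (R ** (T ** T)))" unfolding XX by (rule trace_mul_sym)
 also have "... = trace (T ** T)" by (simp add:matrix_mul_assoc QR)
 finally have t: "trace (T ** T) = trace (X ** X)" ..
 have "X $ i $ j = X $ j $ i" for i j using Xs by (metis transpose_def vec_lambda_beta)
 hence t2: "trace (X ** X) = (SUM i:UNIV. SUM j:UNIV. (X $ i $ j)\<^sup>2)"
  by (simp add:trace_def matrix_matrix_mult_def sq_eq)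
 show "trace (T ** T) >= 0" unfolding t t2 by (intro sum_nonneg) auto
 assume "trace (T ** T) = 0"
 hence "(SUM i:UNIV. SUM j:UNIV. (X $ i $ j)\<^sup>2) = 0" unfolding t t2 .
 hence "X = 0" by (simp add:sum_nonneg_eq_0_iff sum_nonneg vec_eq_iff)
 hence "Q ** X ** R = 0" by (simp add:matrix_matrix_mult_def vec_eq_iff)
 moreover have "Q ** X ** R = Q ** R ** T ** (Q ** R)" by (simp add:X_def matrix_mul_assoc)
 ultimately show "T = 0" by (simp add:QR)
qed

lemma trace_scaleR: "trace (c *R A) = c * trace (A :: real^'n^'n::finite)" by (simp add:trace_def sum_distrib_left)

text \<open>Metric compatibility writes the derivative of \<open>h\<close> as
  \<open>transpose A ** h x + h x ** A\<close> with \<open>A\<close> the matrix of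
  \<open>Gam h x z\<close>. After multiplication by the inverse both summands have the trace of
  \<open>A\<close>.\<close>

lemma (in metric_field) det_h_deriv:
 assumes x: "x : U"
 shows "((%y. det (h y)) hasD (%z. 2 * det (h x) * trace (matrix (Gam h x z)))) (at x)" proof -
 have "trace (minv (h x) ** Df h x z) = 2 * trace (matrix (Gam h x z))" for z proof -
  define A where "A = matrix (Gam h x z)"
  have A: "A *v u = Gam h x z u" for u by (simp add:A_def matrix_works Gam_linear)
  have "u <.> (Df h x z *v w) = u <.> ((transpose A ** h x + h x ** A) *v w)" for u w proof -
   have "u <.> (Df h x z *v w) = (A *v u) <.> (h x *v w) + u <.> (h x *v (A *v w))"
    unfolding A using metric_compatible[OF x, of u z w] h_commute[OF x, of u] by simp
   also have "(A *v u) <.> (h x *v w) = u <.> (transpose A *v (h x *v w))" by (simp add:inner_transpose)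
   finally show ?thesis by (simp add:mv_assoc mv_add_r inner_add_right)
  qed
  hence "Df h x z *v w = (transpose A ** h x + h x ** A) *v w" for w using vector_eq_ldot by blast
  hence "Df h x z = transpose A ** h x + h x ** A" by (simp add:matrix_eq)
  hence "trace (minv (h x) ** Df h x z) = trace (minv (h x) ** (transpose A ** h x)) + trace (minv (h x) ** (h x ** A))"
   by (simp add:matrix_add_ldistrib trace_add)
  also have "trace (minv (h x) ** (transpose A ** h x)) = trace ((transpose A ** h x) ** minv (h x))"
   by (rule trace_mul_sym)
  also have "(transpose A ** h x) ** minv (h x) = transpose A"
   by (simp add:matrix_mul_assoc[symmetric] minv_mult h_det x)
  also have "minv (h x) ** (h x ** A) = A" by (simp add:matrix_mul_assoc minv_mult h_det x)
  also have "trace (transpose A) = trace A" by (simp add:trace_def transpose_def)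
  finally show ?thesis by (simp add:A_def)
 qed
 thus ?thesis using det_has_deriv[OF h_deriv[OF x] h_det[OF x]] by (simp add:mult_ac)
qed

lemma pos_def_det_pos:
 fixes H :: "real^'n^'n::finite"
 assumes "transpose H = H" "!!v. v ~= 0 ==> v <.> (H *v v) > 0"
 shows "det H > 0" proof -
 obtain Q :: "real^'n^'n" where "transpose Q ** H ** Q = mat 1" using pos_def_orthonormalize[OF assms] by blast
 hence "det (transpose Q ** H ** Q) = 1" by simp
 hence "(det Q)^2 * det H = 1" by (simp add:det_mul det_transpose sq_eq mult_ac)
 hence "0 < (det Q)^2 * det H" by simp
 moreover have "(det Q)^2 >= 0" by simp
 ultimately show ?thesis by (simp add:zero_less_mult_iff)
qed

section \<open>Normal coordinates\<close>

lemma ray_deriv: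
 assumes "(F hasD F') (at (t *R v))"
 shows "((%t. F (t *R v)) hasVD F' v) (at t)" proof -
 have "((%t. t *R v) hasD (%s. s *R v)) (at t)" by (auto intro!:deriv_intros)
 from hasD_compose[OF this assms] show ?thesis by (simp add:hasVD_def linear_scale[OF hasD_linear[OF assms]])
qed

lemma matvec_hasD:
 fixes A :: "'a::real_normed_vector => real^'n^'m::finite"
 assumes "(A hasD A') (at x)" "(f hasD f') (at x)"
 shows "((%y. A y *v f y) hasD (%z. A x *v f' z + A' z *v f x)) (at x)" proof -
 have bb: "bounded_bilinear (%(A::real^'n^'m) v. A *v v)" by (rule bilinear_conv_bounded_bilinear[THEN iffD1])
   (auto simp:bilinear_def intro!:linearI simp:mv_add mv_add_r
    mv_scaleR scaleR_mv[symmetric])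
 show ?thesis by (rule bounded_bilinear.FDERIV[OF bb assms])
qed

lemma (in metric_field) Gam_comp_deriv:
 assumes x: "x : U" and a: "(a hasD a') (at x)" and b: "(b hasD b') (at x)"
 shows "((%y. Gam h y (a y) (b y)) hasD
  (%z. DG h (a x) (b x) x z + Gam h x (a x) (b' z) + Gam h x (a' z) (b x))) (at x)" proof -
 have g1: "((%y. Gam h y c (b y)) hasD (%z. DG h c (b x) x z + Gam h x c (b' z))) (at x)" for c
  by (rule apply_hasD[OF openU x, of "%y. Gam h y c", OF Gam_linear(2) _ b])
   (rule differentiableI[OF Gam_hasD[OF x]])
 have "((%y. Gam h y (a y) (b y)) hasD (%z. Df (%y. Gam h y (a x) (b y)) x z + Gam h x (a' z) (b x))) (at x)"
  by (rule apply_hasD[OF openU x, of "%y c. Gam h y c (b y)", OF Gam_linear(1) _ a])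
   (rule differentiableI[OF g1])
 thus ?thesis by (simp add:Df_eq[OF g1])
qed

text \<open>The condition \<open>radial\<close> says that the rays through the origin satisfy the
  geodesic equation. The geometry of the geodesic spheres about the origin follows from it
  alone.\<close>

locale normal_coords = metric_field U h for U and h :: "real^'n::finite => real^'n^'n" +
 assumes zero_U: "0 : U" and star: "x : U ==> 0 <= t ==> t <= 1 ==> t *R x : U"
  and radial: "x : U ==> Gam h x x x = 0"
begin

text \<open>The covariant derivative of the position field, which is the gradient of half the
  squared distance from the origin. On a unit speed ray it is the radial projection plus
  \<open>t\<close> times the shape operator of the sphere of radius \<open>t\<close>, and it stays
  smooth at the origin.\<close>

definition "Sm x = mat 1 + matrix (%u. Gam h x u x)"

definition "Rx x = matrix (%u. Rm h x u x x)"

text \<open>The orthogonal projection onto the line of \<open>v\<close>, formed with the metric at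
  the origin. By the Gauss lemma the metric at any point of the ray gives the same projection, so a
  single matrix serves the whole ray.\<close>

definition "Pm v = matrix (%u. ((u <.> (h 0 *v v)) / (v <.> (h 0 *v v))) *R v)"

lemma Sm_mult: "Sm x *v u = u + Gam h x u x" by (simp add:Sm_def mv_add_r matrix_works Gam_linear)

lemma Rx_mult: "Rx x *v u = Rm h x u x x" by (simp add:Rx_def matrix_works Rm_linear)

lemma Pm_mult: "Pm v *v u = ((u <.> (h 0 *v v)) / (v <.> (h 0 *v v))) *R v" proof -
 have "linear (%u. ((u <.> (h 0 *v v)) / (v <.> (h 0 *v v))) *R v)"
  by (rule linearI) (simp_all add:inner_add_left add_divide_distrib scaleR_add_left)
 thus ?thesis by (simp add:Pm_def matrix_works)
qed

lemma radial': "t ~= 0 ==> t *R v : U ==> Gam h (t *R v) v v = 0"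
 using radial[of "t *R v"] by (simp add:linear_scale[OF Gam_linear(1)] linear_scale[OF Gam_linear(2)])

section \<open>The Gauss lemma and the Riccati equation\<close>

lemma h_ray_deriv:
 assumes "t *R v : U"
 shows "((%t. u <.> (h (t *R v) *v w)) hasRD u <.> (Df h (t *R v) v *v w)) (at t)"
 using ray_deriv[OF matrix_field_deriv[OF h_deriv[OF assms]], of u w] by (simp add:hasRD_iff)

lemma ray_in_U: "x : U ==> t : {0..1} ==> t *R x : U" using star by auto

lemma gauss_norm: "x : U ==> x <.> (h x *v x) = x <.> (h 0 *v x)" proof -
 assume x: "x : U"
 let ?f = "%t. x <.> (h (t *R x) *v x)"
 have "?f 1 = ?f 0" proof (rule DERIV_isconst_end[where f="?f" and a=0 and b=1])
  show "cont_on {0..1} ?f" using DERIV_isCont[OF h_ray_deriv[OF ray_in_U[OF x]]] by (intro cont_onI ballI)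
  fix t :: real assume t: "0 < t" "t < 1"
  hence tx: "t *R x : U" using ray_in_U[OF x] by auto
  have "x <.> (Df h (t *R x) x *v x) = 0" using metric_compatible[OF tx, of x x x] radial'[OF _ tx] t by simp
  thus "(?f hasRD 0) (at t)" using h_ray_deriv[OF tx, of x x] by simp
 qed simp
 thus ?thesis by simp
qed

text \<open>\<open>gauss_norm\<close>, the constant speed of rays, is differentiated in an arbitrary
  direction \<open>w\<close>. The outcome \<open>ii\<close> is a differential equation along the ray
  for the pairing of \<open>w\<close> with the radial field.\<close>

lemma gauss: "x : U ==> h x *v x = h 0 *v x" proof -
 assume x: "x : U"
 have ii: "w <.> (h p *v p) + Gam h p w p <.> (h p *v p) = w <.> (h 0 *v p)" if p: "p : U" for w p proof -
  have "((%y. y <.> (h y *v y)) hasD (%z. p <.> (h p *v z + Df h p z *v p) + z <.> (h p *v p))) (at p)"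
   by (intro has_derivative_inner matvec_hasD h_deriv p hasD_ident)
  hence 1: "((%y. y <.> (h 0 *v y)) hasD (%z. p <.> (h p *v z + Df h p z *v p) + z <.> (h p *v p))) (at p)"
   by (rule hasD_open[OF _ openU p gauss_norm])
  have "((%y. y <.> (h 0 *v y)) hasD (%z. p <.> (h 0 *v z) + z <.> (h 0 *v p))) (at p)"
   by (intro has_derivative_inner hasD_ident bounded_linear.has_derivative[OF matrix_vector_mul_bounded_linear])
  from fun_cong[OF hasD_unique[OF 1 this], of w]
  have "p <.> (h p *v w) + p <.> (Df h p w *v p) + w <.> (h p *v p) = 2 * (w <.> (h 0 *v p))"
   using h_commute[OF zero_U, of p w] by (simp add:inner_add_right)
  thus ?thesis using metric_compatible[OF p, of p w p] h_commute[OF p, of p w] by simp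
 qed
 have "w <.> (h x *v x) = w <.> (h 0 *v x)" for w proof -
  \<comment> \<open>With the extra factor \<open>t\<close> the derivative of \<open>?c\<close>
    vanishes exactly by \<open>ii\<close> at the point \<open>t *R x\<close>.\<close>
  let ?c = "%t. t * (w <.> (h (t *R x) *v x)) - t * (w <.> (h 0 *v x))"
  have der: "(?c hasRD ((w <.> (h (t *R x) *v x)) + t * (w <.> (Df h (t *R x) x *v x)) - w <.> (h 0 *v x))) (at t)"
   if "t : {0..1}" for t using h_ray_deriv[OF ray_in_U[OF x that], of w x] by (auto intro!:deriv_intros)
  have "?c 1 = ?c 0" proof (rule DERIV_isconst_end[where f="?c" and a=0 and b=1])
   show "cont_on {0..1} ?c" using DERIV_isCont[OF der] by (intro cont_onI ballI)
   fix t :: real assume t: "0 < t" "t < 1"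
   hence tx: "t *R x : U" using ray_in_U[OF x] by auto
   have "t * (w <.> (h (t *R x) *v x) + t * (Gam h (t *R x) w x <.> (h (t *R x) *v x))) = t * (w <.> (h 0 *v x))"
    using ii[OF tx, of w] by (simp add:linear_scale[OF Gam_linear(2)] mv_scaleR alg)
   hence "w <.> (h (t *R x) *v x) + t * (Gam h (t *R x) w x <.> (h (t *R x) *v x)) = w <.> (h 0 *v x)" using t by simp
   moreover have "w <.> (Df h (t *R x) x *v x) = Gam h (t *R x) w x <.> (h (t *R x) *v x)"
    using metric_compatible[OF tx, of w x x] radial'[OF _ tx] t Gam_sym[OF tx, of x w] by simp
   ultimately show "(?c hasRD 0) (at t)" using der[of t] t by simp
  qed simp
  thus ?thesis by simp
 qed
 thus ?thesis using vector_eq_ldot by blast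
qed

lemma gauss_ray: "t ~= 0 ==> t *R v : U ==> h (t *R v) *v v = h 0 *v v"
 using gauss[of "t *R v"] by (simp add:mv_scaleR)

text \<open>The covariant derivative of a gradient field is symmetric. Concretely,
  \<open>gauss\<close> is differentiated and the symmetry of \<open>h 0\<close> and of
  \<open>Gam\<close> is used.\<close>

lemma Sm_self_adjoint:
 assumes x: "x : U"
 shows "(Sm x *v u) <.> (h x *v w) = u <.> (h x *v (Sm x *v w))" proof -
 have *: "(Sm x *v u) <.> (h x *v w) = w <.> (h 0 *v u) - Gam h x u w <.> (h x *v x)" for u w proof -
  have "((%y. w <.> (h y *v y)) hasD (%z. w <.> (h x *v z + Df h x z *v x))) (at x)"
   by (intro has_derivative_inner_right matvec_hasD h_deriv x hasD_ident)
  hence 1: "((%y. w <.> (h 0 *v y)) hasD (%z. w <.> (h x *v z + Df h x z *v x))) (at x)"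
   by (rule hasD_open[OF _ openU x]) (simp add:gauss)
  have "((%y. w <.> (h 0 *v y)) hasD (%z. w <.> (h 0 *v z))) (at x)"
   by (intro has_derivative_inner_right hasD_ident bounded_linear.has_derivative[OF matrix_vector_mul_bounded_linear])
  from fun_cong[OF hasD_unique[OF 1 this], of u]
  have "w <.> (h x *v u) + w <.> (Df h x u *v x) = w <.> (h 0 *v u)" by (simp add:inner_add_right)
  thus ?thesis using metric_compatible[OF x, of w u x] h_commute[OF x, of w u] by (simp add:Sm_mult inner_add_left)
 qed
 have "u <.> (h x *v (Sm x *v w)) = (Sm x *v w) <.> (h x *v u)" by (rule h_commute[OF x])
 also have "... = u <.> (h 0 *v w) - Gam h x w u <.> (h x *v x)" by (rule *)
 also have "... = (Sm x *v u) <.> (h x *v w)"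
  unfolding *[of u w] using h_commute[OF zero_U, of u w] Gam_sym[OF x, of u w] by simp
 finally show ?thesis ..
qed

lemma Sm_radial: "x : U ==> Sm x *v x = x" by (simp add:Sm_mult radial)

lemma Sm_entry: "Sm x $ i $ j = mat 1 $ i $ j + Gam h x (axis j 1) x $ i" by (simp add:Sm_def matrix_def)

lemma Sm_Ck: "Ck_on m U Sm" proof -
 have "Ck_on m U (%x. \<chi> i j. mat 1 $ i $ j + Gam h x (axis j 1) x $ i)"
  by (intro Ck_vec_lambda Ck_add Ck_vec_nth Gam_Ck Ck_ident Ck_const openU) auto
 thus ?thesis by (rule Ck_cong[OF openU, rotated]) (simp add:vec_eq_iff Sm_entry)
qed

lemma Sm_deriv: "x : U ==> (Sm hasD Df Sm x) (at x)" by (rule Ck_hasD[OF Sm_Ck[of "Suc 0"]])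

text \<open>Differentiating the identity \<open>radial\<close> in direction \<open>u\<close>
  expresses the derivative of \<open>Gam\<close> that enters \<open>Rm\<close> through
  \<open>Gam h x u x\<close>; the other derivative of \<open>Gam\<close> in \<open>Rm\<close> is the
  radial derivative of \<open>Sm\<close>.\<close>

lemma riccati:
 assumes x: "x : U"
 shows "Df Sm x x = Sm x - Sm x ** Sm x - Rx x" proof -
 have "Df Sm x x *v u = (Sm x - Sm x ** Sm x - Rx x) *v u" for u proof -
  have 1: "((%y. Sm y *v u) hasD (%z. Df Sm x z *v u)) (at x)"
   using matvec_hasD[OF Sm_deriv[OF x] has_derivative_const[of u]] by simp
  have "((%y. u + Gam h y u y) hasD (%z. 0 + (DG h u x x z + Gam h x u z + Gam h x 0 x))) (at x)"
   by (intro has_derivative_add has_derivative_const Gam_comp_deriv x hasD_ident)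
  hence 2: "((%y. Sm y *v u) hasD (%z. 0 + (DG h u x x z + Gam h x u z + Gam h x 0 x))) (at x)"
   by (simp add:Sm_mult)
  have D: "Df Sm x x *v u = DG h u x x x + Gam h x u x"
   using fun_cong[OF hasD_unique[OF 1 2], of x] linear_0[OF Gam_linear(1)] by simp
  have "((%y. Gam h y y y) hasD (%z. DG h x x x z + Gam h x x z + Gam h x z x)) (at x)"
   by (intro Gam_comp_deriv x hasD_ident)
  hence 3: "((%y. 0) hasD (%z. DG h x x x z + Gam h x x z + Gam h x z x)) (at x)"
   by (rule hasD_open[OF _ openU x radial])
  have "DG h x x x u + Gam h x x u + Gam h x u x = 0"
   using fun_cong[OF hasD_unique[OF 3 has_derivative_const], of u] by simp
  hence E: "DG h x x x u = - Gam h x u x - Gam h x u x"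
   using Gam_sym[OF x, of x u] by (simp add:alg add_eq_0_iff)
  have R: "Rx x *v u = - Gam h x u x - Gam h x u x - DG h u x x x - Gam h x (Gam h x u x) x"
   unfolding Rx_mult Rm_eq[OF x] E radial[OF x] using Gam_sym[OF x, of x "Gam h x u x"]
   by (simp add:linear_0[OF Gam_linear(2)])
  show ?thesis by (simp add:D R mv_diff_r mv_assoc[symmetric] Sm_mult
     linear_add[OF Gam_linear(1)] alg)
 qed
 thus ?thesis by (simp add:matrix_eq)
qed

lemma trace_linear: "bounded_linear (trace :: real^'n^'n => real)"
 by (intro linear_conv_bounded_linear[THEN iffD1] linearI) (simp_all add:trace_add trace_scaleR)

lemma Sm_ray_deriv:
 assumes "t ~= 0" "t *R v : U"
 shows "((%t. Sm (t *R v)) hasVD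
  (1 / t) *R (Sm (t *R v) - Sm (t *R v) ** Sm (t *R v) - Rx (t *R v))) (at t)" proof -
 have "linear (Df Sm (t *R v))" using Sm_deriv[OF assms(2)] hasD_linear by blast
 hence "Df Sm (t *R v) (t *R v) = t *R Df Sm (t *R v) v" by (rule linear_scale)
 hence "Df Sm (t *R v) v = (1 / t) *R Df Sm (t *R v) (t *R v)" using assms(1) by simp
 thus ?thesis using ray_deriv[OF Sm_deriv[OF assms(2)]] riccati[OF assms(2)] by simp
qed

lemma Rm_scale: "Rm h x (a *R u) (b *R v) (c *R w) = (a * b * c) *R Rm h x u v w"
 by (simp add:linear_scale[OF Rm_linear(1)] linear_scale[OF Rm_linear(2)] linear_scale[OF Rm_linear(3)])

lemma Rx_ray: "Rx (t *R v) = t^2 *R matrix (%u. Rm h (t *R v) u v v)" proof -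
 have "Rx (t *R v) *v u = (t^2 *R matrix (%u. Rm h (t *R v) u v v)) *v u" for u
  using Rm_scale[of "t *R v" 1 u t v t v]
  by (simp add:Rx_mult scaleR_mv[symmetric] matrix_works Rm_linear sq_eq)
 thus ?thesis by (simp add:matrix_eq)
qed

text \<open>For unit \<open>v\<close> the mean curvature, as a sum of principal curvatures, of the
  sphere of radius \<open>t\<close>. Subtracting 1 removes the radial eigenvalue of
  \<open>Sm\<close>.\<close>

definition "mean_curv v t = (trace (Sm (t *R v)) - 1) / t"

lemma mean_curv_deriv:
 assumes "t ~= 0" "t *R v : U"
 shows "(mean_curv v hasRD
  (1 - trace (Sm (t *R v) ** Sm (t *R v))) / t^2 - Ric h (t *R v) v) (at t)" proof -
 let ?S = "Sm (t *R v)"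
 have "((%t. trace (Sm (t *R v))) hasVD trace ((1 / t) *R (?S - ?S ** ?S - Rx (t *R v)))) (at t)"
  by (rule bounded_linear.has_vector_derivative[OF trace_linear Sm_ray_deriv[OF assms]])
 hence "((%t. trace (Sm (t *R v))) hasRD
   (trace ?S - trace (?S ** ?S) - t^2 * Ric h (t *R v) v) / t) (at t)"
  by (simp add:hasRD_iff trace_scaleR trace_sub Rx_ray Ric_def)
 thus ?thesis unfolding mean_curv_def[abs_def] using assms(1)
  by (auto intro!:deriv_intros simp:field_simps sq_eq)
qed

lemma det_h_pos: "x : U ==> det (h x) > 0" by (rule pos_def_det_pos[OF sym pos])

lemma trace_Sm: "x : U ==> trace (Sm x) = real CARD('n) + trace (matrix (Gam h x x))" proof -
 assume "x : U"
 hence "(%u. Gam h x u x) = Gam h x x" using Gam_sym by auto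
 thus ?thesis by (simp add:Sm_def trace_add trace_I)
qed

text \<open>The logarithmic derivative of the volume density is the trace of \<open>Gam\<close>,
  which \<open>Sm\<close> contains. The subtracted term is what the factor \<open>t ^ (n-1)\<close>
  of polar coordinates would contribute.\<close>

lemma log_det_deriv:
 assumes "t ~= 0" "t *R v : U"
 shows "((%t. ln (sqrt (det (h (t *R v))))) hasRD mean_curv v t - (real CARD('n) - 1) / t) (at t)" proof -
 let ?x = "t *R v"
 have p: "det (h ?x) > 0" using det_h_pos[OF assms(2)] .
 have tr: "trace (matrix (Gam h ?x v)) = (trace (Sm ?x) - real CARD('n)) / t" proof -
  have "matrix (Gam h ?x ?x) = t *R matrix (Gam h ?x v)"
   by (simp add:matrix_def vec_eq_iff linear_scale[OF Gam_linear(1)])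
  thus ?thesis using trace_Sm[OF assms(2)] assms(1) by (simp add:trace_scaleR)
 qed
 have "((%t. det (h (t *R v))) hasRD 2 * det (h ?x) * trace (matrix (Gam h ?x v))) (at t)"
  using ray_deriv[OF det_h_deriv[OF assms(2)]] by (simp add:hasRD_iff)
 hence d: "((%t. ln (sqrt (det (h (t *R v))))) hasRD
   (2 * det (h ?x) * trace (matrix (Gam h ?x v))) * (inverse (sqrt (det (h ?x))) / 2) * inverse (sqrt (det (h ?x)))) (at t)"
  using p by (auto intro!:deriv_intros simp:field_simps)
 define q where "q = sqrt (det (h ?x))"
 have q: "q > 0" "det (h ?x) = q * q" using p by (simp_all add:q_def)
 have "(2 * det (h ?x) * trace (matrix (Gam h ?x v))) * (inverse (sqrt (det (h ?x))) / 2) * inverse (sqrt (det (h ?x)))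
   = trace (matrix (Gam h ?x v))" unfolding q_def[symmetric] q(2) using q(1) by (simp add:field_simps)
 also have "... = mean_curv v t - (real CARD('n) - 1) / t" by (simp add:tr mean_curv_def diff_divide_distrib)
 finally show ?thesis using d by (rule DERIV_cong[rotated])
qed

end

section \<open>Comparison with the model\<close>

text \<open>The derivative of \<open>s_fun k\<close>, so that \<open>c_fun k t / s_fun k t\<close>
  is the principal curvature of the model spheres.\<close>

definition c_fun :: "real => real => real" where
 "c_fun k t = (if k > 0 then cos (sqrt k * t) else if k = 0 then 1 else cosh (sqrt (- k) * t))"

text \<open>The antiderivative of \<open>s_fun\<close> squared that vanishes at 0; divided by
  \<open>s_fun\<close> squared it becomes \<open>phi\<close> (\<open>phi_Psi\<close>).\<close>

definition Psi :: "real => real => real" where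
 "Psi k t = (if k > 0 then (t - sin (sqrt k * t) * cos (sqrt k * t) / sqrt k) / (2 * k)
   else if k = 0 then t ^ 3 / 3
   else (cosh (sqrt (- k) * t) * sinh (sqrt (- k) * t) / sqrt (- k) - t) / (2 * (- k)))"

lemma curvature_sign_cases:
 fixes k :: real
 obtains q where "q > 0" "k = q * q" | "k = 0" | q where "q > 0" "k = - (q * q)" proof -
 consider "k > 0" | "k = 0" | "k < 0" by linarith
 thus ?thesis proof cases
  case 1
  thus ?thesis using that(1)[of "sqrt k"] by simp
 next
  case 3
  thus ?thesis using that(3)[of "sqrt (- k)"] by simp
 qed (use that in simp)
qed

lemma model_pos:
 assumes "q > 0"
 shows "s_fun (q * q) = (%t. sin (q * t) / q)" "c_fun (q * q) = (%t. cos (q * t))"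
  "Psi (q * q) = (%t. (t - sin (q * t) * cos (q * t) / q) / (2 * (q * q)))"
  "phi (q * q) = (%t. (t / (sin (q * t))^2 - cos (q * t) / sin (q * t) / q) / 2)"
 using assms by (auto simp:s_fun_def c_fun_def Psi_def phi_def cot_def fun_eq_iff)

lemma model_neg:
 assumes "q > 0"
 shows "s_fun (- (q * q)) = (%t. sinh (q * t) / q)" "c_fun (- (q * q)) = (%t. cosh (q * t))"
  "Psi (- (q * q)) = (%t. (cosh (q * t) * sinh (q * t) / q - t) / (2 * (q * q)))"
  "phi (- (q * q)) = (%t. (cosh (q * t) / sinh (q * t) / q - t / (sinh (q * t))^2) / 2)" proof -
 have "~ 0 < - (q * q)" "q * q ~= 0" using assms by auto
 thus "s_fun (- (q * q)) = (%t. sinh (q * t) / q)" "c_fun (- (q * q)) = (%t. cosh (q * t))"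
  "Psi (- (q * q)) = (%t. (cosh (q * t) * sinh (q * t) / q - t) / (2 * (q * q)))"
  "phi (- (q * q)) = (%t. (cosh (q * t) / sinh (q * t) / q - t / (sinh (q * t))^2) / 2)"
  using assms by (auto simp:s_fun_def c_fun_def Psi_def phi_def fun_eq_iff)
qed

lemma s_hasRD: "(s_fun k hasRD c_fun k t) (at t)" by (cases k rule:curvature_sign_cases)
  (auto simp:model_pos model_neg s_fun_def[of 0, abs_def] c_fun_def[of 0] intro!:deriv_intros)

lemma c_fun_deriv: "(c_fun k hasRD - k * s_fun k t) (at t)" by (cases k rule:curvature_sign_cases)
  (auto simp:model_pos model_neg s_fun_def[of 0, abs_def] c_fun_def[of 0, abs_def] intro!:deriv_intros)

lemma s_fun_0 [simp]: "s_fun k 0 = 0" and c_fun_0 [simp]: "c_fun k 0 = 1" and Psi_0 [simp]: "Psi k 0 = 0"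
 by (auto simp:s_fun_def c_fun_def Psi_def)

lemma s_fun_pos: "0 < t ==> (k > 0 ==> t < pi / sqrt k) ==> s_fun k t > 0"
 by (auto simp:s_fun_def intro!:divide_pos_pos sin_gt_zero simp:pos_less_divide_eq mult.commute)

lemma Psi_deriv: "(Psi k hasRD (s_fun k t)\<^sup>2) (at t)" proof (cases k rule:curvature_sign_cases)
 case (1 q)
 have "(Psi k hasRD (1 - (cos (q * t) * cos (q * t) - sin (q * t) * sin (q * t))) / (2 * (q * q))) (at t)"
  unfolding 1(2) model_pos[OF 1(1)] using 1(1) by (auto intro!:deriv_intros simp:field_simps)
 moreover have "1 - (cos (q * t) * cos (q * t) - sin (q * t) * sin (q * t)) = 2 * (sin (q * t) * sin (q * t))"
  using sin_cos_squared_add[of "q * t"] by (simp add:sq_eq)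
 ultimately show ?thesis unfolding 1(2) model_pos[OF 1(1)] by (simp add:sq_eq)
next
 case 2
 thus ?thesis by (auto simp:Psi_def[of 0, abs_def] s_fun_def intro!:deriv_intros)
next
 case (3 q)
 have "(Psi k hasRD ((cosh (q * t) * cosh (q * t) + sinh (q * t) * sinh (q * t)) - 1) / (2 * (q * q))) (at t)"
  unfolding 3(2) model_neg[OF 3(1)] using 3(1) by (auto intro!:deriv_intros simp:field_simps)
 moreover have "(cosh (q * t) * cosh (q * t) + sinh (q * t) * sinh (q * t)) - 1 = 2 * (sinh (q * t) * sinh (q * t))"
  using hyperbolic_pythagoras[of "q * t"] by (simp add:sq_eq)
 ultimately show ?thesis unfolding 3(2) model_neg[OF 3(1)] by (simp add:sq_eq)
qed

lemma Psi_nonneg: "0 <= t ==> Psi k t >= 0"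
 using DERIV_nonneg_imp_nondecreasing[of 0 t "Psi k"] Psi_deriv by fastforce

lemma phi_Psi:
 assumes "0 < t" "k > 0 ==> t < pi / sqrt k"
 shows "phi k t = Psi k t / (s_fun k t)^2" proof -
 note s = s_fun_pos[OF assms]
 show ?thesis proof (cases k rule:curvature_sign_cases)
  case (1 q)
  define S C where "S = sin (q * t)" "C = cos (q * t)"
  have "S > 0" using s 1 by (simp add:model_pos S_C_def zero_less_divide_iff)
  hence "(t / S^2 - C / S / q) / 2 = ((t - S * C / q) / (2 * (q * q))) / (S / q)^2"
   using 1(1) by (simp add:field_simps sq_eq)
  thus ?thesis unfolding 1(2) model_pos[OF 1(1)] S_C_def .
 next
  case 2
  thus ?thesis using assms by (simp add:phi_def Psi_def s_fun_def sq_eq power3_eq_cube)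
 next
  case (3 q)
  define S C where "S = sinh (q * t)" "C = cosh (q * t)"
  have "S > 0" using s 3 by (simp add:model_neg S_C_def zero_less_divide_iff)
  hence "(C / S / q - t / S^2) / 2 = ((C * S / q - t) / (2 * (q * q))) / (S / q)^2"
   using 3(1) by (simp add:field_simps sq_eq)
  thus ?thesis unfolding 3(2) model_neg[OF 3(1)] S_C_def .
 qed
qed

lemma matrix_apply: "linear f ==> matrix f *v x = f x" for f :: "real^'n::finite => real^'m::finite"
 by (simp add:matrix_works)

lemma trace_rank_one:
 fixes a v :: "real^'n::finite"
 shows "trace (matrix (%u. (u <.> a) *R v)) = v <.> a"
 by (simp add:trace_def matrix_def inner_axis') (simp add:inner_vec_def mult.commute)

lemma matrix_mult_linear_left:
 fixes A B C :: "real^'n^'n::finite"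
 shows "(A - B) ** C = A ** C - B ** C" "C ** (A - B) = C ** A - C ** B"
  "(A + B) ** C = A ** C + B ** C"
 by (simp_all add:matrix_matrix_mult_def vec_eq_iff sum_subtractf sum.distrib alg)

lemma matrix_norm_mult:
 obtains K where "K >= 0" "!!(A :: real^'n^'n::finite) (B :: real^'n^'n). norm (A ** B) <= K * norm A * norm B"
proof -
 have "bounded_bilinear ((**) :: real^'n^'n => real^'n^'n => real^'n^'n)"
  by (rule bilinear_conv_bounded_bilinear[THEN iffD1])
   (auto simp:bilinear_def intro!:linearI simp:matrix_add_ldistrib matrix_mult_linear_left(3) matrix_mult_scaleR)
 from bounded_bilinear.nonneg_bounded[OF this] obtain K where
  K: "0 <= K" "ALL (A :: real^'n^'n) (B :: real^'n^'n). norm (A ** B) <= norm A * norm B * K" by auto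
 have "norm (A ** B) <= K * norm A * norm B" for A B :: "real^'n^'n"
  using spec[OF spec[OF K(2), of A], of B] by (simp add:mult_ac)
 thus ?thesis by (rule that[OF K(1)])
qed

context normal_coords
begin

context
 fixes v :: "real^'n"
 assumes v: "v ~= 0"
begin

lemma q_pos: "v <.> (h 0 *v v) > 0" using pos[OF zero_U v] .

lemma Pm_facts:
 assumes "t ~= 0" "t *R v : U"
 shows "Sm (t *R v) ** Pm v = Pm v" "Pm v ** Sm (t *R v) = Pm v" "Pm v ** Pm v = Pm v" "trace (Pm v) = 1"
  "(Pm v *v u) <.> (h (t *R v) *v w) = u <.> (h (t *R v) *v (Pm v *v w))" proof -
 let ?x = "t *R v" and ?q = "v <.> (h 0 *v v)"
 have Sv: "Sm ?x *v v = v" using Sm_radial[OF assms(2)] assms(1) by (simp add:mv_scaleR)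
 have g: "h ?x *v v = h 0 *v v" by (rule gauss_ray[OF assms])
 have "(Sm ?x ** Pm v) *v u = Pm v *v u" for u by (simp add:mv_assoc[symmetric] Pm_mult mv_scaleR Sv)
 thus "Sm ?x ** Pm v = Pm v" by (simp add:matrix_eq)
 have "(Pm v ** Sm ?x) *v u = Pm v *v u" for u proof -
  have "(Sm ?x *v u) <.> (h 0 *v v) = u <.> (h 0 *v v)" using Sm_self_adjoint[OF assms(2), of u v] by (simp add:g Sv)
  thus ?thesis by (simp add:mv_assoc[symmetric] Pm_mult)
 qed
 thus "Pm v ** Sm ?x = Pm v" by (simp add:matrix_eq)
 have "(Pm v ** Pm v) *v u = Pm v *v u" for u using q_pos by (simp add:mv_assoc[symmetric] Pm_mult)
 thus "Pm v ** Pm v = Pm v" by (simp add:matrix_eq)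
 have "Pm v = matrix (%u. (u <.> ((1 / ?q) *R (h 0 *v v))) *R v)" by (simp add:Pm_def)
 thus "trace (Pm v) = 1" using q_pos by (simp only: trace_rank_one) simp
 show "(Pm v *v u) <.> (h ?x *v w) = u <.> (h ?x *v (Pm v *v w))"
  using h_commute[OF assms(2), of v w] by (simp add:Pm_mult mv_scaleR g)
qed

text \<open>For \<open>l = t * c_fun k t / s_fun k t\<close> and unit \<open>v\<close> this is
  \<open>t\<close> times the difference between the shape operator and that of the model. The factor
  \<open>mat 1 - Pm v\<close> is the identity on the tangent space of the sphere.\<close>

definition "Mm l t = Sm (t *R v) - Pm v - l *R (mat 1 - Pm v)"

lemma Mm_square:
 assumes "t ~= 0" "t *R v : U"
 shows "trace (Mm l t ** Mm l t) = trace (Sm (t *R v) ** Sm (t *R v)) - 1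
  - 2 * l * (trace (Sm (t *R v)) - 1) + l^2 * (real CARD('n) - 1)" proof -
 note P = Pm_facts[OF assms]
 have "Mm l t ** Mm l t = Sm (t *R v) ** Sm (t *R v) - Pm v - (l + l) *R (Sm (t *R v) - Pm v) + (l * l) *R (mat 1 - Pm v)"
  unfolding Mm_def by (simp add:matrix_mult_linear_left matrix_mult_scaleR P(1-3)) (simp add:vec_eq_iff alg)
 thus ?thesis by (simp add:trace_sub trace_add trace_scaleR P(4) trace_I sq_eq)
qed

lemma Mm_square_nonneg:
 assumes "t ~= 0" "t *R v : U"
 shows "trace (Mm l t ** Mm l t) >= 0" "trace (Mm l t ** Mm l t) = 0 ==> Mm l t = 0" proof -
 have sa: "(Mm l t *v u) <.> (h (t *R v) *v w) = u <.> (h (t *R v) *v (Mm l t *v w))" for u w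
  unfolding Mm_def using Sm_self_adjoint[OF assms(2), of u w] Pm_facts(5)[OF assms, of u w]
  by (simp add:mv_diff_r scaleR_mv[symmetric] inner_diff_left inner_diff_right
    matrix_vector_mult_diff_distrib mv_scaleR)
 show "trace (Mm l t ** Mm l t) >= 0" "trace (Mm l t ** Mm l t) = 0 ==> Mm l t = 0"
  using trace_square_self_adjoint[OF sym[OF assms(2)] pos[OF assms(2)] sa] by auto
qed

text \<open>The gap between the mean curvatures of geodesic spheres in the manifold and in the model,
 multiplied by \<open>s\<^sub>k\<^sup>2\<close>; its derivative contains minus the squared norm of the deviation
 of the shape operator from that of the model.\<close>

definition "gap k t = (s_fun k t)^2 * mean_curv v t - (real CARD('n) - 1) * s_fun k t * c_fun k t"

text \<open>Completing the square in the traced Riccati equation. The chosen \<open>l\<close>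
  absorbs the term linear in the mean curvature that comes from differentiating \<open>s_fun\<close>
  squared, and what is left is the trace of \<open>Mm\<close> squared.\<close>

lemma gap_deriv:
 assumes "t ~= 0" "t *R v : U" "s_fun k t ~= 0"
 shows "(gap k hasRD - (s_fun k t)\<^sup>2 * (Ric h (t *R v) v - (real CARD('n) - 1) * k)
  - (s_fun k t / t)^2 * trace (Mm (t * c_fun k t / s_fun k t) t ** Mm (t * c_fun k t / s_fun k t) t)) (at t)" proof -
 let ?S = "Sm (t *R v)" and ?s = "s_fun k t" and ?c = "c_fun k t" and ?n = "real CARD('n)"
 have "(gap k hasRD (2 * ?s * ?c * mean_curv v t + ?s^2 * ((1 - trace (?S ** ?S)) / t^2 - Ric h (t *R v) v)
   - ((?n - 1) * ?c * ?c + (?n - 1) * ?s * (- k * ?s)))) (at t)" unfolding gap_def[abs_def]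
  by (auto intro!:deriv_intros s_hasRD c_fun_deriv mean_curv_deriv assms simp:sq_eq)
 moreover have "2 * ?s * ?c * mean_curv v t + ?s^2 * ((1 - trace (?S ** ?S)) / t^2 - Ric h (t *R v) v)
   - ((?n - 1) * ?c * ?c + (?n - 1) * ?s * (- k * ?s)) = - ?s\<^sup>2 * (Ric h (t *R v) v - (?n - 1) * k)
   - (?s / t)^2 * trace (Mm (t * ?c / ?s) t ** Mm (t * ?c / ?s) t)"
  unfolding Mm_square[OF assms(1,2)] mean_curv_def using assms(1,3) by (simp add:field_simps sq_eq)
 ultimately show ?thesis by simp
qed

lemma ray_at_0: "((%t. t *R v) ---> 0) (at_right (0::real))" by (rule tendsto_eq_intros refl | simp)+

lemma Sm_tendsto: "((%t. Sm (t *R v)) ---> mat 1) (at_right (0::real))" proof -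
 have "isCont Sm 0" using has_derivative_continuous[OF Sm_deriv[OF zero_U]] .
 from isCont_tendsto_compose[OF this ray_at_0] have "((%t. Sm (t *R v)) ---> Sm 0) (at_right (0::real))" .
 moreover have "Sm 0 = mat 1" by (simp add:vec_eq_iff Sm_entry linear_0[OF Gam_linear(2)])
 ultimately show ?thesis by simp
qed

lemma s_fun_tendsto: "(s_fun k ---> 0) (at_right 0)" "(c_fun k ---> 1) (at_right 0)"
  "((%t. s_fun k t / t) ---> 1) (at_right 0)" proof -
 have "isCont (s_fun k) 0" "isCont (c_fun k) 0" using s_hasRD c_fun_deriv DERIV_isCont by blast+
 thus "(s_fun k ---> 0) (at_right 0)" "(c_fun k ---> 1) (at_right 0)"
  by (metis s_fun_0 c_fun_0 continuous_at filterlim_at_split)+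
 have "((%t. (s_fun k t - s_fun k 0) / (t - 0)) ---> c_fun k 0) (at 0)"
  using s_hasRD[of k 0] unfolding has_field_derivative_iff .
 thus "((%t. s_fun k t / t) ---> 1) (at_right 0)" by (simp add:filterlim_at_split)
qed

lemma gap_tendsto: "(gap k ---> 0) (at_right 0)" proof -
 have "((%t. s_fun k t * (s_fun k t / t) * (trace (Sm (t *R v)) - 1)
   - (real CARD('n) - 1) * s_fun k t * c_fun k t) --->
   0 * 1 * (trace (mat 1 :: real^'n^'n) - 1) - (real CARD('n) - 1) * 0 * 1) (at_right 0)"
  by (intro tendsto_intros s_fun_tendsto bounded_linear.tendsto[OF trace_linear] Sm_tendsto)
 thus ?thesis by (simp add:gap_def[abs_def] mean_curv_def sq_eq)
qed

text \<open>Adding \<open>J\<close> removes the Ricci term from the derivative of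
  \<open>gap\<close>, so the sum decreases from the limit 0. If it is 0 again at \<open>r\<close>,
  it vanishes on the whole interval, and so do its derivative and the square in it.\<close>

lemma gap_comparison:
 assumes r: "0 < r" "r *R v : U" "k > 0 ==> r < pi / sqrt k"
  and J: "!!t. 0 < t ==> t < r ==> (J hasRD (s_fun k t)\<^sup>2 * (Ric h (t *R v) v - (real CARD('n) - 1) * k)) (at t)"
  and Jc: "cont_on {0..r} J" and J0: "J 0 = 0"
 shows "gap k r + J r <= 0"
  and "gap k r + J r = 0 ==> 0 < t ==> t < r ==> Mm (t * c_fun k t / s_fun k t) t = 0" proof -
 have tU: "t *R v : U" if "0 <= t" "t <= r" for t using star[OF r(2), of "t / r"] that r(1) by simp
 have sp: "s_fun k t > 0" if "0 < t" "t <= r" for t using s_fun_pos[of t k] that r(3) by force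
 define f where "f t = gap k t + J t" for t
 let ?T = "%t. trace (Mm (t * c_fun k t / s_fun k t) t ** Mm (t * c_fun k t / s_fun k t) t)"
 have df: "(f hasRD - (s_fun k t / t)\<^sup>2 * ?T t) (at t)" if "0 < t" "t < r" for t proof -
  have "t *R v : U" "t ~= 0" "s_fun k t ~= 0" using tU[of t] sp[of t] that by auto
  from DERIV_add[OF gap_deriv[OF this(2,1,3)] J[OF that]] show ?thesis by (simp add:f_def[abs_def])
 qed
 have T0: "?T t >= 0" if "0 < t" "t <= r" for t using Mm_square_nonneg(1) tU that by auto
 have fc: "cont_on {a..r} f" if "0 < a" for a unfolding f_def proof (intro continuous_on_add cont_subset[OF Jc])
  show "cont_on {a..r} (gap k)" proof (intro cont_onI ballI)
   fix t assume "t : {a..r}"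
   hence "t *R v : U" "t ~= 0" "s_fun k t ~= 0" using tU[of t] sp[of t] that by auto
   from DERIV_isCont[OF gap_deriv[OF this(2,1,3)]] show "isCont (gap k) t" .
  qed
 qed (use that in auto)
 have mono: "f b <= f a" if "0 < a" "a <= b" "b <= r" for a b
 proof (rule DERIV_nonpos_imp_decreasing_open[OF that(2)])
  fix t assume t: "a < t" "t < b"
  have "- (s_fun k t / t)\<^sup>2 * ?T t <= 0" using T0[of t] t that by (intro mult_nonpos_nonneg) auto
  thus "EX y. (f hasRD y) (at t) & y <= 0" using df[of t] t that by auto
 qed (use fc[OF that(1)] cont_subset that(3) in fastforce)
 \<comment> \<open>\<open>gap_deriv\<close> excludes \<open>t = 0\<close>, so the initial value
   enters as a limit from the right. It is 0 because \<open>s_fun\<close> squared tends to 0 faster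
   than \<open>t\<close>.\<close>
 have f0: "(f ---> 0) (at_right 0)" proof -
  have "(J ---> J 0) (at 0 within {0..r})" using Jc r(1) by (simp add:continuous_on_def)
  hence "(J ---> 0) (at_right 0)" using r(1) J0 at_within_Icc_at_right[of 0 r] by simp
  from tendsto_add[OF gap_tendsto this] show ?thesis by (simp add:f_def[abs_def])
 qed
 have le0: "f b <= 0" if "0 < b" "b <= r" for b proof (rule tendsto_lowerbound[OF f0])
  show "\<forall>\<^sub>F a in at_right 0. f b <= f a"
   unfolding eventually_at_right_field using mono that by (intro exI[of _ b]) auto
 qed simp
 show "gap k r + J r <= 0" using le0[of r] r(1) by (simp add:f_def)
 assume eq: "gap k r + J r = 0" and t: "0 < t" "t < r"
 have z: "f a = 0" if "0 < a" "a < r" for a using le0[of a] mono[of a r] that eq by (simp add:f_def)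
 have "(f hasRD 0) (at t)" by (rule hasRD_open[of "%_. 0" 0 t "{0<..<r}"]) (use t z in auto)
 from DERIV_unique[OF df[OF t] this] have "?T t = 0" using sp[of t] t by auto
 thus "Mm (t * c_fun k t / s_fun k t) t = 0" using Mm_square_nonneg(2)[of t] tU[of t] t by auto
qed

text \<open>Inserting the model shape operator into the Riccati equation yields the radial curvature
  for small positive \<open>t\<close>, by the identity \<open>l - l^2 - t l' = k t^2\<close>. The
  limit at 0 carries it to the centre, where every direction occurs as some
  \<open>v\<close>.\<close>

lemma model_shape_curvature:
 assumes r: "0 < r" "r *R v : U" "k > 0 ==> r < pi / sqrt k"
  and M: "!!t. 0 < t ==> t < r ==> Mm (t * c_fun k t / s_fun k t) t = 0"
 shows "Rm h 0 u v v = k *R ((mat 1 - Pm v) *v u)" proof -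
 let ?Z = "mat 1 - Pm v"
 have tU: "t *R v : U" if "0 <= t" "t <= r" for t using star[OF r(2), of "t / r"] that r(1) by simp
 have sp: "s_fun k t > 0" if "0 < t" "t <= r" for t using s_fun_pos[of t k] that r(3) by force
 define l where "l t = t * c_fun k t / s_fun k t" for t
 have S: "Sm (t *R v) = Pm v + l t *R ?Z" if "0 < t" "t < r" for t
  using M[OF that] by (simp add:Mm_def l_def alg)
 have "Rm h (t *R v) u v v = k *R (?Z *v u)" if t: "0 < t" "t < r" for t proof -
  have t0: "t ~= 0" "t *R v : U" "s_fun k t > 0" using t tU sp by auto
  let ?s = "s_fun k t" and ?c = "c_fun k t"
  define l' where "l' = (?c - t * k * ?s) / ?s - t * ?c * ?c / ?s^2"
  have dl: "(l hasRD l') (at t)" unfolding l_def[abs_def] l'_def using t0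
   by (auto intro!:deriv_intros s_hasRD c_fun_deriv simp:field_simps sq_eq)
  have "((%t. Pm v + l t *R ?Z) hasVD l' *R ?Z) (at t)" using dl by (auto intro!:deriv_intros simp:hasRD_iff)
  hence "((%t. Sm (t *R v)) hasVD l' *R ?Z) (at t)" by (rule hasVD_open[of _ _ _ "{0<..<r}"]) (use t S in auto)
  from vector_derivative_unique_at[OF this Sm_ray_deriv[OF t0(1,2)]]
  have "(1 / t) *R (Sm (t *R v) - Sm (t *R v) ** Sm (t *R v) - Rx (t *R v)) = l' *R ?Z" by simp
  hence "t *R ((1 / t) *R (Sm (t *R v) - Sm (t *R v) ** Sm (t *R v) - Rx (t *R v))) = (t * l') *R ?Z" by simp
  hence "Rx (t *R v) = Sm (t *R v) - Sm (t *R v) ** Sm (t *R v) - (t * l') *R ?Z" using t0(1) by (simp add:alg)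
  also have "Sm (t *R v) ** Sm (t *R v) = Pm v + (l t * l t) *R ?Z" unfolding S[OF t] using Pm_facts(3)[OF t0(1,2)]
   by (simp add:matrix_add_ldistrib matrix_mult_scaleR matrix_mult_linear_left)
  also have "Sm (t *R v) - (Pm v + (l t * l t) *R ?Z) - (t * l') *R ?Z = (l t - l t * l t - t * l') *R ?Z"
   unfolding S[OF t] by (simp add:alg)
  also have "l t - l t * l t - t * l' = t^2 * k" using t0 by (simp add:l_def l'_def field_simps sq_eq)
  finally have "t^2 *R (matrix (%u. Rm h (t *R v) u v v) *v u) = t^2 *R (k *R (?Z *v u))"
   unfolding Rx_ray by (metis scaleR_mv scaleR_scaleR)
  hence "t^2 *R Rm h (t *R v) u v v = t^2 *R (k *R (?Z *v u))" unfolding matrix_apply[OF Rm_linear(1)] .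
  thus ?thesis by (rule scaleR_left_imp_eq[rotated]) (use t0(1) in simp)
 qed
 hence "\<forall>\<^sub>F t in at_right 0. Rm h (t *R v) u v v = k *R (?Z *v u)"
  unfolding eventually_at_right_field using r(1) by (intro exI[of _ r]) auto
 hence 1: "((%t. Rm h (t *R v) u v v) ---> k *R (?Z *v u)) (at_right 0)" by (rule tendsto_eventually)
 have "cont_on U (%x. DG h v v x u - DG h u v x v + Gam h x u (Gam h x v v) - Gam h x v (Gam h x u v))"
  by (rule Ck_cont[of 0]) (intro Ck_add Ck_diff Ck_D Gam_Ck openU Ck_ident Ck_const; simp)
 hence "cont_on U (%x. Rm h x u v v)" by (simp add:Rm_eq cong:continuous_on_cong)
 hence "isCont (%x. Rm h x u v v) 0" using openU zero_U continuous_on_eq_continuous_at by blast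
 from isCont_tendsto_compose[OF this ray_at_0]
 have "((%t. Rm h (t *R v) u v v) ---> Rm h 0 u v v) (at_right 0)" .
 from tendsto_unique[OF _ this 1] show ?thesis by simp
qed

text \<open>The converse direction. \<open>N\<close> is \<open>s_fun\<close> times the tangential
  part of \<open>Sm\<close>, minus its value in the model. If the radial curvature is that of the
  model, \<open>N\<close> satisfies a homogeneous linear equation and tends to 0 at the centre, so
  it vanishes.\<close>

lemma model_curvature_mean_curv:
 assumes r: "0 < r" "r *R v : U" "k > 0 ==> r < pi / sqrt k"
  and R: "!!t u. 0 < t ==> t <= r ==> Rm h (t *R v) u v v = k *R ((mat 1 - Pm v) *v u)"
 shows "mean_curv v r = (real CARD('n) - 1) * c_fun k r / s_fun k r" proof -
 let ?Z = "mat 1 - Pm v"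
 have tU: "t *R v : U" if "0 <= t" "t <= r" for t using star[OF r(2), of "t / r"] that r(1) by simp
 define N where "N t = s_fun k t *R (Sm (t *R v) - Pm v) - (t * c_fun k t) *R ?Z" for t
 \<comment> \<open>For \<open>t ~= 0\<close> this is \<open>(Sm (t *R v) - mat 1) / t\<close>; in
   terms of \<open>Gam\<close> it is visibly continuous up to \<open>t = 0\<close>, hence
   bounded.\<close>
 define G where "G t = matrix (%u. Gam h (t *R v) u v)" for t
 have S1: "Sm (t *R v) - mat 1 = t *R G t" for t
  by (simp add:Sm_def G_def vec_eq_iff matrix_def linear_scale[OF Gam_linear(2)])
 have dN: "(N hasVD - (N t ** G t)) (at t)" if t: "0 < t" "t <= r" for t proof -
  have t0: "t ~= 0" "t *R v : U" using t tU by auto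
  note P = Pm_facts[OF t0]
  let ?s = "s_fun k t" and ?c = "c_fun k t" and ?S = "Sm (t *R v)"
  have Rx: "Rx (t *R v) = (t^2 * k) *R ?Z" proof -
   have "matrix (%u. Rm h (t *R v) u v v) = k *R ?Z" by (simp add:R[OF t] scaleR_mv)
   thus ?thesis by (simp add:Rx_ray)
  qed
  have d1: "(s_fun k has_real_derivative ?c) (at t)" "((%t. t * c_fun k t) hasRD (?c - t * k * ?s)) (at t)"
   using s_hasRD[of k t] c_fun_deriv[of k t] by (auto intro!:deriv_intros)
  have "(N hasVD (?s *R ((1 / t) *R (?S - ?S ** ?S - Rx (t *R v)) - 0) + ?c *R (?S - Pm v)
    - ((t * ?c) *R 0 + (?c - t * k * ?s) *R ?Z))) (at t)" unfolding N_def[abs_def]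
   by (intro hasVD_diff has_vector_derivative_scaleR d1 has_vector_derivative_const Sm_ray_deriv t0)
  moreover have "?s *R ((1 / t) *R (?S - ?S ** ?S - Rx (t *R v)) - 0) + ?c *R (?S - Pm v)
    - ((t * ?c) *R 0 + (?c - t * k * ?s) *R ?Z) = (?s / t) *R (?S - ?S ** ?S) + ?c *R (?S - mat 1)"
   using t0(1) by (simp add:Rx alg sq_eq)
  moreover have "- (N t ** G t) = (?s / t) *R (?S - ?S ** ?S) + ?c *R (?S - mat 1)" proof -
   have GG: "G t = (1 / t) *R (?S - mat 1)" using t0(1) by (simp add:S1)
   show ?thesis unfolding N_def GG using t0(1) by (simp add:matrix_mult_scaleR matrix_mult_linear_left P alg)
  qed
  ultimately show ?thesis by simp
 qed
 obtain K0 where K0: "K0 >= 0" "!!(A :: real^'n^'n) (B :: real^'n^'n). norm (A ** B) <= K0 * norm A * norm B"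
  using matrix_norm_mult by blast
 have "cont_on {0..r} G" proof -
  have "Ck_on 0 U (%x. \<chi> i j. Gam h x (axis j 1) v $ i)"
   by (intro Ck_vec_lambda Ck_vec_nth Gam_Ck openU Ck_ident Ck_const) auto
  hence "cont_on U (%x. matrix (%u. Gam h x u v))" by (simp add:matrix_def)
  thus ?thesis unfolding G_def by (rule cont_compose) (use tU in "auto intro!:continuous_intros")
 qed
 hence "bounded (G ` {0..r})" by (intro compact_imp_bounded compact_image) auto
 then obtain B where "ALL t:{0..r}. norm (G t) <= B" by (auto simp:bounded_iff)
 hence B: "norm (G t) <= B" if "0 <= t" "t <= r" for t using that by simp
 define K where "K = K0 * abs B"
 have K: "K >= 0" using K0 by (simp add:K_def)
 have NK: "norm (- (N t ** G t)) <= K * norm (N t) + 0" if "0 < t" "t <= r" for t proof -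
  have "norm (N t ** G t) <= K0 * norm (N t) * norm (G t)" by (rule K0)
  also have "... <= K0 * norm (N t) * abs B" using B[of t] that K0 by (intro mult_left_mono) auto
  finally show ?thesis by (simp add:K_def mult_ac)
 qed
 have N0: "(N ---> 0) (at_right 0)" proof -
  have "(N ---> 0 *R (mat 1 - Pm v) - (0 * 1) *R ?Z) (at_right 0)"
   unfolding N_def[abs_def] by (intro tendsto_intros s_fun_tendsto Sm_tendsto)
  thus ?thesis by simp
 qed
 \<comment> \<open>The equation \<open>dN\<close> is available for positive times only. Gronwall's
   inequality therefore starts at \<open>e > 0\<close>, and afterwards \<open>e\<close> tends to
   0.\<close>
 have "(norm (N r))^2 <= (norm (N e))^2 * exp ((2 * K + 1) * r)" if e: "0 < e" "e < r" for e proof -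
  have "(norm (N ((r - e) + e)))^2 + 0^2 <= ((norm (N (0 + e)))^2 + 0^2) * exp ((2 * K + 1) * (r - e))"
  proof (rule gronwall_forward[where y="%s. N (s + e)" and y'="%s. - (N (s + e) ** G (s + e))"])
   fix s assume s: "0 <= s" "s <= r - e"
   show "((%s. N (s + e)) hasVD - (N (s + e) ** G (s + e))) (at s)" proof -
    have "((%s. s + e) hasVD 1) (at s)" by (auto intro!:deriv_intros)
    from vector_diff_chain_at[OF this dN[of "s + e"]] s e show ?thesis by (simp add:o_def)
   qed
   show "norm (- (N (s + e) ** G (s + e))) <= K * norm (N (s + e)) + 0" using NK[of "s + e"] s e by simp
  qed (use e K in auto)
  hence "(norm (N r))^2 <= (norm (N e))^2 * exp ((2 * K + 1) * (r - e))" by simp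
  also have "... <= (norm (N e))^2 * exp ((2 * K + 1) * r)" using e K by (intro mult_left_mono) auto
  finally show ?thesis .
 qed
 hence "\<forall>\<^sub>F e in at_right 0. (norm (N r))\<^sup>2 <= (norm (N e))^2 * exp ((2 * K + 1) * r)"
  unfolding eventually_at_right_field using r(1) by (intro exI[of _ r]) auto
 moreover have "((%e. (norm (N e))\<^sup>2 * exp ((2 * K + 1) * r)) ---> (norm (0::real^'n^'n))^2 * exp ((2 * K + 1) * r)) (at_right 0)"
  by (intro tendsto_intros N0)
 ultimately have "(norm (N r))^2 <= (norm (0::real^'n^'n))^2 * exp ((2 * K + 1) * r)"
  by (intro tendsto_lowerbound) auto
 hence "N r = 0" by simp
 hence "trace (N r) = 0" by (simp add:trace_def)
 hence "s_fun k r * (trace (Sm (r *R v)) - 1) = r * c_fun k r * (real CARD('n) - 1)"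
  using Pm_facts(4)[of r] r by (simp add:N_def trace_sub trace_scaleR trace_I)
 thus ?thesis using s_fun_pos[OF r(1,3)] r(1) by (simp add:mean_curv_def field_simps)
qed

end

end

section \<open>Charts and geodesics\<close>

locale riem =
 fixes A :: "('a::{t2_space, second_countable_topology}, 'n::finite) chart set"
  and g :: "('a, 'n) metric"
 assumes atlas: "oriented_smooth_atlas A" and metric: "riemannian_metric A g"
begin

abbreviation "img c == map_ch c ` dom_ch c" for c :: "('a, 'n) chart"

abbreviation "ov c d == map_ch c ` (dom_ch c Int dom_ch d)" for c d :: "('a, 'n) chart"

definition L :: "('a, 'n) chart => ('a, 'n) chart => 'a => real^'n => real^'n" where
 "L c d p = Df (transition c d) (map_ch c p)"

lemma chart_at: "chart_at A p : A" "p : dom_ch (chart_at A p)" proof -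
 have "p : (UN c:A. dom_ch c)" using atlas unfolding oriented_smooth_atlas_def by simp
 hence "EX c. c : A & p : dom_ch c" by blast
 from someI_ex[OF this] show "chart_at A p : A" "p : dom_ch (chart_at A p)" unfolding chart_at_def by auto
qed

context
 fixes c assumes c: "c : A"
begin

lemma open_dom: "open (dom_ch c)" and open_img: "open (img c)"
 using atlas c unfolding oriented_smooth_atlas_def by auto

lemma homeo: "homeomorphism (dom_ch c) (img c) (map_ch c) (inv_ch c)"
 using atlas c unfolding oriented_smooth_atlas_def by auto

lemma inv_map: "p : dom_ch c ==> inv_ch c (map_ch c p) = p" using homeomorphism_apply1[OF homeo] .

lemma map_inv: "x : img c ==> map_ch c (inv_ch c x) = x" using homeomorphism_apply2[OF homeo] .

lemma inv_in: "x : img c ==> inv_ch c x : dom_ch c" using homeo unfolding homeomorphism_def by auto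

lemma map_cont: "cont_on (dom_ch c) (map_ch c)" and inv_cont: "cont_on (img c) (inv_ch c)"
 using homeo unfolding homeomorphism_def by auto

lemma inj_map: "inj_on (map_ch c) (dom_ch c)" by (rule inj_on_inverseI[where g="inv_ch c"]) (rule inv_map)

lemma open_image: "open B ==> B <= dom_ch c ==> open (map_ch c ` B)" proof -
 assume B: "open B" "B <= dom_ch c"
 have "map_ch c ` B = img c Int inv_ch c -` B" using B(2) inv_map map_inv inv_in by (auto simp:image_iff)
 thus ?thesis using open_preimage[OF inv_cont open_img B(1)] by simp
qed

lemma mf: "metric_field (img c) (g c)"
 using metric c open_img unfolding riemannian_metric_def metric_field_def by blast

end

lemma ov_open: "c : A ==> d : A ==> open (ov c d)" by (rule open_image) (auto intro:open_dom)

lemma ov_sub: "ov c d <= img c" by auto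

lemma ov_memI: "p : dom_ch c ==> p : dom_ch d ==> map_ch c p : ov c d" by auto

lemma trans_map: "c : A ==> p : dom_ch c ==> transition c d (map_ch c p) = map_ch d p"
 by (simp add:transition_def inv_map)

lemma trans_smooth: "c : A ==> d : A ==> smooth_on (ov c d) (transition c d)"
 using atlas unfolding oriented_smooth_atlas_def by blast

lemma trans_Ck: "c : A ==> d : A ==> Ck_on m (ov c d) (transition c d)"
 using trans_smooth unfolding smooth_on_def by blast

lemma transition_hasD:
 "c : A ==> d : A ==> p : dom_ch c ==> p : dom_ch d ==>
  (transition c d hasD L c d p) (at (map_ch c p))"
 unfolding L_def by (rule Ck_hasD[OF trans_Ck[where m="Suc 0"]]) auto

lemma L_linear: "c : A ==> d : A ==> p : dom_ch c ==> p : dom_ch d ==> linear (L c d p)"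
 using transition_hasD hasD_linear by blast

lemma jacobian_matrix_L:
 assumes "c : A" "d : A" "p : dom_ch c" "p : dom_ch d"
 shows "jacobian_matrix (transition c d) (map_ch c p) *v v = L c d p v"
 using L_linear[OF assms] by (simp add:jacobian_matrix_def L_def matrix_apply)

lemma L_comp:
 assumes "c : A" "d : A" "e : A" "p : dom_ch c" "p : dom_ch d" "p : dom_ch e"
 shows "L d e p (L c d p v) = L c e p v" proof -
 let ?S = "map_ch c ` (dom_ch c Int dom_ch d Int dom_ch e)"
 have o: "open ?S" using assms by (intro open_image) (auto intro:open_dom)
 have m: "map_ch c p : ?S" using assms by auto
 have 1: "((%x. transition d e (transition c d x)) hasD (%v. L d e p (L c d p v))) (at (map_ch c p))"
  by (rule hasD_compose[OF transition_hasD])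
   (use assms trans_map[OF assms(1,4)] transition_hasD[OF assms(2,3,5,6)] in auto)
 have "(transition c e hasD (%v. L d e p (L c d p v))) (at (map_ch c p))"
  by (rule hasD_open[OF 1 o m]) (use assms in "auto simp:trans_map")
 from hasD_unique[OF this transition_hasD[OF assms(1,3,4,6)]] show ?thesis by metis
qed

lemma L_id:
 assumes "c : A" "p : dom_ch c"
 shows "L c c p v = v" proof -
 have "((%x. x) hasD (%v. v)) (at (map_ch c p))" by simp
 hence "(transition c c hasD (%v. v)) (at (map_ch c p))" by (rule hasD_open[OF _ open_img[OF assms(1)]])
   (use assms in "auto simp:trans_map")
 from hasD_unique[OF this transition_hasD[OF assms(1,1,2,2)]] show ?thesis by metis
qed

lemma L_inverse:
 assumes "c : A" "d : A" "p : dom_ch c" "p : dom_ch d"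
 shows "L d c p (L c d p v) = v" using L_comp[OF assms(1,2,1,3,4,3)] L_id[OF assms(1,3)] by simp

lemma metric_L:
 assumes "c : A" "d : A" "p : dom_ch c" "p : dom_ch d"
 shows "u <.> (g c (map_ch c p) *v v) = L c d p u <.> (g d (map_ch d p) *v L c d p v)" proof -
 let ?J = "jacobian_matrix (transition c d) (map_ch c p)"
 have "g c (map_ch c p) = transpose ?J ** g d (transition c d (map_ch c p)) ** ?J"
  using metric assms ov_memI[OF assms(3,4)] unfolding riemannian_metric_def by blast
 hence e: "g c (map_ch c p) = transpose ?J ** g d (map_ch d p) ** ?J" by (simp add:trans_map assms)
 show ?thesis unfolding e jacobian_matrix_L[OF assms, symmetric]
  by (simp add:mv_assoc[symmetric] inner_transpose)
qed

lemma metric_field_subset: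
 "metric_field U h ==> open W ==> W <= U ==> metric_field W h"
 unfolding metric_field_def smooth_on_def using Ck_subset by blast

lemma trans_pullback:
 assumes "c : A" "d : A"
 shows "pullback (ov c d) (g c) (img d) (g d) (transition c d)" proof (rule pullback.intro)
 show "metric_field (ov c d) (g c)" by (rule metric_field_subset[OF mf[OF assms(1)] ov_open[OF assms] ov_sub])
 show "metric_field (img d) (g d)" by (rule mf[OF assms(2)])
 show "pullback_axioms (ov c d) (g c) (img d) (g d) (transition c d)" proof
  show "smooth_on (ov c d) (transition c d)" by (rule trans_smooth[OF assms])
  fix x u v assume "x : ov c d"
  then obtain p where p: "x = map_ch c p" "p : dom_ch c" "p : dom_ch d" by auto
  show "transition c d x : img d" using p assms by (auto simp:trans_map)
  show "u <.> (g c x *v v) = Df (transition c d) x u <.> (g d (transition c d x) *v Df (transition c d) x v)"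
   using metric_L[OF assms p(2,3), of u v] p assms by (simp add:trans_map L_def)
 qed
qed

lemma coord_eq: "coord A p = map_ch (chart_at A p) p" by (simp add:coord_def)

lemma inner_at_chart:
 assumes "c : A" "p : dom_ch c"
 shows "inner_at A g p u v = L (chart_at A p) c p u <.> (g c (map_ch c p) *v L (chart_at A p) c p v)"
 using metric_L[OF chart_at(1) assms(1) chart_at(2) assms(2), of u v] by (simp add:inner_at_def gram_at_def coord_eq)

lemma bch_eq:
 assumes "c : A" "p : dom_ch c"
 shows "bundle_chart A c (p, v) = (map_ch c p, L (chart_at A p) c p v)"
 using jacobian_matrix_L[OF chart_at(1) assms(1) chart_at(2) assms(2), of v] by (simp add:bundle_chart_def coord_eq)

text \<open>The inverse of \<open>bundle_chart A c\<close>: components in \<open>c\<close> are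
  turned back into components in the preferred chart.\<close>

definition "ibc c z = (inv_ch c (fst z), L c (chart_at A (inv_ch c (fst z))) (inv_ch c (fst z)) (snd z))"

lemma ibc_bundle: "c : A ==> p : dom_ch c ==> ibc c (bundle_chart A c (p, v)) = (p, v)"
 by (simp add:ibc_def bch_eq inv_map L_inverse chart_at)

lemma bundle_ibc: "c : A ==> fst z : img c ==> bundle_chart A c (ibc c z) = z"
 by (simp add:ibc_def bch_eq inv_in map_inv L_inverse chart_at prod_eq_iff)

lemma bundle_fst: "c : A ==> p : dom_ch c ==> fst (bundle_chart A c (p, v)) = map_ch c p" by (simp add:bch_eq)

text \<open>The geodesic equation as an autonomous first-order system on the chart
  \<open>TU c\<close> of the tangent bundle.\<close>

definition "spray c z = (snd z, - Gam (g c) (fst z) (snd z) (snd z))"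

definition "TU c = img c >< (UNIV :: (real^'n) set)"

lemma TU_open: "c : A ==> open (TU c)" unfolding TU_def by (intro open_Times open_img) auto

lemma spray_Ck: "c : A ==> Ck_on m (TU c) (spray c)" unfolding spray_def
 by (intro Ck_Pair Ck_minus metric_field.Gam_Ck[OF mf] Ck_fst Ck_snd Ck_ident TU_open)
  (auto simp:TU_def)

definition "vel c ga t = vector_derivative (map_ch c o ga) (at t)"

definition "st c ga t = (map_ch c (ga t), vel c ga t)"

lemma Gam_christoffel:
 "(\<chi> l. - (SUM i:UNIV. SUM j:UNIV. christoffel g c l i j x * v $ i * v $ j)) = - Gam (g c) x v v" proof -
 have "christoffel g c = christoffel (%_::(unit, 'n) chart. g c) undefined" by (rule christoffel_cong_metric) simp
 thus ?thesis by (simp add:Gam_def vec_eq_iff)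
qed

lemma geo_open: "geodesic A g ga ==> c : A ==> open (ga -` dom_ch c)"
 unfolding geodesic_def using open_dom open_vimage by blast

lemma geodesic_st:
 assumes "geodesic A g ga" "c : A" "ga t : dom_ch c"
 shows "((%t. map_ch c (ga t)) hasVD vel c ga t) (at t)"
  and "(st c ga hasVD spray c (st c ga t)) (at t)" proof -
 obtain v where v: "!!t. ga t : dom_ch c ==> ((map_ch c o ga) hasVD v t) (at t)"
  "!!t. ga t : dom_ch c ==> (v hasVD - Gam (g c) (map_ch c (ga t)) (v t) (v t)) (at t)"
  using assms(1,2) unfolding geodesic_def Gam_christoffel by metis
 have ve: "vel c ga t = v t" if "ga t : dom_ch c" for t
  unfolding vel_def using vector_derivative_at[OF v(1)[OF that]] .
 show 1: "((%t. map_ch c (ga t)) hasVD vel c ga t) (at t)" using v(1)[OF assms(3)] by (simp add:ve assms(3) o_def)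
 have "(vel c ga hasVD - Gam (g c) (map_ch c (ga t)) (v t) (v t)) (at t)"
  by (rule hasVD_open[OF v(2)[OF assms(3)] geo_open[OF assms(1,2)]]) (use assms(3) ve in auto)
 from has_vector_derivative_Pair[OF 1 this]
 show "(st c ga hasVD spray c (st c ga t)) (at t)" by (simp add:st_def[abs_def] spray_def ve assms(3))
qed

lemma vel_transform:
 assumes "geodesic A g ga" "c : A" "d : A" "ga t : dom_ch c" "ga t : dom_ch d"
 shows "vel d ga t = L c d (ga t) (vel c ga t)" proof -
 have "((%s. transition c d (map_ch c (ga s))) hasVD L c d (ga t) (vel c ga t)) (at t)"
  using vector_derivative_diff_chain_within[of "%s. map_ch c (ga s)" "vel c ga t" t UNIV "transition c d" "L c d (ga t)"]
   geodesic_st(1)[OF assms(1,2,4)] transition_hasD[OF assms(2-5)] by (simp add:o_def hasD_within)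
 hence "((%s. map_ch d (ga s)) hasVD L c d (ga t) (vel c ga t)) (at t)"
  by (rule hasVD_open[OF _ geo_open[OF assms(1,2)]]) (use assms trans_map in auto)
 from vector_derivative_unique_at[OF this geodesic_st(1)[OF assms(1,3,5)]] show ?thesis ..
qed

text \<open>The velocity in components of the preferred chart, so that it pairs with
  \<open>ga t\<close> to a point of the tangent bundle as represented here. It need not be
  continuous in \<open>t\<close>.\<close>

definition "pvel ga t = vel (chart_at A (ga t)) ga t"

lemma st_bundle:
 assumes "geodesic A g ga" "c : A" "ga t : dom_ch c"
 shows "st c ga t = bundle_chart A c (ga t, pvel ga t)"
 using vel_transform[OF assms(1) chart_at(1) assms(2) chart_at(2) assms(3)] assms
 by (simp add:st_def pvel_def bch_eq)

lemma geodesic_affine: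
 assumes "geodesic A g ga"
 shows "geodesic A g (%t. ga (a * t + b))"
  and "c : A ==> ga (a * t + b) : dom_ch c ==> vel c (%t. ga (a * t + b)) t = a *R vel c ga (a * t + b)" proof -
 have aff: "((%t. a * t + b) hasVD a) (at t)" for t by (auto intro!:deriv_intros simp:hasRD_iff[symmetric])
 have v1: "((map_ch c o (%t. ga (a * t + b))) hasVD a *R vel c ga (a * t + b)) (at t)"
  if "c : A" "ga (a * t + b) : dom_ch c" for c t
  using vector_diff_chain_at[OF aff geodesic_st(1)[OF assms that]] by (simp add:o_def)
 show "vel c (%t. ga (a * t + b)) t = a *R vel c ga (a * t + b)" if "c : A" "ga (a * t + b) : dom_ch c"
  unfolding vel_def[of c "%t. ga (a * t + b)"] using vector_derivative_at[OF v1[OF that]] .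
 show "geodesic A g (%t. ga (a * t + b))" unfolding geodesic_def Gam_christoffel proof (intro conjI ballI)
  have "cont_on UNIV ga" using assms by (simp add:geodesic_def)
  thus "cont_on UNIV (%t. ga (a * t + b))" by (rule cont_compose) (auto intro!:continuous_intros)
  fix c assume c: "c : A"
  define v where "v t = a *R vel c ga (a * t + b)" for t
  have "((map_ch c o (%t. ga (a * t + b))) hasVD v t) (at t) &
   (v hasVD - Gam (g c) (map_ch c (ga (a * t + b))) (v t) (v t)) (at t)" if d: "ga (a * t + b) : dom_ch c" for t proof
   show "((map_ch c o (%t. ga (a * t + b))) hasVD v t) (at t)" unfolding v_def by (rule v1[OF c d])
   have "((%t. snd (st c ga t)) hasVD snd (spray c (st c ga (a * t + b)))) (at (a * t + b))"
    by (rule bounded_linear.has_vector_derivative[OF bounded_linear_snd geodesic_st(2)[OF assms c d]])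
   hence "(vel c ga hasVD - Gam (g c) (map_ch c (ga (a * t + b))) (vel c ga (a * t + b)) (vel c ga (a * t + b))) (at (a * t + b))"
    by (simp add:st_def spray_def)
   from bounded_linear.has_vector_derivative[OF bounded_linear_scaleR_right vector_diff_chain_at[OF aff this], of a]
   show "(v hasVD - Gam (g c) (map_ch c (ga (a * t + b))) (v t) (v t)) (at t)"
    by (simp add:v_def[abs_def] o_def linear_scale[OF Gam_linear(1)] linear_scale[OF Gam_linear(2)])
  qed
  thus "EX v. ALL t. ga (a * t + b) : dom_ch c -->
   ((map_ch c o (%t. ga (a * t + b))) hasVD v t) (at t) &
   (v hasVD - Gam (g c) (map_ch c (ga (a * t + b))) (v t) (v t)) (at t)" by blast
 qed
qed

end

lemma ode_unique_local:
 fixes X :: "'e::euclidean_space => 'e"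
 assumes "open U" "Ck_on (Suc 0) U X" "y1 0 = y2 0" "y1 0 : U" "T > 0"
  and d1: "!!t. abs t < T ==> (y1 hasVD X (y1 t)) (at t)"
  and d2: "!!t. abs t < T ==> (y2 hasVD X (y2 t)) (at t)"
 obtains ep where "ep > 0" "!!t. abs t < ep ==> y1 t = y2 t" proof -
 obtain r where r: "r > 0" "cball (y1 0) r <= U" using assms(1,4) open_contains_cball by blast
 obtain K where K: "K >= 0" "!!y v. y : cball (y1 0) r ==> norm (Df X y v) <= K * norm v"
  using C1_derivative_bound[OF assms(2) compact_cball r(2)] by blast
 have lip: "norm (X a - X b) <= K * norm (a - b)" if "a : cball (y1 0) r" "b : cball (y1 0) r" for a b
 proof (rule differentiable_bound[of "cball (y1 0) r" X "Df X"])
  show "(X hasD Df X x) (at x within cball (y1 0) r)" if "x : cball (y1 0) r" for x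
   using Ck_hasD[OF assms(2)] r(2) that hasD_within by blast
  show "onorm (Df X x) <= K" if "x : cball (y1 0) r" for x using K(2)[OF that] by (rule onorm_le)
 qed (use that in auto)
 have c: "isCont y1 0" "isCont y2 0" using d1[of 0] d2[of 0] assms(5) hasVD_cont by auto
 obtain e1 where e1: "e1 > 0" "!!t. abs t < e1 ==> dist (y1 t) (y1 0) < r"
  using c(1) r(1) unfolding continuous_at_eps_delta dist_norm by (metis diff_zero real_norm_def)
 obtain e2 where e2: "e2 > 0" "!!t. abs t < e2 ==> dist (y2 t) (y2 0) < r"
  using c(2) r(1) unfolding continuous_at_eps_delta dist_norm by (metis diff_zero real_norm_def)
 define ep where "ep = Min {e1, e2, T}"
 have e: "ep > 0" "ep <= e1" "ep <= e2" "ep <= T" using e1 e2 assms(5) by (auto simp:ep_def)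
 have "y1 t = y2 t" if t: "abs t < ep" for t proof -
  have "norm (y1 t - y2 t) <= (norm (y1 0 - y2 0) + 0) * exp ((2 * K + 1) * abs t)"
  proof (rule gronwall[where y="%t. y1 t - y2 t" and y'="%t. X (y1 t) - X (y2 t)", OF order_refl K(1) order_refl])
   fix s assume s: "abs s <= abs t"
   show "((%t. y1 t - y2 t) hasVD X (y1 s) - X (y2 s)) (at s)" by (intro hasVD_diff d1 d2) (use s t e in auto)
   show "norm (X (y1 s) - X (y2 s)) <= K * norm (y1 s - y2 s) + 0"
    using lip[of "y1 s" "y2 s"] e1(2)[of s] e2(2)[of s] s t e assms(3) by (auto simp:dist_commute)
  qed
  thus ?thesis using assms(3) by simp
 qed
 thus ?thesis using that e(1) by blast
qed

context riem
begin

lemma geodesic_agree_local: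
 assumes "geodesic A g ga1" "geodesic A g ga2" "c : A" "ga1 t0 : dom_ch c"
  and eq: "ga1 t0 = ga2 t0" "vel c ga1 t0 = vel c ga2 t0"
 shows "EX ep>0. ALL t. abs (t - t0) < ep --> ga1 t = ga2 t & st c ga1 t = st c ga2 t" proof -
 have "open (ga1 -` dom_ch c Int ga2 -` dom_ch c)" "t0 : ga1 -` dom_ch c Int ga2 -` dom_ch c"
  using open_Int[OF geo_open[OF assms(1,3)] geo_open[OF assms(2,3)]] assms(4,5) by simp_all
 then obtain T where T: "T > 0" "ball t0 T <= ga1 -` dom_ch c Int ga2 -` dom_ch c" using open_contains_ball by blast
 have dom: "ga1 (t + t0) : dom_ch c" "ga2 (t + t0) : dom_ch c" if "abs t < T" for t
  using T(2) that by (auto simp:subset_iff dist_norm)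
 have sh: "((%t. st c ga (t + t0)) hasVD spray c (st c ga (t + t0))) (at t)"
  if "geodesic A g ga" "ga (t + t0) : dom_ch c" for ga t proof -
  have "((%t. t + t0) hasVD 1) (at t)" by (auto intro!:deriv_intros simp:hasRD_iff[symmetric])
  from vector_diff_chain_at[OF this geodesic_st(2)[OF that(1) assms(3) that(2)]] show ?thesis by (simp add:o_def)
 qed
 obtain ep where e: "ep > 0" "!!t. abs t < ep ==> st c ga1 (t + t0) = st c ga2 (t + t0)"
 proof (rule ode_unique_local[of "TU c" "spray c" "%t. st c ga1 (t + t0)" "%t. st c ga2 (t + t0)" T])
  show "st c ga1 (0 + t0) = st c ga2 (0 + t0)" using eq by (simp add:st_def)
  show "st c ga1 (0 + t0) : TU c" using assms(4) by (simp add:st_def TU_def)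
 qed (use T TU_open[OF assms(3)] spray_Ck[OF assms(3)] sh dom assms(1,2) in auto)
 have "ga1 t = ga2 t & st c ga1 t = st c ga2 t" if t: "abs (t - t0) < min ep T" for t proof -
  have s: "st c ga1 t = st c ga2 t" using e(2)[of "t - t0"] t by simp
  hence "map_ch c (ga1 t) = map_ch c (ga2 t)" by (simp add:st_def)
  moreover have "ga1 t : dom_ch c" "ga2 t : dom_ch c" using dom[of "t - t0"] t by auto
  ultimately show ?thesis using s inj_map[OF assms(3)] by (simp add:inj_on_eq_iff)
 qed
 thus ?thesis using e(1) T(1) by (intro exI[of _ "min ep T"]) auto
qed

lemma geodesic_cont: "geodesic A g ga ==> isCont ga t"
 unfolding geodesic_def by (simp add:continuous_on_eq_continuous_at)

text \<open>The set \<open>Z\<close> of times where points and velocities agree is open by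
  uniqueness for the spray. Its complement is open by the Hausdorff property where the points
  differ, and by continuity of velocities in a common chart where they coincide. The line is
  connected.\<close>

lemma geodesic_unique:
 assumes g1: "geodesic A g ga1" and g2: "geodesic A g ga2" and "ga1 t0 = ga2 t0" "pvel ga1 t0 = pvel ga2 t0"
 shows "ga1 = ga2" proof -
 define Z where "Z = {t. ga1 t = ga2 t & pvel ga1 t = pvel ga2 t}"
 have Zc: "t : Z <-> ga1 t = ga2 t & vel c ga1 t = vel c ga2 t" if "c : A" "ga1 t : dom_ch c" for c t
 proof (cases "ga1 t = ga2 t")
  case True
  let ?d = "chart_at A (ga1 t)"
  have e: "vel c ga1 t = L ?d c (ga1 t) (pvel ga1 t)" "vel c ga2 t = L ?d c (ga1 t) (pvel ga2 t)"
   using vel_transform[OF g1 chart_at(1) that(1) chart_at(2) that(2)]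
    vel_transform[OF g2 chart_at(1) that(1) chart_at(2)[of "ga2 t"]] that(2) True by (auto simp:pvel_def)
  have "pvel ga1 t = L c ?d (ga1 t) (vel c ga1 t)" "pvel ga2 t = L c ?d (ga1 t) (vel c ga2 t)"
   unfolding e using L_inverse[OF chart_at(1) that(1) chart_at(2) that(2)] by auto
  thus ?thesis using e True by (auto simp:Z_def)
 qed (simp add:Z_def)
 have "open Z" unfolding open_dist proof
  fix t assume t: "t : Z"
  let ?c = "chart_at A (ga1 t)"
  have "ga1 t = ga2 t" "vel ?c ga1 t = vel ?c ga2 t" using Zc[OF chart_at] t by auto
  then obtain ep where e: "ep > 0" "!!s. abs (s - t) < ep ==> ga1 s = ga2 s & st ?c ga1 s = st ?c ga2 s"
   using geodesic_agree_local[OF g1 g2 chart_at] by blast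
  have "open (ga1 -` dom_ch ?c)" "t : ga1 -` dom_ch ?c" using geo_open[OF g1 chart_at(1)] chart_at by auto
  then obtain e' where e': "e' > 0" "ball t e' <= ga1 -` dom_ch ?c" using open_contains_ball by blast
  have "s : Z" if "dist s t < min ep e'" for s proof -
   have "ga1 s : dom_ch ?c" using e'(2) that by (auto simp:subset_iff dist_commute)
   thus ?thesis using Zc[OF chart_at(1)] e(2)[of s] that by (auto simp:st_def dist_norm)
  qed
  thus "EX e>0. ALL y. dist y t < e --> y : Z" using e e' by (intro exI[of _ "min ep e'"]) auto
 qed
 moreover have "open (- Z)" unfolding open_subopen[of "- Z"] proof
  fix t assume t: "t : - Z"
  show "EX T. open T & t : T & T <= - Z" proof (cases "ga1 t = ga2 t")
   case False
   obtain P Q where PQ: "open P" "open Q" "ga1 t : P" "ga2 t : Q" "P Int Q = {}" using hausdorff[OF False] by blast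
   have "open (ga1 -` P Int ga2 -` Q)"
    using PQ g1 g2 unfolding geodesic_def by (intro open_Int) (auto intro:open_vimage)
   moreover have "ga1 -` P Int ga2 -` Q <= - Z" using PQ(5) by (auto simp:Z_def)
   ultimately show ?thesis using PQ by blast
  next
   case True
   let ?c = "chart_at A (ga1 t)"
   let ?S = "ga1 -` dom_ch ?c Int ga2 -` dom_ch ?c"
   have S: "open ?S" "t : ?S"
    using geo_open[OF g1 chart_at(1)] geo_open[OF g2 chart_at(1)] chart_at(2)[of "ga1 t"] True by auto
   have "cont_on ?S (%s. snd (st ?c ga1 s) - snd (st ?c ga2 s))"
    by (intro continuous_intros cont_onI ballI hasVD_cont[OF geodesic_st(2)[OF g1 chart_at(1)]]
      hasVD_cont[OF geodesic_st(2)[OF g2 chart_at(1)]]) auto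
   hence "open (?S Int (%s. snd (st ?c ga1 s) - snd (st ?c ga2 s)) -` (- {0}))"
    by (rule open_preimage[OF _ S(1)]) auto
   moreover have "?S Int (%s. snd (st ?c ga1 s) - snd (st ?c ga2 s)) -` (- {0}) <= - Z"
    using Zc[OF chart_at(1)] by (auto simp:st_def)
   moreover have "vel ?c ga1 t ~= vel ?c ga2 t" using t Zc[OF chart_at, of t] True by auto
   ultimately show ?thesis using S(2) by (intro exI[of _ "?S Int (%s. snd (st ?c ga1 s) - snd (st ?c ga2 s)) -` (- {0})"]) (auto simp:st_def)
  qed
 qed
 ultimately have "Z = {} \<or> Z = UNIV" using clopen[of Z] unfolding closed_def by blast
 moreover have "t0 : Z" using assms(3,4) by (simp add:Z_def)
 ultimately show ?thesis by (auto simp:Z_def fun_eq_iff)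
qed

end

section \<open>The geodesic flow\<close>

text \<open>Induction along the reals: the infimum of the bad times is good by the first hypothesis,
  and the second pushes the good times beyond it.\<close>

lemma interval_continuation:
 fixes Q :: "real => bool"
 assumes cl: "!!m. 0 <= m ==> m < T ==> (!!s. 0 <= s ==> s < m ==> Q s) ==> Q m"
  and op: "!!m. 0 <= m ==> m < T ==> (!!s. 0 <= s ==> s <= m ==> Q s) ==> EX ep>0. ALL s. m < s & s < m + ep --> Q s"
  and t: "0 <= t" "t < T"
 shows "Q t" proof (rule ccontr)
 assume nQ: "~ Q t"
 define S where "S = {s. 0 <= s & ~ Q s}"
 define m where "m = Inf S"
 have tS: "t : S" using nQ t by (simp add:S_def)
 have bS: "bdd_below S" by (rule bdd_belowI[of _ 0]) (simp add:S_def)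
 have m: "0 <= m" "m <= t" unfolding m_def using tS bS by (auto intro!:cInf_greatest cInf_lower simp:S_def)
 have lt: "Q s" if "0 <= s" "s < m" for s using that cInf_lower[OF _ bS, of s] by (auto simp:S_def m_def)
 have Qm: "Q m" using cl[OF m(1) _ lt] m t by linarith
 hence "Q s" if "0 <= s" "s <= m" for s using lt that by (cases "s = m") auto
 then obtain ep where e: "ep > 0" "!!s. m < s ==> s < m + ep ==> Q s" using op[OF m(1)] m t by force
 have "m + ep <= Inf S" proof (rule cInf_greatest)
  show "S ~= {}" using tS by auto
  fix s assume s: "s : S"
  hence "~ s < m" "s ~= m" using lt Qm by (auto simp:S_def)
  thus "m + ep <= s" using e(2)[of s] s by (force simp:S_def)
 qed
 thus False using e(1) by (simp add:m_def)
qed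

context riem
begin

text \<open>The state moves with speed at most \<open>M\<close>, so in the given time it covers less
  than \<open>ro / 2\<close> and cannot reach the boundary of the ball. \<open>M + 1\<close> instead
  of \<open>M\<close> avoids a vanishing denominator.\<close>

lemma geodesic_stays:
 assumes ga: "geodesic A g ga" and c: "c : A" and ro: "ro > 0" "cball z0 ro <= TU c"
  and M: "M >= 0" "!!z. z : cball z0 ro ==> norm (spray c z) <= M"
  and init: "ga 0 : dom_ch c" "dist z0 (st c ga 0) < ro / 2" and t: "abs t < ro / (2 * (M + 1))"
 shows "ga t : dom_ch c & st c ga t : cball z0 ro" proof -
 define good where "good r <-> ga r : dom_ch c & st c ga r : cball z0 ro" for r
 have stc: "isCont (st c ga) r" if "ga r : dom_ch c" for r using hasVD_cont[OF geodesic_st(2)[OF ga c that]] .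
 \<comment> \<open>A compact set in a Hausdorff space is closed. A limit of points of the geodesic
   in \<open>K\<close> thus stays in the chart domain, which the bound in coordinates alone would
   not guarantee.\<close>
 define K where "K = inv_ch c ` fst ` cball z0 ro"
 have KU: "fst ` cball z0 ro <= img c" using ro(2) by (auto simp:TU_def)
 have "compact K" unfolding K_def
  by (intro compact_image cont_subset[OF inv_cont[OF c] KU] continuous_on_fst continuous_on_id compact_cball)
 hence clK: "closed K" by (rule compact_imp_closed)
 have Kd: "K <= dom_ch c" using KU inv_in[OF c] by (auto simp:K_def)
 have goodK: "ga r : K" if "good r" for r proof -
  have "ga r = inv_ch c (fst (st c ga r))" using that inv_map[OF c] by (simp add:good_def st_def)
  thus ?thesis using that unfolding K_def good_def by blast
 qed
 have closed_step: "good (sg * m)" if m: "m > 0" and ev: "!!s. 0 <= s ==> s < m ==> good (sg * s)" for sg m :: real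
 proof -
  define s where "s n = sg * (m * (1 - 1 / real (Suc n)))" for n
  have gs: "good (s n)" for n unfolding s_def by (rule ev) (use m in "auto simp:field_simps")
  have "(%n. 1 / real (Suc n)) ----> 0" using LIMSEQ_inverse_real_of_nat by (simp add:inverse_eq_divide)
  hence "s ----> sg * (m * (1 - 0))" unfolding s_def by (intro tendsto_intros)
  hence sl: "s ----> sg * m" by simp
  have "ga (sg * m) : K"
   by (rule closed_sequentially[OF clK _ isCont_tendsto_compose[OF geodesic_cont[OF ga] sl]]) (use goodK gs in auto)
  hence d: "ga (sg * m) : dom_ch c" using Kd by auto
  have "st c ga (sg * m) : cball z0 ro"
   by (rule closed_sequentially[OF closed_cball _ isCont_tendsto_compose[OF stc[OF d] sl]]) (use gs in "auto simp:good_def")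
  thus ?thesis using d by (simp add:good_def)
 qed
 have open_step: "EX ep>0. ALL s. m < s & s < m + ep --> good (sg * s)"
  if m: "0 <= m" "m < ro / (2 * (M + 1))" and ev: "!!s. 0 <= s ==> s <= m ==> good (sg * s)" and sg: "abs sg = 1" for sg m :: real
 proof -
  have der: "((%s. st c ga (sg * s)) hasD (%h. h *R sg *R spray c (st c ga (sg * s)))) (at s within {0..m})"
   if "s : {0..m}" for s proof -
   have "((%s. sg * s) hasVD sg) (at s)" by (auto intro!:deriv_intros simp:hasRD_iff[symmetric])
   moreover have "ga (sg * s) : dom_ch c" using ev[of s] that by (auto simp:good_def)
   ultimately show ?thesis using vector_diff_chain_at[OF _ geodesic_st(2)[OF ga c]] hasD_within
    unfolding hasVD_def o_def by blast
  qed
  have "norm (st c ga (sg * m) - st c ga (sg * 0)) <= M * norm (m - 0)" proof (rule differentiable_bound[OF _ der])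
   fix s assume s: "s : {0..m}"
   have n: "norm (spray c (st c ga (sg * s))) <= M" using M(2) ev[of s] s by (auto simp:good_def)
   show "onorm (%h. h *R sg *R spray c (st c ga (sg * s))) <= M" proof (rule onorm_le)
    fix h show "norm (h *R sg *R spray c (st c ga (sg * s))) <= M * norm h"
     using mult_left_mono[OF n, of "abs h"] sg by (simp add:mult.commute abs_mult)
   qed
  qed (use m in auto)
  also have "M * norm (m - 0) <= (M + 1) * m" using m by (simp add:alg)
  also have "... < ro / 2" using m M(1) by (simp add:field_simps)
  finally have "dist (st c ga (sg * m)) (st c ga 0) < ro / 2" by (simp add:dist_norm)
  hence "dist z0 (st c ga (sg * m)) < ro"
   using init(2) dist_triangle[of z0 "st c ga (sg * m)" "st c ga 0"] by (simp add:dist_commute)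
  hence inb: "st c ga (sg * m) : ball z0 ro" by simp
  have d: "ga (sg * m) : dom_ch c" using ev[of m] m by (simp add:good_def)
  have "(st c ga ---> st c ga (sg * m)) (nhds (sg * m))"
   using stc[OF d] unfolding isCont_def tendsto_at_iff_tendsto_nhds .
  hence "\<forall>\<^sub>F r in nhds (sg * m). st c ga r : ball z0 ro"
   by (rule topological_tendstoD[OF _ open_ball inb])
  moreover have "\<forall>\<^sub>F r in nhds (sg * m). ga r : dom_ch c"
   using eventually_nhds_in_open[OF geo_open[OF ga c], of "sg * m"] d by simp
  ultimately have "\<forall>\<^sub>F r in nhds (sg * m). good r" by eventually_elim (auto simp:good_def)
  then obtain ep where e: "ep > 0" "!!r. dist r (sg * m) < ep ==> good r" unfolding eventually_nhds_metric by blast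
  have "good (sg * s)" if "m < s" "s < m + ep" for s proof (rule e(2))
   have "abs (sg * s - sg * m) = abs sg * abs (s - m)" by (simp add:abs_mult[symmetric] alg)
   thus "dist (sg * s) (sg * m) < ep" using sg that by (simp add:dist_norm)
  qed
  thus ?thesis using e(1) by blast
 qed
 have main: "good (sg * s)" if "abs sg = 1" "0 <= s" "s < ro / (2 * (M + 1))" for sg s :: real
 proof (rule interval_continuation[where Q="%s. good (sg * s)" and T="ro / (2 * (M + 1))"])
  fix m :: real assume m: "0 <= m" "!!s. 0 <= s ==> s < m ==> good (sg * s)"
  show "good (sg * m)" proof (cases "m = 0")
   case True
   thus ?thesis using init ro(1) by (simp add:good_def)
  next
   case False
   thus ?thesis using closed_step m by auto
  qed
 qed (use open_step that in auto)
 have "good t" using main[of 1 t] main[of "-1" "- t"] t by (cases "t >= 0") auto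
 thus ?thesis by (simp add:good_def)
qed

end

context riem
begin

abbreviation "chA == chart_at A"
abbreviation "ipA == inner_at A g"
abbreviation "nmA == norm_at A g"
abbreviation "grA == gram_at A g"
abbreviation "exA == exp_map A g"
abbreviation "adm == admissible_radii A g"
abbreviation "tball == tangent_ball A g"
abbreviation "geod == geodesic A g"
abbreviation "curvop == curvature_op A g"
abbreviation "mlj == mean_log_jacobian A g"
abbreviation "mrs == mean_reduced_scalar A g"
abbreviation "bch == bundle_chart A"
abbreviation "sphA == sphere_measure A g"

end

locale riem_complete = riem A g for A :: "('a::{t2_space, second_countable_topology}, 'n::finite) chart set" and g +
 assumes complete: "geodesically_complete A g"
begin

definition "geo p v = (SOME ga. geodesic_from A g p v ga)"

lemma geodesic_from_pvel:
 "geodesic_from A g p v ga <-> geod ga & ga 0 = p & pvel ga 0 = v" proof -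
 have "((map_ch (chA p) o ga) hasVD v) (at 0) <-> pvel ga 0 = v" if "geod ga" "ga 0 = p"
  using geodesic_st(1)[OF that(1) chart_at[of "ga 0"]] vector_derivative_at that(2)
  by (auto simp:pvel_def vel_def o_def)
 thus ?thesis unfolding geodesic_from_def by blast
qed

lemma geo: "geod (geo p v)" "geo p v 0 = p" "pvel (geo p v) 0 = v" proof -
 have "geodesic_from A g p v (geo p v)" using complete unfolding geodesically_complete_def geo_def by (metis someI_ex)
 thus "geod (geo p v)" "geo p v 0 = p" "pvel (geo p v) 0 = v" by (auto simp:geodesic_from_pvel)
qed

lemma geo_eqI: "geod ga ==> ga 0 = p ==> pvel ga 0 = v ==> geo p v = ga"
 by (rule geodesic_unique[where ?t0.0=0]) (auto simp:geo)

lemma exp_map_geo: "exA p v = geo p v 1" unfolding exp_map_def geodesic_from_pvel proof (rule the_equality)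
 show "EX ga. (geod ga & ga 0 = p & pvel ga 0 = v) & ga 1 = geo p v 1"
  by (rule exI[of _ "geo p v"]) (simp add:geo)
 fix q assume "EX ga. (geod ga & ga 0 = p & pvel ga 0 = v) & ga 1 = q"
 then obtain ga where "geod ga" "ga 0 = p" "pvel ga 0 = v" "ga 1 = q" by auto
 thus "q = geo p v 1" using geo_eqI[of ga p v] by simp
qed

definition "Fl t z = (geo (fst z) (snd z) t, pvel (geo (fst z) (snd z)) t)"

lemma Fl_0 [simp]: "Fl 0 z = z" by (simp add:Fl_def geo)

lemma pvel_affine:
 assumes "geod ga"
 shows "pvel (%t. ga (a * t + b)) t = a *R pvel ga (a * t + b)"
 unfolding pvel_def by (rule geodesic_affine(2)[OF assms chart_at])

lemma geo_scale: "geo p (a *R v) t = geo p v (a * t)" "pvel (geo p (a *R v)) t = a *R pvel (geo p v) (a * t)" proof -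
 have "geo p (a *R v) = (%t. geo p v (a * t + 0))"
  using pvel_affine[OF geo(1)[of p v], of a 0 0] geodesic_affine(1)[OF geo(1)[of p v], of a 0]
  by (intro geo_eqI) (auto simp:geo)
 thus "geo p (a *R v) t = geo p v (a * t)" "pvel (geo p (a *R v)) t = a *R pvel (geo p v) (a * t)"
  using pvel_affine[OF geo(1)[of p v], of a 0 t] by simp_all
qed

lemma exp_map_scale: "exA p (t *R v) = geo p v t" by (simp add:exp_map_geo geo_scale)

lemma Fl_add: "Fl s (Fl t z) = Fl (t + s) z" proof -
 let ?ga = "geo (fst z) (snd z)"
 have "geo (?ga t) (pvel ?ga t) = (%s. ?ga (1 * s + t))"
  using pvel_affine[OF geo(1)[of "fst z" "snd z"], of 1 t 0] geodesic_affine(1)[OF geo(1)[of "fst z" "snd z"], of 1 t]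
  by (intro geo_eqI) auto
 thus ?thesis using pvel_affine[OF geo(1)[of "fst z" "snd z"], of 1 t s] by (simp add:Fl_def add.commute)
qed

lemma st_Fl:
 assumes "c : A" "fst (Fl t z) : dom_ch c"
 shows "bch c (Fl t z) = st c (geo (fst z) (snd z)) t"
 using st_bundle[OF geo(1) assms(1), of "fst z" "snd z" t] assms(2) by (simp add:Fl_def)

lemma Fl_deriv:
 assumes "c : A" "fst (Fl t z) : dom_ch c"
 shows "((%t. bch c (Fl t z)) hasVD spray c (bch c (Fl t z))) (at t)" proof -
 have "geo (fst z) (snd z) t : dom_ch c" using assms(2) by (simp add:Fl_def)
 thus ?thesis unfolding st_Fl[OF assms]
  by (intro hasVD_open[OF geodesic_st(2)[OF geo(1) assms(1)] geo_open[OF geo(1) assms(1)]])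
   (use st_Fl[OF assms(1)] in "auto simp:Fl_def")
qed

definition "flowc c d t z = bch d (Fl t (ibc c z))"

text \<open>\<open>geodesic_stays\<close> gives one existence time for all starting points in a
  ball, so the flow is defined on a product. Gronwall's inequality makes it Lipschitz in the
  starting point, and \<open>Ck_flow\<close> upgrades continuity to smoothness.\<close>

lemma local_flow:
 assumes c: "c : A" and z0: "z0 : TU c"
 obtains T P where "T > 0" "open P" "z0 : P" "P <= TU c"
  "!!z t. z : P ==> abs t < T ==> fst (Fl t (ibc c z)) : dom_ch c"
  "!!k. Ck_on k ({-T<..<T} >< P) (%q. flowc c c (fst q) (snd q))" proof -
 obtain ro where ro: "ro > 0" "cball z0 ro <= TU c" using TU_open[OF c] z0 open_contains_cball by blast
 have "compact (spray c ` cball z0 ro)"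
  by (intro compact_image cont_subset[OF Ck_cont[OF spray_Ck[OF c, of 0]] ro(2)] compact_cball)
 hence "bounded (spray c ` cball z0 ro)" by (rule compact_imp_bounded)
 then obtain M0 where M0: "ALL z : cball z0 ro. norm (spray c z) <= M0" by (auto simp:bounded_iff)
 define M where "M = abs M0"
 have M: "M >= 0" "!!z. z : cball z0 ro ==> norm (spray c z) <= M" using M0 by (auto simp:M_def intro:order_trans[OF _ abs_ge_self])
 define T where "T = ro / (2 * (M + 1))"
 have T: "T > 0" using ro(1) M(1) by (simp add:T_def)
 define P where "P = ball z0 (ro / 2)"
 have P: "open P" "z0 : P" "P <= cball z0 ro" "P <= TU c" using ro by (auto simp:P_def)
 have init: "geo (fst (ibc c z)) (snd (ibc c z)) 0 : dom_ch c" "st c (geo (fst (ibc c z)) (snd (ibc c z))) 0 = z"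
  if "z : P" for z proof -
  have f: "fst z : img c" using that P(4) by (auto simp:TU_def)
  have d: "inv_ch c (fst z) : dom_ch c" using inv_in[OF c f] .
  thus "geo (fst (ibc c z)) (snd (ibc c z)) 0 : dom_ch c" by (simp add:geo ibc_def)
  show "st c (geo (fst (ibc c z)) (snd (ibc c z))) 0 = z"
   using st_Fl[OF c, of 0 "ibc c z"] d bundle_ibc[OF c f] by (simp add:ibc_def)
 qed
 have stay: "geo (fst (ibc c z)) (snd (ibc c z)) t : dom_ch c & st c (geo (fst (ibc c z)) (snd (ibc c z))) t : cball z0 ro"
  if "z : P" "abs t < T" for z t
  by (rule geodesic_stays[OF geo(1) c ro M]) (use init[OF that(1)] that in "auto simp:P_def T_def")
 have dom: "fst (Fl t (ibc c z)) : dom_ch c" if "z : P" "abs t < T" for z t using stay[OF that] by (simp add:Fl_def)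
 define ph where "ph q = flowc c c (fst q) (snd q)" for q
 have in_ball: "ph (t, z) : cball z0 ro" if "z : P" "abs t < T" for z t
  using stay[OF that] st_Fl[OF c dom[OF that]] by (simp add:ph_def flowc_def)
 have der: "((%t. ph (t, z)) hasVD spray c (ph (t, z))) (at t)" if "z : P" "abs t < T" for z t
  using Fl_deriv[OF c dom[OF that]] by (simp add:ph_def flowc_def)
 have ph0: "ph (0, z) = z" if "z : P" for z
  using bundle_ibc[OF c, of z] that P(4) by (auto simp:ph_def flowc_def TU_def)
 obtain K where K: "K >= 0" "!!y v. y : cball z0 ro ==> norm (Df (spray c) y v) <= K * norm v"
  using C1_derivative_bound[OF spray_Ck[OF c] compact_cball ro(2)] by blast
 have lip: "norm (spray c a - spray c b) <= K * norm (a - b)" if "a : cball z0 ro" "b : cball z0 ro" for a b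
 proof (rule differentiable_bound[of "cball z0 ro" "spray c" "Df (spray c)"])
  show "(spray c hasD Df (spray c) x) (at x within cball z0 ro)" if "x : cball z0 ro" for x
   using Ck_hasD[OF spray_Ck[OF c, of "Suc 0"]] ro(2) that hasD_within by blast
  show "onorm (Df (spray c) x) <= K" if "x : cball z0 ro" for x using K(2)[OF that] by (rule onorm_le)
 qed (use that in auto)
 define E where "E = exp ((2 * K + 1) * T)"
 have close: "norm (ph (t, z) - ph (t, z')) <= norm (z - z') * E" if "z : P" "z' : P" "abs t < T" for t z z' proof -
  have "norm (ph (t, z) - ph (t, z')) <= (norm (ph (0, z) - ph (0, z')) + 0) * exp ((2 * K + 1) * abs t)"
  proof (rule gronwall[where y="%t. ph (t, z) - ph (t, z')", OF order_refl K(1) order_refl])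
   fix s assume s: "abs s <= abs t"
   show "((%t. ph (t, z) - ph (t, z')) hasVD spray c (ph (s, z)) - spray c (ph (s, z'))) (at s)"
    by (intro hasVD_diff der) (use s that in auto)
   show "norm (spray c (ph (s, z)) - spray c (ph (s, z'))) <= K * norm (ph (s, z) - ph (s, z')) + 0"
    using lip[OF in_ball in_ball] s that by simp
  qed
  also have "... <= norm (z - z') * E" using ph0 that K(1) by (auto simp:E_def intro!:mult_left_mono)
  finally show ?thesis .
 qed
 have E: "E > 0" by (simp add:E_def)
 have cont: "cont_on ({-T<..<T} >< P) ph" proof (intro cont_onI ballI)
  fix q assume "q : {-T<..<T} >< P"
  then obtain t z where q: "q = (t, z)" "abs t < T" "z : P" by (cases q) auto
  show "isCont ph q" unfolding continuous_at_eps_delta proof (intro allI impI)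
   fix e :: real assume e: "e > 0"
   obtain d1 where d1: "d1 > 0" "!!s. dist s t < d1 ==> dist (ph (s, z)) (ph (t, z)) < e / 2"
    using hasVD_cont[OF der[OF q(3,2)]] half_gt_zero[OF e] unfolding continuous_at_eps_delta by blast
   obtain d2 where d2: "d2 > 0" "ball z d2 <= P" using P(1) q(3) open_contains_ball by blast
   define d where "d = Min {d1, d2, T - abs t, e / (2 * E)}"
   have d: "d > 0" "d <= d1" "d <= d2" "d <= T - abs t" "d <= e / (2 * E)"
    using d1(1) d2(1) q(2) e E by (auto simp:d_def)
   have "dist (ph q') (ph q) < e" if q': "dist q' q < d" for q' proof -
    obtain s y where sy: "q' = (s, y)" by (cases q')
    have sd: "dist s t < d" "dist y z < d" using q' dist_fst_le[of q' q] dist_snd_le[of q' q] by (auto simp:sy q)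
    have "y : ball z d2" using sd d by (simp add:dist_commute)
    hence yP: "y : P" using d2(2) by blast
    have "abs s < T" using sd(1) d(4) by (auto simp:dist_norm)
    hence "norm (ph (s, y) - ph (s, z)) <= norm (y - z) * E" by (rule close[OF yP q(3)])
    also have "... < e / (2 * E) * E" using sd(2) d(5) E by (intro mult_strict_right_mono) (auto simp:dist_norm)
    also have "... = e / 2" using E by simp
    finally have "dist (ph (s, y)) (ph (s, z)) < e / 2" by (simp add:dist_norm)
    moreover have "dist (ph (s, z)) (ph (t, z)) < e / 2" using d1(2) sd d by auto
    ultimately show ?thesis using dist_triangle[of "ph (s, y)" "ph (t, z)" "ph (s, z)"] by (simp add:sy q)
   qed
   thus "EX d>0. ALL x'. dist x' q < d --> dist (ph x') (ph q) < e" using d(1) by blast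
  qed
 qed
 interpret ode_family "TU c" "spray c" T P ph 0 "%z. z"
  by (rule ode_family.intro) (use TU_open[OF c] spray_Ck[OF c] P(1) cont in_ball ro(2) der ph0 in "auto simp:linear_id[unfolded id_def]")
 have "Ck_on k ({-T<..<T} >< P) ph" for k by (rule Ck_flow[OF T]) (use spray_Ck[OF c] in "simp add:smooth_on_def")
 hence "Ck_on k ({-T<..<T} >< P) (%q. flowc c c (fst q) (snd q))" for k by (simp add:ph_def[abs_def])
 thus ?thesis using that T P(1,2,4) dom by blast
qed

lemma TU_iff: "z : TU c <-> fst z : img c" by (simp add:TU_def mem_Times_iff)

lemma fst_ibc: "c : A ==> z : TU c ==> fst (ibc c z) : dom_ch c" by (simp add:ibc_def TU_iff inv_in)

lemma flowc_TU:
 assumes "d : A" "fst (Fl t (ibc c z)) : dom_ch d"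
 shows "flowc c d t z : TU d" proof -
 show ?thesis using assms bundle_fst[OF assms, of "snd (Fl t (ibc c z))"] by (simp add:TU_iff flowc_def)
qed

lemma ibc_flowc:
 assumes "d : A" "fst (Fl t (ibc c z)) : dom_ch d"
 shows "ibc d (flowc c d t z) = Fl t (ibc c z)"
 using ibc_bundle[OF assms, of "snd (Fl t (ibc c z))"] by (simp add:flowc_def)

lemma flowc_add:
 assumes "e : A" "fst (Fl t (ibc c z)) : dom_ch e"
 shows "flowc c d (t + s) z = flowc e d s (flowc c e t z)"
 unfolding flowc_def[of e d] ibc_flowc[OF assms] by (simp add:Fl_add flowc_def)

lemma flowc_0_Ck:
 assumes c: "c : A" and d: "d : A"
 shows "open (ov c d >< (UNIV :: (real^'n) set))"
  "z : ov c d >< UNIV ==> fst (Fl 0 (ibc c z)) : dom_ch d"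
  "Ck_on k (ov c d >< UNIV) (flowc c d 0)"
  "z : ov c d >< UNIV ==> flowc c d 0 z = (transition c d (fst z), Df (transition c d) (fst z) (snd z))" proof -
 show o: "open (ov c d >< (UNIV :: (real^'n) set))" by (intro open_Times ov_open c d) auto
 show 1: "fst (Fl 0 (ibc c z)) : dom_ch d" if "z : ov c d >< UNIV" for z using that by (auto simp:ibc_def inv_map c)
 show 2: "flowc c d 0 z = (transition c d (fst z), Df (transition c d) (fst z) (snd z))"
  if z: "z : ov c d >< UNIV" for z proof -
  obtain p where p: "fst z = map_ch c p" "p : dom_ch c" "p : dom_ch d" using z by auto
  have "flowc c d 0 z = bch d (p, L c (chA p) p (snd z))" using p by (simp add:flowc_def ibc_def inv_map c)
  also have "... = (map_ch d p, L c d p (snd z))"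
   by (simp add:bch_eq d p L_comp[OF c chart_at(1) d p(2) chart_at(2) p(3)])
  finally show ?thesis by (simp add:p trans_map c L_def)
 qed
 have lin: "linear (Df (transition c d) x)" if "x : ov c d" for x
  using Ck_hasD[OF trans_Ck[OF c d, of "Suc 0"] that] hasD_linear by blast
 have "Ck_on k (ov c d >< UNIV) (%z. (transition c d (fst z), SUM b:Basis. (snd z <.> b) *R Df (transition c d) (fst z) b))"
  by (intro Ck_Pair Ck_sum Ck_scaleR Ck_inner Ck_snd Ck_ident Ck_const o
    Ck_compose[OF o ov_open[OF c d] Ck_fst[OF o Ck_ident[OF o]] _ trans_Ck[OF c d]]
    Ck_compose[OF o ov_open[OF c d] Ck_fst[OF o Ck_ident[OF o]] _ Ck_D[OF trans_Ck[OF c d]]]) auto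
 thus "Ck_on k (ov c d >< UNIV) (flowc c d 0)" proof (rule Ck_cong[OF o, rotated])
  fix z assume z: "z : ov c d >< (UNIV :: (real^'n) set)"
  hence l: "linear (Df (transition c d) (fst z))" using lin by auto
  have "Df (transition c d) (fst z) (snd z) = Df (transition c d) (fst z) (SUM b:Basis. (snd z <.> b) *R b)"
   by (simp add:eucl_rep)
  thus "(transition c d (fst z), SUM b:Basis. (snd z <.> b) *R Df (transition c d) (fst z) b) = flowc c d 0 z"
   by (simp add:2[OF z] linear_sum[OF l] linear_scale[OF l])
 qed
qed

text \<open>Smoothness of the flow map for one fixed time near one point, with separate charts for
  start and end. In this form it is closed under composition (\<open>smooth_near_comp\<close>)
  although an orbit may leave every single chart.\<close>

definition "smooth_near c d t z0 <-> (EX W. open W & z0 : W & W <= TU c &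
  (ALL z:W. fst (Fl t (ibc c z)) : dom_ch d) & (ALL k. Ck_on k W (flowc c d t)))"

lemma smooth_near_comp:
 assumes A: "c : A" "d : A" "e : A" and 1: "smooth_near c e t z0" and 2: "smooth_near e d s (flowc c e t z0)"
 shows "smooth_near c d (t + s) z0" proof -
 obtain O1 where O1: "open O1" "z0 : O1" "O1 <= TU c" "!!z. z : O1 ==> fst (Fl t (ibc c z)) : dom_ch e"
  "!!k. Ck_on k O1 (flowc c e t)" using 1 unfolding smooth_near_def by blast
 obtain O2 where O2: "open O2" "flowc c e t z0 : O2" "O2 <= TU e" "!!z. z : O2 ==> fst (Fl s (ibc e z)) : dom_ch d"
  "!!k. Ck_on k O2 (flowc e d s)" using 2 unfolding smooth_near_def by blast
 define O3 where "O3 = O1 Int flowc c e t -` O2"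
 have o3: "open O3" unfolding O3_def by (rule open_preimage[OF Ck_cont[OF O1(5)[of 0]] O1(1) O2(1)])
 have sub: "O3 <= O1" by (auto simp:O3_def)
 have "fst (Fl (t + s) (ibc c z)) : dom_ch d" if "z : O3" for z proof -
  have "Fl (t + s) (ibc c z) = Fl s (ibc e (flowc c e t z))"
   using ibc_flowc[OF A(3) O1(4)[of z]] that by (simp add:O3_def Fl_add)
  thus ?thesis using O2(4) that by (simp add:O3_def)
 qed
 moreover have "Ck_on k O3 (flowc c d (t + s))" for k proof (rule Ck_cong[OF o3])
  show "Ck_on k O3 (%z. flowc e d s (flowc c e t z))"
   by (rule Ck_compose[OF o3 O2(1) Ck_subset[OF O1(5) sub] _ O2(5)]) (auto simp:O3_def)
  show "flowc e d s (flowc c e t z) = flowc c d (t + s) z" if "z : O3" for z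
   using flowc_add[OF A(3) O1(4)[of z]] that by (simp add:O3_def)
 qed
 ultimately show ?thesis
  unfolding smooth_near_def using o3 O1(2,3) O2(2) sub by (intro exI[of _ O3]) (auto simp:O3_def)
qed

lemma smooth_near_0:
 assumes "c : A" "d : A" "z : TU c" "fst (ibc c z) : dom_ch d"
 shows "smooth_near c d 0 z" proof -
 have "z : ov c d >< UNIV" proof -
  have "fst z = map_ch c (fst (ibc c z))" using assms(1,3) by (simp add:ibc_def map_inv TU_iff)
  thus ?thesis using fst_ibc[OF assms(1,3)] assms(4) by (cases z) auto
 qed
 thus ?thesis unfolding smooth_near_def using flowc_0_Ck[OF assms(1,2)]
  by (intro exI[of _ "ov c d >< UNIV"]) (auto simp:TU_def)
qed

text \<open>Induction along time: the flow up to a good time, seen in a chart there, is composed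
  with the short flow of \<open>local_flow\<close> and then with a change of chart, which is the
  flow for time 0.\<close>

theorem flow_smooth:
 assumes c: "c : A" and z0: "z0 : TU c" and t: "0 <= t" and d: "d : A" "fst (Fl t (ibc c z0)) : dom_ch d"
 shows "smooth_near c d t z0" proof -
 let ?ga = "%t. fst (Fl t (ibc c z0))"
 have loc: "EX T>0. EX P. open P & bch e (Fl m (ibc c z0)) : P & P <= TU e &
   (ALL z:P. ALL s. abs s < T --> smooth_near e e s z)" if e: "e : A" "?ga m : dom_ch e" for e m proof -
  have tu: "bch e (Fl m (ibc c z0)) : TU e" using flowc_TU[OF e] by (simp add:flowc_def)
  obtain T P where P: "T > 0" "open P" "bch e (Fl m (ibc c z0)) : P" "P <= TU e"
   "!!z t. z : P ==> abs t < T ==> fst (Fl t (ibc e z)) : dom_ch e"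
   "!!k. Ck_on k ({-T<..<T} >< P) (%q. flowc e e (fst q) (snd q))"
   by (rule local_flow[OF e(1) tu]) (rule that; assumption)
  have "smooth_near e e s z" if "z : P" "abs s < T" for z s proof -
   have "Ck_on k P (%z. (%q. flowc e e (fst q) (snd q)) (s, z))" for k by (rule Ck_compose[OF P(2) _ _ _ P(6)])
     (use that P(2) in "auto intro!:open_Times Ck_Pair Ck_ident")
   hence "Ck_on k P (flowc e e s)" for k by simp
   thus ?thesis unfolding smooth_near_def using P that by blast
  qed
  thus ?thesis using P by blast
 qed
 define Q where "Q t <-> (ALL d:A. ?ga t : dom_ch d --> smooth_near c d t z0)" for t
 have step: "Q (m + s)" if e: "e : A" "?ga m : dom_ch e" and Q: "Q m" and s: "abs s < T" "flowc c e m z0 : P"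
   and P: "P <= TU e" "!!z s. z : P ==> abs s < T ==> smooth_near e e s z" for e m s T P unfolding Q_def
 proof (intro ballI impI)
  fix d assume d: "d : A" "?ga (m + s) : dom_ch d"
  have 1: "smooth_near c e m z0" using Q e by (simp add:Q_def)
  have 2: "smooth_near e e s (flowc c e m z0)" by (rule P(2)[OF s(2,1)])
  have 3: "smooth_near c e (m + s) z0" by (rule smooth_near_comp[OF c e(1) e(1) 1 2])
  hence de: "fst (Fl (m + s) (ibc c z0)) : dom_ch e" unfolding smooth_near_def by blast
  have 4: "smooth_near e d 0 (flowc c e (m + s) z0)"
   by (rule smooth_near_0[OF e(1) d(1) flowc_TU[OF e(1) de]]) (simp add:ibc_flowc[OF e(1) de] d(2))
  show "smooth_near c d (m + s) z0" using smooth_near_comp[OF c d(1) e(1) 3 4] by simp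
 qed
 have "Q t" proof (rule interval_continuation[where T="t + 1"])
  fix m :: real assume m: "0 <= m" "!!s. 0 <= s ==> s < m ==> Q s"
  show "Q m" proof (cases "m = 0")
   case True
   thus ?thesis unfolding Q_def using smooth_near_0[OF c _ z0] by simp
  next
   case False
   define e where "e = chA (?ga m)"
   have e: "e : A" "?ga m : dom_ch e" by (simp_all add:e_def chart_at)
   obtain T P where P: "T > 0" "open P" "bch e (Fl m (ibc c z0)) : P" "P <= TU e"
    "!!z s. z : P ==> abs s < T ==> smooth_near e e s z" using loc[OF e] by blast
   have cont: "isCont (%t. bch e (Fl t (ibc c z0))) m" using hasVD_cont[OF Fl_deriv[OF e]] .
   have ev1: "\<forall>\<^sub>F r in at m. bch e (Fl r (ibc c z0)) : P"
    using cont P(2,3) unfolding continuous_within by (rule topological_tendstoD)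
   have "isCont ?ga m" using geodesic_cont[OF geo(1)] by (simp add:Fl_def)
   hence ev2: "\<forall>\<^sub>F r in at m. ?ga r : dom_ch e"
    using open_dom[OF e(1)] e(2) unfolding continuous_within by (rule topological_tendstoD)
   from eventually_conj[OF ev1 ev2] obtain dta where dta: "dta > 0"
    "!!r. r ~= m ==> dist r m < dta ==> bch e (Fl r (ibc c z0)) : P & ?ga r : dom_ch e"
    unfolding eventually_at by blast
   \<comment> \<open>An earlier, hence good, time at which the orbit is already in \<open>P\<close>
     and from which \<open>m\<close> is reached in less than the existence time
     \<open>T\<close>.\<close>
   define r where "r = m - min (m / 2) (min (dta / 2) (T / 2))"
   have r: "0 <= r" "r < m" "dist r m < dta" "abs (m - r) < T"
    using False m(1) dta(1) P(1) by (auto simp:r_def dist_norm min_def)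
   have "Q (r + (m - r))"
    by (rule step[OF e(1) _ m(2)[OF r(1,2)] r(4) _ P(4,5)]) (use dta(2)[of r] r in "auto simp:flowc_def")
   thus ?thesis by simp
  qed
 next
  fix m :: real assume m: "0 <= m" "!!s. 0 <= s ==> s <= m ==> Q s"
  define e where "e = chA (?ga m)"
  have e: "e : A" "?ga m : dom_ch e" by (simp_all add:e_def chart_at)
  obtain T P where P: "T > 0" "open P" "bch e (Fl m (ibc c z0)) : P" "P <= TU e"
   "!!z s. z : P ==> abs s < T ==> smooth_near e e s z" using loc[OF e] by blast
  have "Q s" if "m < s" "s < m + T" for s proof -
   have "Q (m + (s - m))"
    by (rule step[OF e m(2)[OF m(1) order_refl] _ _ P(4,5)]) (use that P in "auto simp:flowc_def")
   thus ?thesis by simp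
  qed
  thus "EX ep>0. ALL s. m < s & s < m + ep --> Q s" using P(1) by blast
 qed (use t in auto)
 thus ?thesis using d by (simp add:Q_def)
qed

end

section \<open>The exponential map and normal coordinates\<close>

lemma Ck_matvec:
 fixes M :: "'a::real_normed_vector => real^'n^'m::finite"
 assumes "open S" "Ck_on k S M" "Ck_on k S f"
 shows "Ck_on k S (%x. M x *v f x)" unfolding matrix_vector_mult_def
 by (intro Ck_vec_lambda Ck_sum Ck_mult Ck_vec_nth assms)

lemma (in metric_field) Rm_antisym: "x : U ==> Rm h x v u w = - Rm h x u v w" by (simp add:Rm_eq)

text \<open>Polarisation: a self-adjoint operator is determined by its quadratic form.\<close>

lemma self_adjoint_eqI:
 fixes H :: "real^'n^'n::finite"
 assumes nd: "!!v. v ~= 0 ==> v <.> (H *v v) > 0" and lin: "linear T" "linear T'"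
  and sa: "!!u w. T u <.> (H *v w) = u <.> (H *v T w)" "!!u w. T' u <.> (H *v w) = u <.> (H *v T' w)"
  and H: "!!u w. u <.> (H *v w) = w <.> (H *v u)" and q: "!!u. T u <.> (H *v u) = T' u <.> (H *v u)"
 shows "T u = T' u" proof -
 have "T u <.> (H *v w) = T' u <.> (H *v w)" for u w
  using q[of "u + w"] q[of u] q[of w] sa(1)[of w u] sa(2)[of w u] H[of w "T u"] H[of w "T' u"]
  by (simp add:linear_add[OF lin(1)] linear_add[OF lin(2)] mv_add inner_add_left inner_add_right)
 hence "(T u - T' u) <.> (H *v (T u - T' u)) = 0" by (simp add:inner_diff_left)
 thus ?thesis using nd[of "T u - T' u"] by fastforce
qed

context normal_coords
begin

text \<open>Instead of using the algebraic symmetries of the curvature tensor, self-adjointness of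
  \<open>Sm\<close> is differentiated radially and the curvature is read off from
  \<open>riccati\<close>.\<close>

lemma Rx_self_adjoint:
 assumes x: "x : U"
 shows "(Rx x *v u) <.> (h x *v w) = u <.> (h x *v (Rx x *v w))" proof -
 let ?S = "Sm x" and ?D = "Df Sm x x"
 note sa = Sm_self_adjoint[OF x]
 have Dh: "a <.> (Df h x x *v b) = 2 * ((?S *v a) <.> (h x *v b)) - 2 * (a <.> (h x *v b))" for a b proof -
  have G: "Gam h x x c = ?S *v c - c" for c using Gam_sym[OF x, of x c] by (simp add:Sm_mult)
  show ?thesis
   using metric_compatible[OF x, of a x b] sa[of b a] h_commute[OF x, of b a] h_commute[OF x, of b "?S *v a"]
   by (simp add:G inner_diff_left)
 qed
 have S: "((%y. Sm y *v u) hasD (%z. Df Sm x z *v u)) (at x)" for u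
  using matvec_hasD[OF Sm_deriv[OF x] has_derivative_const[of u]] by simp
 have hS: "((%y. h y *v f y) hasD (%z. h x *v f' z + Df h x z *v f x)) (at x)" if "(f hasD f') (at x)" for f f'
  by (rule matvec_hasD[OF h_deriv[OF x] that])
 have d1: "((%y. (Sm y *v u) <.> (h y *v w)) hasD
   (%z. (Sm x *v u) <.> (h x *v 0 + Df h x z *v w) + (Df Sm x z *v u) <.> (h x *v w))) (at x)"
  by (intro has_derivative_inner S hS has_derivative_const)
 have d2: "((%y. u <.> (h y *v (Sm y *v w))) hasD
   (%z. u <.> (h x *v (Df Sm x z *v w) + Df h x z *v (Sm x *v w)))) (at x)" by (intro has_derivative_inner_right S hS)
 have "((%y. (Sm y *v u) <.> (h y *v w)) hasD
   (%z. u <.> (h x *v (Df Sm x z *v w) + Df h x z *v (Sm x *v w)))) (at x)"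
  by (rule hasD_open[OF d2 openU x]) (simp add:Sm_self_adjoint)
 from fun_cong[OF hasD_unique[OF d1 this], of x]
 have "(?D *v u) <.> (h x *v w) = u <.> (h x *v (?D *v w))"
  using sa[of "?S *v u" w] sa[of u w] by (simp add:inner_add_right Dh)
 moreover have "Rx x = ?S - ?S ** ?S - ?D" using riccati[OF x] by (simp add:alg)
 ultimately show ?thesis using sa[of "?S *v u" w] sa[of u "?S *v w"] sa[of u w]
  by (simp add:mv_diff_r mv_assoc[symmetric]
    inner_diff_left inner_diff_right matrix_vector_mult_diff_distrib)
qed

text \<open>The hypothesis prescribes the quadratic form of a self-adjoint operator, so
  \<open>self_adjoint_eqI\<close> applies; \<open>Pm\<close> enters because \<open>v\<close> has
  unit length and the Gauss lemma transports its pairing along the ray.\<close>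

lemma sectional_to_curvature:
 assumes t: "t ~= 0" "t *R v : U" and v: "v ~= 0" and unit: "v <.> (h 0 *v v) = 1"
  and q: "!!u. Rm h (t *R v) u v v <.> (h (t *R v) *v u)
   = k * ((u <.> (h (t *R v) *v u)) * (v <.> (h (t *R v) *v v)) - (u <.> (h (t *R v) *v v))^2)"
 shows "Rm h (t *R v) u v v = k *R ((mat 1 - Pm v) *v u)" proof -
 let ?x = "t *R v" and ?Z = "mat 1 - Pm v"
 have g: "h ?x *v v = h 0 *v v" by (rule gauss_ray[OF t])
 have R: "Rm h ?x u v v = (1 / t^2) *R (Rx ?x *v u)" for u
  using t(1) Rm_scale[of ?x 1 u t v t v] by (simp add:Rx_mult sq_eq)
 note P = Pm_facts[OF v t]
 have Zsa: "(?Z *v u) <.> (h ?x *v w) = u <.> (h ?x *v (?Z *v w))" for u w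
  using P(5)[of u w] by (simp add:mv_diff_r inner_diff_left inner_diff_right matrix_vector_mult_diff_distrib)
 show ?thesis proof (rule self_adjoint_eqI[where H="h ?x" and T="%u. Rm h ?x u v v" and T'="%u. k *R (?Z *v u)"])
  show "w <.> (h ?x *v w) > 0" if "w ~= 0" for w using pos[OF t(2) that] .
  show "linear (%u. Rm h ?x u v v)" by (rule Rm_linear)
  show "linear (%u. k *R (?Z *v u))" by (rule linearI) (simp_all add:mv_add mv_scaleR alg)
  show "Rm h ?x u v v <.> (h ?x *v w) = u <.> (h ?x *v Rm h ?x w v v)" for u w
   unfolding R using Rx_self_adjoint[OF t(2), of u w] by (simp add:mv_scaleR)
  show "(k *R (?Z *v u)) <.> (h ?x *v w) = u <.> (h ?x *v (k *R (?Z *v w)))" for u w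
   using Zsa[of u w] by (simp add:mv_scaleR)
  show "u <.> (h ?x *v w) = w <.> (h ?x *v u)" for u w by (rule h_commute[OF t(2)])
  show "Rm h ?x u v v <.> (h ?x *v u) = (k *R (?Z *v u)) <.> (h ?x *v u)" for u
   unfolding q using h_commute[OF t(2), of v u] by (simp add:mv_diff_r Pm_mult unit g inner_diff_left sq_eq)
 qed
qed

end

context riem_complete
begin

section \<open>Exponential coordinates and the pulled-back metric\<close>

definition "Ec p c v = map_ch c (exA p v)"

definition "expdom p c = {v. exA p v : dom_ch c}"

lemma exp_map_Fl: "exA p v = fst (Fl 1 (p, v))" by (simp add:exp_map_geo Fl_def)

lemma ibc_chart_at: "ibc (chA p) (map_ch (chA p) p, v) = (p, v)" by (simp add:ibc_def inv_map chart_at L_id)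

text \<open>The exponential map at \<open>p\<close> is the flow for time 1 restricted to the fibre
  over \<open>p\<close>, followed by the projection to the base.\<close>

lemma exp_smooth_local:
 assumes "c : A" "v0 : expdom p c"
 shows "EX S. open S & v0 : S & S <= expdom p c & (ALL k. Ck_on k S (Ec p c))" proof -
 let ?e = "chA p"
 let ?z = "%v. (map_ch ?e p, v)"
 have "smooth_near ?e c 1 (?z v0)"
  by (rule flow_smooth) (use assms chart_at in "auto simp:TU_iff ibc_chart_at exp_map_Fl expdom_def")
 then obtain W where W: "open W" "?z v0 : W" "W <= TU ?e" "!!z. z : W ==> fst (Fl 1 (ibc ?e z)) : dom_ch c"
  "!!k. Ck_on k W (flowc ?e c 1)" unfolding smooth_near_def by blast
 define S where "S = ?z -` W"
 have S: "open S" unfolding S_def by (intro open_vimage W continuous_intros)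
 have dom: "v : expdom p c" if "v : S" for v
  using W(4)[of "?z v"] that by (simp add:S_def ibc_chart_at expdom_def exp_map_Fl)
 have "Ck_on k S (Ec p c)" for k proof (rule Ck_cong[OF S])
  show "Ck_on k S (%v. fst (flowc ?e c 1 (?z v)))"
   by (intro Ck_fst Ck_compose[OF S W(1) _ _ W(5)] Ck_Pair Ck_const Ck_ident S) (auto simp:S_def)
  show "fst (flowc ?e c 1 (?z v)) = Ec p c v" if "v : S" for v proof -
   have "fst (Fl 1 (p, v)) : dom_ch c" using dom[OF that] by (simp add:expdom_def exp_map_Fl)
   from bundle_fst[OF assms(1) this, of "snd (Fl 1 (p, v))"]
   show ?thesis by (simp add:flowc_def ibc_chart_at Ec_def exp_map_Fl)
  qed
 qed
 thus ?thesis using S W(2) dom by (intro exI[of _ S]) (auto simp:S_def)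
qed

lemma expdom_open:
 assumes "c : A" shows "open (expdom p c)" proof (subst open_subopen, intro ballI)
 fix v assume "v : expdom p c"
 from exp_smooth_local[OF assms this] show "EX T. open T & v : T & T <= expdom p c" by auto
qed

lemma Ec_Ck:
 assumes "c : A" shows "Ck_on k (expdom p c) (Ec p c)" proof (rule Ck_local)
 fix v assume "v : expdom p c"
 from exp_smooth_local[OF assms this] show "EX T. open T & v : T & Ck_on k T (Ec p c)" by auto
qed

lemma Ec_deriv: "c : A ==> v : expdom p c ==> (Ec p c hasD Df (Ec p c) v) (at v)"
 by (rule Ck_hasD[OF Ec_Ck[where k="Suc 0"]])

lemma expdom_chart_at: "v : expdom p (chA (exA p v))" by (simp add:expdom_def chart_at)

lemma DEc_ray:
 assumes "c : A" "t *R v : expdom p c"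
 shows "Df (Ec p c) (t *R v) v = vel c (geo p v) t" proof -
 have d: "geo p v t : dom_ch c" using assms(2) by (simp add:expdom_def exp_map_scale)
 have "((%t. Ec p c (t *R v)) hasVD Df (Ec p c) (t *R v) v) (at t)" by (rule ray_deriv[OF Ec_deriv[OF assms]])
 moreover have "(%t. Ec p c (t *R v)) = (%t. map_ch c (geo p v t))" by (simp add:Ec_def exp_map_scale)
 ultimately show ?thesis using vector_derivative_unique_at geodesic_st(1)[OF geo(1) assms(1) d] by metis
qed

lemma exp_map_0: "exA p 0 = p" using exp_map_scale[of p 0 0] by (simp add:geo)

lemma DEc_0: "Df (Ec p (chA p)) 0 v = v" proof -
 have "Df (Ec p (chA p)) (0 *R v) v = vel (chA p) (geo p v) 0"
  by (rule DEc_ray) (simp_all add:chart_at expdom_def exp_map_0)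
 also have "... = pvel (geo p v) 0" by (simp add:pvel_def geo)
 finally show ?thesis by (simp add:geo)
qed

lemma DEc_transition:
 assumes "c : A" "d : A" "v : expdom p c" "v : expdom p d"
 shows "Df (Ec p d) v u = L c d (exA p v) (Df (Ec p c) v u)" proof -
 have "((%v. transition c d (Ec p c v)) hasD (%u. L c d (exA p v) (Df (Ec p c) v u))) (at v)"
  by (rule hasD_compose[OF Ec_deriv])
   (use assms transition_hasD[OF assms(1,2)] in "auto simp:expdom_def Ec_def")
 hence "(Ec p d hasD (%u. L c d (exA p v) (Df (Ec p c) v u))) (at v)"
  by (rule hasD_open[OF _ expdom_open[OF assms(1)] assms(3)])
   (use assms(1) trans_map in "auto simp:Ec_def expdom_def")
 thus ?thesis by (simp add:Df_eq)
qed

text \<open>The metric pulled back by the exponential map to the tangent space at \<open>p\<close>.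
  The chart at the end point varies with \<open>v\<close>; \<open>hN_eq\<close> shows that any other
  chart there gives the same matrix, which is why smoothness can be checked locally.\<close>

definition "hN p v = (let c = chA (exA p v) in
 \<chi> i j. Df (Ec p c) v (axis i 1) <.> (g c (Ec p c v) *v Df (Ec p c) v (axis j 1)))"

lemma hN_eq:
 assumes c: "c : A" "v : expdom p c"
 shows "u <.> (hN p v *v w) = Df (Ec p c) v u <.> (g c (Ec p c v) *v Df (Ec p c) v w)" proof -
 have lin: "linear (Df (Ec p c) v)" using Ec_deriv[OF c] hasD_linear by blast
 let ?d = "chA (exA p v)"
 have e: "hN p v $ i $ j = Df (Ec p c) v (axis i 1) <.> (g c (Ec p c v) *v Df (Ec p c) v (axis j 1))" for i j
  unfolding hN_def Let_def
  using metric_L[OF c(1) chart_at(1) _ chart_at(2)] DEc_transition[OF c(1) chart_at(1) c(2) expdom_chart_at] c(2)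
  by (simp add:Ec_def expdom_def)
 show ?thesis proof (rule bilinear_eq_axis[where B="%u w. u <.> (hN p v *v w)"])
  show "linear (%u. u <.> (hN p v *v w))" for w by (rule linearI) (simp_all add:inner_add_left)
  show "linear (%w. u <.> (hN p v *v w))" for u
   by (rule linearI) (simp_all add:mv_add inner_add_right mv_scaleR)
  show "linear (%u. Df (Ec p c) v u <.> (g c (Ec p c v) *v Df (Ec p c) v w))" for w
   by (rule linearI) (simp_all add:linear_add[OF lin] linear_scale[OF lin] inner_add_left)
  show "linear (%w. Df (Ec p c) v u <.> (g c (Ec p c v) *v Df (Ec p c) v w))" for u
   by (rule linearI) (simp_all add:linear_add[OF lin] linear_scale[OF lin] mv_add inner_add_right mv_scaleR)
  show "axis i 1 <.> (hN p v *v axis j 1) = Df (Ec p c) v (axis i 1) <.> (g c (Ec p c v) *v Df (Ec p c) v (axis j 1))" for i j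
   using e[of i j] by (simp add:mv_basis inner_axis' column_def)
 qed
qed

lemma hN_metric_field:
 assumes B: "open B" "!!c v. c : A ==> v : B ==> v : expdom p c ==> inj (Df (Ec p c) v)"
 shows "metric_field B (hN p)" proof
 show "open B" by (rule B)
 have "Ck_on k B (hN p)" for k proof (rule Ck_local)
  fix v0 assume v0: "v0 : B"
  define c where "c = chA (exA p v0)"
  have c: "c : A" "v0 : expdom p c" by (auto simp:c_def chart_at expdom_chart_at)
  note o = expdom_open[OF c(1), of p]
  have gE: "Ck_on k (expdom p c) (%v. g c (Ec p c v))" for k
   by (rule Ck_compose[OF o open_img[OF c(1)] Ec_Ck[OF c(1)] _ metric_field.h_Ck[OF mf[OF c(1)]]])
    (auto simp:expdom_def Ec_def)
  have "Ck_on k (expdom p c) (%v. \<chi> i j. Df (Ec p c) v (axis i 1) <.> (g c (Ec p c v) *v Df (Ec p c) v (axis j 1)))"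
   by (intro Ck_vec_lambda Ck_inner Ck_matvec o gE Ck_D[OF Ec_Ck] c)
  hence "Ck_on k (expdom p c) (hN p)" proof (rule Ck_cong[OF o, rotated])
   fix v assume v: "v : expdom p c"
   have "hN p v $ i $ j = axis i 1 <.> (hN p v *v axis j 1)" for i j
    by (simp add:mv_basis inner_axis' column_def)
   thus "(\<chi> i j. Df (Ec p c) v (axis i 1) <.> (g c (Ec p c v) *v Df (Ec p c) v (axis j 1))) = hN p v"
    by (simp add:vec_eq_iff hN_eq[OF c(1) v])
  qed
  thus "EX T. open T & v0 : T & Ck_on k T (hN p)" using o c(2) by blast
 qed
 thus "smooth_on B (hN p)" by (simp add:smooth_on_def)
next
 fix v assume v: "v : B"
 define c where "c = chA (exA p v)"
 have c: "c : A" "v : expdom p c" "Ec p c v : img c" by (auto simp:c_def chart_at expdom_chart_at Ec_def)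
 note E = hN_eq[OF c(1,2)] and M = metric_field.h_commute[OF mf[OF c(1)] c(3)]
 have "hN p v $ i $ j = hN p v $ j $ i" for i j using E[of "axis i 1" "axis j 1"] E[of "axis j 1" "axis i 1"] M
  by (simp add:mv_basis inner_axis' column_def)
 thus "transpose (hN p v) = hN p v" by (simp add:transpose_def vec_eq_iff)
 fix u :: "real^'n" assume u: "u ~= 0"
 have "Df (Ec p c) v u ~= 0" proof
  assume "Df (Ec p c) v u = 0"
  moreover have "linear (Df (Ec p c) v)" using Ec_deriv[OF c(1,2)] hasD_linear by blast
  ultimately show False using B(2)[OF c(1) v c(2)] u linear_injective_0 by blast
 qed
 thus "u <.> (hN p v *v u) > 0" unfolding E by (rule metric_field.pos[OF mf[OF c(1)] c(3)])
qed

lemma hN_pullback: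
 assumes B: "metric_field B (hN p)" and c: "c : A"
 shows "pullback (B Int expdom p c) (hN p) (img c) (g c) (Ec p c)" proof (rule pullback.intro)
 have o: "open (B Int expdom p c)" using metric_field.openU[OF B] expdom_open[OF c] by auto
 show "metric_field (B Int expdom p c) (hN p)" by (rule metric_field_subset[OF B o]) auto
 show "metric_field (img c) (g c)" by (rule mf[OF c])
 show "pullback_axioms (B Int expdom p c) (hN p) (img c) (g c) (Ec p c)" proof
  show "smooth_on (B Int expdom p c) (Ec p c)" unfolding smooth_on_def using Ck_subset[OF Ec_Ck[OF c]] by blast
 qed (use hN_eq[OF c] in "auto simp:expdom_def Ec_def")
qed

text \<open>Rays are mapped to geodesics. The second derivative of \<open>Ec\<close> along a ray is
  therefore the one in the geodesic equation, and \<open>Gam_pullback\<close> leaves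
  \<open>Df (Ec p c) x (Gam (hN p) x x x) = 0\<close>, where the differential is injective.\<close>

lemma hN_normal_coords:
 assumes B: "metric_field B (hN p)" and "0 : B" "!!x t. x : B ==> 0 <= t ==> t <= 1 ==> t *R x : B"
 shows "normal_coords B (hN p)" proof (rule normal_coords.intro[OF B], unfold_locales)
 fix x assume x: "x : B"
 define c where "c = chA (exA p x)"
 have c: "c : A" "x : expdom p c" by (auto simp:c_def chart_at expdom_chart_at)
 interpret pb: pullback "B Int expdom p c" "hN p" "img c" "g c" "Ec p c" by (rule hN_pullback[OF B c(1)])
 have xW: "x : B Int expdom p c" using x c by auto
 have d: "geo p x 1 : dom_ch c" using c(2) exp_map_scale[of p 1 x] by (simp add:expdom_def)
 have vel1: "vel c (geo p x) 1 = Df (Ec p c) x x" using DEc_ray[OF c(1), of 1 x p] c(2) by simp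
 have "((%t. Df (Ec p c) (t *R x) x) hasVD pb.D2 x x x) (at 1)"
  using ray_deriv[of "%y. Df (Ec p c) y x" _ 1 x] pb.DE_deriv[OF xW] by simp
 moreover have "((%t. Df (Ec p c) (t *R x) x) hasVD - Gam (g c) (Ec p c x) (Df (Ec p c) x x) (Df (Ec p c) x x)) (at 1)"
 proof (rule hasVD_open[of "vel c (geo p x)" _ _ "geo p x -` dom_ch c"])
  have "((%t. snd (st c (geo p x) t)) hasVD snd (spray c (st c (geo p x) 1))) (at 1)"
   by (rule bounded_linear.has_vector_derivative[OF bounded_linear_snd geodesic_st(2)[OF geo(1) c(1) d]])
  thus "(vel c (geo p x) hasVD - Gam (g c) (Ec p c x) (Df (Ec p c) x x) (Df (Ec p c) x x)) (at 1)"
   using exp_map_scale[of p 1 x] by (simp add:st_def spray_def vel1 Ec_def)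
  show "open (geo p x -` dom_ch c)" by (rule geo_open[OF geo(1) c(1)])
  show "vel c (geo p x) t = Df (Ec p c) (t *R x) x" if "t : geo p x -` dom_ch c" for t
   using DEc_ray[OF c(1), of t x p] that by (simp add:expdom_def exp_map_scale)
 qed (use d in auto)
 ultimately have "pb.D2 x x x = - Gam (g c) (Ec p c x) (Df (Ec p c) x x) (Df (Ec p c) x x)"
  by (rule vector_derivative_unique_at)
 hence "Df (Ec p c) x (Gam (hN p) x x x) = 0" using pb.Gam_pullback[OF xW, of x x] by simp
 thus "Gam (hN p) x x x = 0" using linear_injective_0[OF pb.DE_linear[OF xW]] pb.DE_inj[OF xW] by blast
qed (use assms(2,3) in auto)

lemma hN_0: "hN p 0 = grA p" by (simp add:hN_def Let_def exp_map_0 DEc_0 vec_eq_iff gram_at_def coord_def Ec_def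
   mv_basis inner_axis' column_def)

definition "ric z = Ric (g (chA (fst z))) (coord A (fst z)) (snd z)"

lemma Ric_transition:
 assumes "c : A" "d : A" "p : dom_ch c" "p : dom_ch d"
 shows "Ric (g c) (map_ch c p) v = Ric (g d) (map_ch d p) (L c d p v)"
 using pullback.Ric_pullback[OF trans_pullback[OF assms(1,2)] ov_memI[OF assms(3,4)], of v] assms
 by (simp add:trans_map L_def)

lemma ric_chart:
 assumes "c : A" "fst z : dom_ch c"
 shows "ric z = Ric (g c) (fst (bch c z)) (snd (bch c z))"
 using Ric_transition[OF chart_at(1) assms(1) chart_at(2) assms(2), of "snd z"]
  bch_eq[OF assms, of "snd z"] by (simp add:ric_def coord_def)

lemma ric_hN:
 assumes B: "metric_field B (hN p)" and x: "t *R v : B"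
 shows "Ric (hN p) (t *R v) v = ric (Fl t (p, v))" proof -
 define c where "c = chA (exA p (t *R v))"
 have c: "c : A" "t *R v : expdom p c" by (auto simp:c_def chart_at expdom_chart_at)
 have "Ric (hN p) (t *R v) v = Ric (g c) (Ec p c (t *R v)) (vel c (geo p v) t)"
  using pullback.Ric_pullback[OF hN_pullback[OF B c(1)], of "t *R v" v] x c(2) DEc_ray[OF c] by simp
 also have "... = ric (Fl t (p, v))" by (simp add:ric_def Fl_def pvel_def c_def coord_def Ec_def exp_map_scale)
 finally show ?thesis .
qed

lemma curvature_op_Rm: "curvop p u v w = Rm (g (chA p)) (coord A p) u v w" proof -
 have "curv g (chA p) = curv (%_::(unit, 'n) chart. g (chA p)) undefined" by (rule curv_cong_metric) simp
 thus ?thesis by (simp add:curvature_op_def Rm_def)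
qed

lemma det_hN:
 assumes c: "c : A" "v : expdom p c"
 shows "det (hN p v) = (det (matrix (Df (Ec p c) v)))^2 * det (g c (Ec p c v))" proof -
 let ?J = "matrix (Df (Ec p c) v)"
 have J: "?J *v u = Df (Ec p c) v u" for u by (rule matrix_apply[OF hasD_linear[OF Ec_deriv[OF c]]])
 have "u <.> (hN p v *v w) = u <.> ((transpose ?J ** g c (Ec p c v) ** ?J) *v w)" for u w
  by (simp add:hN_eq[OF c] mv_assoc[symmetric] inner_transpose J)
 hence "hN p v *v w = (transpose ?J ** g c (Ec p c v) ** ?J) *v w" for w using vector_eq_ldot by blast
 hence "hN p v = transpose ?J ** g c (Ec p c v) ** ?J" by (simp add:matrix_eq)
 thus ?thesis by (simp add:det_mul det_transpose sq_eq mult_ac)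
qed

text \<open>The determinant of a pulled-back metric already contains the square of the Jacobian; the
  root removes both the square and the absolute value.\<close>

lemma exp_jacobian_hN: "exp_jacobian A g p v = sqrt (det (hN p v)) / sqrt (det (grA p))"
 unfolding det_hN[OF chart_at(1) expdom_chart_at] real_sqrt_mult
 by (simp add:exp_jacobian_def Let_def jacobian_matrix_def gram_at_def coord_def)
  (simp add:Ec_def[abs_def] o_def)

end

section \<open>The injectivity radius\<close>

context riem
begin

lemma norm_at_chart:
 assumes "c : A" "p : dom_ch c"
 shows "nmA p v = sqrt (L (chA p) c p v <.> (g c (map_ch c p) *v L (chA p) c p v))"
 using inner_at_chart[OF assms] by (simp add:norm_at_def)

lemma gram_pos: "v ~= 0 ==> v <.> (grA p *v v) > 0"
 using metric_field.pos[OF mf[OF chart_at(1)], of "coord A p" p v] chart_at(2)[of p]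
 by (simp add:gram_at_def coord_def)

lemma gram_sym: "transpose (grA p) = grA p"
 using metric_field.sym[OF mf[OF chart_at(1)], of "coord A p" p] chart_at(2)[of p]
 by (simp add:gram_at_def coord_def)

lemma norm_at_sq: "(nmA p v)^2 = v <.> (grA p *v v)" proof -
 have "v <.> (grA p *v v) >= 0" using gram_pos[of v p] by (cases "v = 0") auto
 thus ?thesis by (simp add:norm_at_def inner_at_def)
qed

lemma norm_at_nonneg: "nmA p v >= 0" proof -
 have "v <.> (grA p *v v) >= 0" using gram_pos[of v p] by (cases "v = 0") auto
 thus ?thesis by (simp add:norm_at_def inner_at_def)
qed

lemma norm_at_scale: "nmA p (t *R v) = abs t * nmA p v" proof -
 have "(t *R v) <.> (grA p *v (t *R v)) = t^2 * (v <.> (grA p *v v))" by (simp add:mv_scaleR sq_eq)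
 thus ?thesis by (simp add:norm_at_def inner_at_def real_sqrt_mult)
qed

lemma norm_at_cont: "cont_on UNIV (nmA p)" unfolding norm_at_def inner_at_def
 by (intro continuous_intros linear_continuous_on linear_linear[THEN iffD2] matrix_vector_mul_linear)

lemma tangent_ball_open: "open (tball p r)" proof -
 have "tball p r = nmA p -` {..<r}" by (auto simp:tangent_ball_def)
 thus ?thesis using norm_at_cont by (simp add:open_vimage)
qed

lemma tangent_ball_star: "x : tball p r ==> 0 <= t ==> t <= 1 ==> t *R x : tball p r"
 using mult_left_le_one_le[of "nmA p x" t] norm_at_nonneg[of p x] by (auto simp:tangent_ball_def norm_at_scale)

lemma tangent_ball_0: "r > 0 ==> 0 : tball p r" by (simp add:tangent_ball_def norm_at_def inner_at_def)

end

context riem_complete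
begin

text \<open>By the chain rule the differential of the smooth inverse is a left inverse of the
  differential.\<close>

lemma exp_diffeo_inj:
 assumes "open B" "exp_diffeo_on A g p B" "c : A" "v : B" "v : expdom p c"
 shows "inj (Df (Ec p c) v)" proof -
 define G where "G = inv_into B (exA p) o inv_ch c"
 let ?V = "map_ch c ` (dom_ch c Int exA p ` B)"
 have inj: "inj_on (exA p) B" and sm: "smooth_on ?V G" using assms(2,3) unfolding exp_diffeo_on_def G_def by auto
 have fV: "Ec p c v : ?V" using assms(4,5) by (auto simp:Ec_def expdom_def)
 have "Ck_on (Suc 0) ?V G" using sm unfolding smooth_on_def by blast
 from Ck_hasD[OF this fV] have dG: "(G hasD Df G (Ec p c v)) (at (Ec p c v))" .
 have d: "((%u. G (Ec p c u)) hasD (%u. Df G (Ec p c v) (Df (Ec p c) v u))) (at v)"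
  by (rule hasD_compose[OF Ec_deriv[OF assms(3,5)] dG])
 have o: "open (B Int expdom p c)" using assms(1) expdom_open[OF assms(3)] by auto
 have "((%u. u) hasD (%u. Df G (Ec p c v) (Df (Ec p c) v u))) (at v)" by (rule hasD_open[OF d o])
   (use assms(3-5) inj inv_map in "auto simp:G_def Ec_def expdom_def")
 from hasD_unique[OF this hasD_ident]
 have "Df G (Ec p c v) (Df (Ec p c) v u) = u" for u by metis
 thus ?thesis by (metis injI)
qed

lemma exp_diffeo_normal_coords:
 assumes "r > 0" "exp_diffeo_on A g p (tball p r)"
 shows "normal_coords (tball p r) (hN p)" proof (rule hN_normal_coords)
 show "metric_field (tball p r) (hN p)"
  by (rule hN_metric_field[OF tangent_ball_open exp_diffeo_inj[OF tangent_ball_open assms(2)]])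
qed (use tangent_ball_0[OF assms(1)] tangent_ball_star in auto)

lemma injectivity_radius_ball:
 assumes "ereal r < injectivity_radius A g"
 obtains ro where "ro > r" "ro > 0" "exp_diffeo_on A g p (tball p ro)" proof -
 have "ereal r < injectivity_radius_at A g p"
  using assms INF_lower[of p UNIV "injectivity_radius_at A g"] unfolding injectivity_radius_def
  by (meson UNIV_I order_less_le_trans)
 then obtain x where "x : {ereal r | r. 0 < r & exp_diffeo_on A g p (tball p r)}" "ereal r < x"
  unfolding injectivity_radius_at_def less_Sup_iff by blast
 thus ?thesis using that by auto
qed

text \<open>One chart containing the whole image is enough. Invariance of domain yields openness of
  the image and continuity of the inverse, \<open>Ck_inverse_function\<close> its smoothness, and
  transition maps spread it to the other charts.\<close>

lemma exp_diffeo_onI: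
 assumes B: "open B" and c: "c : A" and sub: "B <= expdom p c" and inj: "inj_on (Ec p c) B"
  and d: "!!v. v : B ==> inj (Df (Ec p c) v)"
 shows "exp_diffeo_on A g p B" proof -
 have cont: "cont_on B (Ec p c)" by (rule cont_subset[OF Ck_cont[OF Ec_Ck[OF c, of 0]] sub])
 have oV: "open (Ec p c ` B)" by (rule invariance_of_domain[OF cont B inj])
 obtain G where G: "homeomorphism B (Ec p c ` B) (Ec p c) G"
  using invariance_of_domain_homeomorphism[OF B cont _ inj] by auto
 have Gc: "cont_on (Ec p c ` B) G" "G ` Ec p c ` B = B" "!!y. y : Ec p c ` B ==> Ec p c (G y) = y"
  "!!v. v : B ==> G (Ec p c v) = v" using G unfolding homeomorphism_def by auto
 have Gs: "Ck_on (Suc k) (Ec p c ` B) G" for k proof (rule Ck_inverse_function[OF B oV Ck_subset[OF Ec_Ck[OF c] sub]])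
  fix v assume v: "v : B"
  have "linear (Df (Ec p c) v)" using Ec_deriv[OF c] v sub hasD_linear by blast
  thus "det (matrix (Df (Ec p c) v)) ~= 0" using det_nz_iff_inj d[OF v] by blast
 qed (use Gc in auto)
 have einj: "inj_on (exA p) B" using inj by (auto simp:inj_on_def Ec_def)
 have im: "exA p ` B = dom_ch c Int map_ch c -` (Ec p c ` B)" proof
  show "exA p ` B <= dom_ch c Int map_ch c -` (Ec p c ` B)" using sub by (auto simp:expdom_def Ec_def)
  show "dom_ch c Int map_ch c -` (Ec p c ` B) <= exA p ` B" proof
   fix q assume q: "q : dom_ch c Int map_ch c -` (Ec p c ` B)"
   then obtain v where v: "v : B" "map_ch c q = map_ch c (exA p v)" by (auto simp:Ec_def)
   moreover have "exA p v : dom_ch c" using v sub by (auto simp:expdom_def)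
   ultimately have "q = exA p v" using q inj_onD[OF inj_map[OF c]] by blast
   thus "q : exA p ` B" using v by blast
  qed
 qed
 have oE: "open (exA p ` B)" unfolding im by (rule open_preimage[OF map_cont[OF c] open_dom[OF c] oV])
 have s1: "smooth_on {v : B. exA p v : dom_ch c'} (map_ch c' o exA p)" if "c' : A" for c' proof -
  have "Ck_on k {v : B. exA p v : dom_ch c'} (Ec p c')" for k
   by (rule Ck_subset[OF Ec_Ck[OF that]]) (auto simp:expdom_def)
  thus ?thesis by (simp add:smooth_on_def Ec_def[abs_def] o_def)
 qed
 have s2: "smooth_on (map_ch c' ` (dom_ch c' Int exA p ` B)) (inv_into B (exA p) o inv_ch c')" if c': "c' : A" for c'
 proof -
  let ?V = "map_ch c' ` (dom_ch c' Int exA p ` B)"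
  have o: "open ?V" by (rule open_image[OF c']) (use oE open_dom[OF c'] in auto)
  have Vs: "?V <= ov c' c" using im by auto
  have tr: "transition c' c ` ?V <= Ec p c ` B" using im by (auto simp:trans_map[OF c'])
  have "Ck_on k ?V (%y. G (transition c' c y))" for k
   by (rule Ck_compose[OF o oV Ck_subset[OF trans_Ck[OF c' c] Vs] tr]) (rule Ck_Suc[OF Gs])
  hence "Ck_on k ?V (inv_into B (exA p) o inv_ch c')" for k proof (rule Ck_cong[OF o, rotated])
   fix y assume "y : ?V"
   then obtain v where v: "v : B" "exA p v : dom_ch c'" "y = map_ch c' (exA p v)" by auto
   thus "G (transition c' c y) = (inv_into B (exA p) o inv_ch c') y"
    using Gc(4)[OF v(1)] by (simp add:trans_map[OF c'] inv_map[OF c'] einj Ec_def)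
  qed
  thus ?thesis by (simp add:smooth_on_def)
 qed
 show ?thesis unfolding exp_diffeo_on_def using einj oE s1 s2 by blast
qed

text \<open>The exponential map in charts as a function of base point and vector together;
  \<open>Ec\<close> fixes the base point.\<close>

definition "ec c d z = fst (flowc c d 1 z)"

lemma Ec_ec:
 assumes "c : A" "p : dom_ch c" "d : A" "v : expdom p d"
 shows "Ec p d v = ec c d (bch c (p, v))" proof -
 have "fst (Fl 1 (p, v)) : dom_ch d" using assms(4) by (simp add:expdom_def exp_map_Fl)
 from bundle_fst[OF assms(3) this, of "snd (Fl 1 (p, v))"]
 show ?thesis by (simp add:ec_def flowc_def ibc_bundle[OF assms(1,2)] Ec_def exp_map_Fl)
qed

lemma ec_Ck_near:
 assumes "c : A" "z0 : TU c" "d : A" "exA (fst (ibc c z0)) (snd (ibc c z0)) : dom_ch d"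
 obtains W where "open W" "z0 : W" "W <= TU c" "!!z. z : W ==> exA (fst (ibc c z)) (snd (ibc c z)) : dom_ch d"
  "!!k. Ck_on k W (ec c d)" proof -
 have "smooth_near c d 1 z0" by (rule flow_smooth) (use assms in "auto simp:exp_map_Fl")
 then obtain W where W: "open W" "z0 : W" "W <= TU c" "!!z. z : W ==> fst (Fl 1 (ibc c z)) : dom_ch d"
  "!!k. Ck_on k W (flowc c d 1)" unfolding smooth_near_def by blast
 have "Ck_on k W (ec c d)" for k unfolding ec_def[abs_def] by (intro Ck_fst W)
 thus ?thesis using that[OF W(1-3)] W(4) by (simp add:exp_map_Fl)
qed

lemma DEc_ec:
 assumes c: "c : A" "p : dom_ch c" and d: "d : A" "v : expdom p d" and e: "(ec c d hasD e') (at (bch c (p, v)))"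
 shows "Df (Ec p d) v u = e' (0, L (chA p) c p u)" proof -
 let ?La = "L (chA p) c p"
 have lin: "linear ?La" by (rule L_linear[OF chart_at(1) c(1) chart_at(2) c(2)])
 have "((%v. bch c (p, v)) hasD (%u. (0, ?La u))) (at v)" unfolding bch_eq[OF c]
  by (intro has_derivative_Pair has_derivative_const linear_imp_has_derivative lin)
 from hasD_compose[OF this e]
 have "((%v. ec c d (bch c (p, v))) hasD (%u. e' (0, ?La u))) (at v)" .
 hence "(Ec p d hasD (%u. e' (0, ?La u))) (at v)"
  by (rule hasD_open[OF _ expdom_open[OF d(1)] d(2)]) (simp add:Ec_ec[OF c d(1)])
 thus ?thesis by (simp add:Df_eq)
qed

lemma metric_lower_bound:
 assumes c: "c : A" and K: "compact K" "K <= img c"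
 obtains l where "l > 0" "!!x w. x : K ==> l * (norm w)^2 <= w <.> (g c x *v w)" proof (cases "K = {}")
 case True
 thus ?thesis using that[of 1] by simp
next
 case False
 let ?f = "%z. snd z <.> (g c (fst z) *v snd z)"
 let ?S = "K >< sphere (0::real^'n) 1"
 have S: "compact ?S" using K(1) by (intro compact_Times compact_sphere)
 have gc: "cont_on (img c) (g c)" by (rule Ck_cont[OF metric_field.h_Ck[OF mf[OF c], of 0]])
 have "Ck_on 0 (TU c) ?f" by (intro Ck_inner Ck_matvec Ck_snd Ck_ident TU_open[OF c]
   Ck_compose[OF TU_open[OF c] open_img[OF c] Ck_fst[OF TU_open[OF c] Ck_ident[OF TU_open[OF c]]] _ metric_field.h_Ck[OF mf[OF c]]])
   (auto simp:TU_def)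
 hence "cont_on ?S ?f" using K(2) by (auto simp:TU_def intro:cont_subset)
 moreover have "?S ~= {}" using False by simp
 ultimately obtain z0 where z0: "z0 : ?S" "!!z. z : ?S ==> ?f z0 <= ?f z" using continuous_attains_inf[OF S] by blast
 have "?f z0 > 0" using z0(1) K(2) by (intro metric_field.pos[OF mf[OF c]]) auto
 moreover have "?f z0 * (norm w)^2 <= w <.> (g c x *v w)" if x: "x : K" for x w proof (cases "w = 0")
  case False
  have "?f z0 <= ?f (x, w /\<^sub>R norm w)" using z0(2)[of "(x, w /\<^sub>R norm w)"] x False by simp
  also have "?f (x, w /\<^sub>R norm w) = (w <.> (g c x *v w)) / (norm w)^2"
   by (simp add:mv_scaleR sq_eq divide_inverse mult_ac)
  finally show ?thesis using False by (simp add:field_simps)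
 qed simp
 ultimately show ?thesis using that by blast
qed

text \<open>At the zero vector over \<open>p0\<close> the fibre derivative of the exponential map is
  the identity. Near it, in base point and vector, the derivative differs from the identity by at
  most 1/2, so \<open>ec c c\<close> minus the identity contracts; this gives injectivity on balls
  of one radius for all nearby \<open>p\<close>.\<close>

lemma injectivity_radius_local:
 "EX N dta. open N & p0 : N & dta > 0 & (ALL p:N. exp_diffeo_on A g p (tball p dta))" proof -
 define c where "c = chA p0"
 have c: "c : A" "p0 : dom_ch c" by (simp_all add:c_def chart_at)
 define x0 where "x0 = map_ch c p0"
 have i0: "ibc c (x0, 0) = (p0, 0)" by (simp add:c_def x0_def ibc_chart_at)
 have z0: "(x0, 0) : TU c" using c by (simp add:TU_iff x0_def)
 obtain W where W: "open W" "(x0, 0) : W" "W <= TU c"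
  "!!z. z : W ==> exA (fst (ibc c z)) (snd (ibc c z)) : dom_ch c" "!!k. Ck_on k W (ec c c)"
  by (rule ec_Ck_near[OF c(1) z0 c(1)]) (use i0 c in "auto simp:exp_map_0")
 note De = Ck_hasD[OF W(5)[of "Suc 0"]]
 have D0: "Df (ec c c) (x0, 0) (0, u) = u" for u proof -
  have "0 : expdom p0 c" using c by (simp add:expdom_def exp_map_0)
  from DEc_ec[OF c c(1) this, of "Df (ec c c) (x0, 0)" u] De[OF W(2)] DEc_0[of p0 u]
  show ?thesis by (simp add:bch_eq[OF c] L_id c linear_0 c_def[symmetric] x0_def)
 qed
 \<comment> \<open>Summed over the basis, deviations below \<open>e\<close> add up to operator norm
   at most 1/2.\<close>
 define e where "e = 1 / (2 * real DIM(real^'n))"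
 have e: "e > 0" "real DIM(real^'n) * e = 1 / 2" by (simp_all add:e_def)
 have "EX d>0. ALL z. dist z (x0, 0) < d --> z : W & norm (Df (ec c c) z (0, b) - b) < e" for b proof -
  have "cont_on W (%z. Df (ec c c) z (0, b))" using Ck_cont[OF Ck_D[OF W(5)[of "Suc 0"]]] .
  hence "isCont (%z. Df (ec c c) z (0, b)) (x0, 0)" using W(1,2) continuous_on_eq_continuous_at by blast
  then obtain d1 where "d1 > 0" "ALL z. dist z (x0, 0) < d1 --> dist (Df (ec c c) z (0, b)) b < e"
   using e(1) D0 unfolding continuous_at_eps_delta by metis
  moreover obtain d2 where "d2 > 0" "ALL z. dist z (x0, 0) < d2 --> z : W" using W(1,2) open_dist by blast
  ultimately show ?thesis by (intro exI[of _ "min d1 d2"]) (auto simp:dist_norm)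
 qed
 then obtain D where D: "!!b. D b > 0"
  "!!b z. dist z (x0, 0) < D b ==> z : W & norm (Df (ec c c) z (0, b) - b) < e" by metis
 \<comment> \<open>Halved because the distance of pairs is at most the sum of two distances below
   \<open>et\<close>; \<open>D 0\<close> secures membership in \<open>W\<close>.\<close>
 define et where "et = Min (insert (D 0) (D ` (Basis :: (real^'n) set))) / 2"
 have h2: "2 * et = Min (insert (D 0) (D ` (Basis :: (real^'n) set)))" by (simp add:et_def)
 have h: "et > 0" "2 * et <= D 0" "!!b. b : Basis ==> 2 * et <= D b" proof -
  show "2 * et <= D 0" "!!b. b : Basis ==> 2 * et <= D b" unfolding h2 by (rule Min_le; simp)+
  have "2 * et > 0" unfolding h2 using D(1) by (subst Min_gr_iff) auto
  thus "et > 0" by simp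
 qed
 have near: "dist (x, w) (x0, 0) < 2 * et" if "dist x x0 < et" "norm w < et" for x w proof -
  have "dist (x, w) (x0, 0) <= dist x x0 + dist w 0" by (simp add:dist_Pair_Pair sqrt_sum_squares_le_sum)
  thus ?thesis using that by simp
 qed
 have inW: "(x, w) : W" if "dist x x0 < et" "norm w < et" for x w using D(2)[of "(x, w)" 0] near[OF that] h(2) by auto
 have lin: "linear (Df (ec c c) z)" if "z : W" for z using De[OF that] hasD_linear by blast
 have Dn: "norm (Df (ec c c) (x, w) (0, u) - u) <= 1 / 2 * norm u" if xw: "dist x x0 < et" "norm w < et" for x w u
 proof -
  note l = lin[OF inW[OF xw]]
  let ?F = "%u. Df (ec c c) (x, w) (0, u) - u"
  have lF: "linear ?F" proof (rule linearI)
   fix a b :: "real^'n" and k :: real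
   show "?F (a + b) = ?F a + ?F b" "?F (k *R b) = k *R ?F b"
    using linear_add[OF l, of "(0, a)" "(0, b)"] linear_scale[OF l, of k "(0, b)"] by (simp_all add:alg)
  qed
  have "?F u = ?F (SUM b:Basis. (u <.> b) *R b)" by (simp only: eucl_rep)
  also have "... = (SUM b:Basis. (u <.> b) *R ?F b)" by (simp only: linear_sum[OF lF] linear_scale[OF lF])
  finally have "norm (?F u) <= (SUM b:Basis. norm ((u <.> b) *R ?F b))" by (simp only: norm_sum)
  also have "... <= (SUM b:(Basis::(real^'n) set). norm u * e)" proof (rule sum_mono)
   fix b :: "real^'n" assume b: "b : Basis"
   have "norm (?F b) <= e" using D(2)[of "(x, w)" b] near[OF xw] h(3)[OF b] by auto
   thus "norm ((u <.> b) *R ?F b) <= norm u * e"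
    unfolding norm_scaleR using Basis_le_norm[OF b, of u] by (intro mult_mono) auto
  qed
  also have "... = (real DIM(real^'n) * e) * norm u" by simp
  finally show ?thesis unfolding e(2) .
 qed
 have einj: "w = w'" if x: "dist x x0 < et" and w: "norm w < et" "norm w' < et" "ec c c (x, w) = ec c c (x, w')" for x w w'
 proof -
  let ?f = "%w. ec c c (x, w) - w"
  have "norm (?f w - ?f w') <= 1 / 2 * norm (w - w')"
  proof (rule differentiable_bound[of "ball 0 et" ?f "%w u. Df (ec c c) (x, w) (0, u) - u"])
   fix w assume w: "w : ball (0::real^'n) et"
   hence wn: "norm w < et" by simp
   have "((%w. (x, w)) hasD (%u. (0, u))) (at w)" by (intro has_derivative_Pair has_derivative_const hasD_ident)
   from hasD_compose[OF this De[OF inW[OF x wn]]]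
   have "((%w. ec c c (x, w)) hasD (%u. Df (ec c c) (x, w) (0, u))) (at w)" .
   from hasD_within[OF has_derivative_diff[OF this hasD_ident]]
   show "(?f hasD (%u. Df (ec c c) (x, w) (0, u) - u)) (at w within ball 0 et)" .
   show "onorm (%u. Df (ec c c) (x, w) (0, u) - u) <= 1 / 2" by (rule onorm_le) (rule Dn[OF x wn])
  qed (use w in auto)
  moreover have "norm (?f w - ?f w') = norm (w - w')" using w(3) by (simp add:norm_minus_commute)
  ultimately show ?thesis by simp
 qed
 obtain et' where h': "et' > 0" "cball x0 et' <= img c"
  using open_img[OF c(1)] c(2) open_contains_cball unfolding x0_def by blast
 obtain l where l: "l > 0" "!!x w. x : cball x0 et' ==> l * (norm w)^2 <= w <.> (g c x *v w)"
  using metric_lower_bound[OF c(1) compact_cball h'(2)] by blast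
 \<comment> \<open>\<open>l\<close> compares the metric with the coordinate norm, so tangent vectors
   of length below \<open>dta\<close> have coordinates of norm below \<open>et\<close>.\<close>
 define dta where "dta = et * sqrt l"
 have dta: "dta > 0" "dta^2 = l * et^2" using h(1) l(1) by (simp_all add:dta_def power_mult_distrib)
 define N where "N = dom_ch c Int map_ch c -` ball x0 (min et et')"
 have N: "open N" unfolding N_def by (rule open_preimage[OF map_cont[OF c(1)] open_dom[OF c(1)]]) auto
 have "exp_diffeo_on A g p (tball p dta)" if p: "p : N" for p proof -
  let ?x = "map_ch c p" and ?La = "L (chA p) c p"
  have pd: "p : dom_ch c" "dist ?x x0 < et" "?x : cball x0 et'" using p by (auto simp:N_def dist_commute)
  have La: "norm (?La v) < et" if "v : tball p dta" for v proof -
   have "nmA p v < dta" using that by (simp add:tangent_ball_def)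
   hence "(nmA p v)^2 < dta^2" using norm_at_nonneg by (intro power_strict_mono) auto
   moreover have "(nmA p v)^2 = ?La v <.> (g c ?x *v ?La v)"
    using norm_at_chart[OF c(1) pd(1), of v] metric_field.pos[OF mf[OF c(1)], of ?x "?La v"] pd(1)
    by (cases "?La v = 0") auto
   ultimately have "l * (norm (?La v))^2 < l * et^2" using l(2)[OF pd(3), of "?La v"] dta(2) by linarith
   hence "(norm (?La v))^2 < et^2" using l(1) by simp
   thus ?thesis using h(1) by (simp add:power2_less_imp_less)
  qed
  have Lainj: "?La u = ?La v ==> u = v" for u v using L_inverse[OF chart_at(1) c(1) chart_at(2) pd(1)] by metis
  have bc: "bch c (p, v) = (?x, ?La v)" for v by (rule bch_eq[OF c(1) pd(1)])
  have sub: "v : expdom p c" if "v : tball p dta" for v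
   using W(4)[OF inW[OF pd(2) La[OF that]]] ibc_bundle[OF c(1) pd(1), of v] by (simp add:bc expdom_def)
  show ?thesis proof (rule exp_diffeo_onI[OF tangent_ball_open c(1)])
   show "tball p dta <= expdom p c" using sub by blast
   show "inj_on (Ec p c) (tball p dta)" proof (rule inj_onI)
    fix u v assume uv: "u : tball p dta" "v : tball p dta" "Ec p c u = Ec p c v"
    hence "ec c c (?x, ?La u) = ec c c (?x, ?La v)" using Ec_ec[OF c(1) pd(1) c(1)] sub bc by metis
    thus "u = v" using einj[OF pd(2) La[OF uv(1)] La[OF uv(2)]] Lainj by blast
   qed
   fix v assume v: "v : tball p dta"
   have d: "Df (Ec p c) v u = Df (ec c c) (?x, ?La v) (0, ?La u)" for u
    using DEc_ec[OF c(1) pd(1) c(1) sub[OF v], of "Df (ec c c) (?x, ?La v)" u] De[OF inW[OF pd(2) La[OF v]]] bc by simp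
   have "linear (Df (Ec p c) v)" using Ec_deriv[OF c(1) sub[OF v]] hasD_linear by blast
   moreover have "u = 0" if "Df (Ec p c) v u = 0" for u proof -
    have "norm (?La u) <= 1 / 2 * norm (?La u)" using Dn[OF pd(2) La[OF v], of "?La u"] that d[of u] by simp
    hence "?La u = ?La 0" using linear_0[OF L_linear[OF chart_at(1) c(1) chart_at(2) pd(1)]] by simp
    thus ?thesis using Lainj by blast
   qed
   ultimately show "inj (Df (Ec p c) v)" by (simp add:linear_injective_0)
  qed
 qed
 moreover have "p0 : N" using c(2) h(1) h'(1) by (simp add:N_def x0_def)
 ultimately show ?thesis using N dta(1) by blast
qed

end

locale riem_compact = riem_complete A g for A :: "('a::{t2_space, second_countable_topology}, 'n::finite) chart set" and g +
 assumes compact_M: "compact (UNIV :: 'a set)"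
begin

text \<open>Finitely many of the neighbourhoods of \<open>injectivity_radius_local\<close> cover the
  compact manifold, and the least of their radii works everywhere. Without it there might be no
  admissible radius at which equality could hold.\<close>

lemma injectivity_radius_pos: "EX dta>0. ereal dta <= injectivity_radius A g" proof -
 obtain N dta where N: "!!p. open (N p)" "!!p. p : N p" "!!p. dta p > (0::real)"
  "!!p q. q : N p ==> exp_diffeo_on A g q (tball q (dta p))" using injectivity_radius_local by metis
 have cov: "UNIV <= (UN p:UNIV. N p)" using N(2) by auto
 obtain F where F: "finite F" "UNIV <= (UN p:F. N p)" by (rule compactE_image[OF compact_M N(1) cov])
 have ne: "F ~= {}" using F(2) by auto
 define d where "d = Min (dta ` F)"
 have "d > 0" using F(1) ne N(3) by (simp add:d_def)
 moreover have "ereal d <= injectivity_radius A g" unfolding injectivity_radius_def proof (rule INF_greatest)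
  fix q
  obtain p where p: "p : F" "q : N p" using F(2) by blast
  have "ereal (dta p) <= injectivity_radius_at A g q"
   unfolding injectivity_radius_at_def by (rule Sup_upper) (use N(3,4) p in blast)
  moreover have "d <= dta p" using F(1) p(1) by (simp add:d_def)
  ultimately show "ereal d <= injectivity_radius_at A g q" by (meson ereal_less_eq(3) order_trans)
 qed
 ultimately show ?thesis by blast
qed

end

section \<open>Change of variables\<close>

text \<open>The change of variables theorem of the library needs a well-ordered index type, so it is transported along a bijective renaming of the coordinates.\<close>

typedef (overloaded) ('n::finite) idx = "{..<CARD('n)}" by (rule exI[of _ 0]) simp

instance idx :: (finite) finite proof
 have "(UNIV :: 'a idx set) = Abs_idx ` {..<CARD('a)}" by (rule type_definition.univ[OF type_definition_idx])
 thus "finite (UNIV :: 'a idx set)" by (rule ssubst) (rule finite_imageI[OF finite_lessThan])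
qed

instantiation idx :: (finite) wellorder
begin

definition "less_eq_idx (a :: 'a idx) (b :: 'a idx) <-> Rep_idx a <= Rep_idx b"
definition "less_idx (a :: 'a idx) (b :: 'a idx) <-> Rep_idx a < Rep_idx b"

instance proof
 fix x y z :: "'a idx"
 show "x < y <-> x <= y & ~ y <= x" "x <= x" "x <= y \<or> y <= x"
  unfolding less_eq_idx_def less_idx_def by linarith+
 show "x <= y ==> y <= z ==> x <= z" unfolding less_eq_idx_def by (rule order_trans)
 show "x <= y ==> y <= x ==> x = y"
  unfolding less_eq_idx_def by (rule Rep_idx_inject[THEN iffD1]) (rule order_antisym)
next
 fix P :: "'a idx => bool" and a
 assume H: "!!x. (!!y. y < x ==> P y) ==> P x"
 show "P a" proof (rule measure_induct_rule[of Rep_idx P a])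
  fix x :: "'a idx" assume *: "!!y. Rep_idx y < Rep_idx x ==> P y"
  show "P x" by (rule H) (rule *, simp only: less_idx_def)
 qed
qed

end

lemma card_idx: "CARD('n::finite idx) = CARD('n)" proof -
 have "(UNIV :: 'n idx set) = Abs_idx ` {..<CARD('n)}" by (rule type_definition.univ[OF type_definition_idx])
 moreover have "inj_on (Abs_idx :: nat => 'n idx) {..<CARD('n)}" by (simp add:Abs_idx_inject inj_on_def)
 ultimately show ?thesis using card_image by fastforce
qed

lemma det_reindex:
 fixes e :: "'m::finite => 'n::finite" and M :: "real^'n^'n"
 assumes e: "bij e"
 shows "det (\<chi> i j. M $ e i $ e j) = det M" proof -
 let ?m = "map_permutation UNIV e"
 have inj: "inj_on e UNIV" and im: "e ` UNIV = UNIV" using e by (auto simp:bij_def)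
 have ap: "?m p (e i) = e (p i)" if "p permutes UNIV" for p i by (rule map_permutation_apply[OF inj]) simp
 have "det M = (SUM p:{p. p permutes (UNIV :: 'm set)}. of_int (sign (?m p)) * (PROD i:UNIV. M $ i $ ?m p i))"
  unfolding det_def proof (rule sum.reindex_bij_betw[symmetric, of ?m])
  show "bij_betw ?m {p. p permutes (UNIV :: 'm set)} {p. p permutes (UNIV :: 'n set)}"
  proof (rule bij_betw_byWitness[where f' = "map_permutation UNIV (inv e)"])
   have inv: "inj_on (inv e) UNIV" "inv e ` UNIV = UNIV" using bij_imp_bij_inv[OF e] by (auto simp:bij_def)
   show "?m ` {p. p permutes UNIV} <= {p. p permutes (UNIV :: 'n set)}"
    "map_permutation UNIV (inv e) ` {p. p permutes (UNIV :: 'n set)} <= {p. p permutes UNIV}"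
    using map_permutation_permutes[OF e] map_permutation_permutes[OF bij_imp_bij_inv[OF e]] by auto
   show "ALL p:{p. p permutes UNIV}. map_permutation UNIV (inv e) (?m p) = p" proof safe
    fix p :: "'m => 'm" assume p: "p permutes UNIV"
    have "map_permutation UNIV (inv e) (?m p) (inv e (e i)) = inv e (?m p (e i))" for i
     by (rule map_permutation_apply[OF inv(1)]) simp
    thus "map_permutation UNIV (inv e) (?m p) = p" using ap[OF p] e by (simp add:bij_def inv_f_f fun_eq_iff)
   qed
   show "ALL p:{p. p permutes UNIV}. ?m (map_permutation UNIV (inv e) p) = p" proof safe
    fix p :: "'n => 'n" assume p: "p permutes UNIV"
    have "map_permutation UNIV (inv e) p (inv e i) = inv e (p i)" for i
     by (rule map_permutation_apply[OF inv(1)]) simp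
    moreover have "?m q (e (inv e i)) = e (q (inv e i))" for q i by (rule map_permutation_apply[OF inj]) simp
    ultimately show "?m (map_permutation UNIV (inv e) p) = p" using e by (simp add:bij_def surj_f_inv_f fun_eq_iff)
   qed
  qed
 qed
 also have "... = (SUM p:{p. p permutes (UNIV :: 'm set)}. of_int (sign p) * (PROD i:UNIV. M $ e i $ e (p i)))"
 proof (rule sum.cong[OF refl])
  fix p assume "p : {p. p permutes (UNIV :: 'm set)}"
  hence p: "p permutes UNIV" by simp
  have "(PROD i:UNIV. M $ i $ ?m p i) = (PROD i:UNIV. M $ e i $ ?m p (e i))"
   by (rule prod.reindex_bij_betw[OF e, symmetric])
  thus "of_int (sign (?m p)) * (PROD i:UNIV. M $ i $ ?m p i) = of_int (sign p) * (PROD i:UNIV. M $ e i $ e (p i))"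
   using sign_map_permutation[OF inj p] by (simp add:ap[OF p])
 qed
 finally show ?thesis by (simp add:det_def)
qed

text \<open>\<open>has_measure_differentiable_image\<close> compares finite values only, but as an
  equivalence: the image has finite measure exactly if the integral is finite. In the remaining case
  both sides are infinite.\<close>

lemma emeasure_image_wellorder:
 fixes T :: "real^'n::{finite,wellorder} => real^'n::_"
 assumes S: "S : sets borel" and T: "!!x. x : S ==> (T hasD T' x) (at x)" and inj: "inj_on T S"
  and m: "(%x. abs (det (matrix (T' x))) * ind S x) : BM" and TS: "T ` S : sets borel"
 shows "em lborel (T ` S) = (NN lborel (%x. ennreal (abs (det (matrix (T' x))) * ind S x)))" proof -
 let ?d = "%x. abs (det (matrix (T' x)))" and ?f = "%x. abs (det (matrix (T' x))) * ind S x"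
 have iff: "T ` S : lmeasurable & measure lebesgue (T ` S) = I <-> (?d has_integral I) S" for I
  by (rule has_measure_differentiable_image[OF _ hasD_within[OF T] inj]) (use S in auto)
 have res: "(?d has_integral I) S <-> (?f has_integral I) UNIV" for I
  using has_integral_restrict_UNIV[of S ?d I] by (simp add:indicator_def if_distrib of_bool_def cong:if_cong)
 show ?thesis proof (cases "(NN lborel (%x. ennreal (?f x))) < \<infinity>")
  case True
  hence "integrable lborel ?f" using m by (intro integrableI_nonneg) auto
  from has_integral_integral_lborel[OF this]
  have "T ` S : lmeasurable" "measure lebesgue (T ` S) = integral\<^sup>L lborel ?f" using iff res by auto
  moreover have "(NN lborel (%x. ennreal (?f x))) = ennreal (integral\<^sup>L lborel ?f)"
   by (rule nn_integral_eq_integral) (use `integrable lborel ?f` in auto)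
  moreover have "em lebesgue (T ` S) = em lborel (T ` S)" using TS by (simp add:main_part_sets)
  ultimately show ?thesis using fmeasurableD2 emeasure_eq_ennreal_measure by metis
 next
  case False
  have "~ em lborel (T ` S) < \<infinity>" proof
   assume "em lborel (T ` S) < \<infinity>"
   hence "T ` S : lmeasurable" using TS by (simp add:fmeasurable_def)
   then obtain I where "(?f has_integral I) UNIV" using iff res by blast
   from nn_integral_has_integral_lborel[OF _ _ this] m False show False by simp
  qed
  thus ?thesis using False by (simp add:not_less top_unique)
 qed
qed

lemma emeasure_reindex:
 fixes e :: "'m::finite => 'n::finite"
 assumes e: "bij e" and B: "B : sets borel"
 shows "em lborel ((%x::real^'n. \<chi> j. x $ e j) -` B) = em lborel B" proof -
 let ?P = "%x::real^'n. (\<chi> j. x $ e j) :: real^'m"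
 have lin: "linear ?P" by (rule linearI) (auto simp:vec_eq_iff)
 hence c: "cont_on UNIV ?P" by (simp add:linear_continuous_on linear_linear)
 have "lborel = distr lborel borel ?P" proof (rule lborel_eqI)
  fix l u :: "real^'m" assume lu: "!!b. b : Basis ==> l <.> b <= u <.> b"
  have le: "l $ i <= u $ i" for i using lu[of "axis i 1"] by (simp add:inner_axis)
  let ?I = "%y::real^'m. (\<chi> i. y $ inv e i) :: real^'n"
  have bx: "?P -` box l u = box (?I l) (?I u)" proof (rule set_eqI)
   fix x :: "real^'n"
   have "(ALL i. l $ i < x $ e i & x $ e i < u $ i) <-> (ALL i. l $ inv e i < x $ i & x $ i < u $ inv e i)"
    using e by (metis bij_inv_eq_iff)
   thus "x : ?P -` box l u <-> x : box (?I l) (?I u)" by (simp add:mem_box_cart)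
  qed
  have P: "prod f Basis = (PROD i:UNIV. f (axis i 1))" for f :: "real^'k::finite => real" proof -
   have "Basis = range (%i::'k. axis i (1::real))" by (auto simp:Basis_vec_def)
   thus ?thesis using prod.reindex[of "%i::'k. axis i (1::real)" UNIV f] by (simp add:inj_on_def axis_eq_axis)
  qed
  have "em (distr lborel borel ?P) (box l u) = em lborel (box (?I l) (?I u))"
   using c by (subst emeasure_distr) (auto simp:bx intro:cont_BM)
  also have "... = ennreal (PROD b:Basis. (?I u - ?I l) <.> b)"
   by (rule emeasure_lborel_box) (use le in "auto simp:Basis_vec_def inner_axis")
  also have "(PROD b:Basis. (?I u - ?I l) <.> b) = (PROD b:Basis. (u - l) <.> b)"
   unfolding P using prod.reindex_bij_betw[OF bij_imp_bij_inv[OF e], of "%i. u $ i - l $ i"] by (simp add:inner_axis)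
  finally show "em (distr lborel borel ?P) (box l u) = ennreal (PROD b:Basis. (u - l) <.> b)" .
 qed simp
 hence "em lborel B = em (distr lborel borel ?P) B" by simp
 also have "... = em lborel (?P -` B)" using c B by (subst emeasure_distr) (auto intro:cont_BM)
 finally show ?thesis by simp
qed

lemma emeasure_image:
 fixes T :: "real^'n::finite => real^'n"
 assumes S: "S : sets borel" and T: "!!x. x : S ==> (T hasD T' x) (at x)" and inj: "inj_on T S"
  and m: "(%x. abs (det (matrix (T' x))) * ind S x) : BM" and TS: "T ` S : sets borel"
 shows "em lborel (T ` S) = (NN lborel (%x. ennreal (abs (det (matrix (T' x))) * ind S x)))" proof -
 obtain e :: "'n idx => 'n" where e: "bij e"
  using finite_same_card_bij[of "UNIV :: 'n idx set" "UNIV :: 'n set"] card_idx by auto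
 define P where "P x = (\<chi> j. x $ e j)" for x :: "real^'n"
 define Q where "Q y = (\<chi> i. y $ inv e i)" for y :: "real^'n idx"
 have ie: "inv e (e i) = i" "e (inv e j) = j" for i j using e by (simp_all add:bij_def surj_f_inv_f)
 have PQ: "P (Q y) = y" "Q (P x) = x" for x y by (simp_all add:P_def Q_def vec_eq_iff ie)
 have lP: "linear P" and lQ: "linear Q" by (rule linearI; simp add:P_def Q_def vec_eq_iff)+
 have cP: "cont_on UNIV P" and cQ: "cont_on UNIV Q" using lP lQ by (simp_all add:linear_continuous_on linear_linear)
 have mP: "P : BM" and mQ: "Q : BM" by (rule cont_BM; fact)+
 have P: "em lborel (P -` B) = em lborel B" if "B : sets borel" for B
  using emeasure_reindex[OF e that] by (simp add:P_def[abs_def])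
 have d: "distr lborel borel P = lborel" by (rule measure_eqI) (use P mP in "auto simp:emeasure_distr")
 have im: "P ` B = Q -` B" for B using PQ by (auto simp:image_iff) (metis PQ)+
 have imb: "P ` B : sets borel" if "B : sets borel" for B unfolding im using measurable_sets[OF mQ that] by simp
 define U where "U y = P (T (Q y))" for y
 define U' where "U' y h = P (T' (Q y) (Q h))" for y h
 have det: "det (matrix (U' (P x))) = det (matrix (T' x))" if "x : S" for x proof -
  have "matrix (U' (P x)) = (\<chi> i j. matrix (T' x) $ e i $ e j)" proof -
   have "Q (axis j 1) = axis (e j) 1" for j by (auto simp:Q_def vec_eq_iff axis_def ie)
   note Qa = this
   show ?thesis unfolding matrix_def U'_def PQ Qa by (simp add:P_def)
  qed
  thus ?thesis using det_reindex[OF e] by simp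
 qed
 have ind: "ind (P ` S) (P x) = (ind S x :: real)" for x by (simp add:im PQ indicator_def)
 have fe: "abs (det (matrix (U' y))) * ind (P ` S) y = abs (det (matrix (T' (Q y)))) * ind S (Q y)" for y
  using det[of "Q y"] ind[of "Q y"] by (cases "Q y : S") (simp_all add:PQ im)
 have US: "U ` P ` S = P ` T ` S" by (auto simp:U_def PQ image_iff)
 have "em lborel (T ` S) = em lborel (U ` P ` S)"
  using P[OF imb[OF TS]] by (simp add:US inj_vimage_image_eq inj_on_inverseI[of _ Q] PQ)
 also have "... = (NN lborel (%y. ennreal (abs (det (matrix (U' y))) * ind (P ` S) y)))"
 proof (rule emeasure_image_wellorder)
  show "P ` S : sets borel" "U ` P ` S : sets borel" using imb S TS by (auto simp:US)
  show "inj_on U (P ` S)" using inj by (auto simp:inj_on_def U_def PQ) (metis PQ(2))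
  show "(%y. abs (det (matrix (U' y))) * ind (P ` S) y) : BM" unfolding fe using measurable_compose[OF mQ m] .
  fix y assume "y : P ` S"
  hence "Q y : S" by (auto simp:PQ)
  show "(U hasD U' y) (at y)" unfolding U_def[abs_def] U'_def[abs_def]
   by (rule hasD_compose[OF hasD_compose[OF linear_imp_has_derivative[OF lQ] T[OF `Q y : S`]] linear_imp_has_derivative[OF lP]])
 qed
 also have "... = (NN (distr lborel borel P) (%y. ennreal (abs (det (matrix (T' (Q y)))) * ind S (Q y))))"
  unfolding fe d ..
 also have "... = (NN lborel (%x. ennreal (abs (det (matrix (T' x))) * ind S x)))"
  using measurable_compose[OF mQ m] mP by (subst nn_integral_distr) (simp_all add:PQ)
 finally show ?thesis .
qed

lemma nn_integral_image:
 fixes T :: "real^'n::finite => real^'n"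
 assumes W: "open W" "open (T ` W)" and T: "!!x. x : W ==> (T hasD T' x) (at x)"
  and G: "cont_on (T ` W) G" "!!x. x : W ==> G (T x) = x"
  and d: "cont_on W (%x. det (matrix (T' x)))" and f: "f : BM"
 shows "(NN lborel (%y. f y * ind (T ` W) y)) = (NN lborel (%x. ennreal \<bar>det (matrix (T' x))\<bar> * f (T x) * ind W x))"
proof -
 \<comment> \<open>Extended by 0 off \<open>W\<close> to be Borel on the whole space; the density
   used below vanishes there.\<close>
 define T0 where "T0 x = (if x : W then T x else 0)" for x
 have Wb: "W : sets borel" "T ` W : sets borel" using W by auto
 have cT: "cont_on W T" using T has_derivative_continuous cont_onI by blast
 have m0: "T0 : BM" unfolding T0_def[abs_def] using cont_if_BM[OF Wb(1) cT, of "%_. 0"] by simp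
 have md: "(%x. abs (det (matrix (T' x))) * ind S x) : BM" if S: "S : sets borel" "S <= W" for S proof -
  have "(%x. if x : W then \<bar>det (matrix (T' x))\<bar> else 0) : BM"
   by (rule cont_if_BM[OF Wb(1)]) (auto intro!:continuous_intros d)
  hence "(%x. (if x : W then \<bar>det (matrix (T' x))\<bar> else 0) * ind S x) : BM" using S by simp
  moreover have "(%x. (if x : W then \<bar>det (matrix (T' x))\<bar> else 0) * ind S x) = (%x. abs (det (matrix (T' x))) * ind S x)"
   using S(2) by (auto simp:fun_eq_iff split:split_indicator)
  ultimately show ?thesis by simp
 qed
 let ?ph = "%x. ennreal (abs (det (matrix (T' x))) * ind W x)"
 have mph: "?ph : BM" using md[OF Wb(1)] by simp
 have inj: "inj_on T W" using G(2) by (metis inj_onI)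
 have "distr (density lborel ?ph) borel T0 = density lborel (ind (T ` W))" proof (rule measure_eqI)
  fix B assume "B : sets (distr (density lborel ?ph) borel T0)"
  hence B: "B : sets borel" by simp
  define S where "S = W Int T0 -` B"
  have S: "S : sets borel" "S <= W" using measurable_sets[OF m0 B] Wb by (auto simp:S_def)
  have TS: "T ` S = T ` W Int B" using G(2) by (auto simp:S_def T0_def)
  have "em (distr (density lborel ?ph) borel T0) B = (NN lborel (%x. ?ph x * ind (T0 -` B) x))"
   using B m0 mph measurable_sets[OF m0 B] by (simp add:emeasure_distr emeasure_density)
  also have "... = (NN lborel (%x. ennreal (abs (det (matrix (T' x))) * ind S x)))"
   by (intro nn_integral_cong) (auto simp:S_def split:split_indicator)
  also have "... = em lborel (T ` S)"
   by (rule emeasure_image[symmetric]) (use S T inj md Wb B in "auto simp:TS inj_on_subset")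
  also have "... = em (density lborel (ind (T ` W))) B"
   using B Wb by (simp add:TS emeasure_density indicator_inter_arith[symmetric] )
  finally show "em (distr (density lborel ?ph) borel T0) B = em (density lborel (ind (T ` W))) B" .
 qed simp
 hence "(NN (density lborel (ind (T ` W))) (%y. f y)) = (NN (distr (density lborel ?ph) borel T0) (%y. f y))" by simp
 also have "... = (NN lborel (%x. ?ph x * f (T0 x)))"
  using f m0 mph by (simp add:nn_integral_distr nn_integral_density measurable_compose)
 also have "... = (NN lborel (%x. ennreal \<bar>det (matrix (T' x))\<bar> * f (T x) * ind W x))"
  by (intro nn_integral_cong) (auto simp:T0_def split:split_indicator)
 also have "(NN (density lborel (ind (T ` W))) (%y. f y)) = (NN lborel (%y. f y * ind (T ` W) y))"
  using f Wb by (simp add:nn_integral_density mult.commute)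
 finally show ?thesis .
qed

lemma nn_integral_linear_image:
 fixes T :: "real^'n::finite => real^'n"
 assumes T: "linear T" "det (matrix T) ~= 0" and f: "f : BM"
 shows "(NN lborel (%y. f y)) = ennreal \<bar>det (matrix T)\<bar> * (NN lborel (%x. f (T x)))" proof -
 have inj: "inj T" using T det_nz_iff_inj by blast
 hence surj: "surj T" using T(1) linear_injective_imp_surjective by blast
 obtain R where R: "linear R" "R o T = id" using linear_injective_left_inverse[OF T(1) inj] by blast
 hence c: "cont_on UNIV R" by (simp add:linear_continuous_on linear_linear)
 have mT: "T : BM" using T(1) by (intro cont_BM) (simp add:linear_continuous_on linear_linear)
 have "(NN lborel (%y. f y * ind (T ` UNIV) y)) = (NN lborel (%x. ennreal \<bar>det (matrix T)\<bar> * f (T x) * ind UNIV x))"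
  by (rule nn_integral_image[where G = R and T' = "%_. T"])
   (use surj R c f linear_imp_has_derivative[OF T(1)] pointfree_idE in auto)
 moreover have "(NN lborel (%x. ennreal \<bar>det (matrix T)\<bar> * f (T x))) = ennreal \<bar>det (matrix T)\<bar> * (NN lborel (%x. f (T x)))"
  by (rule nn_integral_cmult) (use measurable_compose[OF mT f] in simp)
 ultimately show ?thesis using surj by (simp only: indicator_UNIV mult_1_right)
qed

section \<open>The Riemannian volume\<close>

context riem_compact
begin

lemma det_g_pos: "c : A ==> x : img c ==> det (g c x) > 0"
 by (rule pos_def_det_pos) (auto intro:metric_field.pos[OF mf] simp:metric_field.sym[OF mf])

lemma det_g_Ck: "c : A ==> Ck_on k (img c) (%x. det (g c x))" by (intro Ck_det metric_field.entry_Ck[OF mf] open_img)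

definition "vd c x = sqrt (det (g c x))"

lemma vd_transition:
 assumes "c : A" "d : A" "p : dom_ch c" "p : dom_ch d"
 shows "vd c (map_ch c p) = abs (det (matrix (L c d p))) * vd d (map_ch d p)" proof -
 have "g c (map_ch c p) = transpose (matrix (L c d p)) ** g d (transition c d (map_ch c p)) ** matrix (L c d p)"
  using metric assms ov_memI[OF assms(3,4)] unfolding riemannian_metric_def jacobian_matrix_def L_def by blast
 hence "det (g c (map_ch c p)) = (det (matrix (L c d p)))^2 * det (g d (map_ch d p))"
  by (simp add:trans_map assms det_mul det_transpose sq_eq mult_ac)
 thus ?thesis by (simp add:vd_def real_sqrt_mult)
qed

text \<open>An extension to all of \<open>real^'n\<close>, Borel measurable as needed for
  \<open>distr\<close>; the value outside the image of the chart is immaterial because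
  \<open>vdens\<close> is 0 there.\<close>

definition "inv0 c x = (if x : img c then inv_ch c x else undefined)"

lemma inv0_meas: "c : A ==> inv0 c : BM"
 unfolding inv0_def[abs_def] using open_img inv_cont by (intro cont_if_BM) auto

lemma img_borel [measurable]: "c : A ==> img c : sets borel" and dom_borel: "c : A ==> dom_ch c : sets borel"
 using open_img open_dom by auto

definition "vdens c x = (if x : img c then vd c x else 0)"

lemma vdens_meas: "c : A ==> vdens c : BM" unfolding vdens_def[abs_def] vd_def
 by (intro cont_if_BM continuous_on_real_sqrt Ck_cont[OF det_g_Ck[where k = 0]] img_borel) auto

text \<open>The Riemannian volume of one chart, pushed to the whole manifold; nothing of its mass
  lies outside the chart domain.\<close>

definition "cvol c = distr (density lborel (vdens c)) borel (inv0 c)"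

lemma cvol_emeasure:
 assumes c: "c : A" and B: "B : sets borel"
 shows "em (cvol c) B = (NN lborel (%x. ennreal (vdens c x) * ind B (inv0 c x)))" proof -
 note [measurable] = inv0_meas[OF c] vdens_meas[OF c]
 have m: "inv0 c -` B : sets borel" using measurable_sets[OF inv0_meas[OF c] B] by simp
 have "em (cvol c) B = (NN lborel (%x. ennreal (vdens c x) * ind (inv0 c -` B) x))"
  using B m unfolding cvol_def by (simp add:emeasure_distr emeasure_density)
 thus ?thesis unfolding indicator_vimage by simp
qed

lemma cvol_emeasure_dom:
 assumes c: "c : A" and B: "B : sets borel" "B <= dom_ch c"
 shows "em (cvol c) B = (NN lborel (%x. ennreal (sqrt (det (g c x))) * ind (map_ch c ` B) x))"
 unfolding cvol_emeasure[OF c B(1)] proof (rule nn_integral_cong)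
 fix x
 have "x : map_ch c ` B <-> x : img c & inv_ch c x : B"
  using B(2) inv_map[OF c] by (auto simp:image_iff map_inv[OF c])
 thus "ennreal (vdens c x) * ind B (inv0 c x) = ennreal (sqrt (det (g c x))) * ind (map_ch c ` B) x"
  by (auto simp:vdens_def vd_def inv0_def split:split_indicator)
qed

text \<open>Change of variables under the transition map, whose Jacobian is exactly the ratio of the
  two densities (\<open>vd_transition\<close>).\<close>

lemma cvol_agree:
 assumes c: "c : A" "d : A" and B: "B : sets borel" "B <= dom_ch c Int dom_ch d"
 shows "em (cvol c) B = em (cvol d) B" proof -
 let ?f = "%y. ennreal (vdens d y) * ind B (inv0 d y)"
 note [measurable] = inv0_meas[OF c(2)] vdens_meas[OF c(2)] B(1)
 have T: "transition c d ` ov c d = ov d c" using c by (auto simp:trans_map image_iff)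
 have "em (cvol d) B = (NN lborel (%y. ?f y * ind (transition c d ` ov c d) y))"
  unfolding cvol_emeasure[OF c(2) B(1)] T proof (rule nn_integral_cong)
  fix y
  have "y : ov d c" if "inv0 d y : B" "y : img d"
   using that B(2) map_inv[OF c(2) that(2)] ov_memI[of "inv_ch d y" d c] by (auto simp:inv0_def)
  thus "?f y = ?f y * ind (ov d c) y" by (auto simp:vdens_def split:split_indicator)
 qed
 also have "... = (NN lborel (%x. ennreal \<bar>det (matrix (Df (transition c d) x))\<bar> * ?f (transition c d x) * ind (ov c d) x))"
 proof (rule nn_integral_image[where G = "transition d c"])
  show "open (ov c d)" "open (transition c d ` ov c d)" using ov_open c by (auto simp:T)
  show "(transition c d hasD Df (transition c d) x) (at x)" if "x : ov c d" for x
   using Ck_hasD[OF trans_Ck[OF c, of "Suc 0"] that] .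
  show "cont_on (transition c d ` ov c d) (transition d c)"
   unfolding T using Ck_cont[OF trans_Ck[OF c(2,1), of 0]] .
  show "transition d c (transition c d x) = x" if "x : ov c d" for x using that c by (auto simp:trans_map)
  have "Ck_on 0 (ov c d) (%x. det (matrix (Df (transition c d) x)))" unfolding matrix_def
   by (intro Ck_det ov_open c) (simp del:Ck_on.simps, intro Ck_vec_nth ov_open c Ck_D[OF trans_Ck])
  thus "cont_on (ov c d) (%x. det (matrix (Df (transition c d) x)))" by simp
 qed simp
 also have "... = em (cvol c) B" unfolding cvol_emeasure[OF c(1) B(1)] proof (rule nn_integral_cong)
  fix x
  show "ennreal \<bar>det (matrix (Df (transition c d) x))\<bar> * ?f (transition c d x) * ind (ov c d) x =
    ennreal (vdens c x) * ind B (inv0 c x)" proof (cases "x : ov c d")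
   case True
   then obtain p where p: "x = map_ch c p" "p : dom_ch c" "p : dom_ch d" by auto
   thus ?thesis using vd_transition[OF c p(2,3)] c
    by (simp add:trans_map vdens_def inv0_def inv_map L_def ennreal_mult'' ennreal_mult' mult.assoc)
  next
   case False
   have "inv0 c x ~: B" if "x : img c"
    using False that B(2) map_inv[OF c(1) that] ov_memI[of "inv_ch c x" c d] by (auto simp:inv0_def)
   thus ?thesis using False by (auto simp:vdens_def)
  qed
 qed
 finally show ?thesis ..
qed

text \<open>Finitely many coordinate balls whose closures stay inside chart images. The compact
  closures give bounds, for finite volume and for continuous functions, and later the supports of a
  partition of unity.\<close>

definition "ball_cover F <-> finite F & (ALL c x dta. (c, x, dta) : F --> c : A & dta > 0 & cball x dta <= img c)
 & (ALL p. EX c x dta. (c, x, dta) : F & p : dom_ch c & dist (map_ch c p) x < dta)"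

lemma ball_cover_exists: "EX F. ball_cover F" proof -
 let ?I = "{(c, x, dta). c : A & dta > 0 & cball x dta <= img c}"
 let ?N = "%(c, x, dta). dom_ch c Int map_ch c -` ball x dta"
 have 1: "open (?N t)" if "t : ?I" for t
  using that open_preimage[OF map_cont open_dom] by (auto split:prod.splits)
 have 2: "UNIV <= (UN t:?I. ?N t)" proof
  fix p
  let ?c = "chA p"
  obtain dta where "dta > 0" "cball (map_ch ?c p) dta <= img ?c"
   using open_img[OF chart_at(1)] chart_at(2)[of p] open_contains_cball by blast
  thus "p : (UN t:?I. ?N t)" using chart_at by (intro UN_I[of "(?c, map_ch ?c p, dta)"]) auto
 qed
 obtain F where F: "F <= ?I" "finite F" "UNIV <= (UN t:F. ?N t)" by (rule compactE_image[OF compact_M 1 2])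
 have "ball_cover F" unfolding ball_cover_def proof (intro conjI allI F(2))
  fix p
  obtain t where t: "t : F" "p : ?N t" using F(3) by blast
  show "EX c x dta. (c, x, dta) : F & p : dom_ch c & dist (map_ch c p) x < dta"
   by (rule exI[of _ "fst t"], rule exI[of _ "fst (snd t)"], rule exI[of _ "snd (snd t)"])
    (use t in "auto simp:dist_commute split:prod.splits")
 qed (use F(1) in auto)
 thus ?thesis ..
qed

definition "BC = (SOME F. ball_cover F)"

lemma BC: "finite BC" "(c, x, dta) : BC ==> c : A" "(c, x, dta) : BC ==> dta > 0" "(c, x, dta) : BC ==> cball x dta <= img c"
 "EX c x dta. (c, x, dta) : BC & p : dom_ch c & dist (map_ch c p) x < dta" proof -
 have "ball_cover BC" unfolding BC_def by (rule someI_ex[OF ball_cover_exists])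
 thus "finite BC" "(c, x, dta) : BC ==> c : A" "(c, x, dta) : BC ==> dta > 0" "(c, x, dta) : BC ==> cball x dta <= img c"
  "EX c x dta. (c, x, dta) : BC & p : dom_ch c & dist (map_ch c p) x < dta" unfolding ball_cover_def by blast+
qed

text \<open>A finite Borel partition subordinate to charts. Unlike a cover it lets measures of
  charts be added without overlap.\<close>

definition "pieces cD <-> (ALL i < length cD. fst (cD ! i) : A & snd (cD ! i) : sets borel & snd (cD ! i) <= dom_ch (fst (cD ! i)))
 & (ALL p. EX! i. i < length cD & p : snd (cD ! i))"

lemma pieces_exist: "EX cD. pieces cD" proof -
 obtain l where l: "set l = fst ` BC" by (rule exE[OF finite_list[OF finite_imageI[OF BC(1), of fst]]])
 have lA: "l ! i : A" if "i < length l" for i proof -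
  have "l ! i : fst ` BC" using that l nth_mem by blast
  thus ?thesis using BC(2) by auto
 qed
 define D where "D i = dom_ch (l ! i) - (\<Union>j<i. dom_ch (l ! j))" for i
 let ?cD = "map (%i. (l ! i, D i)) [0..<length l]"
 have "EX! i. i < length l & p : D i" for p proof -
  let ?P = "%i. i < length l & p : dom_ch (l ! i)"
  obtain c x dta where "(c, x, dta) : BC" "p : dom_ch c" using BC(5) by blast
  hence "c : set l" "p : dom_ch c" unfolding l by force+
  hence "EX i. ?P i" by (metis in_set_conv_nth)
  then obtain m where m: "?P m" "ALL j<m. ~ ?P j" using exists_least_iff[of ?P] by auto
  show ?thesis proof (rule ex1I[of _ m])
   show "m < length l & p : D m" using m by (auto simp:D_def)
   fix j assume j: "j < length l & p : D j"
   hence "~ m < j" using m(1) by (auto simp:D_def)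
   moreover have "~ j < m" using m(2) j by (auto simp:D_def)
   ultimately show "j = m" by simp
  qed
 qed
 moreover have "D i : sets borel" if "i < length l" for i
  unfolding D_def using that by (intro sets.Diff sets.finite_UN dom_borel lA) auto
 moreover have "D i <= dom_ch (l ! i)" for i by (auto simp:D_def)
 ultimately have "pieces ?cD" using lA by (simp add:pieces_def cong:conj_cong)
 thus ?thesis ..
qed

definition "cD = (SOME cD. pieces cD)"
definition "nD = length cD"
definition "ch i = fst (cD ! i)"
definition "D i = snd (cD ! i)"

lemma ch: "i < nD ==> ch i : A" and D_borel: "i < nD ==> D i : sets borel" and D_dom: "i < nD ==> D i <= dom_ch (ch i)"
 and D_ex1: "EX! i. i < nD & p : D i" proof -
 have "pieces cD" unfolding cD_def by (rule someI_ex[OF pieces_exist])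
 thus "i < nD ==> ch i : A" "i < nD ==> D i : sets borel" "i < nD ==> D i <= dom_ch (ch i)" "EX! i. i < nD & p : D i"
  by (simp_all add:pieces_def ch_def D_def nD_def)
qed

lemma D_unique: "i < nD ==> j < nD ==> p : D i ==> p : D j ==> i = j" using D_ex1[of p] by auto

lemma sum_D:
 fixes f :: "nat => 'b::semiring_1"
 assumes "i < nD" "p : D i"
 shows "(\<Sum>i<nD. ind (D i) p * f i) = f i" proof -
 have "(\<Sum>j<nD. ind (D j) p * f j) = (SUM j:{i}. ind (D j) p * f j)"
  by (rule sum.mono_neutral_right) (use assms D_ex1 in "auto simp:indicator_def")
 thus ?thesis using assms by simp
qed

lemma emeasure_pieces:
 assumes M: "sets M = sets borel" and B: "B : sets borel"
 shows "em M B = (\<Sum>i<nD. em M (B Int D i))" proof -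
 have "em M (UN i:{..<nD}. B Int D i) = (\<Sum>i<nD. em M (B Int D i))" by (rule sum_emeasure[symmetric])
   (use M B D_borel D_unique in "auto simp:disjoint_family_on_def")
 moreover have "(UN i:{..<nD}. B Int D i) = B" using D_ex1 by blast
 ultimately show ?thesis by simp
qed

definition "is_volume M <-> sets M = sets borel &
 (ALL c:A. ALL B:sets borel. B <= dom_ch c --> em M B = em (cvol c) B)"

text \<open>Justifies the definite description in \<open>volume_measure\<close>. The measure is the
  sum of chart volumes over the partition; \<open>cvol_agree\<close> makes it correct in every
  chart, and any competitor is determined by the pieces.\<close>

lemma volume_exists: "EX! M. is_volume M" proof -
 define m where "m B = (\<Sum>i<nD. em (cvol (ch i)) (B Int D i))" for B
 define M where "M = measure_of UNIV (sets (borel :: 'a measure)) m"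
 have sc: "sets (cvol c) = sets borel" for c by (simp add:cvol_def)
 have sM: "sets M = sets borel" unfolding M_def using sets.sigma_sets_eq[of "borel :: 'a measure"] by simp
 have em: "em M B = m B" if "B : sets borel" for B proof (rule emeasure_measure_of[OF M_def])
  show "positive (sets M) m" by (simp add:positive_def m_def)
  show "countably_additive (sets M) m" unfolding countably_additive_def sM proof safe
   fix X :: "nat => 'a set" assume X: "range X <= sets borel" "disjoint_family X"
   have "(\<Sum>j. m (X j)) = (\<Sum>i<nD. \<Sum>j. em (cvol (ch i)) (X j Int D i))"
    unfolding m_def by (rule suminf_sum) (rule summableI)
   also have "... = (\<Sum>i<nD. em (cvol (ch i)) (\<Union>j. X j Int D i))"
    by (intro sum.cong refl suminf_emeasure) (use X D_borel in "auto simp:disjoint_family_on_def sc")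
   also have "... = m (\<Union>j. X j)" by (simp add:m_def)
   finally show "(\<Sum>j. m (X j)) = m (\<Union>j. X j)" .
  qed
  show "B : sets M" using that sM by simp
 qed auto
 have vM: "is_volume M" unfolding is_volume_def proof (intro conjI ballI impI sM)
  fix c B assume c: "c : A" and B: "B : sets borel" "B <= dom_ch c"
  have "em M B = (\<Sum>i<nD. em (cvol (ch i)) (B Int D i))" by (simp add:em[OF B(1)] m_def)
  also have "... = (\<Sum>i<nD. em (cvol c) (B Int D i))"
   by (intro sum.cong refl cvol_agree) (use c B ch D_borel D_dom in "auto simp:subset_eq")
  also have "... = em (cvol c) B" by (rule emeasure_pieces[symmetric]) (use sc B in auto)
  finally show "em M B = em (cvol c) B" .
 qed
 moreover have "M' = M" if M': "is_volume M'" for M' proof (rule measure_eqI)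
  show "sets M' = sets M" using M' sM by (simp add:is_volume_def)
  fix B assume "B : sets M'"
  hence B: "B : sets borel" using M' by (simp add:is_volume_def)
  have "em M' B = (\<Sum>i<nD. em M' (B Int D i))"
   by (rule emeasure_pieces) (use B M' in "auto simp:is_volume_def")
  also have "... = (\<Sum>i<nD. em (cvol (ch i)) (B Int D i))" proof (rule sum.cong[OF refl])
   fix i assume "i : {..<nD}"
   thus "em M' (B Int D i) = em (cvol (ch i)) (B Int D i)"
    using M' ch[of i] D_borel[of i] D_dom[of i] B unfolding is_volume_def by (simp add:le_infI2 sets.Int)
  qed
  finally show "em M' B = em M B" by (simp add:em[OF B] m_def)
 qed
 ultimately show ?thesis by (rule ex1I)
qed

abbreviation "vol == volume_measure A g"

lemma vol: "sets vol = sets borel" "c : A ==> B : sets borel ==> B <= dom_ch c ==> em vol B = em (cvol c) B"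
proof -
 have "volume_measure A g = (THE M. is_volume M)"
  unfolding volume_measure_def is_volume_def by (rule arg_cong[where f = The]) (auto simp:cvol_emeasure_dom fun_eq_iff)
 hence "is_volume vol" using theI'[OF volume_exists] by simp
 thus "sets vol = sets borel" "c : A ==> B : sets borel ==> B <= dom_ch c ==> em vol B = em (cvol c) B"
  by (auto simp:is_volume_def)
qed

lemma space_vol [simp]: "space vol = UNIV" using sets_eq_imp_space_eq[OF vol(1)] by simp

lemma vol_chart:
 fixes f :: "'a => ennreal"
 assumes c: "c : A" and f: "f : BM"
 shows "(NN vol (%p. f p * ind (dom_ch c) p)) = (NN lborel (%x. vdens c x * f (inv0 c x)))" proof -
 have d: "density vol (ind (dom_ch c)) = cvol c" proof (rule measure_eqI)
  show "sets (density vol (ind (dom_ch c))) = sets (cvol c)" by (simp add:cvol_def vol)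
  fix B assume "B : sets (density vol (ind (dom_ch c)))"
  hence B: "B : sets borel" by (simp add:vol)
  have "em (density vol (ind (dom_ch c))) B = em vol (dom_ch c Int B)"
   using B dom_borel[OF c] by (simp add:emeasure_density vol indicator_inter_arith[symmetric] borel_measurable_indicator measurable_cong_sets[OF vol(1) refl])
  also have "... = em (cvol c) (dom_ch c Int B)" by (rule vol(2)) (use c B dom_borel in auto)
  also have "... = em (cvol c) B"
   unfolding cvol_emeasure[OF c B] cvol_emeasure[OF c sets.Int[OF dom_borel[OF c] B]]
   by (intro nn_integral_cong) (auto simp:vdens_def inv0_def inv_in[OF c] split:split_indicator)
  finally show "em (density vol (ind (dom_ch c))) B = em (cvol c) B" .
 qed
 have "(NN vol (%p. f p * ind (dom_ch c) p)) = (NN (density vol (ind (dom_ch c))) (%p. f p))"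
  using f dom_borel[OF c] by (simp add:nn_integral_density measurable_cong_sets[OF vol(1) refl] mult.commute)
 also have "... = (NN lborel (%x. vdens c x * f (inv0 c x)))"
  unfolding d cvol_def using f inv0_meas[OF c] vdens_meas[OF c]
  by (simp add:nn_integral_distr nn_integral_density measurable_compose)
 finally show ?thesis .
qed

lemma vol_finite: "em vol UNIV < \<infinity>" proof -
 let ?N = "%(c, x, dta). dom_ch c Int map_ch c -` ball x dta"
 have fin: "?N t : sets vol & em vol (?N t) < \<infinity>" if "t : BC" for t proof -
  obtain c x dta where t: "t = (c, x, dta)" by (cases t)
  have c: "c : A" "cball x dta <= img c" using BC(2,4) that t by auto
  have o: "open (?N t)" unfolding t using open_preimage[OF map_cont[OF c(1)] open_dom[OF c(1)]] by auto
  have "cont_on (cball x dta) (vd c)"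
   unfolding vd_def[abs_def] by (intro continuous_on_real_sqrt cont_subset[OF Ck_cont[OF det_g_Ck[OF c(1), of 0]] c(2)])
  hence "bounded (vd c ` cball x dta)" by (intro compact_imp_bounded compact_image) auto
  then obtain b where b: "!!y. y : cball x dta ==> vd c y <= b" unfolding bounded_iff by (metis abs_le_D1 imageI real_norm_def)
  have "em vol (?N t) = (NN lborel (%y. ennreal (vd c y) * ind (map_ch c ` ?N t) y))"
   using o cvol_emeasure_dom[OF c(1), of "?N t"] vol(2)[OF c(1), of "?N t"] by (auto simp:t vd_def)
  also have "... <= (NN lborel (%y. ennreal b * ind (cball x dta) y))"
   by (intro nn_integral_mono) (use b in "auto simp:t split:split_indicator intro!:ennreal_leI")
  also have "... < \<infinity>" by (simp add:nn_integral_cmult_indicator ennreal_mult_less_top emeasure_bounded_finite[OF bounded_cball, simplified])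
  finally show ?thesis using o by (simp add:vol)
 qed
 have "(UN t:BC. ?N t) = UNIV" proof -
  have "p : (UN t:BC. ?N t)" for p using BC(5)[of p] by (force simp:dist_commute)
  thus ?thesis by blast
 qed
 hence "em vol UNIV <= (SUM t:BC. em vol (?N t))"
  using emeasure_subadditive_finite[OF BC(1), of ?N vol] fin by (auto simp:image_subset_iff)
 also have "... < \<infinity>" using fin BC(1) by simp
 finally show ?thesis .
qed

end

section \<open>The measure on the unit sphere bundle\<close>

lemma borel_measurable_fst: "(fst :: 'a::second_countable_topology \<times> 'b::second_countable_topology => 'a) : BM"
 and borel_measurable_snd: "(snd :: 'a * 'b => 'b) : BM" by (intro cont_BM continuous_intros)+

context riem_compact
begin

text \<open>The squared length of a tangent vector in chart components. The value 0 off
  \<open>TU c\<close> makes any positive value of \<open>nq\<close> certify that the point is in the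
  chart.\<close>

definition "nq c z = (if z : TU c then snd z <.> (g c (fst z) *v snd z) else 0)"

lemma nq_Ck: "c : A ==> Ck_on k (TU c) (nq c)" proof (rule Ck_cong[OF TU_open])
 assume c: "c : A"
 show "Ck_on k (TU c) (%z. snd z <.> (g c (fst z) *v snd z))"
  by (intro Ck_inner Ck_matvec Ck_snd Ck_ident TU_open[OF c]
   Ck_compose[OF TU_open[OF c] open_img[OF c] Ck_fst[OF TU_open[OF c] Ck_ident[OF TU_open[OF c]]] _ metric_field.h_Ck[OF mf[OF c]]])
   (auto simp:TU_def)
qed (auto simp:nq_def)

lemma nq_meas: "c : A ==> nq c : BM" proof -
 assume c: "c : A"
 have "nq c = (%z. if z : TU c then nq c z else 0)" by (auto simp:nq_def)
 moreover have "(%z. if z : TU c then nq c z else 0) : BM"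
  by (intro cont_if_BM Ck_cont[OF nq_Ck[OF c, of 0]]) (use TU_open[OF c] in auto)
 ultimately show ?thesis by simp
qed

lemma nq_pos: "c : A ==> z : TU c ==> snd z ~= 0 ==> nq c z > 0"
 by (auto simp:nq_def TU_iff intro:metric_field.pos[OF mf])

lemma nq_nonneg: "c : A ==> nq c z >= 0" using nq_pos[of c z] by (cases "z : TU c & snd z ~= 0") (auto simp:nq_def)

lemma nq_scale: "nq c (fst z, t *R snd z) = t^2 * nq c z" by (simp add:nq_def TU_iff mv_scaleR sq_eq)

lemma nq_one: "nq c z = 1 ==> z : TU c" and nq_gt: "0 < nq c z ==> z : TU c"
 by (simp_all add:nq_def split:if_splits)

lemma norm_at_nq:
 assumes "c : A" "p : dom_ch c"
 shows "nmA p v = sqrt (nq c (bch c (p, v)))"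
 using norm_at_chart[OF assms, of v] assms by (simp add:bch_eq nq_def TU_iff)

definition "nz c z = (fst z, snd z /\<^sub>R sqrt (nq c z))"

lemma nz_unit: "c : A ==> nq c z > 0 ==> nq c (nz c z) = 1"
 using nq_scale[of c z "inverse (sqrt (nq c z))"] by (simp add:nz_def power_inverse)

lemma nz_meas: "c : A ==> nz c : BM" proof -
 assume "c : A"
 note [measurable] = nq_meas[OF this]
 show ?thesis unfolding nz_def[abs_def]
  by (intro borel_measurable_Pair borel_measurable_fst borel_measurable_snd borel_measurable_scaleR) measurable
qed

abbreviation "SN == unit_sphere_bundle A g"

lemma ibc_SN: "c : A ==> z : TU c ==> ibc c z : SN <-> nq c z = 1"
 using norm_at_nq[OF _ fst_ibc, of c z "snd (ibc c z)"] bundle_ibc[of c z] nq_nonneg[of c z]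
 by (auto simp:unit_sphere_bundle_def TU_iff case_prod_beta)

lemma fst_ibc_eq: "fst (ibc c z) = inv_ch c (fst z)" by (simp add:ibc_def)

definition "TB c B = {z : TU c. ibc c z : B}"

lemma TB_image: "c : A ==> bch c ` {(p, th) : B. p : dom_ch c} = TB c B" proof -
 assume c: "c : A"
 have "bch c z : TB c B" if "z : B" "fst z : dom_ch c" for z
  using that ibc_bundle[OF c, of "fst z" "snd z"] bundle_fst[OF c, of "fst z" "snd z"] by (simp add:TB_def TU_iff)
 moreover have "z : bch c ` {(p, th) : B. p : dom_ch c}" if "z : TB c B" for z
  using that bundle_ibc[OF c, of z] fst_ibc[OF c, of z]
  by (intro image_eqI[of _ _ "ibc c z"]) (auto simp:TB_def TU_iff case_prod_beta)
 ultimately show ?thesis by auto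
qed

definition "SB = {B. B <= SN & (ALL c:A. TB c B : sets borel)}"

lemma unit_borel: "c : A ==> {z. nq c z = 1} : sets borel"
 using measurable_sets[OF nq_meas, of c "{1}"] by (simp add:vimage_def)

lemma TB_SN: "c : A ==> TB c SN = {z. nq c z = 1}" by (auto simp:TB_def ibc_SN nq_one)

lemma SB_sigma: "sigma_algebra SN SB" unfolding sigma_algebra_iff2 proof (intro conjI ballI allI impI)
 show "SB <= Pow SN" "{} : SB" by (auto simp:SB_def TB_def)
 show "SN - B : SB" if "B : SB" for B proof -
  have "TB c (SN - B) = TB c SN - TB c B" for c by (auto simp:TB_def)
  thus ?thesis using that unit_borel by (auto simp:SB_def TB_SN)
 qed
 fix X :: "nat => _" assume X: "range X <= SB"
 have "TB c (\<Union> (range X)) = (\<Union>i. TB c (X i))" for c by (auto simp:TB_def)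
 moreover have "(\<Union>i. TB c (X i)) : sets borel" if "c : A" for c
  using X that by (intro sets.countable_UN) (auto simp:SB_def)
 ultimately show "\<Union> (range X) : SB" using X by (auto simp:SB_def simp del:split_paired_All)
qed

abbreviation "mu == sphere_bundle_measure A g"

lemma mu_eq: "mu = measure_of SN SB (%B. \<integral>\<^sup>+ p. em (sphA p) {th. (p, th) : B} \<partial>vol)"
 unfolding sphere_bundle_measure_def SB_def by (simp add:TB_image cong:conj_cong ball_cong)

lemma sets_mu: "sets mu = SB" and space_mu: "space mu = SN" proof -
 have "SB <= Pow SN" by (auto simp:SB_def)
 thus "sets mu = SB" "space mu = SN" using sigma_algebra.sigma_sets_eq[OF SB_sigma] unfolding mu_eq by auto
qed

text \<open>The part of the punctured unit ball bundle lying radially over \<open>B\<close>.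
  \<open>sphere_measure\<close> is defined by solid balls, so integrals over the bundle become
  Lebesgue integrals over such sets, and no coordinates on spheres are needed.\<close>

definition "RB c B = {z. 0 < nq c z & nq c z < 1 & nz c z : TB c B}"

lemma RB_borel: "c : A ==> B : SB ==> RB c B : sets borel" proof -
 assume c: "c : A" and B: "B : SB"
 note [measurable] = nq_meas[OF c]
 have "nz c -` TB c B : sets borel" using measurable_sets[OF nz_meas[OF c], of "TB c B"] B c by (simp add:SB_def)
 moreover have "{z. 0 < nq c z & nq c z < 1} : sets borel" by measurable
 moreover have "RB c B = {z. 0 < nq c z & nq c z < 1} Int nz c -` TB c B" by (auto simp:RB_def)
 ultimately show ?thesis by (simp del:vimage_eq add:sets.Int)
qed

definition Th :: "('a, 'n) chart => ('a * (real^'n)) set => real^'n => ennreal"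
 where "Th c B x = ennreal (real CARD('n) * vdens c x) * (NN lborel (%w. ind (RB c B) (x, w)))"

lemma Th_meas: "c : A ==> B : SB ==> Th c B : BM" proof -
 assume c: "c : A" and B: "B : SB"
 note [measurable] = vdens_meas[OF c]
 have "(ind (RB c B) :: _ => ennreal) : BM" using RB_borel[OF c B] by simp
 hence "(%(x, w). ind (RB c B) (x, w) :: ennreal) : borel_measurable (borel \<Otimes>\<^sub>M lborel)"
  by (simp add:borel_prod[symmetric] cong:measurable_cong_sets sets_pair_measure_cong)
 from lborel.borel_measurable_nn_integral[OF this]
 show ?thesis unfolding Th_def[abs_def] by measurable
qed

lemma slice_meas: "(%w. (x, w)) : BM" for x :: "real^'n" by (intro cont_BM continuous_intros)

lemma sphere_measure_chart:
 assumes c: "c : A" and p: "p : dom_ch c" and B: "B : SB"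
 shows "em (sphA p) {th. (p, th) : B} = Th c B (map_ch c p)" "{th. (p, th) : B} : sets borel" proof -
 let ?x = "map_ch c p" and ?La = "L (chA p) c p" and ?N = "nmA p" and ?E = "{th. (p, th) : B}"
 let ?S = "{v. 0 < ?N v & ?N v < 1}" and ?f = "%v. v /\<^sub>R nmA p v"
 let ?k = "real CARD('n) * sqrt (det (grA p))"
 have lin: "linear ?La" by (rule L_linear[OF chart_at(1) c chart_at(2) p])
 have bc: "bch c (p, v) = (?x, ?La v)" for v by (rule bch_eq[OF c p])
 have xT: "(?x, w) : TU c" for w using p by (simp add:TU_iff)
 have TBi: "(?x, ?La v) : TB c B <-> (p, v) : B" for v using ibc_bundle[OF c p, of v] xT by (simp add:TB_def bc)
 have mL: "(%v. (?x, ?La v)) : BM"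
  by (intro cont_BM continuous_on_Pair continuous_intros) (use lin in "simp add:linear_continuous_on linear_linear")
 have TBb: "TB c B : sets borel" using B c by (simp add:SB_def)
 have "?E = (%v. (?x, ?La v)) -` TB c B" using TBi by auto
 thus E: "?E : sets borel" using measurable_sets[OF mL TBb] by simp
 have [measurable]: "?N : BM" by (rule cont_BM[OF norm_at_cont])
 have S: "?S : sets borel" by measurable
 have f: "?f : BM" by measurable
 have N: "?N v = sqrt (nq c (?x, ?La v))" for v using norm_at_nq[OF c p, of v] by (simp add:bc)
 have ind: "ind (?f -` ?E Int ?S) v = (ind (RB c B) (?x, ?La v) :: ennreal)" for v
  using TBi[of "?f v"] by (auto simp:RB_def nz_def N linear_scale[OF lin] split:split_indicator)
 have det: "det (matrix ?La) ~= 0"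
  using det_nz_iff_inj[OF lin] L_inverse[OF chart_at(1) c chart_at(2) p] by (metis injI)
 have "em (sphA p) ?E = ennreal ?k * em lborel (?f -` ?E Int ?S)" proof -
  have fE: "?f -` ?E : sets borel" using measurable_sets[OF f E] by simp
  show ?thesis unfolding sphere_measure_def using E S f fE
   by (subst emeasure_distr) (auto simp:space_scale_measure space_restrict_space emeasure_restrict_space
    measurable_cong_sets[OF sets_scale_measure refl] intro:measurable_restrict_space1)
 qed
 also have "... = ennreal ?k * (NN lborel (%v. ind (?f -` ?E Int ?S) v))"
  using measurable_sets[OF f E] S by simp
 also have "... = ennreal ?k * (NN lborel (%v. ind (RB c B) (?x, ?La v)))" by (simp only: ind)
 also have "?k = real CARD('n) * vdens c ?x * abs (det (matrix ?La))"
  using vd_transition[OF chart_at(1) c chart_at(2) p] p by (simp add:vdens_def gram_at_def coord_def vd_def)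
 also have "ennreal (real CARD('n) * vdens c ?x * abs (det (matrix ?La))) * (NN lborel (%v. ind (RB c B) (?x, ?La v))) = Th c B ?x"
  unfolding Th_def nn_integral_linear_image[OF lin det, of "%w. ind (RB c B) (?x, w)", OF measurable_compose[OF slice_meas borel_measurable_indicator[OF RB_borel[OF c B]]]]
  by (simp only: ennreal_mult''[OF abs_ge_zero]) (simp only: mult.assoc)
 finally show "em (sphA p) ?E = Th c B ?x" .
qed

definition "map0 c p = (if p : dom_ch c then map_ch c p else 0)"

lemma map0_meas: "c : A ==> map0 c : BM"
 unfolding map0_def[abs_def] by (intro cont_if_BM dom_borel map_cont) auto

lemma sphere_measure_meas:
 assumes B: "B : SB"
 shows "(%p. em (sphA p) {th. (p, th) : B}) : borel_measurable vol" proof -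
 have "em (sphA p) {th. (p, th) : B} = (\<Sum>i<nD. ind (D i) p * Th (ch i) B (map0 (ch i) p))" for p proof -
  obtain i where i: "i < nD" "p : D i" using D_ex1[of p] by auto
  show ?thesis unfolding sum_D[OF i] using sphere_measure_chart(1)[OF ch[OF i(1)] _ B, of p] D_dom[OF i(1)] i(2)
   by (auto simp:map0_def)
 qed
 moreover have "(%p. \<Sum>i<nD. ind (D i) p * Th (ch i) B (map0 (ch i) p)) : BM"
  by (intro borel_measurable_sum borel_measurable_times_ennreal borel_measurable_indicator D_borel
   measurable_compose[OF map0_meas Th_meas] ch B) auto
 ultimately show ?thesis by (simp add:measurable_cong_sets[OF vol(1) refl])
qed

lemma emeasure_mu:
 assumes B: "B : SB"
 shows "em mu B = (NN vol (%p. em (sphA p) {th. (p, th) : B}))" proof (rule emeasure_measure_of[OF mu_eq])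
 let ?m = "%B. \<integral>\<^sup>+p. em (sphA p) {th. (p, th) : B} \<partial>vol"
 show "SB <= Pow SN" by (auto simp:SB_def)
 show "B : sets mu" using B by (simp add:sets_mu)
 show "positive (sets mu) ?m" by (simp add:positive_def)
 show "countably_additive (sets mu) ?m" unfolding countably_additive_def sets_mu proof safe
  fix X :: "nat => ('a * (real^'n)) set" assume X: "range X <= SB" "disjoint_family X"
  have "(\<Sum>j. ?m (X j)) = (NN vol (%p. (\<Sum>j. em (sphA p) {th. (p, th) : X j})))"
   by (rule nn_integral_suminf[symmetric]) (use X sphere_measure_meas in blast)
  also have "... = ?m (\<Union> (range X))" proof (rule nn_integral_cong)
   fix p
   have "(\<Sum>j. em (sphA p) {th. (p, th) : X j}) = em (sphA p) (\<Union>j. {th. (p, th) : X j})"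
    by (rule suminf_emeasure)
     (use X sphere_measure_chart(2)[OF chart_at] in "auto simp:disjoint_family_on_def sphere_measure_def")
   also have "(\<Union>j. {th. (p, th) : X j}) = {th. (p, th) : \<Union> (range X)}" by auto
   finally show "(\<Sum>j. em (sphA p) {th. (p, th) : X j}) = em (sphA p) {th. (p, th) : \<Union> (range X)}" .
  qed
  finally show "(\<Sum>j. ?m (X j)) = ?m (\<Union> (range X))" .
 qed
qed

text \<open>One factor \<open>vdens\<close> comes from the volume of the base, the other from
  Lebesgue measure in the fibre. Their product is \<open>det g\<close>, the density preserved by the
  geodesic flow in a chart of the tangent bundle.\<close>

definition sdens :: "('a, 'n) chart => (real^'n) * (real^'n) => real"
 where "sdens c z = real CARD('n) * (vdens c (fst z))^2 * ind {z. 0 < nq c z & nq c z < 1} z"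

lemma sdens_meas: "c : A ==> sdens c : BM" proof -
 assume c: "c : A"
 note [measurable] = nq_meas[OF c] measurable_compose[OF _ vdens_meas[OF c]]
 note [measurable] = borel_measurable_fst
 show ?thesis unfolding sdens_def[abs_def] by measurable
qed

definition "Pc c = {z : SN. fst z : dom_ch c}"

lemma Pc_SB: "c : A ==> Pc c : SB" proof -
 assume c: "c : A"
 have "TB d (Pc c) : sets borel" if d: "d : A" for d proof -
  have "inv_ch d x : dom_ch c <-> x : ov d c" if "x : img d" for x
   using ov_memI[of "inv_ch d x" d c] map_inv[OF d that] inv_in[OF d that] inv_map[OF d] by auto
  hence "TB d (Pc c) = {z. nq d z = 1} Int (ov d c >< UNIV)"
   by (auto simp:TB_def Pc_def ibc_SN[OF d] fst_ibc_eq TU_iff[of _ d] nq_one dest:nq_one[unfolded TU_iff])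
  thus ?thesis using sets.Int[OF unit_borel[OF d] borel_open[OF open_Times[OF ov_open[OF d c] open_UNIV]]] by simp
 qed
 thus ?thesis by (auto simp:SB_def Pc_def)
qed

lemma Pc_meas: "c : A ==> Pc c : sets mu" by (simp add:sets_mu Pc_SB)

lemma emeasure_mu_chart:
 assumes c: "c : A" and B: "B : SB" "B <= Pc c"
 shows "em mu B = (NN lborel (%z. ennreal (sdens c z) * ind (TB c B) (nz c z)))" proof -
 have "em mu B = (NN vol (%p. Th c B (map0 c p) * ind (dom_ch c) p))" unfolding emeasure_mu[OF B(1)]
 proof (rule nn_integral_cong)
  fix p
  show "em (sphA p) {th. (p, th) : B} = Th c B (map0 c p) * ind (dom_ch c) p" proof (cases "p : dom_ch c")
   case True
   thus ?thesis using sphere_measure_chart(1)[OF c True B(1)] by (simp add:map0_def)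
  next
   case False
   hence "{th. (p, th) : B} = {}" using B(2) by (auto simp:Pc_def)
   thus ?thesis using False by simp
  qed
 qed
 also have "... = (NN lborel (%x. vdens c x * Th c B (map0 c (inv0 c x))))"
  by (rule vol_chart[OF c measurable_compose[OF map0_meas[OF c] Th_meas[OF c B(1)]]])
 also have "... = (NN lborel (%x. (NN lborel (%w. ennreal (real CARD('n) * (vdens c x)^2) * ind (RB c B) (x, w)))))"
 proof (rule nn_integral_cong)
  fix x
  have v: "vdens c x >= 0" using det_g_pos[OF c, of x] by (auto simp:vdens_def vd_def less_imp_le)
  have "(NN lborel (%w. ennreal (real CARD('n) * (vdens c x)^2) * ind (RB c B) (x, w)))
    = ennreal (real CARD('n) * (vdens c x)^2) * (NN lborel (%w. ind (RB c B) (x, w)))"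
   by (rule nn_integral_cmult) (use measurable_compose[OF slice_meas borel_measurable_indicator[OF RB_borel[OF c B(1)]]] in simp)
  moreover have "ennreal (real CARD('n) * (vdens c x)^2) = ennreal (vdens c x) * ennreal (real CARD('n) * vdens c x)"
   using v by (subst ennreal_mult[symmetric]) (auto simp:sq_eq mult_ac)
  moreover have "vdens c x = 0 \<or> map0 c (inv0 c x) = x"
   by (auto simp:vdens_def map0_def inv0_def inv_in[OF c] map_inv[OF c])
  ultimately show "vdens c x * Th c B (map0 c (inv0 c x)) = (NN lborel (%w. ennreal (real CARD('n) * (vdens c x)^2) * ind (RB c B) (x, w)))"
   by (auto simp:Th_def mult.assoc)
 qed
 also have "... = (NN (lborel \<Otimes>\<^sub>M lborel) (%z. ennreal (real CARD('n) * (vdens c (fst z))^2) * ind (RB c B) z))"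
 proof -
  note [measurable] = measurable_compose[OF borel_measurable_fst vdens_meas[OF c]] RB_borel[OF c B(1)]
  have "(%z. ennreal (real CARD('n) * (vdens c (fst z))^2) * ind (RB c B) z) : BM" by measurable
  hence "(%z. ennreal (real CARD('n) * (vdens c (fst z))^2) * ind (RB c B) z) : borel_measurable (lborel \<Otimes>\<^sub>M lborel)"
   unfolding lborel_prod by simp
  from lborel.nn_integral_fst[OF this] show ?thesis by simp
 qed
 also have "... = (NN lborel (%z. ennreal (sdens c z) * ind (TB c B) (nz c z)))"
  unfolding lborel_prod by (intro nn_integral_cong) (auto simp:sdens_def RB_def split:split_indicator)
 finally show ?thesis .
qed

lemma SN_nonempty: "EX z. z : SN" proof -
 define v :: "real^'n" where "v = axis undefined 1"
 define c where "c = chA undefined"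
 have c: "c : A" "undefined : dom_ch c" by (auto simp:c_def chart_at)
 let ?z = "(map_ch c undefined, v)"
 have "nq c ?z > 0" using nq_pos[OF c(1), of ?z] c by (auto simp:TU_iff v_def axis_eq_0_iff)
 from nz_unit[OF c(1) this] have "ibc c (nz c ?z) : SN" using ibc_SN[OF c(1) nq_one] by simp
 thus ?thesis ..
qed

text \<open>Radial projection from the chart to the unit sphere bundle. The arbitrary default keeps
  the values inside \<open>SN\<close> and is taken only where \<open>sdens\<close> vanishes.\<close>

definition "psi c z = (if 0 < nq c z then ibc c (nz c z) else (SOME z. z : SN))"

lemma psi_meas:
 assumes c: "c : A"
 shows "psi c : measurable borel mu" proof (rule measurableI)
 show "psi c z : space mu" for z proof (cases "nq c z > 0")
  case True
  thus ?thesis using ibc_SN[OF c nq_one[OF nz_unit[OF c True]]] nz_unit[OF c True] by (simp add:space_mu psi_def)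
 qed (simp add:space_mu psi_def someI_ex[OF SN_nonempty])
 fix B assume "B : sets mu"
 hence "TB c B : sets borel" using c by (simp add:sets_mu SB_def)
 hence 1: "nz c -` TB c B : sets borel" using measurable_sets[OF nz_meas[OF c]] by simp
 note [measurable] = nq_meas[OF c] 1
 have "psi c -` B = {z. 0 < nq c z & z : nz c -` TB c B} Un (if (SOME z. z : SN) : B then {z. ~ 0 < nq c z} else {})"
  using nq_one[OF nz_unit[OF c]] by (auto simp:psi_def TB_def split:if_splits)
 moreover have "{z. 0 < nq c z & z : nz c -` TB c B} : sets borel" "{z. ~ 0 < nq c z} : sets borel" by measurable
 ultimately show "psi c -` B Int space borel : sets borel" by auto
qed

lemma density_mu_chart:
 assumes c: "c : A"
 shows "density mu (ind (Pc c)) = distr (density lborel (sdens c)) mu (psi c)" proof (rule measure_eqI)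
 note sm = sdens_meas[OF c]
 fix B assume "B : sets (density mu (ind (Pc c)))"
 hence B: "B : SB" by (simp add:sets_mu)
 have I: "Pc c Int B : SB" using sets.Int[of "Pc c" mu B] B Pc_SB[OF c] by (simp add:sets_mu)
 have "em (density mu (ind (Pc c))) B = em mu (Pc c Int B)"
  using B I Pc_meas[OF c] by (subst emeasure_density) (auto simp:sets_mu[symmetric] indicator_inter_arith[symmetric])
 also have "... = (NN lborel (%z. ennreal (sdens c z) * ind (TB c (Pc c Int B)) (nz c z)))"
  by (rule emeasure_mu_chart[OF c I]) auto
 also have "... = (NN lborel (%z. ennreal (sdens c z) * ind (psi c -` B) z))" proof (rule nn_integral_cong)
  fix z
  have "nz c z : TB c (Pc c Int B) <-> z : psi c -` B" if z: "0 < nq c z" proof -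
   have 1: "nz c z : TU c" by (rule nq_one[OF nz_unit[OF c z]])
   show ?thesis using 1 z ibc_SN[OF c 1] nz_unit[OF c z] fst_ibc[OF c 1] by (simp add:TB_def Pc_def psi_def)
  qed
  thus "ennreal (sdens c z) * ind (TB c (Pc c Int B)) (nz c z) = ennreal (sdens c z) * ind (psi c -` B) z"
   by (auto simp:sdens_def split:split_indicator)
 qed
 also have "... = em (distr (density lborel (sdens c)) mu (psi c)) B"
  using sm B psi_meas[OF c] measurable_sets[OF psi_meas[OF c], of B]
  by (simp add:emeasure_distr emeasure_density sets_mu)
 finally show "em (density mu (ind (Pc c))) B = em (distr (density lborel (sdens c)) mu (psi c)) B" .
qed simp

lemma sdens_nonneg: "sdens c z >= 0" by (simp add:sdens_def)

lemma sdens_psi: "sdens c z * f (psi c z) = sdens c z * f (ibc c (nz c z))" "ennreal (sdens c z) * h (psi c z) = ennreal (sdens c z) * h (ibc c (nz c z))"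
 by (auto simp:sdens_def psi_def split:split_indicator)

lemma mu_chart:
 fixes f :: "_ => real"
 assumes c: "c : A" and f: "f : borel_measurable mu"
 shows "(LINT z|mu. ind (Pc c) z * f z) = (LINT z|lborel. sdens c z * f (ibc c (nz c z)))" proof -
 have "(LINT z|mu. ind (Pc c) z * f z) = (LINT z|density mu (%z. ennreal (ind (Pc c) z)). f z)"
  using f Pc_meas[OF c] by (subst integral_density) auto
 also have "(%z. ennreal (ind (Pc c) z)) = ind (Pc c)" by (auto simp:fun_eq_iff split:split_indicator)
 also have "(LINT z|density mu (ind (Pc c)). f z) = (LINT z|lborel. sdens c z * f (psi c z))" proof -
  have "(%z. f (psi c z)) : BM" using measurable_compose[OF psi_meas[OF c] f] .
  thus ?thesis unfolding density_mu_chart[OF c] using f psi_meas[OF c] sdens_meas[OF c]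
   by (subst integral_distr, simp, simp) (subst integral_density, auto simp:sdens_nonneg)
 qed
 finally show ?thesis unfolding sdens_psi by simp
qed

lemma mu_chart_nn:
 fixes f :: "_ => ennreal"
 assumes c: "c : A" and f: "f : borel_measurable mu"
 shows "(NN mu (%z. ind (Pc c) z * f z)) = (NN lborel (%z. ennreal (sdens c z) * f (ibc c (nz c z))))" proof -
 have "(NN mu (%z. ind (Pc c) z * f z)) = (NN (density mu (ind (Pc c))) (%z. f z))"
  using f Pc_meas[OF c] by (subst nn_integral_density) auto
 also have "... = (NN lborel (%z. ennreal (sdens c z) * f (psi c z)))"
  unfolding density_mu_chart[OF c] using f psi_meas[OF c] sdens_meas[OF c]
  by (subst nn_integral_distr) (auto intro!:nn_integral_density measurable_compose[OF psi_meas[OF c]])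
 finally show ?thesis unfolding sdens_psi .
qed

text \<open>Continuity on the unit sphere bundle. The product topology on pairs is not the right
  one, since preferred charts may jump with \<open>p\<close>; continuity is therefore tested in
  bundle charts.\<close>

definition "Cfun f <-> (ALL c:A. cont_on {z. nq c z = 1} (%z. f (ibc c z)))" for f :: "'a * (real^'n) => real"

lemma Cfun_meas:
 assumes "Cfun f"
 shows "f : borel_measurable mu" proof (rule measurableI)
 fix S :: "real set" assume S: "S : sets borel"
 have "TB c (f -` S Int SN) : sets borel" if c: "c : A" for c proof -
  let ?h = "%z. if z : {z. nq c z = 1} then f (ibc c z) else 0"
  have "?h : BM" by (rule cont_if_BM[OF unit_borel[OF c]]) (use assms c in "auto simp:Cfun_def")
  from measurable_sets[OF this S] have "?h -` S Int {z. nq c z = 1} : sets borel" using unit_borel[OF c] by (simp del:vimage_eq add:sets.Int)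
  moreover have "TB c (f -` S Int SN) = ?h -` S Int {z. nq c z = 1}" by (auto simp:TB_def ibc_SN[OF c] nq_one)
  ultimately show ?thesis by simp
 qed
 thus "f -` S Int space mu : sets mu" by (simp add:sets_mu space_mu SB_def)
qed simp

lemma compact_shell:
 assumes c: "c : A" and K: "compact K" "K <= img c" and J: "closed J" "J <= {..1}"
 shows "compact {z. fst z : K & nq c z : J}" proof -
 obtain l where l: "l > 0" "!!x w. x : K ==> l * (norm w)^2 <= w <.> (g c x *v w)"
  using metric_lower_bound[OF c K] by blast
 have cl: "closed ((K >< UNIV) Int nq c -` J)"
  by (rule continuous_closed_preimage) (use K J compact_imp_closed[OF K(1)] in
   "auto intro!:closed_Times cont_subset[OF Ck_cont[OF nq_Ck[OF c, of 0]]] simp:TU_iff")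
 have eq: "{z. fst z : K & nq c z : J} = (K >< UNIV) Int nq c -` J" by auto
 have "{z. fst z : K & nq c z : J} <= K >< cball 0 (1 / sqrt l)" proof (rule subsetI)
  fix z assume z: "z : {z. fst z : K & nq c z : J}"
  obtain x w where xw: "z = (x, w)" by (cases z)
  with z J(2) have x: "x : K" "nq c (x, w) <= 1" by auto
  hence "l * (norm w)^2 <= 1" using l(2)[of x w] K(2) by (auto simp:nq_def TU_iff split:if_splits)
  hence "(norm w)^2 <= (1 / sqrt l)^2" using l(1) by (simp add:power_divide field_simps)
  hence "norm w <= 1 / sqrt l" by (rule power2_le_imp_le) (use l(1) in auto)
  thus "z : K >< cball 0 (1 / sqrt l)" using x by (simp add:xw)
 qed
 hence "bounded {z. fst z : K & nq c z : J}"
  by (rule bounded_subset[rotated]) (intro bounded_Times compact_imp_bounded K bounded_cball)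
 thus ?thesis using cl unfolding eq compact_eq_bounded_closed by simp
qed

lemma compact_unit: "c : A ==> compact K ==> K <= img c ==> compact {z. fst z : K & nq c z = 1}"
 using compact_shell[of c K "{1}"] by simp

text \<open>The unit vectors over each closed ball of the finite cover \<open>BC\<close> form a
  compact set in the chart, so finitely many bounds suffice.\<close>

lemma chart_bounded:
 fixes f :: "real => 'a * (real^'n) => real"
 assumes I: "compact I" and f: "!!c. c : A ==> cont_on ({z. nq c z = 1} >< I) (%(z, t). f t (ibc c z))"
 shows "EX b. ALL t:I. ALL z:SN. abs (f t z) <= b" proof -
 let ?K = "%(c, x, dta). {z. fst z : cball x dta & nq c z = 1} >< I"
 have "EX b. ALL (z, t) : ?K T. abs (f t (ibc (fst T) z)) <= b" if T: "T : BC" for T proof -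
  obtain c x dta where t: "T = (c, x, dta)" by (cases T)
  have c: "c : A" "cball x dta <= img c" using BC(2,4) T t by auto
  have "compact (?K T)" unfolding t using compact_Times[OF compact_unit[OF c(1) compact_cball c(2)] I] by simp
  moreover have "cont_on (?K T) (%(z, t). f t (ibc c z))" unfolding t by (rule cont_subset[OF f[OF c(1)]]) auto
  ultimately have "bounded ((%(z, t). f t (ibc c z)) ` ?K T)" by (intro compact_imp_bounded compact_image)
  thus ?thesis unfolding bounded_iff t by (auto simp:case_prod_beta)
 qed
 then obtain b where b: "!!T z t. T : BC ==> (z, t) : ?K T ==> abs (f t (ibc (fst T) z)) <= b T" by (metis (no_types, lifting) case_prodD)
 have "abs (f t z) <= (SUM T:BC. abs (b T))" if "t : I" "z : SN" for t z proof -
  obtain c x dta where T: "(c, x, dta) : BC" "fst z : dom_ch c" "dist (map_ch c (fst z)) x < dta" using BC(5)[of "fst z"] by blast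
  have c: "c : A" using BC(2) T(1) .
  let ?z = "bch c z"
  have i: "ibc c ?z = z" "fst ?z = map_ch c (fst z)" using ibc_bundle[OF c T(2), of "snd z"] bundle_fst[OF c T(2), of "snd z"] by simp_all
  hence "nq c ?z = 1" using ibc_SN[OF c, of ?z] that T(2) by (auto simp:TU_iff)
  hence "abs (f t z) <= b (c, x, dta)" using b[OF T(1), of ?z t] T(3) that i by (simp add:dist_commute)
  also have "... <= (SUM T:BC. abs (b T))" using member_le_sum[OF T(1), of "%T. abs (b T)"] BC(1) by force
  finally show ?thesis .
 qed
 thus ?thesis by blast
qed

lemma Cfun_bounded: "Cfun f ==> EX b. ALL z:SN. abs (f z) <= b" proof -
 assume f: "Cfun f"
 have "cont_on ({z. nq c z = 1} >< {0::real}) (%(z, t). f (ibc c z))" if "c : A" for c unfolding case_prod_beta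
  by (rule cont_compose[of "{z. nq c z = 1}" "%z. f (ibc c z)"])
   (use f that in "auto simp:Cfun_def intro!:continuous_intros")
 from chart_bounded[OF _ this] show ?thesis by simp
qed

lemma psi_cont:
 assumes c: "c : A" and f: "Cfun f"
 shows "cont_on {z. 0 < nq c z} (%z. f (ibc c (nz c z)))"
proof (rule cont_compose[of "{z. nq c z = 1}" "%z. f (ibc c z)"])
 show "cont_on {z. nq c z = 1} (%z. f (ibc c z))" using f c by (simp add:Cfun_def)
 have "cont_on {z. 0 < nq c z} (nq c)"
  by (rule cont_subset[OF Ck_cont[OF nq_Ck[OF c, of 0]]]) (auto intro:nq_gt)
 thus "cont_on {z. 0 < nq c z} (nz c)" unfolding nz_def[abs_def] by (intro continuous_intros) auto
qed (use nz_unit[OF c] in auto)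

lemma open_nq: "c : A ==> open {z. a < nq c z & nq c z < b}" if "0 <= a" proof -
 assume c: "c : A"
 have "open (TU c Int nq c -` {a<..<b})"
  by (rule open_preimage[OF Ck_cont[OF nq_Ck[OF c, of 0]] TU_open[OF c]]) simp
 moreover have "{z. a < nq c z & nq c z < b} = TU c Int nq c -` {a<..<b}" using that by (auto intro:nq_gt)
 ultimately show ?thesis by simp
qed

text \<open>In a chart the integrand vanishes almost everywhere on the solid shell. A nonempty open
  set where it differs from 0 would have positive Lebesgue measure.\<close>

lemma Cfun_zero:
 assumes f: "Cfun f" and pos: "!!z. z : SN ==> f z >= 0" and 0: "(NN mu (%z. ennreal (f z))) = 0" and z: "z0 : SN"
 shows "f z0 = 0" proof (rule ccontr)
 assume n: "f z0 ~= 0"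
 define c where "c = chA (fst z0)"
 have c: "c : A" "fst z0 : dom_ch c" by (auto simp:c_def chart_at)
 let ?z = "bch c z0"
 have i: "ibc c ?z = z0" using ibc_bundle[OF c, of "snd z0"] by simp
 have zT: "?z : TU c" using bundle_fst[OF c, of "snd z0"] c(2) by (simp add:TU_iff)
 have nq1: "nq c ?z = 1" using ibc_SN[OF c(1) zT] z i by simp
 let ?U = "{z. 0 < nq c z & nq c z < 1}" and ?h = "%z. f (ibc c (nz c z))"
 \<comment> \<open>Half the unit vector lies inside the open shell over which the chart integral
   runs, and it projects back to \<open>?z\<close>.\<close>
 let ?y = "(fst ?z, (1/2) *R snd ?z)"
 have y: "nq c ?y = 1 / 4" using nq_scale[of c ?z "1/2"] nq1 by (simp add:sq_eq)
 have "nz c ?y = ?z" unfolding nz_def y by (simp add:real_sqrt_divide prod_eq_iff)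
 hence hy: "?h ?y ~= 0" using n i by simp
 have mf: "(%z. ennreal (f z)) : borel_measurable mu" using Cfun_meas[OF f] by simp
 have "(NN mu (%z. ind (Pc c) z * ennreal (f z))) <= (NN mu (%z. ennreal (f z)))"
  by (intro nn_integral_mono) (auto split:split_indicator)
 hence "(NN lborel (%z. ennreal (sdens c z) * ennreal (?h z))) = 0" unfolding mu_chart_nn[OF c(1) mf] 0 by simp
 moreover have hm: "(%z. ennreal (sdens c z) * ennreal (?h z)) : BM"
  unfolding sdens_psi(2)[where h = "%z. ennreal (f z)", symmetric] using sdens_meas[OF c(1)] measurable_compose[OF psi_meas[OF c(1)] mf] by simp
 ultimately have ae: "AE z in lborel. ennreal (sdens c z) * ennreal (?h z) = 0" by (subst (asm) nn_integral_0_iff_AE) auto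
 have "open (?U Int ?h -` (- {0}))"
  by (rule open_preimage[OF cont_subset[OF psi_cont[OF c(1) f]] open_nq[OF _ c(1)]]) auto
 moreover have "0 < nq c ?y" "nq c ?y < 1" unfolding y by simp_all
 hence "?U Int ?h -` (- {0}) ~= {}" using hy by blast
 ultimately have "~ negligible (?U Int ?h -` (- {0}))" by (rule open_not_negligible)
 moreover have "?U Int ?h -` (- {0}) <= {z. ennreal (sdens c z) * ennreal (?h z) ~= 0}" proof safe
  fix x w assume zz: "0 < nq c (x, w)" "nq c (x, w) < 1" "?h (x, w) ~= 0" "ennreal (sdens c (x, w)) * ennreal (?h (x, w)) = 0"
  have "sdens c (x, w) > 0" using zz(1,2) nq_gt[of c "(x, w)"] det_g_pos[OF c(1), of x] by (simp add:sdens_def vdens_def vd_def TU_iff)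
  moreover have "?h (x, w) >= 0" using pos psi_meas[OF c(1)] zz(1) measurable_space[of "psi c" borel mu "(x, w)"] by (simp add:psi_def space_mu)
  ultimately show False using zz(3,4) by (simp add:ennreal_eq_0_iff)
 qed
 moreover have "negligible {z. ennreal (sdens c z) * ennreal (?h z) ~= 0}" proof -
  have "{z : space lborel. ennreal (sdens c z) * ennreal (?h z) ~= 0} : sets lborel" using hm by measurable
  with ae have "{z. ennreal (sdens c z) * ennreal (?h z) ~= 0} : null_sets lborel" by (subst (asm) AE_iff_null) auto
  thus ?thesis by (simp add:negligible_iff_null_sets null_sets_completionI)
 qed
 ultimately show False using negligible_subset by blast
qed

end

section \<open>Averages of quadratic forms over unit spheres\<close>

lemma lborel_orthogonal_integral:
 fixes f :: "real^'n::finite => real" and T :: "real^'n => real^'n"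
 assumes T: "orthogonal_transformation T" and f: "f : BM"
 shows "(LINT y|lborel. f (T y)) = (LINT y|lborel. f y)" proof -
 have lin: "linear T" using T orthogonal_transformation_linear by blast
 have m: "T : BM" using lin by (intro cont_BM) (simp add:linear_continuous_on linear_linear)
 have "distr lborel borel T = lborel" proof (rule measure_eqI)
  fix B assume "B : sets (distr lborel borel T)"
  hence B: "B : sets borel" by simp
  have d: "abs (det (matrix T)) = 1" using T by simp
  hence "det (matrix T) ~= 0" by auto
  from nn_integral_linear_image[OF lin this, of "ind B"] d B
  have "em lborel B = (NN lborel (%x. ind (T -` B) x))" by (simp add:indicator_vimage[symmetric] del:indicator_vimage)
  thus "em (distr lborel borel T) B = em lborel B"
   using m B measurable_sets[OF m B] by (simp add:emeasure_distr)
 qed simp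
 hence "(LINT y|lborel. f y) = (LINT y|distr lborel borel T. f y)" by simp
 also have "... = (LINT y|lborel. f (T y))" using m f by (subst integral_distr) auto
 finally show ?thesis ..
qed

text \<open>Dividing by the squared norm evaluates a quadratic form at \<open>y / norm y\<close>, so
  integrating over the punctured unit ball gives the spherical integral up to the factor n.\<close>

definition ball_weight :: "real^'n::finite => real" where
 "ball_weight y = ind {y. 0 < norm y & norm y < 1} y / (norm y)^2"

text \<open>The common second moment of all coordinates; \<open>undefined\<close> stands for an
  arbitrary one. Its value is never computed, for it cancels in averages and only its positivity
  matters.\<close>

definition kap :: "'n::finite itself => real" where
 "kap _ = (LINT y|(lborel :: (real^'n) measure). ball_weight y * (y $ undefined)^2)"

lemma ball_weight_meas: "ball_weight : BM" unfolding ball_weight_def[abs_def] by measurable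

lemma vec_nth_meas: "(%y::real^'n::finite. y $ i) : BM" by (intro cont_BM continuous_intros)

text \<open>Transposing two coordinates makes the diagonal moments equal, and reflecting one
  coordinate makes the mixed moments vanish.\<close>

lemma ball_weight_product:
 fixes i j :: "'n::finite"
 shows "integrable lborel (%y::real^'n. ball_weight y * (y $ i * y $ j))"
  and "(LINT y|(lborel :: (real^'n) measure). ball_weight y * (y $ i * y $ j)) = (if i = j then kap TYPE('n) else 0)"
proof -
 note [measurable] = ball_weight_meas vec_nth_meas
 have bd: "abs (ball_weight y * (y $ i * y $ j)) <= ind (ball 0 1) y" for y :: "real^'n" proof (cases "y = 0")
  case False
  have "abs (y $ i * y $ j) <= (norm y)^2"
   unfolding abs_mult sq_eq by (intro mult_mono component_le_norm_cart) auto
  thus ?thesis using False by (auto simp:ball_weight_def abs_mult divide_le_eq split:split_indicator)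
 qed (simp add:ball_weight_def)
 have ib: "integrable lborel (ind (ball (0::real^'n) 1) :: _ => real)"
  using emeasure_bounded_finite[OF bounded_ball] by (intro integrable_real_indicator) auto
 show "integrable lborel (%y::real^'n. ball_weight y * (y $ i * y $ j))"
  by (rule Bochner_Integration.integrable_bound[OF ib _ AE_I2]) (use bd in simp_all)
 have w: "ball_weight (T y) = ball_weight y" if "orthogonal_transformation T" for T and y :: "real^'n" proof -
  have n: "norm (T y) = norm y" by (rule orthogonal_transformation_norm[OF that])
  hence "T y = 0 <-> y = 0" by (metis norm_eq_zero)
  with n show ?thesis by (simp add:ball_weight_def indicator_def)
 qed
 have m: "(%y::real^'n. ball_weight y * (y $ i * y $ j)) : BM" for i j by measurable
 show "(LINT y|(lborel :: (real^'n) measure). ball_weight y * (y $ i * y $ j)) = (if i = j then kap TYPE('n) else 0)"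
 proof (cases "i = j")
  case True
  define T where "T y = (\<chi> k. y $ Transposition.transpose i undefined k)" for y :: "real^'n"
  have b: "bij (Transposition.transpose i (undefined :: 'n))" by simp
  have T: "orthogonal_transformation T"
   unfolding orthogonal_transformation using sum.reindex_bij_betw[OF b, of "%k. (_ $ k)\<^sup>2"]
   by (auto simp:T_def norm_vec_def L2_set_def intro!:linearI simp:vec_eq_iff)
  from lborel_orthogonal_integral[OF T m, of undefined undefined] show ?thesis
   using True by (simp add:w[OF T] kap_def sq_eq) (simp add:T_def)
 next
  case False
  have [simp]: "(if a = i then (v $ i)\<^sup>2 else (v $ a)\<^sup>2) = (v $ a)^2" for v :: "real^'n" and a by simp
  define T where "T y = (\<chi> k. if k = i then - y $ k else y $ k)" for y :: "real^'n"
  have T: "orthogonal_transformation T" unfolding orthogonal_transformation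
   by (auto simp:T_def norm_vec_def L2_set_def if_distrib[of "%x. x\<^sup>2"] intro!:linearI simp:vec_eq_iff cong:if_cong)
  from lborel_orthogonal_integral[OF T m, of i j] show ?thesis using False by (simp add:w[OF T]) (simp add:T_def)
 qed
qed

lemma ball_weight_trace:
 fixes M :: "real^'n^'n::finite"
 shows "integrable lborel (%y. ball_weight y * (y <.> (M *v y)))" "(LINT y|lborel. ball_weight y * (y <.> (M *v y))) = kap TYPE('n) * trace M"
proof -
 have e: "(%y. ball_weight y * (y <.> (M *v y))) = (%y. SUM i:UNIV. SUM j:UNIV. M $ i $ j * (ball_weight y * (y $ i * y $ j)))"
  by (auto simp:inner_vec_def matrix_vector_mult_def sum_distrib_left mult_ac fun_eq_iff)
 show "integrable lborel (%y. ball_weight y * (y <.> (M *v y)))"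
  unfolding e by (intro Bochner_Integration.integrable_sum integrable_mult_right ball_weight_product)
 show "(LINT y|lborel. ball_weight y * (y <.> (M *v y))) = kap TYPE('n) * trace M"
  unfolding e by (simp add:Bochner_Integration.integral_sum ball_weight_product trace_def sum_distrib_left mult.commute if_distrib cong:if_cong)
qed

context riem_compact
begin

section \<open>Disintegration of the bundle measure into fibre spheres\<close>

definition "psip p v = (if 0 < nmA p v then (p, v /\<^sub>R nmA p v) else (SOME z. z : SN))"

definition "pdens p v = real CARD('n) * sqrt (det (grA p)) * ind {v. 0 < nmA p v & nmA p v < 1} v"

text \<open>The measure of the sphere over \<open>p\<close> regarded as a measure on the bundle. All
  \<open>nu p\<close> live on the sigma algebra of \<open>mu\<close>, as integration over
  \<open>p\<close> requires.\<close>

definition "nu p = distr (density lborel (pdens p)) mu (psip p)"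

lemma norm_at_meas: "nmA p : BM" by (rule cont_BM[OF norm_at_cont])

lemma pdens_meas: "pdens p : BM" proof -
 note [measurable] = norm_at_meas
 show ?thesis unfolding pdens_def[abs_def] by measurable
qed

lemma psip_meas: "psip p : measurable borel mu" proof (rule measurableI)
 note [measurable] = norm_at_meas
 show "psip p v : space mu" for v using norm_at_scale[of p "inverse (nmA p v)" v] someI_ex[OF SN_nonempty]
  by (auto simp:psip_def space_mu unit_sphere_bundle_def)
 fix B assume "B : sets mu"
 hence E: "{th. (p, th) : B} : sets borel" using sphere_measure_chart(2)[OF chart_at] by (simp add:sets_mu)
 have f: "(%v. v /\<^sub>R nmA p v) : BM" by measurable
 have [measurable]: "(%v. v /\<^sub>R nmA p v) -` {th. (p, th) : B} : sets borel" using measurable_sets[OF f E] by simp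
 have "psip p -` B = {v. 0 < nmA p v & v : (%v. v /\<^sub>R nmA p v) -` {th. (p, th) : B}} Un (if (SOME z. z : SN) : B then {v. ~ 0 < nmA p v} else {})"
  by (auto simp:psip_def split:if_splits)
 moreover have "{v. 0 < nmA p v & v : (%v. v /\<^sub>R nmA p v) -` {th. (p, th) : B}} : sets borel"
  "{v. ~ 0 < nmA p v} : sets borel" by measurable
 ultimately show "psip p -` B Int space borel : sets borel" by auto
qed

lemma nu_integral:
 fixes f :: "_ => ennreal"
 assumes f: "f : borel_measurable mu"
 shows "(NN (nu p) (%z. f z)) = (NN lborel (%v. ennreal (pdens p v) * f (p, v /\<^sub>R nmA p v)))" proof -
 have "(NN (nu p) (%z. f z)) = (NN lborel (%v. ennreal (pdens p v) * f (psip p v)))"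
  unfolding nu_def using f psip_meas pdens_meas[of p]
  by (subst nn_integral_distr) (auto intro!:nn_integral_density measurable_compose[OF psip_meas])
 also have "... = (NN lborel (%v. ennreal (pdens p v) * f (p, v /\<^sub>R nmA p v)))"
  by (intro nn_integral_cong) (auto simp:pdens_def psip_def split:split_indicator)
 finally show ?thesis .
qed

lemma emeasure_nu:
 assumes B: "B : SB"
 shows "em (nu p) B = em (sphA p) {th. (p, th) : B}" proof -
 note [measurable] = norm_at_meas
 let ?S = "{v. 0 < nmA p v & nmA p v < 1}" and ?f = "%v. v /\<^sub>R nmA p v" and ?E = "{th. (p, th) : B}"
 let ?k = "real CARD('n) * sqrt (det (grA p))"
 have f: "?f : BM" and S: "?S : sets borel" by measurable
 have E: "?E : sets borel" by (rule sphere_measure_chart(2)[OF chart_at B])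
 have fE: "?f -` ?E : sets borel" using measurable_sets[OF f E] by simp
 have "em (sphA p) ?E = ennreal ?k * em lborel (?f -` ?E Int ?S)" unfolding sphere_measure_def using E S f fE
  by (subst emeasure_distr) (auto simp:space_scale_measure space_restrict_space emeasure_restrict_space
    measurable_cong_sets[OF sets_scale_measure refl] intro:measurable_restrict_space1)
 also have "... = (NN lborel (%v. ennreal ?k * ind (?f -` ?E Int ?S) v))" using fE S by (subst nn_integral_cmult_indicator) auto
 also have "... = (NN lborel (%v. ennreal (pdens p v) * ind B (p, ?f v)))"
  by (intro nn_integral_cong) (auto simp:pdens_def split:split_indicator)
 also have "... = (NN (nu p) (%z. ind B z))" using B by (subst nu_integral) (auto simp:sets_mu[symmetric])
 finally show ?thesis using B by (simp add:nu_def sets_mu)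
qed

lemma mu_disintegrate:
 fixes f :: "_ => ennreal"
 assumes "f : borel_measurable mu"
 shows "(%p. \<integral>\<^sup>+z. f z \<partial>nu p) : borel_measurable vol & (NN mu (%z. f z)) = (NN vol (%p. \<integral>\<^sup>+z. f z \<partial>nu p))"
proof -
 have s: "sets (nu p) = sets mu" for p by (simp add:nu_def)
 have sp: "space (nu p) = space mu" for p by (rule sets_eq_imp_space_eq[OF s])
 have mn: "borel_measurable (nu p) = borel_measurable mu" for p :: 'a by (rule measurable_cong_sets[OF s refl])
 show ?thesis using assms proof (induction f rule:borel_measurable_induct)
  case (cong f h)
  hence "(NN (nu p) (%z. f z)) = (NN (nu p) (%z. h z))" for p by (intro nn_integral_cong) (simp add:sp)
  moreover have "(NN mu (%z. f z)) = (NN mu (%z. h z))" using cong by (intro nn_integral_cong) simp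
  ultimately show ?case using cong by simp
 next
  case (set B)
  thus ?case using sphere_measure_meas[of B] emeasure_mu[of B] by (simp add:s emeasure_nu sets_mu)
 next
  case (mult u c)
  thus ?case by (simp add:nn_integral_cmult mn borel_measurable_times_ennreal)
 next
  case (add u v)
  thus ?case by (simp add:nn_integral_add mn borel_measurable_add)
 next
  case (seq U)
  have "(NN (nu p) (%z. (SUP i. U i) z)) = (SUP i. \<integral>\<^sup>+z. U i z \<partial>nu p)" for p
   using seq by (simp add:nn_integral_monotone_convergence_SUP mn image_comp)
  moreover have "(NN mu (%z. (SUP i. U i) z)) = (SUP i. \<integral>\<^sup>+z. U i z \<partial>mu)"
   using seq by (simp add:nn_integral_monotone_convergence_SUP image_comp)
  moreover have "(NN vol (%p. (SUP i. \<integral>\<^sup>+z. U i z \<partial>nu p))) = (SUP i. \<integral>\<^sup>+p. \<integral>\<^sup>+z. U i z \<partial>nu p \<partial>vol)"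
   using seq by (intro nn_integral_monotone_convergence_SUP) (auto simp:incseq_def le_fun_def intro!:nn_integral_mono)
  ultimately show ?case using seq by (simp add:borel_measurable_SUP)
 qed
qed

lemma minv_orthonormal:
 fixes G :: "real^'m^'m::finite"
 assumes Q: "transpose Q ** G ** Q = mat 1"
 shows "minv G = Q ** transpose Q" "(det Q)^2 * det G = 1" proof -
 have "Q ** (transpose Q ** G) = mat 1" using Q matrix_left_right_inverse by blast
 hence 1: "(Q ** transpose Q) ** G = mat 1" by (simp add:matrix_mul_assoc)
 hence 2: "G ** (Q ** transpose Q) = mat 1" using matrix_left_right_inverse by blast
 have d: "det (transpose Q ** G ** Q) = 1" using Q by simp
 thus "(det Q)^2 * det G = 1" by (simp add:det_mul det_transpose sq_eq mult_ac)
 hence "det G ~= 0" by auto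
 hence "minv G ** G = mat 1" by (rule minv_mult)
 hence "minv G = minv G ** (G ** (Q ** transpose Q))" by (simp add:2)
 also have "... = Q ** transpose Q" using `minv G ** G = mat 1` by (simp add:matrix_mul_assoc)
 finally show "minv G = Q ** transpose Q" .
qed

text \<open>An orthonormal frame \<open>Q\<close> turns the fibre into Euclidean space and
  \<open>B\<close> into \<open>transpose Q ** B ** Q\<close>. Its trace is that of
  \<open>minv (grA p) ** B\<close>, and the determinant of \<open>Q\<close> cancels the density of
  the metric.\<close>

lemma nu_quadratic:
 assumes f: "f : borel_measurable mu" and q: "!!v. (p, v) : SN ==> f (p, v) = v <.> (B *v v)"
  and pos: "!!v. (p, v) : SN ==> f (p, v) >= 0"
 shows "(NN (nu p) (%z. ennreal (f z))) = ennreal (real CARD('n) * kap TYPE('n) * trace (minv (grA p) ** B))"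
  "trace (minv (grA p) ** B) >= 0" proof -
 let ?G = "grA p" and ?N = "nmA p"
 obtain Q :: "real^'n^'n" where Q: "transpose Q ** ?G ** Q = mat 1" by (rule pos_def_orthonormalize[OF gram_sym[of p] gram_pos[of _ p]]) (assumption | rule that)+
 note o = minv_orthonormal[OF Q]
 have Nq: "?N (Q *v y) = norm y" for y proof -
  have "(Q *v y) <.> (?G *v (Q *v y)) = y <.> ((transpose Q ** ?G ** Q) *v y)"
   by (simp add:mv_assoc[symmetric] inner_transpose)
  thus ?thesis unfolding Q by (simp add:norm_at_def inner_at_def norm_eq_sqrt_inner)
 qed
 have unit: "(p, (Q *v y) /\<^sub>R norm y) : SN" if "y ~= 0" for y
  using that norm_at_scale[of p "inverse (norm y)" "Q *v y"] by (simp add:unit_sphere_bundle_def Nq)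
 let ?M = "transpose Q ** B ** Q"
 have qM: "v <.> (?M *v v) = (Q *v v) <.> (B *v (Q *v v))" for v
  by (simp add:mv_assoc[symmetric] inner_transpose)
 have fM: "f (p, (Q *v y) /\<^sub>R norm y) = (y <.> (?M *v y)) / (norm y)^2" if "y ~= 0" for y
  unfolding q[OF unit[OF that]] qM by (simp add:mv_scaleR sq_eq divide_inverse mult_ac)
 have tr: "trace ?M = trace (minv ?G ** B)" unfolding o by (metis matrix_mul_assoc trace_mul_sym)
 have Mpos: "y <.> (?M *v y) >= 0" for y proof (cases "y = 0")
  case False
  hence "(y <.> (?M *v y)) / (norm y)^2 >= 0" using fM pos[OF unit[OF False]] by simp
  thus ?thesis using False by (simp add:zero_le_divide_iff)
 qed simp
 have "trace ?M = (SUM i:UNIV. axis i 1 <.> (?M *v axis i 1))"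
  by (simp add:trace_def mv_basis column_def inner_axis')
 thus "trace (minv ?G ** B) >= 0" unfolding tr[symmetric] using Mpos by (simp add:sum_nonneg)
 have d: "abs (det Q) * sqrt (det ?G) = 1" proof -
  have "sqrt ((det Q)^2 * det ?G) = 1" using o(2) by simp
  thus ?thesis by (simp add:real_sqrt_mult)
 qed
 hence dQ: "det (matrix (%y. Q *v y)) ~= 0" by (auto simp:matrix_of_matrix_vector_mul)
 let ?F = "%v. ennreal (pdens p v) * ennreal (f (p, v /\<^sub>R ?N v))"
 have F: "?F = (%v. ennreal (pdens p v) * ennreal (f (psip p v)))"
  by (auto simp:fun_eq_iff pdens_def psip_def split:split_indicator)
 have mF: "?F : BM" unfolding F using pdens_meas measurable_compose[OF psip_meas f] by simp
 have Fy: "ennreal \<bar>det Q\<bar> * ?F (Q *v y) = ennreal (real CARD('n) * (ball_weight y * (y <.> (?M *v y))))" for y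
 proof (cases "0 < norm y & norm y < 1")
  case True
  hence "ennreal \<bar>det Q\<bar> * ?F (Q *v y) = ennreal (abs (det Q) * (real CARD('n) * sqrt (det ?G)) * ((y <.> (?M *v y)) / (norm y)^2))"
   using fM[of y] Mpos[of y] pos_def_det_pos[OF gram_sym gram_pos, of p]
   by (simp add:pdens_def Nq ennreal_mult[symmetric] mult.assoc)
  also have "abs (det Q) * (real CARD('n) * sqrt (det ?G)) = real CARD('n)" using d by (simp add:mult_ac)
  finally show ?thesis using True by (simp add:ball_weight_def)
 qed (auto simp:pdens_def Nq ball_weight_def)
 have "(NN (nu p) (%z. ennreal (f z))) = (NN lborel (%v. ?F v))" using f by (subst nu_integral) auto
 also have "... = (NN lborel (%y. ennreal \<bar>det Q\<bar> * ?F (Q *v y)))" proof -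
  have "(%y. Q *v y) : BM"
   by (intro cont_BM linear_continuous_on linear_linear[THEN iffD2] matrix_vector_mul_linear)
  from measurable_compose[OF this mF] show ?thesis using nn_integral_linear_image[OF matrix_vector_mul_linear dQ mF]
   by (subst nn_integral_cmult) (auto simp:matrix_of_matrix_vector_mul)
 qed
 also have "... = ennreal (LINT y|lborel. real CARD('n) * (ball_weight y * (y <.> (?M *v y))))"
  unfolding Fy by (intro nn_integral_eq_integral integrable_mult_right ball_weight_trace) (auto simp:Mpos ball_weight_def)
 finally show "(NN (nu p) (%z. ennreal (f z))) = ennreal (real CARD('n) * kap TYPE('n) * trace (minv ?G ** B))"
  by (simp add:ball_weight_trace tr mult.assoc)
qed

lemma mu_quadratic:
 assumes f: "f : borel_measurable mu" and q: "!!p v. (p, v) : SN ==> f (p, v) = v <.> (B p *v v)"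
  and pos: "!!z. z : SN ==> f z >= 0"
 shows "(NN mu (%z. ennreal (f z))) = (NN vol (%p. ennreal (real CARD('n) * kap TYPE('n) * trace (minv (grA p) ** B p))))"
  "(%p. ennreal (real CARD('n) * kap TYPE('n) * trace (minv (grA p) ** B p))) : borel_measurable vol" proof -
 have e: "(NN (nu p) (%z. ennreal (f z))) = ennreal (real CARD('n) * kap TYPE('n) * trace (minv (grA p) ** B p))" for p
  by (rule nu_quadratic(1)[OF f q pos])
 have "(%z. ennreal (f z)) : borel_measurable mu" using f by simp
 from mu_disintegrate[OF this] show "(NN mu (%z. ennreal (f z))) = (NN vol (%p. ennreal (real CARD('n) * kap TYPE('n) * trace (minv (grA p) ** B p))))"
  "(%p. ennreal (real CARD('n) * kap TYPE('n) * trace (minv (grA p) ** B p))) : borel_measurable vol"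
  unfolding e by auto
qed

text \<open>The metric itself is a quadratic form that equals 1 on unit vectors and has trace n. The
  total mass thus comes from the same formula as the averages.\<close>

lemma mu_total: "em mu SN = ennreal (real CARD('n) * kap TYPE('n) * real CARD('n)) * em vol UNIV" proof -
 have 1: "v <.> (grA p *v v) = 1" if "(p, v) : SN" for p v
  using norm_at_sq[of p v] that by (simp add:unit_sphere_bundle_def)
 have t: "trace (minv (grA p) ** grA p) = real CARD('n)" for p
  using minv_mult[of "grA p"] pos_def_det_pos[OF gram_sym gram_pos, of p] by (simp add:trace_I)
 have "em mu SN = (NN mu (%z. ennreal 1))" by (simp add:space_mu)
 also have "... = (NN vol (%p. ennreal (real CARD('n) * kap TYPE('n) * real CARD('n))))"
  using mu_quadratic(1)[of "%_. 1" "grA"] by (simp add:1 t)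
 finally show ?thesis by simp
qed

lemma mu_finite: "finite_measure mu"
 using mu_total vol_finite by (intro finite_measureI) (simp add:space_mu ennreal_mult_eq_top_iff)

lemma mu_pos: "em mu SN ~= 0" proof
 assume 0: "em mu SN = 0"
 obtain z0 where z0: "z0 : SN" using SN_nonempty by blast
 have "(%_. 1::real) z0 = 0" by (rule Cfun_zero[of "%_. 1", OF _ _ _ z0]) (use 0 in "auto simp:Cfun_def space_mu")
 thus False by simp
qed

text \<open>Positivity of \<open>kap\<close> and of the volume is read off from the product formula
  once the total mass is known to be positive and finite.\<close>

lemma measure_mu: "measure mu SN > 0" "measure mu SN = real CARD('n) * kap TYPE('n) * real CARD('n) * measure vol UNIV"
 "kap TYPE('n) > 0" "measure vol UNIV > 0" proof -
 have m: "measure mu SN = enn2real (ennreal (real CARD('n) * kap TYPE('n) * real CARD('n))) * measure vol UNIV"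
  by (simp add:measure_def mu_total enn2real_mult)
 interpret finite_measure mu by (rule mu_finite)
 show p: "measure mu SN > 0" using mu_pos by (simp add:emeasure_eq_measure zero_less_measure_iff)
 with m have "enn2real (ennreal (real CARD('n) * kap TYPE('n) * real CARD('n))) > 0 & measure vol UNIV > 0"
  using measure_nonneg[of vol UNIV] by (auto simp:zero_less_mult_iff)
 hence "real CARD('n) * kap TYPE('n) * real CARD('n) > 0" "measure vol UNIV > 0" by (auto simp:enn2real_positive_iff)
 thus k: "kap TYPE('n) > 0" "measure vol UNIV > 0" by (auto simp:zero_less_mult_iff)
 show "measure mu SN = real CARD('n) * kap TYPE('n) * real CARD('n) * measure vol UNIV" unfolding m using k by simp
qed

lemma Cfun_integrable: "Cfun f ==> integrable mu f" proof -
 assume f: "Cfun f"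
 obtain b where "!!z. z : SN ==> abs (f z) <= b" using Cfun_bounded[OF f] by blast
 thus ?thesis using Cfun_meas[OF f]
  by (intro finite_measure.integrable_const_bound[OF mu_finite, of _ b] AE_I2) (auto simp:space_mu)
qed

definition "Rmat p = (\<chi> j k. ricci g (chA p) j k (coord A p))"

lemma ric_Rmat: "ric (p, v) = v <.> (Rmat p *v v)" proof -
 let ?c = "chA p" and ?x = "coord A p"
 have e: "curv (%_::(unit, 'n) chart. g ?c) undefined = curv g ?c" by (rule curv_cong_metric) simp
 have dl: "(SUM a:UNIV. SUM j:UNIV. if a = i then F j else 0) = (SUM j:UNIV. F j :: real)" for F and i :: 'n
  by (subst sum.swap) simp
 have "ric (p, v) = (SUM i:UNIV. SUM k:UNIV. SUM j:UNIV. curv g ?c i k i j ?x * v $ j * v $ k)"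
  by (simp add:ric_def Ric_def trace_def matrix_def Rm_def e axis_def if_distrib if_distribR dl cong:if_cong)
 also have "... = (SUM k:UNIV. SUM j:UNIV. SUM i:UNIV. curv g ?c i k i j ?x * v $ j * v $ k)"
  by (rule trans[OF sum.swap]) (rule sum.cong[OF refl], rule sum.swap)
 also have "... = (SUM j:UNIV. SUM k:UNIV. v $ j * (ricci g ?c j k ?x * v $ k))"
  by (subst sum.swap) (simp add:ricci_def sum_distrib_left sum_distrib_right mult_ac)
 finally show ?thesis by (simp add:Rmat_def inner_vec_def matrix_vector_mult_def sum_distrib_left)
qed

lemma scalar_Rmat: "scalar_curvature A g p = trace (minv (grA p) ** Rmat p)" proof -
 have "transpose (minv (grA p)) = minv (grA p)" proof -
  obtain Q :: "real^'n^'n" where "transpose Q ** grA p ** Q = mat 1" by (rule pos_def_orthonormalize[OF gram_sym[of p] gram_pos[of _ p]]) (assumption | rule that)+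
  from minv_orthonormal(1)[OF this] show ?thesis by (simp add:matrix_transpose_mul)
 qed
 hence "minv (grA p) $ j $ k = minv (grA p) $ k $ j" for j k
  by (auto dest!:arg_cong[where f = "%X. X $ k $ j"] simp:transpose_def)
 thus ?thesis by (simp add:scalar_curvature_def trace_def matrix_matrix_mult_def Rmat_def) (subst sum.swap, simp)
qed

lemma ric_Ck: "c : A ==> Ck_on m (TU c) (%z. ric (ibc c z))" proof (rule Ck_cong[OF TU_open])
 assume c: "c : A"
 note o = TU_open[OF c] and id = Ck_ident[OF TU_open[OF c]]
 let ?\<Gamma> = "christoffel (%_::(unit, 'n) chart. g c) undefined"
 have G: "Ck_on k (img c) (?\<Gamma> l i j)" for k l i j by (rule metric_field.christoffel_Ck[OF mf[OF c]])
 have C: "Ck_on m (img c) (%x. curv (%_::(unit, 'n) chart. g c) undefined l k i j x)" for l k i j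
  unfolding curv_def pd_def by (intro Ck_add Ck_diff Ck_sum Ck_mult Ck_D[OF G] G open_img c)
 show "Ck_on m (TU c) (%z. Ric (g c) (fst z) (snd z))" unfolding Ric_def trace_def matrix_def Rm_def vec_lambda_beta
  by (intro Ck_sum Ck_mult Ck_vec_nth Ck_snd Ck_const o id
   Ck_compose[OF o open_img[OF c] Ck_fst[OF o id] _ C]) (auto simp:TU_def)
 show "Ric (g c) (fst z) (snd z) = ric (ibc c z)" if "z : TU c" for z
  using ric_chart[OF c fst_ibc[OF c that]] bundle_ibc[OF c, of z] that by (simp add:TU_iff)
qed

lemma Ck_Cfun: "(!!c. c : A ==> Ck_on m (TU c) (%z. f (ibc c z))) ==> Cfun f"
 unfolding Cfun_def using Ck_cont nq_one by (blast intro:cont_subset)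

lemma ric_Cfun: "Cfun ric" by (rule Ck_Cfun[OF ric_Ck[of _ 0]])

text \<open>The spherical mean of a quadratic form is its trace divided by n, and the trace of the
  Ricci form is the scalar curvature. The last term restores the constant subtracted in
  \<open>mean_reduced_scalar\<close>.\<close>

lemma ric_average:
 "(LINT z|mu. ric z) / measure mu SN = mrs k / real CARD('n) + (real CARD('n) - 1) * k" proof -
 let ?n = "real CARD('n)" and ?ka = "kap TYPE('n)" and ?S = "scalar_curvature A g" and ?V = "measure vol UNIV"
 obtain b where b: "!!z. z : SN ==> abs (ric z) <= b" using Cfun_bounded[OF ric_Cfun] by blast
 \<comment> \<open>On unit vectors adding the constant \<open>b\<close> means adding
   \<open>b\<close> times the metric to the form. The shifted form is nonnegative, so
   \<open>mu_quadratic\<close> applies; it also supplies measurability and integrability of the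
   scalar curvature.\<close>
 let ?B = "%p. Rmat p + b *R grA p" and ?f = "%z. ric z + b"
 note fm = borel_measurable_add[OF Cfun_meas[OF ric_Cfun] borel_measurable_const[of b]]
 have q: "?f (p, v) = v <.> (?B p *v v)" if "(p, v) : SN" for p v using norm_at_sq[of p v] that
  by (simp add:unit_sphere_bundle_def ric_Rmat mv_add_r inner_add_right scaleR_mv[symmetric])
 have pos: "?f z >= 0" if "z : SN" for z using b[OF that] by linarith
 have tr: "trace (minv (grA p) ** ?B p) = ?S p + b * ?n" for p
  using minv_mult[of "grA p"] pos_def_det_pos[OF gram_sym gram_pos, of p]
  by (simp add:scalar_Rmat matrix_add_ldistrib trace_add matrix_scalar_ac scalar_matrix_assoc[symmetric] trace_scaleR trace_I)
 have Spos: "?S p + b * ?n >= 0" for p using nu_quadratic(2)[OF fm q pos, of p] by (simp add:tr)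
 have "(%p. enn2real (ennreal (?n * ?ka * (?S p + b * ?n)))) : borel_measurable vol"
  using mu_quadratic(2)[OF fm q pos] by (simp add:tr)
 hence "(%p. ?n * ?ka * (?S p + b * ?n)) : borel_measurable vol" using Spos measure_mu(3) by simp
 hence "(%p. (?n * ?ka * (?S p + b * ?n)) / (?n * ?ka) - b * ?n) : borel_measurable vol" by measurable
 hence Sm: "?S : borel_measurable vol" using measure_mu(3) by simp
 interpret M: finite_measure mu by (rule mu_finite)
 interpret V: finite_measure vol using vol_finite by (intro finite_measureI) simp
 have ri: "integrable mu ric" by (rule Cfun_integrable[OF ric_Cfun])
 have fi: "(NN mu (%z. ennreal (?f z))) = ennreal ((LINT z|mu. ric z) + b * measure mu SN)"
  using ri pos by (subst nn_integral_eq_integral) (auto simp:space_mu mult.commute intro!:AE_I2)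
 have "(NN mu (%z. ennreal (?f z))) = (NN vol (%p. ennreal (?n * ?ka * (?S p + b * ?n))))"
  using mu_quadratic(1)[OF fm q pos] by (simp add:tr)
 note E = this
 have lt: "(NN vol (%p. ennreal (?n * ?ka * (?S p + b * ?n)))) < \<infinity>" unfolding E[symmetric] fi by simp
 have i: "integrable vol (%p. ?n * ?ka * (?S p + b * ?n))"
  using lt Sm Spos measure_mu(3) by (intro integrableI_nonneg) auto
 note E
 also have "(NN vol (%p. ennreal (?n * ?ka * (?S p + b * ?n)))) = ennreal (LINT p|vol. ?n * ?ka * (?S p + b * ?n))"
  by (rule nn_integral_eq_integral[OF i]) (use Spos measure_mu(3) in auto)
 finally have e: "(LINT z|mu. ric z) + b * measure mu SN = (LINT p|vol. ?n * ?ka * (?S p + b * ?n))" unfolding fi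
 proof (rule ennreal_inj[THEN iffD1, rotated 2])
  have "(LINT z|mu. ?f z) >= 0" using pos by (intro integral_nonneg_AE AE_I2) (simp add:space_mu)
  thus "0 <= (LINT z|mu. ric z) + b * measure mu SN" using ri by (simp add:space_mu mult.commute)
  show "0 <= (LINT p|vol. ?n * ?ka * (?S p + b * ?n))"
   using Spos measure_mu(3) by (intro integral_nonneg_AE AE_I2) simp
 qed
 have "integrable vol (%p. (?n * ?ka * (?S p + b * ?n)) / (?n * ?ka) - b * ?n)" using i by (intro Bochner_Integration.integrable_diff integrable_divide) auto
 hence Si: "integrable vol ?S" using measure_mu(3) by simp
 have "(LINT z|mu. ric z) = ?n * ?ka * (LINT p|vol. ?S p)" using e Si by (simp add:measure_mu(2) alg)
 moreover have "mrs k = (LINT p|vol. ?S p) / ?V - ?n * (?n - 1) * k"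
  unfolding mean_reduced_scalar_def using Si measure_mu(4) by (simp add:diff_divide_distrib)
 ultimately show ?thesis using measure_mu(3,4) by (simp add:measure_mu(2) field_simps)
qed

end

section \<open>Invariance of the measure under the geodesic flow\<close>

text \<open>Dominated convergence along sequences, with difference quotients bounded by the mean
  value inequality. The derivative is taken within \<open>I\<close>, which also covers end points of
  intervals.\<close>

lemma deriv_integral:
 fixes f :: "real => 'z => real"
 assumes I: "convex I" "t0 : I" and f: "!!t. t : I ==> integrable M (f t)"
  and d: "!!z t. z : space M ==> t : I ==> ((%s. f s z) hasRD f' t z) (at t within I)"
  and b: "!!z t. z : space M ==> t : I ==> abs (f' t z) <= w z" and w: "integrable M w"
  and m: "f' t0 : borel_measurable M"
 shows "integrable M (f' t0)" "((%s. \<integral>z. f s z \<partial>M) hasRD (LINT z|M. f' t0 z)) (at t0 within I)"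
proof -
 show "integrable M (f' t0)" by (rule Bochner_Integration.integrable_bound[OF w m AE_I2]) (use b I(2) in fastforce)
 have "((%s. ((LINT z|M. f s z) - (LINT z|M. f t0 z)) / (s - t0)) o X) ----> (LINT z|M. f' t0 z)"
  if X: "ALL i. X i : I - {t0}" "X ----> t0" for X proof -
  let ?q = "%i z. (f (X i) z - f t0 z) / (X i - t0)"
  have XI: "X i : I" "X i ~= t0" for i using X(1) by auto
  have "(%i. \<integral>z. ?q i z \<partial>M) ----> (LINT z|M. f' t0 z)"
  proof (rule integral_dominated_convergence[OF m _ w])
   show "?q i : borel_measurable M" for i
    using borel_measurable_integrable[OF f[OF XI(1)]] borel_measurable_integrable[OF f[OF I(2)]] by simp
   show "AE z in M. (%i. ?q i z) ----> f' t0 z" proof (rule AE_I2)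
    fix z assume "z : space M"
    from d[OF this I(2)] X show "(%i. ?q i z) ----> f' t0 z"
     unfolding has_field_derivative_iff tendsto_at_iff_sequentially by (auto simp:o_def)
   qed
   show "AE z in M. norm (?q i z) <= w z" for i proof (rule AE_I2)
    fix z assume z: "z : space M"
    have "norm (f (X i) z - f t0 z) <= w z * norm (X i - t0)"
     by (rule field_differentiable_bound[OF I(1) d[OF z]]) (use b[OF z] XI I(2) in auto)
    thus "norm (?q i z) <= w z" using XI(2)[of i] by (simp add:divide_le_eq)
   qed
  qed
  moreover have "(%i. \<integral>z. ?q i z \<partial>M) = (%s. ((LINT z|M. f s z) - (LINT z|M. f t0 z)) / (s - t0)) o X"
   using f[OF XI(1)] f[OF I(2)] by (simp add:fun_eq_iff)
  ultimately show ?thesis by simp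
 qed
 thus "((%s. \<integral>z. f s z \<partial>M) hasRD (LINT z|M. f' t0 z)) (at t0 within I)"
  unfolding has_field_derivative_iff tendsto_at_iff_sequentially by blast
qed

text \<open>By translation invariance the integral of \<open>v (z + s *R b)\<close> does not depend
  on \<open>s\<close>; differentiating under the integral at \<open>s = 0\<close> gives the
  claim.\<close>

lemma integral_derivative_zero:
 fixes v :: "'e::euclidean_space => real"
 assumes v: "Ck_on (Suc 0) UNIV v" and K: "compact K" "!!z. z ~: K ==> v z = 0"
 shows "integrable lborel (%z. Df v z b)" "(LINT z|lborel. Df v z b) = 0" proof -
 note dv = Ck_hasD[OF v UNIV_I]
 have cont: "cont_on UNIV (%z. Df v z b)" "cont_on UNIV v" using Ck_D[OF v] Ck_cont[OF v] by auto
 have zero: "Df v z b = 0" if "z ~: K" for z proof -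
  have "Df v z = Df (%_. 0) z" by (rule Df_cong[of "- K"]) (use K that compact_imp_closed[OF K(1)] in auto)
  thus ?thesis by simp
 qed
 have bound: "EX B. ALL z. abs (h z) <= B" if h: "cont_on UNIV h" "!!z. z ~: K ==> h z = 0" for h :: "'e => real"
 proof -
  have "bounded (h ` K)" using K(1) h(1) by (intro compact_imp_bounded compact_image cont_subset[OF h(1)]) auto
  then obtain B where "ALL z:K. abs (h z) <= B" unfolding bounded_iff by auto
  hence "abs (h z) <= abs B" for z using h(2)[of z] by (cases "z : K") fastforce+
  thus ?thesis by blast
 qed
 obtain B where B: "!!z. abs (Df v z b) <= B" using bound[OF cont(1) zero] by blast
 obtain C where C: "!!z. abs (v z) <= C" using bound[OF cont(2) K(2)] by blast
 obtain R where R: "ALL z:K. norm z <= R" using compact_imp_bounded[OF K(1)] unfolding bounded_iff by blast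
 \<comment> \<open>Contains every point that a translation by \<open>s *R b\<close> with
   \<open>abs s <= 1\<close> can bring into \<open>K\<close>, so one integrable bound serves all
   these \<open>s\<close>.\<close>
 let ?K = "cball (0::'e) (R + norm b)"
 have int: "integrable lborel (%z. ind ?K z * D :: real)" for D
  using emeasure_bounded_finite[OF bounded_cball] by (intro integrable_mult_left integrable_real_indicator) auto
 have off: "z + s *R b ~: K" if "z ~: ?K" "abs s <= 1" for z s proof
  assume "z + s *R b : K"
  hence "norm (z + s *R b) <= R" using R by auto
  moreover have "norm z <= norm (z + s *R b) + norm (s *R b)" using norm_triangle_ineq4[of "z + s *R b" "s *R b"] by simp
  moreover have "norm (s *R b) <= norm b" using that(2) by (simp add:mult_left_le_one_le)
  ultimately show False using that(1) by simp
 qed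
 let ?f = "%s z. v (z + s *R b)" and ?f' = "%s z. Df v (z + s *R b) b"
 have m: "(%z. h (z + s *R b)) : borel_measurable lborel" if "cont_on UNIV h" for h :: "'e => real" and s
  using that by (auto intro!:cont_BM cont_compose[OF that] continuous_intros)
 have dm: "abs (h (z + s *R b)) <= ind ?K z * D" if "!!z. abs (h z) <= D" "!!z. z ~: K ==> h z = 0" "s : {-1..1}"
  for h :: "'e => real" and D s z proof (cases "z : ?K")
  case True
  thus ?thesis using that(1)[of "z + s *R b"] by (simp add:indicator_def)
 next
  case False
  thus ?thesis using that(2)[OF off[of z s]] that(3) by (auto simp:indicator_def)
 qed
 have i: "integrable lborel (?f s)" if "s : {-1..1}" for s
  by (rule Bochner_Integration.integrable_bound[OF int[of C] m[OF cont(2)] AE_I2])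
   (unfold real_norm_def, rule order_trans[OF dm[OF C K(2) that] abs_ge_self])
 have d: "((%s. ?f s z) has_real_derivative ?f' s z) (at s within {-1..1})" for s z proof -
  have "((%s. z + s *R b) hasD (%h. h *R b)) (at s)" by (auto intro!:deriv_intros)
  from hasD_compose[OF this dv[of "z + s *R b"]]
  have "((%s. ?f s z) hasD (%h. h * ?f' s z)) (at s)"
   using linear_scale[OF hasD_linear[OF dv[of "z + s *R b"]]] by simp
  thus ?thesis by (simp add:hasRD_def mult_commute_abs hasD_within)
 qed
 note u = deriv_integral[of "{-1..1}" 0 lborel ?f ?f' "%z. ind ?K z * B", OF _ _ i d _ int m[OF cont(1)]]
 have bd: "abs (?f' s z) <= ind ?K z * B" if "s : {-1..1}" for s z by (rule dm[OF B zero that])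
 show "integrable lborel (%z. Df v z b)" using u(1) bd by simp
 have "(LINT z|lborel. ?f s z) = (LINT z|lborel. v z)" for s proof -
  have "(LINT z|distr lborel borel ((+) (s *R b)). v z) = (LINT z|lborel. ?f s z)"
   by (subst integral_distr) (use cont(2) in "auto simp:add.commute intro:cont_BM")
  thus ?thesis by (simp add:lborel_distr_plus)
 qed
 hence "((%s. \<integral>z. v z \<partial>lborel) hasRD (LINT z|lborel. Df v z b)) (at (0::real) within {-1..1})"
  using u(2) bd by simp
 hence "((%s. \<integral>z. v z \<partial>lborel) hasRD (LINT z|lborel. Df v z b)) (at (0::real))"
  by (simp add:at_within_Icc_at)
 from DERIV_unique[OF this DERIV_const] show "(LINT z|lborel. Df v z b) = 0" .
qed

lemma integral_derivative_zero_on: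
 fixes v :: "'e::euclidean_space => real"
 assumes U: "open U" and v: "Ck_on (Suc 0) U v" and K: "compact K" "K <= U" "!!z. z : U ==> z ~: K ==> v z = 0"
 shows "integrable lborel (%z. ind U z * Df v z b)" "(LINT z|lborel. ind U z * Df v z b) = 0" proof -
 let ?v = "%z. if z : U then v z else 0"
 have oK: "open (- K)" using compact_imp_closed[OF K(1)] by auto
 have C: "Ck_on (Suc 0) UNIV ?v" proof (rule Ck_local)
  fix z
  have "Ck_on (Suc 0) U ?v" by (rule Ck_cong[OF U _ v]) simp
  moreover have "Ck_on (Suc 0) (- K) ?v" by (rule Ck_cong[OF oK _ Ck_const[where c = 0]]) (use K(3) in auto)
  ultimately show "EX T. open T & z : T & Ck_on (Suc 0) T ?v" using U oK K(2) by (cases "z : K") blast+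
 qed
 have "ind U z * Df v z b = Df ?v z b" for z proof (cases "z : U")
  case True
  thus ?thesis using Df_cong[OF U True, of v ?v] by simp
 next
  case False
  hence "Df ?v z = Df (%_. 0) z" by (intro Df_cong[OF oK]) (use K(2,3) in auto)
  thus ?thesis using False by simp
 qed
 thus "integrable lborel (%z. ind U z * Df v z b)" "(LINT z|lborel. ind U z * Df v z b) = 0"
  using integral_derivative_zero[OF C K(1), of b] K(2,3) by auto
qed

text \<open>The building block of all cutoffs and bumps. Squaring the positive part makes it once
  continuously differentiable, the order demanded by \<open>C1fun\<close> and the divergence
  argument.\<close>

definition pos_sq :: "real => real" where "pos_sq y = (max 0 y)^2"

lemma pos_sq_Ck: "Ck_on (Suc 0) UNIV pos_sq" proof (rule Ck_SucI)
 fix y :: real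
 have "(pos_sq hasRD 2 * max 0 y) (at y)" proof (cases "y = 0")
  case True
  have "((%h. pos_sq h / h) ---> 0) (at 0)" proof (rule Lim_null_comparison)
   show "\<forall>\<^sub>F h in at 0. norm (pos_sq h / h) <= abs h"
    by (rule always_eventually) (auto simp:pos_sq_def sq_eq max_def)
   show "((%h::real. abs h) ---> 0) (at 0)" by (rule tendsto_eq_intros refl | simp)+
  qed
  thus ?thesis using True by (simp add:has_field_derivative_iff pos_sq_def)
 next
  case False
  show ?thesis proof (cases "y > 0")
   case True
   have "((%y. y\<^sup>2) hasRD 2 * y) (at y)" by (auto intro!:deriv_intros)
   hence "(pos_sq hasRD 2 * y) (at y)"
    by (rule hasRD_open[of _ _ _ "{0<..}"]) (use True in "auto simp:pos_sq_def")
   thus ?thesis using True by simp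
  next
   case F: False
   have "(pos_sq hasRD 0) (at y)"
    by (rule hasRD_open[of "%_. 0" _ _ "{..<0}"]) (use False F in "auto simp:pos_sq_def")
   thus ?thesis using F by simp
  qed
 qed
 thus "(pos_sq hasD (%h. h * (2 * max 0 y))) (at y)" by (simp add:hasRD_def mult_commute_abs)
qed (auto intro!:continuous_intros)

lemma Ck_pos_sq:
 fixes f :: "'a::real_normed_vector => real"
 shows "open S ==> Ck_on (Suc 0) S f ==> Ck_on (Suc 0) S (%x. pos_sq (f x))"
 by (rule Ck_compose[OF _ open_UNIV _ _ pos_sq_Ck]) auto

context riem_compact
begin

section \<open>The geodesic flow as a derivation, and its divergence\<close>

lemma ibc_bundle_fst: "c : A ==> fst z : dom_ch c ==> ibc c (bch c z) = z"
 using ibc_bundle[of c "fst z" "snd z"] by simp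

lemma nq_spray:
 assumes c: "c : A" and z: "z : TU c"
 shows "(nq c hasD Df (nq c) z) (at z)" "Df (nq c) z (spray c z) = 0" proof -
 obtain x v where xv: "z = (x, v)" by (cases z)
 have x: "x : img c" using z xv by (simp add:TU_iff)
 let ?h = "g c"
 interpret m: metric_field "img c" ?h by (rule mf[OF c])
 have "((%z. ?h (fst z)) hasD (%h. Df ?h x (fst h))) (at z)"
  by (rule hasD_compose[OF has_derivative_fst[OF hasD_ident]]) (use m.h_deriv[OF x] xv in simp)
 from has_derivative_inner[OF has_derivative_snd[OF hasD_ident] matvec_hasD[OF this has_derivative_snd[OF hasD_ident]]]
 have "((%z. snd z <.> (?h (fst z) *v snd z)) hasD
   (%h. v <.> (?h x *v snd h + Df ?h x (fst h) *v v) + snd h <.> (?h x *v v))) (at z)" by (simp add:xv)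
 hence d: "(nq c hasD (%h. v <.> (?h x *v snd h + Df ?h x (fst h) *v v) + snd h <.> (?h x *v v))) (at z)"
  by (rule hasD_open[OF _ TU_open[OF c] z]) (simp add:nq_def)
 thus "(nq c hasD Df (nq c) z) (at z)" using Df_eq[OF d] by simp
 have "v <.> (?h x *v a) = a <.> (?h x *v v)" for a using m.h_commute[OF x] by blast
 thus "Df (nq c) z (spray c z) = 0" unfolding Df_eq[OF d] using m.metric_compatible[OF x, of v v v]
  by (simp add:spray_def xv inner_add_right)
qed

lemma Fl_preimage_open: "c : A ==> open {t. fst (Fl t z) : dom_ch c}"
 using geo_open[OF geo(1)[of "fst z" "snd z"]] by (simp add:Fl_def vimage_def)

text \<open>Metric compatibility makes \<open>nq\<close> constant along the spray
  (\<open>nq_spray\<close>). The vanishing derivative is checked in a chart at each time separately,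
  so the orbit may pass through many charts.\<close>

lemma norm_Fl: "nmA (fst (Fl t z)) (snd (Fl t z)) = nmA (fst z) (snd z)" proof -
 let ?e = "%t. (nmA (fst (Fl t z)) (snd (Fl t z)))\<^sup>2"
 have "(?e hasRD 0) (at t)" for t proof -
  define c where "c = chA (fst (Fl t z))"
  have c: "c : A" "fst (Fl t z) : dom_ch c" by (auto simp:c_def chart_at)
  let ?ga = "%s. bch c (Fl s z)"
  have g: "?ga t : TU c" using bundle_fst[OF c, of "snd (Fl t z)"] c(2) by (simp add:TU_iff)
  have "((%s. nq c (?ga s)) hasD (%h. Df (nq c) (?ga t) (h *R spray c (?ga t)))) (at t)"
   by (rule hasD_compose[OF Fl_deriv[OF c, unfolded hasVD_def] nq_spray(1)[OF c(1) g]])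
  moreover have "Df (nq c) (?ga t) (h *R spray c (?ga t)) = 0" for h
   using linear_scale[OF hasD_linear[OF nq_spray(1)[OF c(1) g]]] nq_spray(2)[OF c(1) g] by simp
  ultimately have "((%s. nq c (?ga s)) hasRD 0) (at t)" by (simp add:hasRD_def lambda_zero)
  thus ?thesis proof (rule hasRD_open[OF _ Fl_preimage_open[OF c(1)]])
   fix s assume "s : {t. fst (Fl t z) : dom_ch c}"
   thus "nq c (?ga s) = ?e s" using norm_at_nq[OF c(1), of "fst (Fl s z)" "snd (Fl s z)"] nq_nonneg[OF c(1)] by simp
  qed (use c in simp)
 qed
 hence "?e t = ?e 0" using DERIV_isconst_all[of ?e] by blast
 thus ?thesis using norm_at_nonneg by (simp add:power2_eq_iff_nonneg)
qed

lemma Fl_SN: "z : SN ==> Fl t z : SN" using norm_Fl[of t z] by (simp add:unit_sphere_bundle_def case_prod_beta)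

definition "C1fun F <-> (ALL c:A. Ck_on (Suc 0) (TU c) (%z. F (ibc c z)))" for F :: "'a * (real^'n) => real"

text \<open>The geodesic vector field acting on functions of the tangent bundle. Defined by the
  flow, it does not refer to any chart.\<close>

definition "X F z = deriv (%s. F (Fl s z)) 0" for F :: "'a * (real^'n) => real"

lemma flow_deriv:
 assumes F: "C1fun F" and c: "c : A" "fst (Fl t z) : dom_ch c"
 shows "((%s. F (Fl s z)) hasRD Df (%y. F (ibc c y)) (bch c (Fl t z)) (spray c (bch c (Fl t z)))) (at t)" proof -
 let ?ga = "%s. bch c (Fl s z)" and ?F = "%y. F (ibc c y)"
 have g: "?ga t : TU c" using bundle_fst[OF c, of "snd (Fl t z)"] c(2) by (simp add:TU_iff)
 have dF: "(?F hasD Df ?F (?ga t)) (at (?ga t))" using F c(1) g unfolding C1fun_def by (blast intro:Ck_hasD)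
 have "((%s. ?F (?ga s)) hasD (%h. Df ?F (?ga t) (h *R spray c (?ga t)))) (at t)"
  by (rule hasD_compose[OF Fl_deriv[OF c, unfolded hasVD_def] dF])
 hence "((%s. ?F (?ga s)) hasRD Df ?F (?ga t) (spray c (?ga t))) (at t)"
  using linear_scale[OF hasD_linear[OF dF]] by (simp add:hasRD_def mult_commute_abs)
 thus ?thesis proof (rule hasRD_open[OF _ Fl_preimage_open[OF c(1)]])
  fix s assume "s : {t. fst (Fl t z) : dom_ch c}"
  thus "F (ibc c (?ga s)) = F (Fl s z)" using ibc_bundle_fst[OF c(1), of "Fl s z"] by simp
 qed (use c in simp)
qed

lemma X_chart:
 assumes "C1fun F" "c : A" "z : TU c"
 shows "X F (ibc c z) = Df (%y. F (ibc c y)) z (spray c z)" proof -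
 have "bch c (Fl 0 (ibc c z)) = z" using bundle_ibc[OF assms(2)] assms(3) by (simp add:TU_iff)
 thus ?thesis using flow_deriv[OF assms(1,2), of 0 "ibc c z"] fst_ibc[OF assms(2,3)]
  unfolding X_def by (intro DERIV_imp_deriv) simp
qed

lemma X_deriv:
 assumes F: "C1fun F"
 shows "((%s. F (Fl s z)) hasRD X F (Fl t z)) (at t)" proof -
 let ?c = "chA (fst (Fl t z))"
 have "bch ?c (Fl t z) : TU ?c"
  using bundle_fst[OF chart_at, of "fst (Fl t z)" "snd (Fl t z)"] chart_at(2) by (simp add:TU_iff)
 from X_chart[OF F chart_at(1) this] flow_deriv[OF F chart_at, where t = t and z = z]
 show ?thesis using ibc_bundle[OF chart_at, of "fst (Fl t z)" "snd (Fl t z)"] by simp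
qed

lemma X_Cfun: "C1fun F ==> Cfun (X F)" proof (rule Ck_Cfun[of 0])
 assume F: "C1fun F"
 fix c assume c: "c : A"
 note o = TU_open[OF c]
 have FC: "Ck_on (Suc 0) (TU c) (%z. F (ibc c z))" using F c by (simp add:C1fun_def)
 have "Ck_on 0 (TU c) (%z. SUM b:Basis. (spray c z <.> b) * Df (%y. F (ibc c y)) z b)"
  by (intro Ck_sum Ck_mult Ck_inner Ck_const spray_Ck c Ck_D[OF FC] o)
 moreover have "(SUM b:Basis. (spray c z <.> b) * Df (%y. F (ibc c y)) z b) = X F (ibc c z)" if "z : TU c" for z
 proof -
  have l: "linear (Df (%y. F (ibc c y)) z)" by (rule hasD_linear[OF Ck_hasD[OF FC that]])
  show ?thesis unfolding X_chart[OF F c that]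
   by (subst (3) eucl_rep[symmetric]) (simp only: linear_sum[OF l] linear_scale[OF l] real_scaleR_def)
 qed
 ultimately show "Ck_on 0 (TU c) (%z. X F (ibc c z))" by (rule Ck_cong[OF o, rotated])
qed

lemma ibc_scale: "c : A ==> z : TU c ==> ibc c (fst z, t *R snd z) = (fst (ibc c z), t *R snd (ibc c z))"
 using linear_scale[OF L_linear[OF _ chart_at(1) _ chart_at(2), of c]] by (simp add:ibc_def TU_iff inv_in)

lemma Fl_scale: "Fl s (p, a *R v) = (fst (Fl (a * s) (p, v)), a *R snd (Fl (a * s) (p, v)))"
 by (simp add:Fl_def geo_scale)

lemma nq_pos_open: "c : A ==> open {z. 0 < nq c z}" proof -
 assume c: "c : A"
 have "{z. 0 < nq c z} = TU c Int nq c -` {0<..}" by (auto intro:nq_gt)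
 thus ?thesis using open_preimage[OF Ck_cont[OF nq_Ck[OF c, of 0]] TU_open[OF c]] by simp
qed

text \<open>The horizontal part of the spray does not depend on the position, so only the vertical
  part has divergence, namely minus twice the trace of \<open>Gam\<close>. The logarithmic
  derivative of \<open>det g\<close> along the vector is the same trace taken twice
  (\<open>det_h_deriv\<close>).\<close>

lemma spray_divergence:
 assumes c: "c : A" and z: "z : TU c"
 shows "Df (%z. det (g c (fst z))) z (spray c z) + det (g c (fst z)) * (SUM b:Basis. Df (spray c) z b <.> b) = 0"
proof -
 obtain x v where xv: "z = (x, v)" by (cases z)
 have x: "x : img c" using z xv by (simp add:TU_iff)
 interpret m: metric_field "img c" "g c" by (rule mf[OF c])
 let ?G = "Gam (g c) x"
 have dS: "(spray c hasD Df (spray c) z) (at z)" by (rule Ck_hasD[OF spray_Ck[OF c, of "Suc 0"] z])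
 have lS: "linear (Df (spray c) z)" by (rule hasD_linear[OF dS])
 have bb: "bounded_bilinear ?G"
  using Gam_linear[of "g c" x] by (simp add:bilinear_conv_bounded_bilinear[symmetric] bilinear_def)
 have 0: "Df (spray c) z (0, b) = (b, - (?G v b + ?G b v))" for b proof -
  have "((%w. (x, w)) hasD (%b. (0, b))) (at v)" by (auto intro!:deriv_intros)
  from hasD_compose[OF this dS[unfolded xv]]
  have d1: "((%w. spray c (x, w)) hasD (%b. Df (spray c) z (0, b))) (at v)" by (simp add:xv)
  have d2: "((%w. spray c (x, w)) hasD (%b. (b, - (?G v b + ?G b v)))) (at v)" unfolding spray_def fst_conv snd_conv
   by (intro has_derivative_Pair has_derivative_minus hasD_ident bounded_bilinear.FDERIV[OF bb])
  show ?thesis by (rule fun_cong[OF hasD_unique[OF d1 d2]])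
 qed
 have 1: "Df (spray c) z (b, 0) <.> (b, 0) = 0" for b proof -
  have d1: "((%z. fst (spray c z)) hasD (%h. fst (Df (spray c) z h))) (at z)" by (rule has_derivative_fst[OF dS])
  have d2: "((%z. fst (spray c z)) hasD (%h. snd h)) (at z)" unfolding spray_def by (auto intro!:deriv_intros)
  from fun_cong[OF hasD_unique[OF d1 d2]] have "fst (Df (spray c) z (b, 0)) = snd (b, 0::real^'n)" .
  thus ?thesis by (simp add:inner_prod_def)
 qed
 have "(SUM b:Basis. Df (spray c) z b <.> b) = (SUM b:Basis. Df (spray c) z (b, 0) <.> (b, 0)) + (SUM b:Basis. Df (spray c) z (0, b) <.> (0, b))"
  unfolding Basis_prod_def by (subst sum.union_disjoint) (auto simp:sum.reindex inj_on_def)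
 also have "... = - 2 * (SUM b:Basis. ?G v b <.> b)" proof -
  have "Df (spray c) z (0, b) <.> (0, b) = - 2 * (?G v b <.> b)" for b proof -
   have "Df (spray c) z (0, b) <.> (0, b) = - (?G v b <.> b) - ?G b v <.> b" by (simp add:0 inner_prod_def inner_add_left inner_diff_left)
   thus ?thesis using arg_cong[OF m.Gam_sym[OF x, of b v], of "%w. w <.> b"] by linarith
  qed
  thus ?thesis using 1 by (simp add:sum_distrib_left sum_negf)
 qed
 also have "(SUM b:Basis. ?G v b <.> b) = trace (matrix (?G v))" proof -
  have "Basis = range (%i::'n. axis i (1::real))" by (auto simp:Basis_vec_def)
  thus ?thesis using sum.reindex[of "%i::'n. axis i (1::real)" UNIV "%b. ?G v b <.> b"]
   by (simp add:inj_on_def axis_eq_axis trace_def matrix_def inner_axis)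
 qed
 finally have s: "(SUM b:Basis. Df (spray c) z b <.> b) = - 2 * trace (matrix (?G v))" .
 have "((%z. det (g c (fst z))) hasD (%h. 2 * det (g c x) * trace (matrix (?G (fst h))))) (at z)"
  by (rule hasD_compose[OF has_derivative_fst[OF hasD_ident]]) (use m.det_h_deriv[OF x] xv in simp)
 from Df_eq[OF this] show ?thesis unfolding s by (simp add:xv spray_def)
qed

text \<open>Integration by parts: each component of \<open>det g\<close> times \<open>v\<close>
  times the spray has compact support, so its derivatives integrate to 0, and by
  \<open>spray_divergence\<close> their sum is the integrand.\<close>

lemma integral_spray:
 assumes c: "c : A" and U: "open U" "U <= TU c" and v: "Ck_on (Suc 0) U v"
  and K: "compact K" "K <= U" "!!z. z : U ==> z ~: K ==> v z = 0"
 shows "(LINT z|lborel. ind U z * (det (g c (fst z)) * Df v z (spray c z))) = 0" proof -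
 let ?r = "%z. det (g c (fst z))" and ?S = "spray c"
 have o: "open (TU c)" by (rule TU_open[OF c])
 have rC: "Ck_on (Suc 0) (TU c) ?r"
  by (rule Ck_compose[OF o open_img[OF c] Ck_fst[OF o Ck_ident[OF o]] _ det_g_Ck[OF c]]) (auto simp:TU_def)
 define Y where "Y b z = ?r z * v z * (?S z <.> b)" for b z
 have YC: "Ck_on (Suc 0) U (Y b)" for b unfolding Y_def[abs_def]
  by (intro Ck_mult Ck_inner Ck_const U v Ck_subset[OF rC U(2)] Ck_subset[OF spray_Ck[OF c] U(2)])
 have Y0: "Y b z = 0" if "z : U" "z ~: K" for b z using K(3)[OF that] by (simp add:Y_def)
 note I = integral_derivative_zero_on[OF U(1) YC K(1,2) Y0]
 have "(SUM b:Basis. Df (Y b) z b) = ?r z * Df v z (?S z)" if z: "z : U" for z proof -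
  have zT: "z : TU c" using z U(2) by blast
  note dv = Ck_hasD[OF v z] and dr = Ck_hasD[OF rC zT] and dS = Ck_hasD[OF spray_Ck[OF c, of "Suc 0"] zT]
  have "Df (Y b) z b = (?r z * v z) * (Df ?S z b <.> b) + (?r z * Df v z b + Df ?r z b * v z) * (?S z <.> b)" for b
   unfolding Y_def[abs_def]
   by (subst Df_eq[OF has_derivative_mult[OF has_derivative_mult[OF dr dv] has_derivative_inner_left[OF dS]]]) simp
  hence "(SUM b:Basis. Df (Y b) z b) = (?r z * v z) * (SUM b:Basis. Df ?S z b <.> b)
    + ?r z * (SUM b:Basis. (?S z <.> b) * Df v z b) + v z * (SUM b:Basis. (?S z <.> b) * Df ?r z b)"
   by (simp add:sum.distrib sum_distrib_left alg)
  moreover have "(SUM b:Basis. (?S z <.> b) * f b) = f (?S z)" if "linear f" for f :: "_ => real"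
   by (subst (3) eucl_rep[symmetric]) (simp only: linear_sum[OF that] linear_scale[OF that] real_scaleR_def)
  ultimately have "(SUM b:Basis. Df (Y b) z b) = ?r z * Df v z (?S z) + v z * (Df ?r z (?S z) + ?r z * (SUM b:Basis. Df ?S z b <.> b))"
   using hasD_linear[OF dv] hasD_linear[OF dr] by (simp add:alg)
  thus ?thesis using spray_divergence[OF c zT] by simp
 qed
 hence "(%z. ind U z * (?r z * Df v z (?S z))) = (%z. SUM b:Basis. ind U z * Df (Y b) z b)"
  by (auto simp:fun_eq_iff sum_distrib_left[symmetric] split:split_indicator)
 note e = this
 have "(LINT z|lborel. (SUM b:Basis. ind U z * Df (Y b) z b)) = (SUM b:Basis. \<integral>z. ind U z * Df (Y b) z b \<partial>lborel)"
  by (rule Bochner_Integration.integral_sum) (rule I(1))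
 also have "... = (SUM b:(Basis :: ((real^'n) * (real^'n)) set). 0)" by (rule sum.cong[OF refl]) (rule I(2))
 finally show ?thesis unfolding e by simp
qed

text \<open>A differentiable replacement for the indicator of the interval from 0 to 1. It vanishes
  unless \<open>m * s * (1 - s) > 1\<close>, hence near both ends; the quotient keeps it below 1,
  and it tends to 1 inside as \<open>m\<close> grows.\<close>

definition "cutoff m s = pos_sq (real m * (s * (1 - s)) - 1) / (1 + pos_sq (real m * (s * (1 - s)) - 1))"

lemma pos_sq_nonneg: "pos_sq y >= 0" and pos_sq_zero: "y <= 0 ==> pos_sq y = 0" and pos_sq_pos: "y > 0 ==> pos_sq y > 0"
 by (simp_all add:pos_sq_def)

lemma cut_bound: "0 <= cutoff m s" "cutoff m s <= 1" "cutoff m s ~= 0 ==> 0 < s & s < 1" proof -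
 note p = pos_sq_nonneg[of "real m * (s * (1 - s)) - 1"]
 show "0 <= cutoff m s" "cutoff m s <= 1" using p by (simp_all add:cutoff_def divide_le_eq)
 assume "cutoff m s ~= 0"
 hence "real m * (s * (1 - s)) - 1 > 0" using pos_sq_zero by (force simp:cutoff_def not_le[symmetric])
 hence "s * (1 - s) > 0" by (metis less_add_same_cancel1 diff_gt_0_iff_gt less_trans zero_less_mult_pos zero_less_one of_nat_0_le_iff mult_nonneg_nonpos not_le)
 thus "0 < s & s < 1" by (auto simp:zero_less_mult_iff)
qed

lemma cut_tendsto: "0 < s ==> s < 1 ==> (%m. cutoff m s) ----> 1" proof -
 assume s: "0 < s" "s < 1"
 let ?a = "s * (1 - s)"
 have a: "?a > 0" using s by simp
 have top: "filterlim (%m. real m * ?a - 1) at_top sequentially"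
  using filterlim_tendsto_pos_mult_at_top[OF tendsto_const a filterlim_real_sequentially]
  by (intro filterlim_tendsto_add_at_top[OF tendsto_const[of "-1"], of "%m. real m * ?a", simplified add.commute[of "-1"] add_uminus_conv_diff]) (simp add:mult.commute)
 have "(%m. 1 - 1 / (1 + (real m * ?a - 1)^2)) ----> 1 - 0"
  by (intro tendsto_diff tendsto_const tendsto_divide_0[OF tendsto_const] filterlim_at_top_imp_at_infinity
   filterlim_tendsto_add_at_top[OF tendsto_const] filterlim_pow_at_top top) simp
 moreover have "\<forall>\<^sub>F m in sequentially. 1 - 1 / (1 + (real m * ?a - 1)^2) = cutoff m s"
  using filterlim_at_top_dense[THEN iffD1, OF top, rule_format, of 0] proof eventually_elim
  case (elim m)
  hence "pos_sq (real m * ?a - 1) = (real m * ?a - 1)^2" by (simp add:pos_sq_def)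
  moreover have "1 + (real m * ?a - 1)^2 > 0" by (simp add:add_pos_nonneg)
  ultimately show ?case by (simp add:cutoff_def field_simps)
 qed
 ultimately show ?thesis by (simp add:tendsto_cong)
qed

lemma X_zero:
 assumes K: "closed K" and F: "!!z. fst z ~: K ==> F z = 0" and z: "fst z ~: K"
 shows "X F z = 0" proof -
 have "cont_on UNIV (%t. fst (Fl t z))"
  using geodesic_cont[OF geo(1)[of "fst z" "snd z"]] by (simp add:Fl_def cont_onI)
 hence "open ((%t. fst (Fl t z)) -` (- K))" using K by (simp add:open_vimage open_Compl)
 hence "((%t. F (Fl t z)) hasRD 0) (at 0)"
  by (intro hasRD_open[OF DERIV_const[of 0]]) (use F[of "Fl _ z"] z in auto)
 thus ?thesis unfolding X_def by (rule DERIV_imp_deriv)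
qed

text \<open>\<open>mu_chart\<close> turns the integral into one over the solid shell, where
  \<open>integral_spray\<close> needs compact support away from the zero section and the unit
  sphere. Cutoffs in \<open>nq\<close> provide it and are removed by dominated convergence.\<close>

lemma liouville_chart:
 assumes c: "c : A" and F: "C1fun F" and K: "compact K" "K <= img c" and F0: "!!z. fst z ~: inv_ch c ` K ==> F z = 0"
 shows "(LINT z|mu. X F z) = 0" proof -
 let ?U = "{z. 0 < nq c z}" and ?H = "%z. X F (psi c z)"
 have oU: "open ?U" by (rule nq_pos_open[OF c])
 have UT: "?U <= TU c" using nq_gt by blast
 have psi: "psi c z = ibc c (nz c z)" if "z : ?U" for z using that by (simp add:psi_def)
 have nzT: "nz c z : TU c" if "z : ?U" for z using nq_one[OF nz_unit[OF c]] that by simp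
 have Kp: "closed (inv_ch c ` K)" "inv_ch c ` K <= dom_ch c"
  using compact_imp_closed[OF compact_image[OF cont_subset[OF inv_cont[OF c] K(2)] K(1)]] inv_in[OF c] K(2) by auto
 have notK: "fst (psi c z) ~: inv_ch c ` K" if zU: "z : ?U" and zK: "fst z ~: K" for z proof
  assume "fst (psi c z) : inv_ch c ` K"
  then obtain k where k: "k : K" "inv_ch c (fst z) = inv_ch c k" by (auto simp:psi[OF zU] ibc_def nz_def)
  have "fst z : img c" using UT zU by (auto simp:TU_iff)
  hence "fst z = k" using k map_inv[OF c] K(2) by (metis subsetD)
  thus False using k zK by simp
 qed
 have H0: "?H z = 0" if "z : ?U" "fst z ~: K" for z by (rule X_zero[OF Kp(1) F0 notK[OF that]])
 \<comment> \<open>On vectors of length \<open>N\<close> the flow runs \<open>N\<close> times as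
   fast as on unit vectors (\<open>Fl_scale\<close>); the root in the denominator compensates. The
   cutoff is constant along the flow, so the derivative along the spray is the cutoff times
   \<open>X F\<close> at the projected vector, as stated in \<open>D\<close>.\<close>
 define v where "v m z = cutoff m (nq c z) / sqrt (nq c z) * F (ibc c (nz c z))" for m z
 have vC: "Ck_on (Suc 0) ?U (v m)" for m proof -
  note nqU = Ck_subset[OF nq_Ck[OF c] UT] and idU = Ck_ident[OF oU]
  have sq: "Ck_on (Suc 0) ?U (%z. sqrt (nq c z))" by (rule Ck_sqrt[OF oU nqU]) simp
  have "Ck_on (Suc 0) ?U (%z. (fst z, (1 / sqrt (nq c z)) *R snd z))"
   by (intro Ck_Pair Ck_scaleR Ck_divide Ck_const Ck_fst Ck_snd idU oU sq) auto
  hence nzC: "Ck_on (Suc 0) ?U (nz c)" by (simp add:nz_def[abs_def] divide_inverse del:Ck_on.simps)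
  have FC: "Ck_on (Suc 0) (TU c) (%z. F (ibc c z))" using F c by (simp add:C1fun_def)
  have "Ck_on (Suc 0) ?U (%z. F (ibc c (nz c z)))"
   by (rule Ck_compose[OF oU TU_open[OF c] nzC _ FC]) (use nzT in auto)
  moreover have "Ck_on (Suc 0) ?U (%z. pos_sq (real m * (nq c z * (1 - nq c z)) - 1))"
   by (intro Ck_pos_sq Ck_diff Ck_mult Ck_const nqU oU)
  ultimately show ?thesis unfolding v_def[abs_def] cutoff_def
   by (intro Ck_mult Ck_divide Ck_add Ck_const oU sq) (auto simp:add_pos_nonneg pos_sq_nonneg pos_sq_def add_nonneg_eq_0_iff)
 qed
 have D: "Df (v m) z (spray c z) = cutoff m (nq c z) * ?H z" if z: "z : ?U" for m z proof -
  define N where "N = sqrt (nq c z)"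
  have N: "N > 0" using z by (simp add:N_def)
  have zT: "z : TU c" using z UT by blast
  let ?y = "ibc c z" and ?y' = "ibc c (nz c z)"
  let ?ga = "%s. bch c (Fl s ?y)"
  have yd: "fst (Fl 0 ?y) : dom_ch c" using fst_ibc[OF c zT] by simp
  have g0: "?ga 0 = z" using bundle_ibc[OF c] zT by (simp add:TU_iff)
  have y: "?y = (fst ?y', N *R snd ?y')"
   using ibc_scale[OF c nzT[OF z], of N] N by (simp add:nz_def N_def[symmetric] flip: N_def)
  note dv = Ck_hasD[OF vC[of m] z]
  have dv0: "(v m hasD Df (v m) z) (at (?ga 0))" unfolding g0 by (rule dv)
  have "((%s. v m (?ga s)) hasD (%h. Df (v m) z (h *R spray c z))) (at 0)"
   using hasD_compose[OF Fl_deriv[OF c yd, unfolded hasVD_def] dv0] unfolding g0 .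
  hence d1: "((%s. v m (?ga s)) hasRD Df (v m) z (spray c z)) (at 0)"
   using linear_scale[OF hasD_linear[OF dv]] by (simp add:hasRD_def mult_commute_abs)
  have "((%s. F (Fl s ?y')) hasRD X F ?y') (at (N * 0))" using X_deriv[OF F, of ?y' 0] by simp
  from DERIV_cmult[OF DERIV_chain2[OF this DERIV_cmult_Id[of N]], of "cutoff m (nq c z) / N"]
  have "((%s. cutoff m (nq c z) / N * F (Fl (N * s) ?y')) hasRD cutoff m (nq c z) * ?H z) (at 0)"
   using N z by (simp add:psi)
  hence "((%s. v m (?ga s)) hasRD cutoff m (nq c z) * ?H z) (at 0)"
  proof (rule hasRD_open[OF _ Fl_preimage_open[OF c, of ?y]])
   fix s assume "s : {t. fst (Fl t ?y) : dom_ch c}"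
   hence s: "fst (Fl s ?y) : dom_ch c" by simp
   have sT: "?ga s : TU c" using bundle_fst[OF c s, of "snd (Fl s ?y)"] s by (simp add:TU_iff)
   have "sqrt (nq c (?ga s)) = sqrt (nq c z)"
    using norm_at_nq[OF c s, of "snd (Fl s ?y)"] norm_at_nq[OF c yd, of "snd ?y"] norm_Fl[of s ?y] g0 by simp
   hence n: "nq c (?ga s) = nq c z" by simp
   have 1: "ibc c (nz c (?ga s)) = (fst (Fl s ?y), inverse N *R snd (Fl s ?y))"
    using ibc_scale[OF c sT, of "inverse N"] ibc_bundle_fst[OF c s] by (simp add:nz_def n N_def)
   have 2: "Fl s ?y = (fst (Fl (N * s) ?y'), N *R snd (Fl (N * s) ?y'))"
    unfolding y using Fl_scale[of s "fst ?y'" N "snd ?y'"] by simp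
   have "ibc c (nz c (?ga s)) = Fl (N * s) ?y'" unfolding 1 using N by (simp add:2)
   thus "cutoff m (nq c z) / N * F (Fl (N * s) ?y') = v m (?ga s)" by (simp add:v_def n N_def)
  qed (use yd in simp)
  thus ?thesis using d1 DERIV_unique by blast
 qed
 have Im: "(LINT z|lborel. ind ?U z * (det (g c (fst z)) * Df (v m) z (spray c z))) = 0" for m
 proof (rule integral_spray[OF c oU UT vC])
  let ?J = "{s. 1 <= real m * (s * (1 - s))}"
  have J: "0 < s & s < 1" if "s : ?J" for s proof -
   have "~ s * (1 - s) <= 0" using that mult_nonneg_nonpos[of "real m" "s * (1 - s)"] by auto
   thus ?thesis by (auto simp:not_le zero_less_mult_iff)
  qed
  have "closed ?J" by (intro closed_Collect_le continuous_intros)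
  thus "compact {z. fst z : K & nq c z : ?J}" using J by (intro compact_shell[OF c K]) force+
  show "{z. fst z : K & nq c z : ?J} <= ?U" using J by auto
  fix z assume z: "z : ?U" "z ~: {z. fst z : K & nq c z : ?J}"
  show "v m z = 0" proof (cases "fst z : K")
   case True
   hence "real m * (nq c z * (1 - nq c z)) - 1 <= 0" using z by auto
   thus ?thesis using pos_sq_zero by (simp add:v_def cutoff_def)
  next
   case False
   thus ?thesis using F0[OF notK[OF z(1) False]] psi[OF z(1)] by (simp add:v_def)
  qed
 qed
 have vd: "det (g c (fst z)) = (vdens c (fst z))^2" if "z : ?U" for z proof -
  have "fst z : img c" using UT that by (auto simp:TU_iff)
  thus ?thesis using det_g_pos[OF c, of "fst z"] by (simp add:vdens_def vd_def)
 qed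
 let ?g = "%m z. ind ?U z * ((vdens c (fst z))^2 * (cutoff m (nq c z) * ?H z))"
 let ?g' = "%z. ind {z. 0 < nq c z & nq c z < 1} z * ((vdens c (fst z))^2 * ?H z)"
 have g0: "(LINT z|lborel. ?g m z) = 0" for m proof -
  have "ind ?U z * (det (g c (fst z)) * Df (v m) z (spray c z)) = ?g m z" for z
   using D[of z m] vd[of z] by (auto split:split_indicator)
  from Im[of m, unfolded this] show ?thesis .
 qed
 have "bounded ((%x. det (g c x)) ` K)"
  using K cont_subset[OF Ck_cont[OF det_g_Ck[OF c, of 0]]] by (intro compact_imp_bounded compact_image)
 then obtain R where R: "!!x. x : K ==> abs (det (g c x)) <= R" unfolding bounded_iff by auto
 obtain B where B: "!!z. z : SN ==> abs (X F z) <= B" using Cfun_bounded[OF X_Cfun[OF F]] by blast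
 let ?K = "{z. fst z : K & nq c z : {..1}}"
 have cK: "compact ?K" by (rule compact_shell[OF c K]) auto
 let ?w = "%z. ind ?K z * (abs R * abs B) :: real"
 have w: "integrable lborel ?w"
  using cK emeasure_bounded_finite[OF compact_imp_bounded[OF cK]] compact_imp_closed[OF cK]
  by (intro integrable_mult_left integrable_real_indicator) auto
 have psiSN: "psi c z : SN" for z using measurable_space[OF psi_meas[OF c], of z] by (simp add:space_mu)
 have bd: "norm (?g m z) <= ?w z" for m z proof (cases "z : ?U & fst z : K & nq c z < 1")
  case True
  have "abs (cutoff m (nq c z) * ?H z) <= 1 * abs B"
   unfolding abs_mult using cut_bound[of m "nq c z"] B[OF psiSN[of z]] by (intro mult_mono) auto
  hence "abs ((vdens c (fst z))^2 * (cutoff m (nq c z) * ?H z)) <= abs R * abs B"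
   unfolding abs_mult[of "(vdens c (fst z))^2"] using True vd[of z] R[of "fst z"] by (intro mult_mono) auto
  thus ?thesis using True by simp
 next
  case False
  hence "?g m z = 0" using H0[of z] cut_bound(3)[of m "nq c z"] by (auto split:split_indicator)
  thus ?thesis by (simp only: norm_zero) simp
 qed
 note [measurable] = nq_meas[OF c] measurable_compose[OF borel_measurable_fst vdens_meas[OF c]]
  measurable_compose[OF psi_meas[OF c] Cfun_meas[OF X_Cfun[OF F]]]
 have "(%m. \<integral>z. ?g m z \<partial>lborel) ----> (LINT z|lborel. ?g' z)"
 proof (rule integral_dominated_convergence[OF _ _ w])
  show "?g' : borel_measurable lborel" by measurable
  show "?g m : borel_measurable lborel" for m unfolding cutoff_def pos_sq_def by measurable
  show "AE z in lborel. (%m. ?g m z) ----> ?g' z" proof (rule AE_I2)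
   fix z
   show "(%m. ?g m z) ----> ?g' z" proof (cases "0 < nq c z & nq c z < 1")
    case True
    hence "(%m. (vdens c (fst z))\<^sup>2 * (cutoff m (nq c z) * ?H z)) ----> (vdens c (fst z))^2 * (1 * ?H z)"
     by (intro tendsto_intros cut_tendsto) auto
    thus ?thesis using True by simp
   next
    case False
    hence e: "?g m z = 0" for m using cut_bound(3)[of m "nq c z"] by auto
    show ?thesis unfolding e using False by simp
   qed
  qed
 qed (use bd in simp)
 hence "(LINT z|lborel. ?g' z) = 0" unfolding g0 by (simp add:LIMSEQ_const_iff)
 moreover have "(%z. sdens c z * X F (ibc c (nz c z))) = (%z. real CARD('n) * ?g' z)"
  by (auto simp:sdens_def psi_def fun_eq_iff split:split_indicator)
 ultimately have "(LINT z|mu. ind (Pc c) z * X F z) = 0"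
  unfolding mu_chart[OF c Cfun_meas[OF X_Cfun[OF F]]] by simp
 moreover have "ind (Pc c) z * X F z = X F z" if "z : SN" for z proof (cases "fst z : dom_ch c")
  case False
  hence "X F z = 0" by (intro X_zero[OF Kp(1) F0]) (use Kp(2) in auto)
  thus ?thesis by simp
 qed (use that in "simp add:Pc_def")
 ultimately show ?thesis using Bochner_Integration.integral_cong[OF refl, of mu "%z. ind (Pc c) z * X F z" "X F"] by (simp add:space_mu)
qed

text \<open>Positive exactly on the coordinate ball of \<open>T\<close>. Divided by their sum these
  functions form the partition of unity used in \<open>liouville\<close>.\<close>

definition "bump T p = (if p : dom_ch (fst T) then pos_sq ((snd (snd T))^2 - (norm (map_ch (fst T) p - fst (snd T)))^2) else 0)"

lemma bump_C1:
 assumes T: "(c, x0, dta) : BC"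
 shows "C1fun (%z. bump (c, x0, dta) (fst z))" "fst z ~: inv_ch c ` cball x0 dta ==> bump (c, x0, dta) (fst z) = 0"
proof -
 note c = BC(2)[OF T] and dta = BC(3)[OF T] and K = BC(4)[OF T]
 let ?Kp = "inv_ch c ` cball x0 dta"
 have Kp: "closed ?Kp" "?Kp <= dom_ch c"
  using compact_imp_closed[OF compact_image[OF cont_subset[OF inv_cont[OF c] K] compact_cball]] inv_in[OF c] K by auto
 have zero: "bump (c, x0, dta) p = 0" if "p ~: ?Kp" for p proof (cases "p : dom_ch c")
  case True
  have "map_ch c p ~: cball x0 dta" using that inv_map[OF c True] by (metis imageI)
  hence "dta^2 <= (norm (map_ch c p - x0))^2" using dta by (intro power_mono) (auto simp:dist_norm norm_minus_commute)
  thus ?thesis using pos_sq_zero by (simp add:bump_def)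
 qed (simp add:bump_def)
 thus "fst z ~: ?Kp ==> bump (c, x0, dta) (fst z) = 0" .
 have "Ck_on (Suc 0) (TU d) (%z. bump (c, x0, dta) (fst (ibc d z)))" if d: "d : A" for d proof (rule Ck_local)
  fix z assume z: "z : TU d"
  let ?O1 = "ov d c >< (UNIV :: (real^'n) set)" and ?O2 = "TU d Int (%z. inv_ch d (fst z)) -` (- ?Kp)"
  have o1: "open ?O1" using ov_open[OF d c] by (simp add:open_Times)
  have o2: "open ?O2"
   by (rule open_preimage[OF cont_compose[OF inv_cont[OF d] continuous_on_fst[OF continuous_on_id]] TU_open[OF d]])
    (use Kp(1) in "auto simp:TU_def")
  have C1: "Ck_on (Suc 0) ?O1 (%z. bump (c, x0, dta) (fst (ibc d z)))" proof (rule Ck_cong[OF o1])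
   have t: "Ck_on (Suc 0) ?O1 (%z. transition d c (fst z))"
    by (rule Ck_compose[OF o1 ov_open[OF d c] Ck_fst[OF o1 Ck_ident[OF o1]] _ trans_Ck[OF d c]]) auto
   show "Ck_on (Suc 0) ?O1 (%z. pos_sq (dta^2 - (transition d c (fst z) - x0) <.> (transition d c (fst z) - x0)))"
    by (intro Ck_pos_sq Ck_diff Ck_inner Ck_const t o1)
  qed (auto simp:bump_def ibc_def inv_map[OF d] trans_map[OF d] power2_norm_eq_inner)
  have C2: "Ck_on (Suc 0) ?O2 (%z. bump (c, x0, dta) (fst (ibc d z)))"
   by (rule Ck_cong[OF o2 _ Ck_const[where c = 0]]) (use zero in "auto simp:ibc_def")
  show "EX T. open T & z : T & Ck_on (Suc 0) T (%z. bump (c, x0, dta) (fst (ibc d z)))"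
  proof (cases "inv_ch d (fst z) : ?Kp")
   case True
   hence "z : ?O1" using z Kp(2) map_inv[OF d, of "fst z"] inv_in[OF d, of "fst z"] ov_memI[of "inv_ch d (fst z)" d c]
    by (cases z) (auto simp:TU_iff)
   thus ?thesis using o1 C1 by blast
  next
   case False
   hence "z : ?O2" using z by simp
   thus ?thesis using o2 C2 by blast
  qed
 qed
 thus "C1fun (%z. bump (c, x0, dta) (fst z))" by (simp add:C1fun_def del:Ck_on.simps)
qed

text \<open>\<open>X\<close> is additive, so a partition of unity splits \<open>F\<close> into
  pieces supported over compact subsets of single charts, where \<open>liouville_chart\<close>
  applies.\<close>

theorem liouville:
 assumes F: "C1fun F"
 shows "(LINT z|mu. X F z) = 0" proof -
 define S where "S p = (SUM T:BC. bump T p)" for p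
 have nonneg: "bump T p >= 0" for T p by (simp add:bump_def pos_sq_nonneg)
 have S: "S p > 0" for p proof -
  obtain c x dta where T: "(c, x, dta) : BC" "p : dom_ch c" "dist (map_ch c p) x < dta" using BC(5)[of p] by blast
  have "(norm (map_ch c p - x))^2 < dta^2" using T(3) by (intro power_strict_mono) (auto simp:dist_norm)
  hence "bump (c, x, dta) p > 0" using pos_sq_pos T(2) by (simp add:bump_def)
  also have "bump (c, x, dta) p <= S p" unfolding S_def by (rule member_le_sum[OF T(1) nonneg BC(1)])
  finally show ?thesis .
 qed
 let ?F = "%T z. bump T (fst z) * F z / S (fst z)"
 have bC: "Ck_on (Suc 0) (TU c) (%z. bump T (fst (ibc c z)))" if "c : A" "T : BC" for c T
  using bump_C1(1)[of "fst T" "fst (snd T)" "snd (snd T)"] that by (simp add:C1fun_def del:Ck_on.simps)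
 have C1: "C1fun (?F T)" if "T : BC" for T unfolding C1fun_def S_def proof
  fix c assume c: "c : A"
  have "Ck_on (Suc 0) (TU c) (%z. F (ibc c z))" using F c by (simp add:C1fun_def)
  thus "Ck_on (Suc 0) (TU c) (%z. bump T (fst (ibc c z)) * F (ibc c z) / (SUM T:BC. bump T (fst (ibc c z))))"
   by (intro Ck_divide Ck_mult Ck_sum bC c that TU_open) (use S in "simp_all add:S_def less_imp_neq[symmetric]")
 qed
 have "X F z = (SUM T:BC. X (?F T) z)" for z proof -
  have "((%s. SUM T:BC. ?F T (Fl s z)) hasRD (SUM T:BC. X (?F T) z)) (at 0)"
   by (rule DERIV_sum) (use X_deriv[OF C1, of _ z 0] in simp)
  moreover have "(SUM T:BC. ?F T y) = F y" for y
   using S[of "fst y"] by (simp add:S_def sum_divide_distrib[symmetric] sum_distrib_right[symmetric])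
  ultimately show ?thesis using X_deriv[OF F, of z 0] DERIV_unique by simp blast
 qed
 hence "(LINT z|mu. X F z) = (LINT z|mu. (SUM T:BC. X (?F T) z))" by simp
 also have "... = (SUM T:BC. \<integral>z. X (?F T) z \<partial>mu)"
  by (rule Bochner_Integration.integral_sum) (rule Cfun_integrable[OF X_Cfun[OF C1]])
 also have "... = 0" proof (rule sum.neutral, rule ballI)
  fix T assume T: "T : BC"
  obtain c x dta where t: "T = (c, x, dta)" by (cases T)
  show "(LINT z|mu. X (?F T) z) = 0" by (rule liouville_chart[of c _ "cball x dta", OF _ C1[OF T]])
    (use T bump_C1(2)[of c x dta] BC(2,4) in "auto simp:t")
 qed
 finally show ?thesis .
qed

lemma Ck_flow_comp:
 assumes F: "!!d. d : A ==> Ck_on k (TU d) (%z. F (ibc d z))" and c: "c : A" and t: "0 <= t"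
 shows "Ck_on k (TU c) (%z. F (Fl t (ibc c z)))" proof (rule Ck_local)
 fix z0 assume z0: "z0 : TU c"
 let ?d = "chA (fst (Fl t (ibc c z0)))"
 have "smooth_near c ?d t z0" by (rule flow_smooth) (use c z0 t chart_at in auto)
 then obtain W where W: "open W" "z0 : W" "W <= TU c" "!!z. z : W ==> fst (Fl t (ibc c z)) : dom_ch ?d"
  "!!k. Ck_on k W (flowc c ?d t)" unfolding smooth_near_def by blast
 have "Ck_on k W (%z. F (ibc ?d (flowc c ?d t z)))"
  by (rule Ck_compose[OF W(1) TU_open[OF chart_at(1)] W(5) _ F[OF chart_at(1)]]) (use flowc_TU[OF chart_at(1) W(4)] in auto)
 hence "Ck_on k W (%z. F (Fl t (ibc c z)))"
  by (rule Ck_cong[OF W(1), rotated]) (simp add:ibc_flowc[OF chart_at(1) W(4)])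
 thus "EX W. open W & z0 : W & Ck_on k W (%z. F (Fl t (ibc c z)))" using W by blast
qed

text \<open>The derivative in \<open>t\<close> of the average is the integral of \<open>X\<close>
  applied to the transported function, which is 0 by \<open>liouville\<close>. Invariance of the
  measure is thus used in its infinitesimal form.\<close>

lemma ric_flow_average:
 assumes "0 <= t"
 shows "(LINT z|mu. ric (Fl t z)) = (LINT z|mu. ric z)" proof -
 have C1: "C1fun ric" using ric_Ck by (simp add:C1fun_def del:Ck_on.simps)
 have C1t: "C1fun (%z. ric (Fl t z))" if "0 <= t" for t
  using Ck_flow_comp[OF ric_Ck _ that] by (simp add:C1fun_def del:Ck_on.simps)
 have Ct: "Cfun (%z. ric (Fl t z))" if "0 <= t" for t by (rule Ck_Cfun[OF Ck_flow_comp[OF ric_Ck _ that, of _ 0]])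
 \<comment> \<open>The generator commutes with its own flow, by \<open>Fl_add\<close>.\<close>
 have Xt: "X ric (Fl t z) = X (%z. ric (Fl t z)) z" if "0 <= t" for t z proof -
  have "((%s. ric (Fl s (Fl t z))) hasRD X ric (Fl t z)) (at 0)" using X_deriv[OF C1, of "Fl t z" 0] by simp
  thus ?thesis unfolding X_def[of "%z. ric (Fl t z)"] by (simp add:Fl_add add.commute DERIV_imp_deriv)
 qed
 obtain B where B: "!!z. z : SN ==> abs (X ric z) <= B" using Cfun_bounded[OF X_Cfun[OF C1]] by blast
 interpret finite_measure mu by (rule mu_finite)
 have "((%t. \<integral>z. ric (Fl t z) \<partial>mu) hasRD 0) (at t0 within {0..})" if t0: "t0 : {0..}" for t0
 proof -
  have "((%t. \<integral>z. ric (Fl t z) \<partial>mu) hasRD (LINT z|mu. X ric (Fl t0 z))) (at t0 within {0..})"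
  proof (rule deriv_integral(2)[where w = "%_. B"])
   show "(%z. X ric (Fl t0 z)) : borel_measurable mu" using Cfun_meas[OF X_Cfun[OF C1t]] t0 by (simp add:Xt)
  qed (use t0 B Fl_SN Cfun_integrable[OF Ct] has_field_derivative_at_within[OF X_deriv[OF C1]] in "auto simp:space_mu")
  thus ?thesis using liouville[OF C1t] t0 by (simp add:Xt)
 qed
 from has_field_derivative_zero_constant[OF _ this] obtain a where "!!t. t : {0..} ==> (LINT z|mu. ric (Fl t z)) = a" by auto
 from this[of t] this[of 0] show ?thesis using assms by simp
qed

end

section \<open>The mean logarithmic Jacobian\<close>

context riem_compact
begin

text \<open>The square of \<open>exp_jacobian\<close>. Free of root and absolute value, it is smooth
  on the whole tangent bundle, even where the Jacobian vanishes.\<close>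

definition "EJ z = det (hN (fst z) (snd z)) / det (grA (fst z))"

lemma EJ_local:
 assumes c: "c : A" "z : TU c" and d: "d : A" "exA (fst (ibc c z)) (snd (ibc c z)) : dom_ch d"
  and e: "(ec c d hasD e') (at z)"
 shows "EJ (ibc c z) = (det (matrix (%u. e' (0, u))))^2 * det (g d (ec c d z)) / det (g c (fst z))" proof -
 let ?p = "fst (ibc c z)" and ?v = "snd (ibc c z)"
 let ?La = "L (chA ?p) c ?p"
 have p: "?p : dom_ch c" by (rule fst_ibc[OF c])
 have b: "bch c (?p, ?v) = z" using bundle_ibc[OF c(1)] c(2) by (simp add:TU_iff)
 have v: "?v : expdom ?p d" using d(2) by (simp add:expdom_def)
 have lin: "linear ?La" by (rule L_linear[OF chart_at(1) c(1) chart_at(2) p])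
 have "linear (%u. (0 :: real^'n, u :: real^'n))" by (rule linearI) auto
 from linear_compose[OF this hasD_linear[OF e]] have lin2: "linear (%u. e' (0, u))" by (simp add:o_def)
 have "Df (Ec ?p d) ?v = (%u. e' (0, u)) o ?La" using DEc_ec[OF c(1) p d(1) v, of e'] e b by (simp add:fun_eq_iff)
 hence m: "det (matrix (Df (Ec ?p d) ?v)) = det (matrix (%u. e' (0, u))) * det (matrix ?La)"
  using matrix_compose[OF lin lin2] by (simp add:det_mul)
 have x: "map_ch c ?p = fst z" using b bundle_fst[OF c(1) p, of ?v] by simp
 have gp: "det (grA ?p) > 0" "det (g c (fst z)) > 0" using pos_def_det_pos[OF gram_sym gram_pos] det_g_pos[OF c(1)] c(2) by (auto simp:TU_iff)
 have "sqrt (det (grA ?p)) = abs (det (matrix ?La)) * sqrt (det (g c (fst z)))"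
  using vd_transition[OF chart_at(1) c(1) chart_at(2) p] by (simp add:vd_def gram_at_def coord_def x)
 hence "(sqrt (det (grA ?p)))^2 = (abs (det (matrix ?La)) * sqrt (det (g c (fst z))))^2" by simp
 hence gr: "det (grA ?p) = (det (matrix ?La))^2 * det (g c (fst z))" using gp by (simp add:power_mult_distrib)
 hence "det (matrix ?La) ~= 0" using gp by auto
 thus ?thesis using Ec_ec[OF c(1) p d(1) v] b gp by (simp add:EJ_def det_hN[OF d(1) v] m gr power_mult_distrib)
qed

lemma EJ_Ck: "c : A ==> Ck_on k (TU c) (%z. EJ (ibc c z))" proof (rule Ck_local)
 fix z0 assume c: "c : A" and z0: "z0 : TU c"
 let ?d = "chA (exA (fst (ibc c z0)) (snd (ibc c z0)))"
 note d = chart_at(1)[of "exA (fst (ibc c z0)) (snd (ibc c z0))"]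
 obtain W where W: "open W" "z0 : W" "W <= TU c" "!!z. z : W ==> exA (fst (ibc c z)) (snd (ibc c z)) : dom_ch ?d"
  "!!k. Ck_on k W (ec c ?d)" using ec_Ck_near[OF c z0 d chart_at(2)] by blast
 have im: "ec c ?d ` W <= img ?d" using flowc_TU[OF d, of 1 c] W(4) by (auto simp:ec_def TU_iff exp_map_Fl)
 have "Ck_on k W (%z. (det (matrix (%u. Df (ec c ?d) z (0, u))))\<^sup>2 * det (g ?d (ec c ?d z)) / det (g c (fst z)))"
  unfolding sq_eq by (intro Ck_divide Ck_mult W(1) Ck_compose[OF W(1) open_img[OF d] W(5) im det_g_Ck[OF d]]
   Ck_compose[OF W(1) open_img[OF c] Ck_fst[OF W(1) Ck_ident[OF W(1)]] _ det_g_Ck[OF c]] Ck_det)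
   (use W(3) det_g_pos[OF c] Ck_D[OF W(5)[of "Suc k"]] in "auto simp:TU_iff subset_eq matrix_def less_imp_neq[symmetric] simp del:Ck_on.simps intro!:Ck_vec_nth W(1)")
 hence "Ck_on k W (%z. EJ (ibc c z))"
  by (rule Ck_cong[OF W(1), rotated]) (use EJ_local[OF c _ d W(4) Ck_hasD[OF W(5)[of "Suc 0"]]] W(3) in "auto simp:subset_eq")
 thus "EX W. open W & z0 : W & Ck_on k W (%z. EJ (ibc c z))" using W by blast
qed

lemma admissible_coords:
 assumes r: "r : adm k" and z: "z : SN"
 obtains ro where "ro > r" "normal_coords (tball (fst z) ro) (hN (fst z))"
  "!!t. abs t < ro ==> t *R snd z : tball (fst z) ro" proof -
 have "ereal r < injectivity_radius A g" using r by (simp add:admissible_radii_def)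
 then obtain ro where ro: "ro > r" "ro > 0" "exp_diffeo_on A g (fst z) (tball (fst z) ro)" by (rule injectivity_radius_ball)
 show ?thesis by (rule that[OF ro(1) exp_diffeo_normal_coords[OF ro(2,3)]])
   (use z norm_at_scale in "auto simp:tangent_ball_def unit_sphere_bundle_def")
qed

lemma SN_nonzero: "z : SN ==> snd z ~= 0" by (auto simp:unit_sphere_bundle_def norm_at_def inner_at_def)

text \<open>Nonemptiness rests on \<open>injectivity_radius_pos\<close>; openness permits two-sided
  derivatives at every admissible radius.\<close>

lemma admissible_open: "open (adm k)" and admissible_nonempty: "adm k ~= {}"
 and admissible_pos: "r : adm k ==> r > 0 & s_fun k r > 0 & (k > 0 --> r < pi / sqrt k)"
 and admissible_less: "r : adm k ==> 0 < t ==> t <= r ==> t : adm k" proof -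
 let ?I = "adm k"
 have e: "?I = {0<..} Int ereal -` {..<injectivity_radius A g} Int (if k > 0 then {..<pi / sqrt k} else UNIV)"
  by (auto simp:admissible_radii_def)
 have o: "open (ereal -` {..<injectivity_radius A g})" by (intro open_vimage continuous_intros)
 show "open ?I" unfolding e by (intro open_Int o) simp_all
 show less: "t : ?I" if "r : ?I" "0 < t" "t <= r" for r t
  using that by (auto simp:admissible_radii_def intro:le_less_trans[of "ereal t" "ereal r"])
 show "r > 0 & s_fun k r > 0 & (k > 0 --> r < pi / sqrt k)" if "r : ?I"
  using that s_fun_pos[of r k] by (auto simp:admissible_radii_def)
 obtain dta where dta: "dta > 0" "ereal dta <= injectivity_radius A g" using injectivity_radius_pos by blast
 have "EX r>0. r < dta & (k > 0 --> r < pi / sqrt k)" proof (cases "k > 0")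
  case True
  define m where "m = min dta (pi / sqrt k)"
  have "m > 0" "m <= dta" "m <= pi / sqrt k" using True dta(1) by (auto simp:m_def)
  hence "0 < m / 2" "m / 2 < dta" "m / 2 < pi / sqrt k" by linarith+
  thus ?thesis by blast
 next
  case False
  thus ?thesis using dta(1) by (intro exI[of _ "dta / 2"]) auto
 qed
 then obtain r where r: "r > 0" "r < dta" "k > 0 --> r < pi / sqrt k" by blast
 hence "ereal r < ereal dta" by simp
 hence "ereal r < injectivity_radius A g" using dta(2) by (rule less_le_trans)
 hence "r : ?I" using r by (simp add:admissible_radii_def)
 thus "?I ~= {}" by blast
qed

definition "fL k t z = ln (polar_jacobian A g (fst z) t (snd z) / model_jacobian TYPE('n) k t)"
text \<open>The excess of the mean curvature of a geodesic sphere over that of the model sphere. It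
  is the radial derivative of \<open>fL\<close>, and \<open>s_fun\<close> squared times it is
  \<open>gap\<close>.\<close>

definition "fL' k t z = normal_coords.mean_curv (hN (fst z)) (snd z) t - (real CARD('n) - 1) * c_fun k t / s_fun k t"

lemma fL_eq:
 assumes t: "t : adm k" and z: "z : SN"
 shows "EJ (fst z, t *R snd z) > 0"
  and "fL k t z = (real CARD('n) - 1) * ln t + ln (sqrt (EJ (fst z, t *R snd z))) - (real CARD('n) - 1) * ln (s_fun k t)"
  and "ln (sqrt (EJ (fst z, t *R snd z))) = ln (sqrt (det (hN (fst z) (t *R snd z)))) - ln (sqrt (det (grA (fst z))))"
proof -
 let ?h = "det (hN (fst z) (t *R snd z))" and ?G = "det (grA (fst z))"
 obtain ro where ro: "ro > t" "normal_coords (tball (fst z) ro) (hN (fst z))" "!!t. abs t < ro ==> t *R snd z : tball (fst z) ro"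
  by (rule admissible_coords[OF t z]) (rule that; assumption)
 note tp = admissible_pos[OF t]
 have h: "?h > 0" by (rule normal_coords.det_h_pos[OF ro(2) ro(3)]) (use ro(1) tp in simp)
 have G: "?G > 0" by (rule pos_def_det_pos[OF gram_sym gram_pos])
 show E: "EJ (fst z, t *R snd z) > 0" using h G by (simp add:EJ_def)
 show "ln (sqrt (EJ (fst z, t *R snd z))) = ln (sqrt ?h) - ln (sqrt ?G)"
  using h G by (simp add:EJ_def real_sqrt_divide ln_div)
 have n: "real (CARD('n) - 1) = real CARD('n) - 1" by (simp add:of_nat_diff Suc_leI)
 have "polar_jacobian A g (fst z) t (snd z) = t ^ (CARD('n) - 1) * sqrt (EJ (fst z, t *R snd z))"
  by (simp add:polar_jacobian_def exp_jacobian_hN EJ_def real_sqrt_divide)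
 thus "fL k t z = (real CARD('n) - 1) * ln t + ln (sqrt (EJ (fst z, t *R snd z))) - (real CARD('n) - 1) * ln (s_fun k t)"
  using E tp by (simp add:fL_def model_jacobian_def ln_div ln_mult ln_realpow n)
qed

lemma EJ_deriv:
 assumes t: "t : adm k" and z: "z : SN"
 shows "((%s. ln (sqrt (EJ (fst z, s *R snd z)))) hasRD fL' k t z + (real CARD('n) - 1) * c_fun k t / s_fun k t - (real CARD('n) - 1) / t) (at t)"
proof -
 obtain ro where ro: "ro > t" "normal_coords (tball (fst z) ro) (hN (fst z))" "!!t. abs t < ro ==> t *R snd z : tball (fst z) ro"
  by (rule admissible_coords[OF t z]) (rule that; assumption)
 note tp = admissible_pos[OF t]
 have tU: "t *R snd z : tball (fst z) ro" using ro(1,3) tp by simp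
 from normal_coords.log_det_deriv[OF ro(2) _ tU] tp
 have "((%s. ln (sqrt (det (hN (fst z) (s *R snd z)))) - ln (sqrt (det (grA (fst z))))) hasRD
   normal_coords.mean_curv (hN (fst z)) (snd z) t - (real CARD('n) - 1) / t - 0) (at t)"
  by (intro DERIV_diff DERIV_const) auto
 hence "((%s. ln (sqrt (EJ (fst z, s *R snd z)))) hasRD normal_coords.mean_curv (hN (fst z)) (snd z) t - (real CARD('n) - 1) / t - 0) (at t)"
  by (rule hasRD_open[OF _ admissible_open[of k] t]) (use fL_eq(3)[OF _ z] in simp)
 thus ?thesis by (simp add:fL'_def)
qed

lemma fL_deriv:
 assumes t: "t : adm k" and z: "z : SN"
 shows "((%s. fL k s z) hasRD fL' k t z) (at t)" proof -
 let ?n = "real CARD('n) - 1"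
 note tp = admissible_pos[OF t]
 have "((%s. ?n * ln s + ln (sqrt (EJ (fst z, s *R snd z))) - ?n * ln (s_fun k s)) has_real_derivative
   ?n * (1 / t) + (fL' k t z + ?n * c_fun k t / s_fun k t - ?n / t) - ?n * (1 / s_fun k t * c_fun k t)) (at t)"
  by (intro DERIV_diff DERIV_add DERIV_cmult EJ_deriv[OF t z] DERIV_chain2[OF DERIV_ln_divide s_hasRD] DERIV_ln_divide) (use tp in auto)
 hence "((%s. ?n * ln s + ln (sqrt (EJ (fst z, s *R snd z))) - ?n * ln (s_fun k s)) hasRD fL' k t z) (at t)" by simp
 thus ?thesis by (rule hasRD_open[OF _ admissible_open t]) (simp add:fL_eq(2)[OF _ z])
qed

lemma s_fun_cont: "cont_on S (s_fun k)" and c_fun_continuous: "cont_on S (c_fun k)"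
 by (rule cont_onI; simp add:DERIV_isCont[OF s_hasRD] DERIV_isCont[OF c_fun_deriv])+

text \<open>\<open>fL'\<close> is defined through normal coordinates at each \<open>p\<close>
  separately, which shows no regularity in \<open>p\<close>. Its joint continuity is obtained by
  identifying it with an expression in the derivative of the smooth function
  \<open>EJ\<close>.\<close>

lemma fL_chart:
 assumes c: "c : A" and J: "J <= adm k"
 shows "cont_on ({z. nq c z = 1} \<times> J) (%(z, t). fL k t (ibc c z))"
  and "cont_on ({z. nq c z = 1} \<times> J) (%(z, t). fL' k t (ibc c z))" proof -
 let ?n = "real CARD('n) - 1" and ?E = "%z. EJ (ibc c z)" and ?S = "{z. nq c z = 1} \<times> J"
 let ?sg = "%y :: ((real^'n) * (real^'n)) \<times> real. (fst (fst y), snd y *R snd (fst y))"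
 have sg: "cont_on ?S ?sg" "?sg ` ?S <= TU c" using nq_one[of c] by (auto intro!:continuous_intros simp:TU_iff)
 have sn: "ibc c z : SN" "z : TU c" if "nq c z = 1" for z using that ibc_SN[OF c] nq_one by auto
 have ES: "EJ (fst (ibc c z), t *R snd (ibc c z)) = ?E (fst z, t *R snd z)" if "nq c z = 1" for z t
  using ibc_scale[OF c sn(2)[OF that]] by simp
 have Epos: "?E (?sg y) > 0" if "y : ?S" for y
  using fL_eq(1)[of "snd y" k "ibc c (fst y)"] ES[of "fst y" "snd y"] sn(1)[of "fst y"] that J by auto
 have cE: "cont_on ?S (%y. ?E (?sg y))" by (rule cont_compose[OF Ck_cont[OF EJ_Ck[OF c, of 0]] sg])
 have cs: "cont_on ?S (%y. s_fun k (snd y))" "cont_on ?S (%y. c_fun k (snd y))"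
  by (rule cont_compose[OF s_fun_cont[of UNIV] continuous_on_snd[OF continuous_on_id]]
   cont_compose[OF c_fun_continuous[of UNIV] continuous_on_snd[OF continuous_on_id]]; simp)+
 have tp: "snd y > 0 & s_fun k (snd y) > 0" if "y : ?S" for y using that J admissible_pos by auto
 have "cont_on ?S (%y. ?n * ln (snd y) + ln (sqrt (?E (?sg y))) - ?n * ln (s_fun k (snd y)))"
  by (intro continuous_intros cE cs continuous_on_ln) (use Epos tp in "auto simp:less_imp_neq[symmetric]")
 moreover have "?n * ln (snd y) + ln (sqrt (?E (?sg y))) - ?n * ln (s_fun k (snd y)) = (%(z, t). fL k t (ibc c z)) y" if "y : ?S" for y
  using fL_eq(2)[of "snd y" k "ibc c (fst y)"] ES[of "fst y" "snd y"] sn(1)[of "fst y"] that J by (auto simp:case_prod_beta)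
 ultimately show "cont_on ?S (%(z, t). fL k t (ibc c z))" by (rule continuous_on_eq)
 have dE: "(?E hasD Df ?E z) (at z)" if "z : TU c" for z by (rule Ck_hasD[OF EJ_Ck[OF c, of "Suc 0"] that])
 have "cont_on ?S (%y. ?n / snd y - ?n * c_fun k (snd y) / s_fun k (snd y)
   + (SUM b:Basis. (snd (fst y) <.> b) * Df ?E (?sg y) (0, b)) / (2 * ?E (?sg y)))"
  by (intro continuous_intros cE cs cont_compose[OF Ck_cont[OF Ck_D[OF EJ_Ck[OF c, of "Suc 0"]]] sg])
   (use Epos tp in "auto simp:less_imp_neq[symmetric]")
 moreover have "?n / snd y - ?n * c_fun k (snd y) / s_fun k (snd y)
   + (SUM b:Basis. (snd (fst y) <.> b) * Df ?E (?sg y) (0, b)) / (2 * ?E (?sg y)) = (%(z, t). fL' k t (ibc c z)) y" if y: "y : ?S" for y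
 proof -
  obtain z t where yz: "y = (z, t)" by (cases y)
  have z: "nq c z = 1" and t: "t : adm k" using y yz J by auto
  let ?s = "(fst z, t *R snd z)"
  have sT: "?s : TU c" using sn(2)[OF z] by (simp add:TU_iff)
  have E0: "?E ?s > 0" using Epos[OF y] yz by simp
  have l: "linear (Df ?E ?s)" by (rule hasD_linear[OF dE[OF sT]])
  have "((%t. (fst z, t *R snd z)) hasD (%h. (0, h *R snd z))) (at t)" by (auto intro!:deriv_intros)
  from hasD_compose[OF this dE[OF sT]]
  have "((%t. ?E (fst z, t *R snd z)) hasRD Df ?E ?s (0, snd z)) (at t)"
   using linear_scale[OF l, of _ "(0, snd z)"] by (simp add:hasRD_def mult_commute_abs)
  from DERIV_chain2[OF DERIV_ln_divide DERIV_chain2[OF DERIV_real_sqrt this]] E0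
  have "((%t. ln (sqrt (?E (fst z, t *R snd z)))) hasRD 1 / sqrt (?E ?s) * (inverse (sqrt (?E ?s)) / 2 * Df ?E ?s (0, snd z))) (at t)" by simp
  moreover have "1 / sqrt (?E ?s) * (inverse (sqrt (?E ?s)) / 2 * Df ?E ?s (0, snd z)) = Df ?E ?s (0, snd z) / (2 * ?E ?s)"
  proof -
   have w: "1 / w * (inverse w / 2 * D) = D / (2 * (w * w))" for w D :: real
    by (simp only: divide_inverse inverse_mult_distrib mult_1_left mult_ac)
   have "sqrt (?E ?s) * sqrt (?E ?s) = ?E ?s" using E0 by simp
   thus ?thesis unfolding w by simp
  qed
  ultimately have "fL' k t (ibc c z) + ?n * c_fun k t / s_fun k t - ?n / t = Df ?E ?s (0, snd z) / (2 * ?E ?s)"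
   using EJ_deriv[OF t sn(1)[OF z]] unfolding ES[OF z] by (metis DERIV_unique)
  moreover have "Df ?E ?s (0, snd z) = (SUM b:Basis. (snd z <.> b) * Df ?E ?s (0, b))" proof -
   have "linear (%u. (0 :: real^'n, u :: real^'n))" by (rule linearI) auto
   from linear_compose[OF this l] have "linear (%u. Df ?E ?s (0, u))" by (simp add:o_def)
   from linear_sum[OF this, of "%b. (snd z <.> b) *R b" Basis] linear_scale[OF this]
   show ?thesis by (simp add:eucl_rep)
  qed
  ultimately show ?thesis by (simp add:yz)
 qed
 ultimately show "cont_on ?S (%(z, t). fL' k t (ibc c z))" by (rule continuous_on_eq)
qed

lemma Cfun_slice: "(!!c. c : A ==> cont_on ({z. nq c z = 1} >< {t}) (%(z, t). f t (ibc c z))) ==> Cfun (f t)"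
 unfolding Cfun_def proof
 fix c assume "!!c. c : A ==> cont_on ({z. nq c z = 1} >< {t}) (%(z, t). f t (ibc c z))" "c : A"
 hence "cont_on ({z. nq c z = 1} >< {t}) (%(z, t). f t (ibc c z))" .
 moreover have "cont_on {z. nq c z = 1} (%z. (z, t))" by (intro continuous_intros)
 ultimately show "cont_on {z. nq c z = 1} (%z. f t (ibc c z))"
  using cont_compose[of "{z. nq c z = 1} >< {t}" "%(z, t). f t (ibc c z)" "{z. nq c z = 1}" "%z. (z, t)"] by auto
qed

lemma mean_log_deriv:
 assumes r: "r : adm k"
 shows "(mlj k hasRD (LINT z|mu. fL' k r z) / measure mu SN) (at r)" "integrable mu (fL' k r)" "Cfun (fL' k r)"
proof -
 obtain ep where ep: "ep > 0" "cball r ep <= adm k" using admissible_open r open_contains_cball by blast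
 let ?J = "{r - ep..r + ep}"
 have J: "?J <= adm k" using ep(2) by (simp add:cball_eq_atLeastAtMost)
 obtain B where B: "ALL t:?J. ALL z:SN. abs (fL' k t z) <= B" using chart_bounded[OF compact_Icc fL_chart(2)[OF _ J]] by blast
 have C: "Cfun (fL k t)" "Cfun (fL' k t)" if "t : ?J" for t
  by (rule Cfun_slice[of t "fL k"] Cfun_slice[of t "fL' k"], rule fL_chart, assumption, use that J in blast)+
 have rJ: "r : ?J" using ep(1) by simp
 interpret finite_measure mu by (rule mu_finite)
 have d: "((%s. fL k s z) hasRD fL' k t z) (at t within ?J)" if "z : space mu" "t : ?J" for z t
  using fL_deriv[of t k z] that J has_field_derivative_at_within by (force simp:space_mu)
 note D = deriv_integral[of ?J r mu "fL k" "fL' k" "%_. B", OF _ rJ Cfun_integrable[OF C(1)] d _ _ Cfun_meas[OF C(2)[OF rJ]]]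
 have "((%s. \<integral>z. fL k s z \<partial>mu) hasRD (LINT z|mu. fL' k r z)) (at r within ?J)"
  using D(2) B by (simp add:space_mu)
 hence "((%s. \<integral>z. fL k s z \<partial>mu) hasRD (LINT z|mu. fL' k r z)) (at r)" using ep(1) by (simp add:at_within_Icc_at)
 from DERIV_cdivide[OF this, of "measure mu SN"]
 show "(mlj k hasRD (LINT z|mu. fL' k r z) / measure mu SN) (at r)"
  by (simp add:mean_log_jacobian_def[abs_def] fL_def)
 show "integrable mu (fL' k r)" "Cfun (fL' k r)" using Cfun_integrable C(2)[OF rJ] by auto
qed

lemma ric_C1: "C1fun ric" using ric_Ck by (simp add:C1fun_def del:Ck_on.simps)

lemma ric_scale: "ric (p, a *R v) = a^2 * ric (p, v)" by (simp add:ric_Rmat mv_scaleR sq_eq)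

definition "Jf k t z = integral {0..t} (%ta. (s_fun k ta)\<^sup>2 * (ric (Fl ta z) - (real CARD('n) - 1) * k))"

lemma Jf_deriv:
 assumes "t : {0..r}"
 shows "((%t. Jf k t z) hasRD (s_fun k t)\<^sup>2 * (ric (Fl t z) - (real CARD('n) - 1) * k)) (at t within {0..r})"
proof -
 have "cont_on {0..r} (%ta. ric (Fl ta z))" by (rule cont_onI) (simp add:DERIV_isCont[OF X_deriv[OF ric_C1]])
 hence "cont_on {0..r} (%ta. (s_fun k ta)\<^sup>2 * (ric (Fl ta z) - (real CARD('n) - 1) * k))"
  by (intro continuous_intros s_fun_cont)
 from integral_has_vector_derivative[OF this assms] show ?thesis by (simp add:Jf_def hasRD_iff)
qed

text \<open>Homogeneity of the Ricci form turns the integrand into a jointly continuous function, although smoothness of the flow is only available for a fixed time.\<close>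

lemma Jf_Cfun: "Cfun (Jf k t)" unfolding Cfun_def proof
 fix c assume c: "c : A"
 define q where "q ta = (if ta = 0 then 1 else s_fun k ta / ta)" for ta
 let ?R = "%z. ric (Fl 1 (ibc c z))" and ?S = "{z. nq c z = 1}"
 have "isCont q ta" for ta proof (cases "ta = 0")
  case True
  have "((%h. s_fun k h / h) ---> 1) (at 0)" using s_hasRD[of k 0] by (simp add:DERIV_def)
  hence "(q ---> 1) (at 0)" by (rule Lim_transform_eventually) (simp add:q_def eventually_at_filter)
  thus ?thesis using True by (simp add:isCont_def q_def)
 next
  case False
  have "isCont (%ta. s_fun k ta / ta) ta" using False DERIV_isCont[OF s_hasRD] by (intro continuous_intros) auto
  moreover have "\<forall>\<^sub>F x in nhds ta. q x = s_fun k x / x"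
   using t1_space_nhds[OF False] by eventually_elim (simp add:q_def)
  ultimately show ?thesis by (simp add:isCont_cong)
 qed
 hence cq: "cont_on UNIV q" by (simp add:cont_onI)
 have cR: "cont_on (TU c) ?R" by (rule Ck_cont[where m = 0], rule Ck_flow_comp[OF ric_Ck c]) simp_all
 have e: "(s_fun k ta)^2 * ric (Fl ta (ibc c z)) = (q ta)^2 * ?R (fst z, ta *R snd z)" if "nq c z = 1" for z ta
 proof -
  have "?R (fst z, ta *R snd z) = ta^2 * ric (Fl ta (ibc c z))"
   using ibc_scale[OF c nq_one[OF that], of ta] Fl_scale[of 1 "fst (ibc c z)" ta "snd (ibc c z)"]
    ric_scale[of "fst (Fl ta (ibc c z))" ta "snd (Fl ta (ibc c z))"] by simp
  thus ?thesis by (simp add:q_def power_divide)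
 qed
 let ?f = "%z ta. (q ta)\<^sup>2 * ?R (fst z, ta *R snd z) - (s_fun k ta)^2 * ((real CARD('n) - 1) * k)"
 have "cont_on (?S >< cbox 0 t) (%(z, ta). ?f z ta)" unfolding case_prod_beta
  by (intro continuous_intros cont_compose[OF cq] cont_compose[OF cR] cont_compose[OF s_fun_cont[of UNIV]])
   (use nq_one[of c] in "auto simp:TU_iff")
 from integral_continuous_on_param[OF this]
 have "cont_on ?S (%z. integral {0..t} (?f z))" by simp
 thus "cont_on ?S (%z. Jf k t (ibc c z))" by (rule continuous_on_eq) (simp add:Jf_def right_diff_distrib e)
qed

text \<open>Both sides vanish at 0 and have the same derivative, the average Ricci curvature at time
  \<open>t\<close> being constant by \<open>ric_flow_average\<close>. Comparing derivatives replaces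
  an exchange of the order of integration.\<close>

lemma Jf_average:
 assumes r: "0 <= r"
 shows "(LINT z|mu. Jf k r z) = measure mu SN * (mrs k / real CARD('n)) * Psi k r" proof -
 let ?a = "mrs k / real CARD('n)" and ?n = "real CARD('n) - 1"
 let ?f' = "%t z. (s_fun k t)\<^sup>2 * (ric (Fl t z) - ?n * k)"
 have Ct: "Cfun (%z. ric (Fl t z))" if "0 <= t" for t by (rule Ck_Cfun[OF Ck_flow_comp[OF ric_Ck _ that, of _ 0]])
 obtain B where B: "!!z. z : SN ==> abs (ric z) <= B" using Cfun_bounded[OF ric_Cfun] by blast
 have "bounded (s_fun k ` {0..r})" by (intro compact_imp_bounded compact_image s_fun_cont) simp
 then obtain S where S: "ALL t:{0..r}. abs (s_fun k t) <= S" unfolding bounded_iff by auto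
 interpret finite_measure mu by (rule mu_finite)
 have d: "((%t. \<integral>z. Jf k t z \<partial>mu) hasRD measure mu SN * ?a * (s_fun k t)^2) (at t within {0..r})" if t: "t : {0..r}" for t
 proof -
  have "((%t. \<integral>z. Jf k t z \<partial>mu) hasRD (LINT z|mu. ?f' t z)) (at t within {0..r})"
  proof (rule deriv_integral(2)[where w = "%_. S\<^sup>2 * (B + abs (?n * k))", OF _ t Cfun_integrable[OF Jf_Cfun] Jf_deriv])
   fix z t assume zt: "z : space mu" "t : {0..r}"
   have "abs ((s_fun k t)^2) <= S^2" using power_mono[OF bspec[OF S zt(2)], of 2] by simp
   moreover have "abs (ric (Fl t z) - ?n * k) <= B + abs (?n * k)" using B[OF Fl_SN[of z t]] zt(1) by (simp add:space_mu)
   ultimately show "abs (?f' t z) <= S^2 * (B + abs (?n * k))" unfolding abs_mult by (intro mult_mono) auto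
  qed (use Cfun_meas[OF Ct] t in auto)
  moreover have "(LINT z|mu. ?f' t z) = (s_fun k t)^2 * ((LINT z|mu. ric z) - measure mu SN * (?n * k))"
   using Cfun_integrable[OF Ct] ric_flow_average[of t] t by (simp add:space_mu)
  moreover have "(LINT z|mu. ric z) = measure mu SN * (?a + ?n * k)" using ric_average[of k] measure_mu(1) by (simp add:field_simps)
  ultimately show ?thesis by (simp add:alg)
 qed
 have "((%t. (LINT z|mu. Jf k t z) - measure mu SN * ?a * Psi k t) hasRD 0) (at t within {0..r})" if "t : {0..r}" for t
  using DERIV_diff[OF d[OF that] DERIV_cmult[OF has_field_derivative_at_within[OF Psi_deriv[of k t]], of "measure mu SN * ?a"]] by simp
 from has_field_derivative_zero_constant[OF _ this] obtain C where C: "!!t. t : {0..r} ==> (LINT z|mu. Jf k t z) - measure mu SN * ?a * Psi k t = C" by auto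
 from C[of 0] C[of r] r show ?thesis by (simp add:Jf_def)
qed

text \<open>\<open>gap_comparison\<close> in the normal coordinates at the foot point, with
  \<open>Jf\<close> as the accumulated Ricci term. For equality, the curvature at the centre is
  transported to the manifold by the differential of the exponential map, which at 0 is the
  identity.\<close>

lemma gap_pointwise:
 assumes r: "r : adm k" and z: "z : SN"
 shows "(s_fun k r)^2 * fL' k r z + Jf k r z <= 0" and "(s_fun k r)^2 * fL' k r z + Jf k r z = 0 ==>
   curvop (fst z) u (snd z) (snd z) = k *R (u - ipA (fst z) u (snd z) *R snd z)" proof -
 let ?p = "fst z" and ?v = "snd z"
 obtain ro where ro: "ro > r" "normal_coords (tball ?p ro) (hN ?p)" "!!t. abs t < ro ==> t *R ?v : tball ?p ro"
  by (rule admissible_coords[OF r z]) (rule that; assumption)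
 interpret nc: normal_coords "tball ?p ro" "hN ?p" by (rule ro(2))
 note rp = admissible_pos[OF r] and v = SN_nonzero[OF z]
 have rU: "r *R ?v : tball ?p ro" using ro(1,3) rp by simp
 have gp: "nc.gap ?v k r = (s_fun k r)^2 * fL' k r z"
  using rp by (simp add:nc.gap_def[OF v] fL'_def right_diff_distrib sq_eq)
 have J: "((%t. Jf k t z) hasRD (s_fun k t)\<^sup>2 * (Ric (hN ?p) (t *R ?v) ?v - (real CARD('n) - 1) * k)) (at t)" if "0 < t" "t < r" for t
  using Jf_deriv[of t r k z] that ric_hN[OF nc.metric_field_axioms, of t ?v] ro(1) ro(3)[of t] by (simp add:at_within_Icc_at)
 have Jc: "cont_on {0..r} (%t. Jf k t z)" using Jf_deriv by (intro DERIV_continuous_on)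
 note G = nc.gap_comparison[OF v _ rU _ J Jc]
 have J0: "Jf k 0 z = 0" by (simp add:Jf_def)
 show "(s_fun k r)^2 * fL' k r z + Jf k r z <= 0" using G(1) J0 rp gp by simp
 assume "(s_fun k r)^2 * fL' k r z + Jf k r z = 0"
 hence "nc.Mm ?v (t * c_fun k t / s_fun k t) t = 0" if "0 < t" "t < r" for t
  using G(2)[where t = t] that J0 rp gp by simp
 from nc.model_shape_curvature[OF v _ rU _ this] rp
 have R: "Rm (hN ?p) 0 u ?v ?v = k *R ((mat 1 - nc.Pm ?v) *v u)" by simp
 have 0: "0 : tball ?p ro Int expdom ?p (chA ?p)" using nc.zero_U by (simp add:expdom_def exp_map_0 chart_at)
 have "Rm (hN ?p) 0 u ?v ?v = curvop ?p u ?v ?v"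
  using pullback.Rm_pullback[OF hN_pullback[OF nc.metric_field_axioms chart_at(1)] 0, of u ?v ?v]
  by (simp add:DEc_0 curvature_op_Rm Ec_def exp_map_0 coord_def)
 moreover have "?v <.> (grA ?p *v ?v) = 1" using z norm_at_sq[of ?p ?v] by (simp add:unit_sphere_bundle_def case_prod_beta)
 ultimately show "curvop ?p u ?v ?v = k *R (u - ipA ?p u ?v *R ?v)"
  using R by (simp add:mv_diff_r nc.Pm_mult hN_0 inner_at_def)
qed

text \<open>The integral of the pointwise expression equals \<open>s_fun\<close> squared times the
  total mass times the difference of the two sides. If that is 0, the expression, which has a sign
  and is continuous, vanishes everywhere by \<open>Cfun_zero\<close>.\<close>

lemma mean_log_inequality:
 assumes r: "r : adm k"
 shows "deriv (mlj k) r <= - (mrs k / real CARD('n)) * phi k r"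
  and "deriv (mlj k) r = - (mrs k / real CARD('n)) * phi k r ==> z : SN ==>
   (s_fun k r)\<^sup>2 * fL' k r z + Jf k r z = 0" proof -
 let ?m = "measure mu SN" and ?a = "mrs k / real CARD('n)" and ?s = "(s_fun k r)^2"
 note rp = admissible_pos[OF r] and D = mean_log_deriv[OF r]
 let ?G = "%z. ?s * fL' k r z + Jf k r z"
 have s: "?s > 0" using rp by simp
 have d: "deriv (mlj k) r = (LINT z|mu. fL' k r z) / ?m" by (rule DERIV_imp_deriv[OF D(1)])
 have G: "(LINT z|mu. ?G z) = ?s * (LINT z|mu. fL' k r z) + ?m * ?a * Psi k r"
  using D(2) Cfun_integrable[OF Jf_Cfun] Jf_average[of r k] rp by simp
 have I: "(LINT z|mu. fL' k r z) = ?m * deriv (mlj k) r" using d measure_mu(1) by simp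
 have P: "Psi k r = phi k r * ?s" using phi_Psi[of r k] s rp by simp
 have e: "(LINT z|mu. ?G z) = ?s * ?m * (deriv (mlj k) r + ?a * phi k r)" unfolding G I P by (simp add:alg)
 have mi: "(LINT z|mu. - ?G z) = - (LINT z|mu. ?G z)" by (rule integral_minus)
 have "(LINT z|mu. - ?G z) >= 0"
  using gap_pointwise(1)[OF r] by (intro integral_nonneg_AE AE_I2) (simp add:space_mu del:minus_add_distrib)
 hence "?s * ?m * (deriv (mlj k) r + ?a * phi k r) <= 0" unfolding mi e by (simp only: neg_0_le_iff_le)
 moreover have sm: "?s * ?m > 0" using s measure_mu(1) by simp
 ultimately have "deriv (mlj k) r + ?a * phi k r <= 0" using mult_le_cancel_left_pos[OF sm, of _ 0] by simp
 thus "deriv (mlj k) r <= - ?a * phi k r" by simp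
 assume q: "deriv (mlj k) r = - ?a * phi k r" and z: "z : SN"
 have C: "Cfun (%z. - ?G z)" using D(3) Jf_Cfun[of k r] unfolding Cfun_def by (auto intro!:continuous_intros)
 have "(LINT z|mu. - ?G z) = 0" unfolding mi e q by simp
 hence "(NN mu (%z. ennreal (- ?G z))) = 0"
  using gap_pointwise(1)[OF r] by (subst nn_integral_eq_integral[OF Cfun_integrable[OF C] AE_I2]) (auto simp:space_mu simp del:minus_add_distrib)
 from Cfun_zero[OF C _ this z] gap_pointwise(1)[OF r] show "?G z = 0" by force
qed

section \<open>The equality case\<close>

lemma inner_at_sym: "ipA p v u = ipA p u v"
 unfolding inner_at_def by (metis gram_sym dot_lmul_matrix inner_commute vector_transpose_matrix)

lemma inner_at_cauchy_strict:
 assumes uv: "u ~= v & independent {u, v}"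
 shows "v ~= 0" "ipA p u u * ipA p v v - (ipA p u v)^2 > 0" proof -
 show v0: "v ~= 0" using uv dependent_zero by blast
 let ?w = "u - (ipA p u v / ipA p v v) *R v"
 have vv: "ipA p v v > 0" using gram_pos[OF v0] by (simp add:inner_at_def)
 have "?w ~= 0" proof
  assume "?w = 0"
  hence "u : span {v}" by (simp add:span_singleton)
  thus False using uv by (simp add:independent_insert)
 qed
 hence "ipA p ?w ?w > 0" using gram_pos by (simp add:inner_at_def)
 moreover have "ipA p ?w ?w * ipA p v v = ipA p u u * ipA p v v - (ipA p u v)^2" using inner_at_sym[of p v u] vv
  by (simp add:inner_at_def matrix_vector_mult_diff_distrib mv_scaleR inner_diff_left inner_diff_right field_simps sq_eq)
 ultimately show "ipA p u u * ipA p v v - (ipA p u v)^2 > 0" using vv by (metis mult_pos_pos)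
qed

text \<open>The hypothesis only speaks of independent pairs. For dependent ones both sides are 0, by
  antisymmetry of the curvature operator.\<close>

lemma constant_curvature_inner:
 assumes cs: "constant_sectional_curvature A g k"
 shows "curvop p u v v <.> (grA p *v u) = k * (ipA p u u * ipA p v v - (ipA p u v)^2)"
proof (cases "u ~= v & independent {u, v}")
 case True
 have "ipA p u u * ipA p v v - (ipA p u v)^2 > 0" by (rule inner_at_cauchy_strict(2)[OF True])
 moreover have "sectional_curvature A g p u v = k" using cs True by (simp add:constant_sectional_curvature_def)
 ultimately show ?thesis by (simp add:sectional_curvature_def inner_at_def field_simps)
next
 case False
 interpret m: metric_field "img (chA p)" "g (chA p)" by (rule mf[OF chart_at(1)])
 have x: "coord A p : img (chA p)" using chart_at(2) by (simp add:coord_def)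
 have a: "curvop p x x y = 0" for x y
  unfolding curvature_op_Rm vec_eq_iff using arg_cong[OF m.Rm_antisym[OF x, of x x y], of "%w. w $ _"] by simp
 consider a where "u = a *R v" | "v = 0" proof (cases "v = 0 \<or> u = v")
  case True
  thus ?thesis using that(1)[of 1] that(2) by auto
 next
  case F: False
  hence "u : span {v}" using False by (simp add:independent_insert)
  thus ?thesis using that(1) by (auto simp:span_singleton)
 qed
 thus ?thesis proof cases
  case (1 a)
  have "curvop p (a *R v) v v = a *R curvop p v v v"
   unfolding curvature_op_Rm using linear_scale[OF Rm_linear(1)] by blast
  thus ?thesis by (simp add:1 a inner_at_def mv_scaleR sq_eq)
 next
  case 2
  have "curvop p u 0 0 = 0" unfolding curvature_op_Rm using linear_0[OF Rm_linear(3)] by blast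
  thus ?thesis by (simp add:2 inner_at_def)
 qed
qed

text \<open>The exponential map is isometric for \<open>hN\<close>, so the quadratic form of the
  curvature along the ray is that of the model; \<open>sectional_to_curvature\<close> turns it into
  the operator, from which both the mean curvature and the Ricci curvature at radius
  \<open>r\<close> follow.\<close>

lemma constant_curvature_model:
 assumes cs: "constant_sectional_curvature A g k" and r: "r : adm k" and z: "z : SN"
 shows "fL' k r z = 0" "ric (Fl r z) = (real CARD('n) - 1) * k" proof -
 let ?p = "fst z" and ?v = "snd z"
 obtain ro where ro: "ro > r" "normal_coords (tball ?p ro) (hN ?p)" "!!t. abs t < ro ==> t *R ?v : tball ?p ro"
  by (rule admissible_coords[OF r z]) (rule that; assumption)
 interpret nc: normal_coords "tball ?p ro" "hN ?p" by (rule ro(2))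
 note rp = admissible_pos[OF r] and v = SN_nonzero[OF z]
 have unit: "?v <.> (hN ?p 0 *v ?v) = 1" using z norm_at_sq[of ?p ?v] by (simp add:hN_0 unit_sphere_bundle_def case_prod_beta)
 have R: "Rm (hN ?p) (t *R ?v) u ?v ?v = k *R ((mat 1 - nc.Pm ?v) *v u)" if t: "0 < t" "t <= r" for t u
 proof (rule nc.sectional_to_curvature[OF _ _ v unit])
  show tU: "t *R ?v : tball ?p ro" using ro(1,3) t by simp
  fix u
  let ?q = "exA ?p (t *R ?v)"
  let ?c = "chA ?q"
  have q: "t *R ?v : tball ?p ro Int expdom ?p ?c" using tU expdom_chart_at by blast
  let ?D = "Df (Ec ?p ?c) (t *R ?v)"
  have h: "a <.> (hN ?p (t *R ?v) *v b) = ipA ?q (?D a) (?D b)" for a b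
   by (simp add:hN_eq[OF chart_at(1) expdom_chart_at] inner_at_def gram_at_def coord_def Ec_def)
  have "?D (Rm (hN ?p) (t *R ?v) u ?v ?v) = curvop ?q (?D u) (?D ?v) (?D ?v)"
   using pullback.Rm_pullback[OF hN_pullback[OF nc.metric_field_axioms chart_at(1)] q, of u ?v ?v]
   by (simp add:curvature_op_Rm Ec_def coord_def)
  thus "Rm (hN ?p) (t *R ?v) u ?v ?v <.> (hN ?p (t *R ?v) *v u)
   = k * ((u <.> (hN ?p (t *R ?v) *v u)) * (?v <.> (hN ?p (t *R ?v) *v ?v)) - (u <.> (hN ?p (t *R ?v) *v ?v))^2)"
   using constant_curvature_inner[OF cs, of ?q "?D u" "?D ?v"] unfolding h by (simp add:inner_at_def[of A g ?q "curvop ?q _ _ _"])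
 qed (use t in simp)
 have rU: "r *R ?v : tball ?p ro" using ro(1,3) rp by simp
 show "fL' k r z = 0" using nc.model_curvature_mean_curv[OF v _ rU _ R] rp by (simp add:fL'_def)
 have "Ric (hN ?p) (r *R ?v) ?v = trace (k *R (mat 1 - nc.Pm ?v))" proof -
  have "(%u. Rm (hN ?p) (r *R ?v) u ?v ?v) = (%u. (k *R (mat 1 - nc.Pm ?v)) *v u)"
   using R[of r] rp by (simp add:scaleR_mv)
  thus ?thesis unfolding Ric_def by (simp add:matrix_of_matrix_vector_mul)
 qed
 thus "ric (Fl r z) = (real CARD('n) - 1) * k"
  using ric_hN[OF nc.metric_field_axioms rU] nc.Pm_facts(4)[OF v _ rU] rp by (simp add:trace_scaleR trace_sub trace_I)
qed

text \<open>From equality, the curvature operator is that of the model for every unit vector, and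
  homogeneity extends this to all vectors. Conversely, constant curvature makes both sides 0 at any
  admissible radius: \<open>fL'\<close> vanishes, and the average of the constant Ricci curvature,
  moved back to time 0 by the flow, gives \<open>mrs k = 0\<close>.\<close>

lemma equality_iff:
 "(EX r : adm k. deriv (mlj k) r = - (mrs k / real CARD('n)) * phi k r)
  <-> constant_sectional_curvature A g k" proof
 assume "EX r : adm k. deriv (mlj k) r = - (mrs k / real CARD('n)) * phi k r"
 then obtain r where r: "r : adm k" "deriv (mlj k) r = - (mrs k / real CARD('n)) * phi k r" by blast
 have unit: "curvop p u v v = k *R (u - ipA p u v *R v)" if "nmA p v = 1" for p u v
  using gap_pointwise(2)[OF r(1) _ mean_log_inequality(2)[OF r], of "(p, v)" u] that by (simp add:unit_sphere_bundle_def)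
 show "constant_sectional_curvature A g k" unfolding constant_sectional_curvature_def proof (intro allI impI)
  fix p and u v :: "real^'n" assume uv: "u ~= v & independent {u, v}"
  let ?N = "nmA p v"
  have v0: "v ~= 0" by (rule inner_at_cauchy_strict(1)[OF uv])
  have N2: "?N^2 = ipA p v v" by (simp add:norm_at_sq inner_at_def)
  have N: "?N > 0" using gram_pos[OF v0, of p] norm_at_nonneg[of p v] N2 by (auto simp:inner_at_def less_le)
  let ?th = "v /\<^sub>R ?N"
  have th: "nmA p ?th = 1" using N by (simp add:norm_at_scale)
  have "curvop p u v v = curvop p u (?N *R ?th) (?N *R ?th)" using N by simp
  also have "... = ?N^2 *R curvop p u ?th ?th"
   unfolding curvature_op_Rm by (simp only: linear_scale[OF Rm_linear(2)] linear_scale[OF Rm_linear(3)]) (simp add:sq_eq)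
  also have "... = k *R (?N^2 *R u - ?N^2 *R (ipA p u ?th *R ?th))"
   unfolding unit[OF th] scaleR_diff_right scaleR_scaleR by (simp add:mult_ac)
  also have "?N^2 *R (ipA p u ?th *R ?th) = ipA p u v *R v" proof -
   have "?N * (?N * (inverse ?N * inverse ?N)) = (?N * inverse ?N) * (?N * inverse ?N)" by (simp only: mult_ac)
   hence "?N * (?N * (inverse ?N * inverse ?N)) = 1" using N by simp
   thus ?thesis by (simp add:inner_at_def mv_scaleR sq_eq)
  qed
  finally have R: "ipA p (curvop p u v v) u = k * (ipA p v v * ipA p u u - ipA p u v * ipA p v u)"
   unfolding N2 by (simp add:inner_at_def[of _ _ _ "_ - _"] inner_at_def[of _ _ _ "_ *R _"] inner_diff_left inner_at_def)
  have "ipA p u u * ipA p v v - (ipA p u v)^2 > 0" by (rule inner_at_cauchy_strict(2)[OF uv])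
  thus "sectional_curvature A g p u v = k"
   by (simp add:sectional_curvature_def R inner_at_sym[of p v u] sq_eq mult.commute)
 qed
next
 assume cs: "constant_sectional_curvature A g k"
 obtain r where r: "r : adm k" using admissible_nonempty by blast
 note m = constant_curvature_model[OF cs r] and rp = admissible_pos[OF r]
 have "(LINT z|mu. fL' k r z) = (LINT z|mu. 0)" by (rule Bochner_Integration.integral_cong) (auto simp:m space_mu)
 hence "deriv (mlj k) r = 0" using DERIV_imp_deriv[OF mean_log_deriv(1)[OF r]] by simp
 moreover have "(LINT z|mu. ric z) = (LINT z|mu. (real CARD('n) - 1) * k)"
  unfolding ric_flow_average[of r, symmetric, OF less_imp_le[OF conjunct1[OF rp]]]
  by (rule Bochner_Integration.integral_cong) (auto simp:m space_mu)
 hence "mrs k = 0" using ric_average[of k] measure_mu(1) by (simp add:space_mu)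
 ultimately show "EX r : adm k. deriv (mlj k) r = - (mrs k / real CARD('n)) * phi k r" using r by auto
qed

lemma phi_nonneg: "r : adm k ==> 0 <= phi k r" using phi_Psi[of r k] Psi_nonneg[of r k] admissible_pos[of r k] by simp

lemma mean_log_antimono:
 assumes R: "mrs k >= 0"
 shows "antimono_on (adm k) (mlj k)" proof (rule monotone_onI)
 fix r t assume rt: "r : adm k" "t : adm k" "r <= t"
 show "mlj k t <= mlj k r" proof (rule DERIV_nonpos_imp_nonincreasing[OF rt(3)])
  fix s assume "r <= s" "s <= t"
  \<comment> \<open>Admissible radii form an interval, so every radius between \<open>r\<close> and
    \<open>t\<close> is admissible too.\<close>
  hence s: "s : adm k" using admissible_less[OF rt(2)] admissible_pos[OF rt(1)] by force
  have "deriv (mlj k) s <= 0"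
   using mean_log_inequality(1)[OF s] mult_nonneg_nonneg[OF divide_nonneg_nonneg[OF R of_nat_0_le_iff] phi_nonneg[OF s], of "CARD('n)"] by simp
  thus "EX y. (mlj k hasRD y) (at s) & y <= 0" using mean_log_deriv(1)[OF s] DERIV_imp_deriv by metis
 qed
qed

end

theorem theorem7:
  fixes A :: "('a::{t2_space, second_countable_topology}, 'n::finite) chart set"
    and g :: "('a, 'n) metric"
    and k :: real
  assumes "oriented_smooth_atlas A"
    and "riemannian_metric A g"
    and "geodesically_complete A g"
    and "compact (UNIV :: 'a set)"
  shows "(\<forall>r \<in> admissible_radii A g k.
            0 \<le> phi k r \<and>
            mean_log_jacobian A g k differentiable (at r) \<and>
            deriv (mean_log_jacobian A g k) r
              \<le> - (mean_reduced_scalar A g k / real CARD('n)) * phi k r) \<and>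
         (mean_reduced_scalar A g k \<ge> 0 \<longrightarrow>
            antimono_on (admissible_radii A g k) (mean_log_jacobian A g k)) \<and>
         ((\<exists>r \<in> admissible_radii A g k.
            deriv (mean_log_jacobian A g k) r
              = - (mean_reduced_scalar A g k / real CARD('n)) * phi k r)
          \<longleftrightarrow> constant_sectional_curvature A g k)"
proof -
 interpret riem_compact A g by unfold_locales (rule assms)+
 have "mean_log_jacobian A g k differentiable (at r)" if "r : admissible_radii A g k" for r
  using mean_log_deriv(1)[OF that] real_differentiable_def by blast
 thus ?thesis using phi_nonneg mean_log_inequality(1) mean_log_antimono equality_iff by blast
qed

end
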